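(* The following hold. (1) Let $G=SL(2,\mathbb{C})$, let $V$ and $W$ be finite-dimensional rational representations of $G$ with $W$ irreducible, and let $v\in V$, $w\in W$ be non-zero vectors. If the pair $(v,w)$ is numerically semistable, then $(v,w)$ is semistable. (2) For $G=SL(2,\mathbb{C})$, there exist finite-dimensional rational representations $V$ and $W$ of $G$ with $W$ reducible, and non-zero vectors $v\in V$, $w\in W$, such that the pair $(v,w)$ is numerically semistable but not semistable. (3) For $G=SL(3,\mathbb{C})$, there exist irreducible finite-dimensional rational representations $V$ and $W$ of $G$ which are homogeneous, and non-zero vectors $v\in V$, $w\in W$, such that the pair $(v,w)$ is numerically semistable but not semistable.
   Context: Let $G$ be a complex reductive algebraic group, $V,W$ finite-dimensional rational representations of $G$, and $v\in V$, $w\in W$ non-zero vectors. Semistable: put $\mathcal{O}_{(v,w)}=G\cdot[(v,w)]\subset\mathbb{P}(V\oplus W)$ and $\mathcal{O}_v=G\cdot[(v,0)]\subset\mathbb{P}(V\oplus\{0\})\subset \mathbb{P}(V\oplus W)$, with closures $\overline{\mathcal{O}}_{(v,w)}$, $\overline{\mathcal{O}}_v$ in the projective spaces. The pair $(v,w)$ is semistable if $\overline{\mathcal{O}}_{(v,w)}\cap\overline{\mathcal{O}}_v=\emptyset$. Weight polytope: for a maximal algebraic torus $T$ of $G$ and a non-zero vector $u$ in a rational $G$-representation, $\mathcal{N}_T(u)\subset \mathrm{Lie}(T)^*$ denotes the weight polytope of $u$, i.e. the convex hull of the $T$-weights $\chi$ for which the component of $u$ in the $\chi$-weight space is non-zero.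 Numerically semistable: the pair $(v,w)$ is numerically semistable if $\mathcal{N}_T(v)\subset\mathcal{N}_T(w)$ for all maximal algebraic tori $T$ of $G$. Homogeneous (for $SL(3,\mathbb{C})$): let $U=\mathbb{C}^3$ be the standard representation. Every irreducible representation of $SL(3,\mathbb{C})$ is isomorphic to a unique $\Gamma_{a,b}$ with integers $a,b\ge 0$, where $\Gamma_{a,b}$ is the kernel of the natural contraction map $\mathrm{Sym}^aU\otimes\mathrm{Sym}^bU^*\to\mathrm{Sym}^{a-1}U\otimes\mathrm{Sym}^{b-1}U^*$. Two irreducible representations $\Gamma_{a,b}$ and $\Gamma_{a',b'}$ are homogeneous if and only if $a+2b=a'+2b'$. *)

theory Defs
  imports
    "Jordan_Normal_Form.Determinant"
    "Jordan_Normal_Form.VS_Connect"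
    "HOL-Analysis.Function_Topology"
begin

text \<open>
  A finite-dimensional complex vector space is taken to be \<open>\<complex>\<^sup>m\<close>, that is \<^term>\<open>carrier_vec m :: complex vec set\<close>,
  with \<open>m\<close> an ordinary natural number; a representation on it is a homomorphism into \<open>GL(m)\<close>.
\<close>

section \<open>Groups and rational representations\<close>

definition GL :: "nat \<Rightarrow> complex mat monoid" where
  "GL m = \<lparr>carrier = {A \<in> carrier_mat m m. det A \<noteq> 0}, monoid.mult = (*), one = 1\<^sub>m m\<rparr>"

definition SL :: "nat \<Rightarrow> complex mat monoid" where
  "SL n = \<lparr>carrier = {A \<in> carrier_mat n n. det A = 1}, monoid.mult = (*), one = 1\<^sub>m n\<rparr>"

text \<open>The group \<open>(\<complex>\<^sup>\<times>)\<^sup>r\<close>.\<close>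

definition std_torus :: "nat \<Rightarrow> complex vec monoid" where
  "std_torus r = \<lparr>carrier = {t \<in> carrier_vec r. \<forall>i<r. t $ i \<noteq> 0},
     monoid.mult = (\<lambda>s t. vec r (\<lambda>i. s $ i * t $ i)), one = vec r (\<lambda>_. 1)\<rparr>"

definition Gm :: "complex monoid" where
  "Gm = \<lparr>carrier = {z. z \<noteq> 0}, monoid.mult = (*), one = 1\<rparr>"

text \<open>The \<open>\<complex>\<close>-algebra of functions generated by a set \<open>F\<close> of functions.\<close>

inductive_set function_algebra :: "('a \<Rightarrow> complex) set \<Rightarrow> ('a \<Rightarrow> complex) set"
  for F :: "('a \<Rightarrow> complex) set" where
  const: "(\<lambda>_. c) \<in> function_algebra F"
| gen: "f \<in> F \<Longrightarrow> f \<in> function_algebra F"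
| add: "f \<in> function_algebra F \<Longrightarrow> g \<in> function_algebra F \<Longrightarrow> (\<lambda>x. f x + g x) \<in> function_algebra F"
| mult: "f \<in> function_algebra F \<Longrightarrow> g \<in> function_algebra F \<Longrightarrow> (\<lambda>x. f x * g x) \<in> function_algebra F"

definition poly_functions :: "nat \<Rightarrow> (complex mat \<Rightarrow> complex) set" where
  "poly_functions n = function_algebra {\<lambda>g. g $$ (i, j) | i j. i < n \<and> j < n}"

definition laurent_functions :: "nat \<Rightarrow> (complex vec \<Rightarrow> complex) set" where
  "laurent_functions r =
     function_algebra ({\<lambda>t. t $ i | i. i < r} \<union> {\<lambda>t. inverse (t $ i) | i. i < r})"

text \<open>
  \<open>SL(n)\<close> and its algebraic subgroups are Zariski closed in the space of all \<open>n \<times> n\<close> matrices, so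
  their regular functions are the restrictions of polynomials in the matrix entries; no inverse of
  the determinant is needed.
\<close>

definition regular_on :: "nat \<Rightarrow> complex mat set \<Rightarrow> (complex mat \<Rightarrow> complex) \<Rightarrow> bool" where
  "regular_on n T f \<longleftrightarrow> (\<exists>p \<in> poly_functions n. \<forall>g\<in>T. f g = p g)"

definition rational_rep :: "nat \<Rightarrow> nat \<Rightarrow> (complex mat \<Rightarrow> complex mat) \<Rightarrow> bool" where
  "rational_rep n m \<rho> \<longleftrightarrow>
     \<rho> \<in> hom (SL n) (GL m) \<and>
     (\<forall>i<m. \<forall>j<m. regular_on n (carrier (SL n)) (\<lambda>g. \<rho> g $$ (i, j)))"

definition irreducible_rep :: "nat \<Rightarrow> nat \<Rightarrow> (complex mat \<Rightarrow> complex mat) \<Rightarrow> bool" where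
  "irreducible_rep n m \<rho> \<longleftrightarrow>
     0 < m \<and>
     (\<forall>U. VectorSpace.subspace class_ring U (module_vec TYPE(complex) m) \<longrightarrow>
          (\<forall>g\<in>carrier (SL n). \<forall>u\<in>U. \<rho> g *\<^sub>v u \<in> U) \<longrightarrow>
          U = {0\<^sub>v m} \<or> U = carrier_vec m)"


section \<open>Projective space and semistable pairs\<close>

definition vec_topology :: "nat \<Rightarrow> complex vec topology" where
  "vec_topology N =
     pullback_topology (carrier_vec N) (\<lambda>x. \<lambda>i\<in>{..<N}. x $ i)
       (product_topology (\<lambda>_. euclidean) {..<N})"

definition proj_point :: "complex vec \<Rightarrow> complex vec set" where
  "proj_point x = {c \<cdot>\<^sub>v x | c. c \<noteq> 0}"

text \<open>
  \<open>\<P>(\<complex>\<^sup>N)\<close> carries the quotient of the classical topology of \<open>\<complex>\<^sup>N - {0}\<close>. For orbits of algebraic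
  group actions the closures in the classical and in the Zariski topology agree.
\<close>

definition proj_topology :: "nat \<Rightarrow> complex vec set topology" where
  "proj_topology N = topology (\<lambda>S. S \<subseteq> proj_point ` (carrier_vec N - {0\<^sub>v N}) \<and>
     openin (subtopology (vec_topology N) (carrier_vec N - {0\<^sub>v N}))
       {x \<in> carrier_vec N - {0\<^sub>v N}. proj_point x \<in> S})"

lemma topspace_vec_topology [simp]: "topspace (vec_topology N) = carrier_vec N"
  unfolding vec_topology_def topspace_pullback_topology by auto

lemma openin_proj_topology:
  "openin (proj_topology N) S \<longleftrightarrow> S \<subseteq> proj_point ` (carrier_vec N - {0\<^sub>v N}) \<and>
     openin (subtopology (vec_topology N) (carrier_vec N - {0\<^sub>v N}))
       {x \<in> carrier_vec N - {0\<^sub>v N}. proj_point x \<in> S}"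
proof -
  let ?X = "carrier_vec N - {0\<^sub>v N} :: complex vec set"
  let ?L = "\<lambda>S. S \<subseteq> proj_point ` ?X \<and>
    openin (subtopology (vec_topology N) ?X) {x \<in> ?X. proj_point x \<in> S}"
  have "istopology ?L"
    unfolding istopology_def
  proof (intro conjI allI impI)
    fix S T assume S: "?L S" and T: "?L T"
    have "{x \<in> ?X. proj_point x \<in> S \<inter> T} =
        {x \<in> ?X. proj_point x \<in> S} \<inter> {x \<in> ?X. proj_point x \<in> T}" by auto
    with S T show "openin (subtopology (vec_topology N) ?X) {x \<in> ?X. proj_point x \<in> S \<inter> T}"
      by (metis (no_types, lifting) openin_Int)
  next
    fix S T assume "?L S" then show "S \<inter> T \<subseteq> proj_point ` ?X" by auto
  next
    fix \<K> assume K: "\<forall>K\<in>\<K>. ?L K"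
    have "{x \<in> ?X. proj_point x \<in> \<Union>\<K>} = (\<Union>K\<in>\<K>. {x \<in> ?X. proj_point x \<in> K})" by auto
    with K show "openin (subtopology (vec_topology N) ?X) {x \<in> ?X. proj_point x \<in> \<Union>\<K>}"
      by auto
  next
    fix \<K> assume "\<forall>K\<in>\<K>. ?L K" then show "\<Union>\<K> \<subseteq> proj_point ` ?X" by auto
  qed
  then show ?thesis by (simp add: proj_topology_def)
qed

lemma topspace_proj_topology [simp]:
  "topspace (proj_topology N) = proj_point ` (carrier_vec N - {0\<^sub>v N})" (is "_ = proj_point ` ?X")
proof
  show "topspace (proj_topology N) \<subseteq> proj_point ` ?X"
    using openin_topspace[of "proj_topology N"] unfolding openin_proj_topology by blast
  have "{x \<in> ?X. proj_point x \<in> proj_point ` ?X} =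
      topspace (subtopology (vec_topology N) ?X)" by auto
  then have "openin (proj_topology N) (proj_point ` ?X)"
    unfolding openin_proj_topology by (metis openin_topspace order_refl)
  then show "proj_point ` ?X \<subseteq> topspace (proj_topology N)" by (rule openin_subset)
qed

lemma quotient_map_proj_point:
  "quotient_map (subtopology (vec_topology N) (carrier_vec N - {0\<^sub>v N})) (proj_topology N) proj_point"
  unfolding quotient_map_def by (auto simp: openin_proj_topology Int_absorb1)

text \<open>
  For the orbits of \<open>[(v, w)]\<close> and \<open>[(v, 0)]\<close> the direct sum \<open>\<complex>\<^sup>m \<oplus> \<complex>\<^sup>k\<close> is \<open>\<complex>\<^sup>m\<^sup>+\<^sup>k\<close>, via concatenation of
  vectors.
\<close>

definition pair_orbit ::
  "nat \<Rightarrow> (complex mat \<Rightarrow> complex mat) \<Rightarrow> (complex mat \<Rightarrow> complex mat) \<Rightarrow>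
   complex vec \<Rightarrow> complex vec \<Rightarrow> complex vec set set" where
  "pair_orbit n \<rho> \<sigma> v w = {proj_point ((\<rho> g *\<^sub>v v) @\<^sub>v (\<sigma> g *\<^sub>v w)) | g. g \<in> carrier (SL n)}"

definition semistable ::
  "nat \<Rightarrow> nat \<Rightarrow> (complex mat \<Rightarrow> complex mat) \<Rightarrow> nat \<Rightarrow> (complex mat \<Rightarrow> complex mat) \<Rightarrow>
   complex vec \<Rightarrow> complex vec \<Rightarrow> bool" where
  "semistable n m \<rho> k \<sigma> v w \<longleftrightarrow>
     proj_topology (m + k) closure_of pair_orbit n \<rho> \<sigma> v w \<inter>
     proj_topology (m + k) closure_of pair_orbit n \<rho> \<sigma> v (0\<^sub>v k) = {}"


section \<open>Maximal tori and weight polytopes\<close>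

text \<open>
  An algebraic torus is an algebraic subgroup isomorphic to some \<open>(\<complex>\<^sup>\<times>)\<^sup>r\<close> as an algebraic group: both
  \<open>\<phi>\<close> and its inverse are morphisms of varieties. The image of a homomorphism of algebraic groups is
  closed, so closedness of \<open>T\<close> need not be assumed.
\<close>

definition algebraic_torus :: "nat \<Rightarrow> complex mat set \<Rightarrow> bool" where
  "algebraic_torus n T \<longleftrightarrow> subgroup T (SL n) \<and>
     (\<exists>r. \<exists>\<phi> \<in> iso (std_torus r) ((SL n)\<lparr>carrier := T\<rparr>).
        (\<forall>i<n. \<forall>j<n. \<exists>q \<in> laurent_functions r. \<forall>t\<in>carrier (std_torus r). \<phi> t $$ (i, j) = q t) \<and>
        (\<forall>i<r. regular_on n T (\<lambda>g. inv_into (carrier (std_torus r)) \<phi> g $ i)))"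

definition maximal_torus :: "nat \<Rightarrow> complex mat set \<Rightarrow> bool" where
  "maximal_torus n T \<longleftrightarrow>
     algebraic_torus n T \<and> (\<forall>T'. algebraic_torus n T' \<longrightarrow> T \<subseteq> T' \<longrightarrow> T' = T)"

definition characters :: "nat \<Rightarrow> complex mat set \<Rightarrow> (complex mat \<Rightarrow> complex) set" where
  "characters n T = {\<chi> \<in> hom ((SL n)\<lparr>carrier := T\<rparr>) Gm. regular_on n T \<chi>} \<inter> extensional T"

text \<open>\<open>Lie(T)\<close> is the tangent space of \<open>T\<close> at the identity, a space of \<open>n \<times> n\<close> matrices.\<close>

definition tangent_curve :: "nat \<Rightarrow> complex mat set \<Rightarrow> complex mat \<Rightarrow> (real \<Rightarrow> complex mat) \<Rightarrow> bool" where
  "tangent_curve n T X \<gamma> \<longleftrightarrow> \<gamma> 0 = 1\<^sub>m n \<and> (\<forall>s. \<gamma> s \<in> T) \<and>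
     (\<forall>i<n. \<forall>j<n. ((\<lambda>s. \<gamma> s $$ (i, j)) has_vector_derivative X $$ (i, j)) (at 0))"

definition Lie :: "nat \<Rightarrow> complex mat set \<Rightarrow> complex mat set" where
  "Lie n T = {X \<in> carrier_mat n n. \<exists>\<gamma>. tangent_curve n T X \<gamma>}"

definition differential ::
  "nat \<Rightarrow> complex mat set \<Rightarrow> (complex mat \<Rightarrow> complex) \<Rightarrow> complex mat \<Rightarrow> complex" where
  "differential n T \<chi> X =
     (THE d. \<forall>\<gamma>. tangent_curve n T X \<gamma> \<longrightarrow> ((\<lambda>s. \<chi> (\<gamma> s)) has_vector_derivative d) (at 0))"

definition weight_space ::
  "complex mat set \<Rightarrow> nat \<Rightarrow> (complex mat \<Rightarrow> complex mat) \<Rightarrow> (complex mat \<Rightarrow> complex) \<Rightarrow>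
   complex vec set" where
  "weight_space T m \<rho> \<chi> = {u \<in> carrier_vec m. \<forall>t\<in>T. \<rho> t *\<^sub>v u = \<chi> t \<cdot>\<^sub>v u}"

text \<open>
  \<open>c\<close> is the family of components of \<open>u\<close> in the decomposition of \<open>\<complex>\<^sup>m\<close> into weight spaces.
\<close>

definition weight_components ::
  "nat \<Rightarrow> complex mat set \<Rightarrow> nat \<Rightarrow> (complex mat \<Rightarrow> complex mat) \<Rightarrow> complex vec \<Rightarrow>
   ((complex mat \<Rightarrow> complex) \<Rightarrow> complex vec) \<Rightarrow> bool" where
  "weight_components n T m \<rho> u c \<longleftrightarrow>
     (\<forall>\<chi>\<in>characters n T. c \<chi> \<in> weight_space T m \<rho> \<chi>) \<and>
     finite {\<chi> \<in> characters n T. c \<chi> \<noteq> 0\<^sub>v m} \<and>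
     u = finsum_vec TYPE(complex) m c {\<chi> \<in> characters n T. c \<chi> \<noteq> 0\<^sub>v m}"

definition weights ::
  "nat \<Rightarrow> complex mat set \<Rightarrow> nat \<Rightarrow> (complex mat \<Rightarrow> complex mat) \<Rightarrow> complex vec \<Rightarrow>
   (complex mat \<Rightarrow> complex) set" where
  "weights n T m \<rho> u =
     {\<chi> \<in> characters n T. \<exists>c. weight_components n T m \<rho> u c \<and> c \<chi> \<noteq> 0\<^sub>v m}"

text \<open>
  The convex hull, in \<open>Lie(T)\<^sup>*\<close>, of the finitely many weights of \<open>u\<close>. It is written out because
  functions on \<open>Lie(T)\<close> do not form an instance of the class \<^class>\<open>real_vector\<close>.
\<close>

definition weight_polytope ::
  "nat \<Rightarrow> complex mat set \<Rightarrow> nat \<Rightarrow> (complex mat \<Rightarrow> complex mat) \<Rightarrow> complex vec \<Rightarrow>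
   (complex mat \<Rightarrow> complex) set" where
  "weight_polytope n T m \<rho> u =
     {\<lambda>X\<in>Lie n T. \<Sum>\<chi>\<in>weights n T m \<rho> u. complex_of_real (a \<chi>) * differential n T \<chi> X | a.
        (\<forall>\<chi>\<in>weights n T m \<rho> u. 0 \<le> a \<chi>) \<and> (\<Sum>\<chi>\<in>weights n T m \<rho> u. a \<chi>) = (1 :: real)}"

definition numerically_semistable ::
  "nat \<Rightarrow> nat \<Rightarrow> (complex mat \<Rightarrow> complex mat) \<Rightarrow> nat \<Rightarrow> (complex mat \<Rightarrow> complex mat) \<Rightarrow>
   complex vec \<Rightarrow> complex vec \<Rightarrow> bool" where
  "numerically_semistable n m \<rho> k \<sigma> v w \<longleftrightarrow>
     (\<forall>T. maximal_torus n T \<longrightarrow> weight_polytope n T m \<rho> v \<subseteq> weight_polytope n T k \<sigma> w)"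


section \<open>The irreducible representations of \<open>SL(3)\<close>\<close>

text \<open>
  With \<open>U = \<complex>\<^sup>3\<close>, an element of \<open>U\<^sup>\<otimes>\<^sup>a \<otimes> (U\<^sup>*)\<^sup>\<otimes>\<^sup>b\<close> is the array of its coordinates \<open>t I J\<close> in the
  standard basis, where \<open>I\<close> and \<open>J\<close> are lists of indices below \<open>3\<close> of length \<open>a\<close> and \<open>b\<close>.
  \<open>Sym\<^sup>a U \<otimes> Sym\<^sup>b U\<^sup>*\<close> is the subspace of tensors symmetric in \<open>I\<close> and in \<open>J\<close>. On it, the natural
  contraction is, up to a non-zero scalar, the contraction of one index in \<open>I\<close> with one in \<open>J\<close>; by
  symmetry these may be the first ones. It vanishes if \<open>a = 0\<close> or \<open>b = 0\<close>.
\<close>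

definition indices :: "nat \<Rightarrow> nat list set" where
  "indices a = {I. length I = a \<and> set I \<subseteq> {..<3}}"

definition sym_tensors :: "nat \<Rightarrow> nat \<Rightarrow> (nat list \<Rightarrow> nat list \<Rightarrow> complex) set" where
  "sym_tensors a b = {t.
     (\<forall>I J. I \<notin> indices a \<or> J \<notin> indices b \<longrightarrow> t I J = 0) \<and>
     (\<forall>I I' J J'. mset I = mset I' \<longrightarrow> mset J = mset J' \<longrightarrow> t I J = t I' J')}"

definition contraction ::
  "(nat list \<Rightarrow> nat list \<Rightarrow> complex) \<Rightarrow> nat list \<Rightarrow> nat list \<Rightarrow> complex" where
  "contraction t I J = (\<Sum>k<3. t (k # I) (k # J))"

definition Gamma :: "nat \<Rightarrow> nat \<Rightarrow> (nat list \<Rightarrow> nat list \<Rightarrow> complex) set" where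
  "Gamma a b = {t \<in> sym_tensors a b. contraction t = (\<lambda>I J. 0)}"

text \<open>
  \<open>g\<close> maps the \<open>i\<close>-th basis vector of \<open>U\<close> to the sum of the \<open>g $$ (i', i) \<cdot> e\<^sub>i\<^sub>'\<close>, and acts on \<open>U\<^sup>*\<close> by the
  transpose of \<open>g\<^sup>-\<^sup>1\<close>.
\<close>

definition tensor_action ::
  "nat \<Rightarrow> nat \<Rightarrow> complex mat \<Rightarrow> (nat list \<Rightarrow> nat list \<Rightarrow> complex) \<Rightarrow>
   nat list \<Rightarrow> nat list \<Rightarrow> complex" where
  "tensor_action a b g t I J =
     (if I \<in> indices a \<and> J \<in> indices b
      then \<Sum>I'\<in>indices a. \<Sum>J'\<in>indices b.
             (\<Prod>p<a. g $$ (I ! p, I' ! p)) * (\<Prod>q<b. (inv\<^bsub>SL 3\<^esub> g) $$ (J' ! q, J ! q)) * t I' J'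
      else 0)"

definition isomorphic_to_Gamma :: "nat \<Rightarrow> (complex mat \<Rightarrow> complex mat) \<Rightarrow> nat \<Rightarrow> nat \<Rightarrow> bool" where
  "isomorphic_to_Gamma m \<rho> a b \<longleftrightarrow>
     (\<exists>L. bij_betw L (carrier_vec m) (Gamma a b) \<and>
          (\<forall>x\<in>carrier_vec m. \<forall>y\<in>carrier_vec m. L (x + y) = (\<lambda>I J. L x I J + L y I J)) \<and>
          (\<forall>c. \<forall>x\<in>carrier_vec m. L (c \<cdot>\<^sub>v x) = (\<lambda>I J. c * L x I J)) \<and>
          (\<forall>g\<in>carrier (SL 3). \<forall>x\<in>carrier_vec m. L (\<rho> g *\<^sub>v x) = tensor_action a b g (L x)))"

definition homogeneous ::
  "nat \<Rightarrow> (complex mat \<Rightarrow> complex mat) \<Rightarrow> nat \<Rightarrow> (complex mat \<Rightarrow> complex mat) \<Rightarrow> bool" where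
  "homogeneous m \<rho> k \<sigma> \<longleftrightarrow>
     (\<exists>a b a' b'. isomorphic_to_Gamma m \<rho> a b \<and> isomorphic_to_Gamma k \<sigma> a' b' \<and>
        a + 2 * b = a' + 2 * b')"

end

theory Submission
  imports Defs
begin

text \<open>
  All maximal tori are conjugate to the diagonal one. Semistability of \<open>(v, w)\<close> follows from a bound
  \<open>\<parallel>g v\<parallel> \<le> C \<parallel>g w\<parallel>\<close> over the group. For \<open>SL(2)\<close> the Iwasawa decomposition reduces the bound to \<open>g = d n\<close> with
  \<open>d = diag(s, 1/s)\<close>, \<open>s \<ge> 1\<close>, and \<open>n\<close> in a compact set of upper unipotents, hence, after translating the pair,
  to \<open>n\<close> near \<open>1\<close>. There the component of \<open>n w\<close> in the highest weight of \<open>W\<close> starts with the power of the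
  coordinate of \<open>n\<close> that leads up from the highest weight of \<open>w\<close>; its coefficient is non-zero because \<open>W\<close> is
  irreducible. The components of \<open>n v\<close> are no larger, since no weight of a translate of \<open>v\<close> exceeds the highest
  weight of the same translate of \<open>w\<close>.

  The counterexamples are \<open>(x y, x\<^sup>2 + 1)\<close> in \<open>Sym\<^sup>2\<close> and \<open>Sym\<^sup>2 \<oplus> 1\<close> for \<open>SL(2)\<close>, and, with \<open>X, Y, Z\<close> dual to
  \<open>x, y, z\<close>, \<open>(X Y, z (z Z - x X - y Y + y X))\<close> in \<open>\<Gamma>\<^sub>0\<^sub>,\<^sub>2\<close> and \<open>\<Gamma>\<^sub>2\<^sub>,\<^sub>1\<close> for \<open>SL(3)\<close>. In both, rescaled translates
  of \<open>(v, w)\<close> along a curve in the group converge to \<open>(l\<^sup>2, 0)\<close> with a linear form \<open>l\<close>.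
\<close>

section \<open>Regular functions and the group SL(n)\<close>

text \<open>Numerical semistability records only which weight components vanish, whereas
  semistability compares their sizes. A bound cannot be found torus by torus: in
  \<open>dg s * up z\<close> the parameter \<open>s\<close> tends to infinity while \<open>z\<close>
  may approach values at which high components of \<open>w\<close> degenerate. For SL(2) two
  components of \<open>w\<close> control everything. With \<open>M\<close> the highest weight of
  \<open>w\<close>, \<open>d\<close> that of \<open>W\<close> and \<open>r = sqrt (cmod z)\<close>,
  they are at least of order \<open>s powi M\<close> and \<open>s powi d * r ^ (d - M)\<close>, and
  the weights of \<open>v\<close> between \<open>M\<close> and \<open>d\<close> are interpolated.
  Irreducibility provides the second one. For \<open>x^2 + 1\<close> it fails: once a translate has
  lost its terms in \<open>x^2\<close> and \<open>x y\<close>, its weight-0 part is the invariant 1,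
  from which \<open>up z\<close> never reaches weight 2.

  In the SL(3) example the invariant tensor \<open>1 = x X + y Y + z Z\<close> rewrites
  \<open>w\<close> as \<open>z (2 z Z - 1 + y X)\<close>. This does not mention \<open>x\<close>, so
  \<open>w\<close> stays bounded on a curve that fixes \<open>z\<close> and \<open>Z\<close>,
  shrinks \<open>y\<close> and \<open>X\<close>, and enlarges \<open>x\<close> and
  \<open>Y\<close>.\<close>

lemma function_algebra_sum:
  assumes "finite A" "\<And>a. a \<in> A \<Longrightarrow> f a \<in> function_algebra F"
  shows "(\<lambda>x. \<Sum>a\<in>A. f a x) \<in> function_algebra F"
  using assms
proof (induction A rule: finite_induct)
  case empty
  then show ?case using function_algebra.const[of 0 F] by simp
next
  case (insert a A)
  then have "(\<lambda>x. f a x + (\<Sum>a\<in>A. f a x)) \<in> function_algebra F"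
    by (intro function_algebra.add) auto
  then show ?case using insert.hyps by simp
qed

lemma function_algebra_prod:
  assumes "finite A" "\<And>a. a \<in> A \<Longrightarrow> f a \<in> function_algebra F"
  shows "(\<lambda>x. \<Prod>a\<in>A. f a x) \<in> function_algebra F"
  using assms
proof (induction A rule: finite_induct)
  case empty
  then show ?case using function_algebra.const[of 1 F] by simp
next
  case (insert a A)
  then have "(\<lambda>x. f a x * (\<Prod>a\<in>A. f a x)) \<in> function_algebra F"
    by (intro function_algebra.mult) auto
  then show ?case using insert.hyps by simp
qed

lemma poly_functions_entry: "i < n \<Longrightarrow> j < n \<Longrightarrow> (\<lambda>g. g $$ (i, j)) \<in> poly_functions n"
  unfolding poly_functions_def by (rule function_algebra.gen) blast

lemma regular_on_poly: "p \<in> poly_functions n \<Longrightarrow> regular_on n T p"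
  unfolding regular_on_def by blast

lemma regular_on_cong: "regular_on n T f \<Longrightarrow> (\<And>g. g \<in> T \<Longrightarrow> f' g = f g) \<Longrightarrow> regular_on n T f'"
  unfolding regular_on_def by metis

lemma regular_on_subset: "regular_on n T f \<Longrightarrow> S \<subseteq> T \<Longrightarrow> regular_on n S f"
  unfolding regular_on_def by blast

lemma regular_on_const: "regular_on n T (\<lambda>_. c)"
  unfolding poly_functions_def regular_on_def using function_algebra.const by fastforce

lemma regular_on_mult: "regular_on n T f \<Longrightarrow> regular_on n T f' \<Longrightarrow> regular_on n T (\<lambda>g. f g * f' g)"
proof -
  assume "regular_on n T f" "regular_on n T f'"
  then obtain p p' where "p \<in> poly_functions n" "\<forall>g\<in>T. f g = p g"
      "p' \<in> poly_functions n" "\<forall>g\<in>T. f' g = p' g"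
    unfolding regular_on_def by blast
  moreover from this have "(\<lambda>g. p g * p' g) \<in> poly_functions n"
    unfolding poly_functions_def by (intro function_algebra.mult)
  ultimately show ?thesis unfolding regular_on_def by (intro bexI[of _ "\<lambda>g. p g * p' g"]) auto
qed

lemma regular_on_sum:
  assumes "finite A" "\<And>a. a \<in> A \<Longrightarrow> regular_on n T (f a)"
  shows "regular_on n T (\<lambda>g. \<Sum>a\<in>A. f a g)"
proof -
  from assms(2) have "\<forall>a\<in>A. \<exists>p. p \<in> poly_functions n \<and> (\<forall>g\<in>T. f a g = p g)"
    unfolding regular_on_def by blast
  then obtain p where p: "\<And>a. a \<in> A \<Longrightarrow> p a \<in> poly_functions n" "\<And>a g. a \<in> A \<Longrightarrow> g \<in> T \<Longrightarrow> f a g = p a g"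
    by metis
  have "(\<lambda>g. \<Sum>a\<in>A. p a g) \<in> poly_functions n"
    using p(1) assms(1) unfolding poly_functions_def by (intro function_algebra_sum) auto
  from regular_on_poly[OF this] show ?thesis
    by (rule regular_on_cong) (auto intro!: sum.cong p(2))
qed

lemma regular_on_prod:
  assumes "finite A" "\<And>a. a \<in> A \<Longrightarrow> regular_on n T (f a)"
  shows "regular_on n T (\<lambda>g. \<Prod>a\<in>A. f a g)"
  using assms
  by (induction A rule: finite_induct) (auto intro: regular_on_const regular_on_mult)

lemma regular_on_power: "regular_on n T f \<Longrightarrow> regular_on n T (\<lambda>g. f g ^ k)"
  using regular_on_prod[of "{..<k}" n T "\<lambda>_. f"] by simp

lemma regular_on_entry: "i < n \<Longrightarrow> j < n \<Longrightarrow> regular_on n T (\<lambda>g. g $$ (i, j))"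
  by (intro regular_on_poly poly_functions_entry)

section \<open>The group SL(n) and regularity of its inverse\<close>

lemma carrier_SL: "carrier (SL n) = {A \<in> carrier_mat n n. det A = 1}"
  and mult_SL [simp]: "x \<otimes>\<^bsub>SL n\<^esub> y = x * y"
  and one_SL [simp]: "\<one>\<^bsub>SL n\<^esub> = 1\<^sub>m n"
  by (auto simp: SL_def)

lemma carrier_GL: "carrier (GL n) = {A \<in> carrier_mat n n. det A \<noteq> 0}"
  and mult_GL [simp]: "x \<otimes>\<^bsub>GL n\<^esub> y = x * y"
  and one_GL [simp]: "\<one>\<^bsub>GL n\<^esub> = 1\<^sub>m n"
  by (auto simp: GL_def)

lemma SL_carrier_mat: "g \<in> carrier (SL n) \<Longrightarrow> g \<in> carrier_mat n n"
  by (simp add: carrier_SL)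

lemma adj_mat_SL:
  assumes "g \<in> carrier (SL n)"
  shows "adj_mat g \<in> carrier (SL n)" "g * adj_mat g = 1\<^sub>m n" "adj_mat g * g = 1\<^sub>m n"
proof -
  have g: "g \<in> carrier_mat n n" "det g = 1" using assms by (auto simp: carrier_SL)
  note a = adj_mat[OF g(1)]
  show 1: "g * adj_mat g = 1\<^sub>m n" "adj_mat g * g = 1\<^sub>m n" using a g(2) by auto
  have "det g * det (adj_mat g) = 1"
    using det_mult[OF g(1) a(1)] 1 by simp
  then show "adj_mat g \<in> carrier (SL n)" using a(1) g(2) by (simp add: carrier_SL)
qed

lemma group_SL: "group (SL n)"
proof (rule groupI)
  fix x assume "x \<in> carrier (SL n)"
  then show "\<exists>y\<in>carrier (SL n). y \<otimes>\<^bsub>SL n\<^esub> x = \<one>\<^bsub>SL n\<^esub>"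
    using adj_mat_SL[of x n] by auto
qed (auto simp: carrier_SL det_mult assoc_mult_mat[of _ n n _ n _ n])

lemma inv_SL_eq_adj: "g \<in> carrier (SL n) \<Longrightarrow> inv\<^bsub>SL n\<^esub> g = adj_mat g"
  using group.inv_equality[OF group_SL] adj_mat_SL by fastforce

lemma inv_SL:
  assumes "g \<in> carrier (SL n)"
  shows "inv\<^bsub>SL n\<^esub> g \<in> carrier (SL n)" "g * inv\<^bsub>SL n\<^esub> g = 1\<^sub>m n" "inv\<^bsub>SL n\<^esub> g * g = 1\<^sub>m n"
  using adj_mat_SL[OF assms] by (auto simp: inv_SL_eq_adj[OF assms])

lemma mult_in_SL: "x \<in> carrier (SL n) \<Longrightarrow> y \<in> carrier (SL n) \<Longrightarrow> x * y \<in> carrier (SL n)"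
  by (auto simp: carrier_SL det_mult)

lemma one_in_SL: "1\<^sub>m n \<in> carrier (SL n)"
  by (auto simp: carrier_SL)

lemma regular_on_det:
  assumes "\<And>g. g \<in> T \<Longrightarrow> M g \<in> carrier_mat k k"
    "\<And>i j. i < k \<Longrightarrow> j < k \<Longrightarrow> regular_on n T (\<lambda>g. M g $$ (i, j))"
  shows "regular_on n T (\<lambda>g. det (M g))"
proof (rule regular_on_cong)
  show "regular_on n T (\<lambda>g. \<Sum>p \<in> {p. p permutes {0..<k}}. signof p * (\<Prod>i=0..<k. M g $$ (i, p i)))"
    by (intro regular_on_sum regular_on_mult regular_on_const regular_on_prod assms(2) finite_permutations)
       (auto dest: permutes_in_image)
qed (auto dest: assms(1) simp: det_def)

text \<open>On SL(n) the inverse is the adjugate, whose entries are signed minors and therefore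
  polynomials in the entries.\<close>

lemma regular_on_inv_entry:
  assumes "i < n" "j < n"
  shows "regular_on n (carrier (SL n)) (\<lambda>g. (inv\<^bsub>SL n\<^esub> g) $$ (i, j))"
proof (rule regular_on_cong)
  \<comment> \<open>Deleting row \<open>j\<close> and column \<open>i\<close> shifts the later
    indices by one.\<close>
  have "regular_on n (carrier (SL n)) (\<lambda>g. mat_delete g j i $$ (p, q))" if "p < n - 1" "q < n - 1" for p q
    using assms that
    by (intro regular_on_cong[OF regular_on_entry[of "if p < j then p else Suc p" n "if q < i then q else Suc q"]])
       (auto simp: carrier_SL mat_delete_def)
  then show "regular_on n (carrier (SL n)) (\<lambda>g. (-1) ^ (j + i) * det (mat_delete g j i))"
    by (intro regular_on_mult regular_on_const regular_on_det[where k = "n - 1"])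
       (auto simp: carrier_SL mat_delete_def)
next
  fix g assume "g \<in> carrier (SL n)"
  then show "(inv\<^bsub>SL n\<^esub> g) $$ (i, j) = (- 1) ^ (j + i) * det (mat_delete g j i)"
    using assms by (auto simp: inv_SL_eq_adj adj_mat_def cofactor_def carrier_SL)
qed

section \<open>Linear independence of characters\<close>

text \<open>Common setting of three families: the regular characters of a subgroup of SL(n), the
  multiplicative functions on the standard torus, and the integer powers on the nonzero complex
  numbers. Extensionality ensures that distinct members differ at a point of
  \<open>X\<close>.\<close>

locale character_family =
  fixes X :: "'a set" and mul :: "'a \<Rightarrow> 'a \<Rightarrow> 'a" and e :: 'a and C :: "('a \<Rightarrow> complex) set"
  assumes closed: "x \<in> X \<Longrightarrow> y \<in> X \<Longrightarrow> mul x y \<in> X"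
    and unit: "e \<in> X"
    and ext: "\<chi> \<in> C \<Longrightarrow> \<chi> \<in> extensional X"
    and char_mul: "\<chi> \<in> C \<Longrightarrow> x \<in> X \<Longrightarrow> y \<in> X \<Longrightarrow> \<chi> (mul x y) = \<chi> x * \<chi> y"
    and char_unit: "\<chi> \<in> C \<Longrightarrow> \<chi> e = 1"
    and char_one: "(\<lambda>x\<in>X. 1) \<in> C"
    and char_prod: "\<chi> \<in> C \<Longrightarrow> \<psi> \<in> C \<Longrightarrow> (\<lambda>x\<in>X. \<chi> x * \<psi> x) \<in> C"
begin

text \<open>Artin's argument: subtracting \<open>\<psi> y\<close> times the relation at
  \<open>x\<close> from the relation at \<open>mul y x\<close> eliminates \<open>\<psi>\<close> and
  leaves a shorter relation with coefficients
  \<open>c \<chi> * (\<chi> y - \<psi> y)\<close>.\<close>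

lemma independent:
  assumes "finite A" "A \<subseteq> C" "\<And>x. x \<in> X \<Longrightarrow> (\<Sum>\<chi>\<in>A. c \<chi> * \<chi> x) = 0"
  shows "\<forall>\<chi>\<in>A. c \<chi> = 0"
  using assms
proof (induction A arbitrary: c rule: finite_induct)
  case (insert \<psi> A)
  have *: "c \<chi> = 0" if "\<chi> \<in> A" for \<chi>
  proof -
    have "\<chi> \<noteq> \<psi>" using that insert by auto
    moreover have "\<chi> \<in> extensional X" "\<psi> \<in> extensional X"
      using insert.prems(1) that by (auto intro: ext)
    ultimately have "\<not> (\<forall>y\<in>X. \<chi> y = \<psi> y)"
      using extensionalityI[of \<chi> X \<psi>] by blast
    then obtain y where y: "y \<in> X" "\<chi> y \<noteq> \<psi> y" by blast
    have "\<forall>\<chi>\<in>A. c \<chi> * (\<chi> y - \<psi> y) = 0"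
    proof (rule insert.IH)
      fix x assume x: "x \<in> X"
      have "(\<Sum>\<chi>\<in>insert \<psi> A. c \<chi> * \<chi> (mul y x)) - \<psi> y * (\<Sum>\<chi>\<in>insert \<psi> A. c \<chi> * \<chi> x) = 0"
        using insert.prems(2) x closed y(1) by simp
      moreover have "(\<Sum>\<chi>\<in>insert \<psi> A. c \<chi> * \<chi> (mul y x)) = (\<Sum>\<chi>\<in>insert \<psi> A. c \<chi> * (\<chi> y * \<chi> x))"
        using insert.prems(1) x y(1) by (intro sum.cong refl) (subst char_mul, auto)
      ultimately show "(\<Sum>\<chi>\<in>A. c \<chi> * (\<chi> y - \<psi> y) * \<chi> x) = 0"
        using insert.hyps by (simp add: algebra_simps sum_subtractf sum_distrib_left)
    qed (use insert in auto)
    then show ?thesis using that y(2) by auto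
  qed
  then have "c \<psi> * \<psi> e = 0"
    using insert.prems(2)[OF unit] insert.hyps by simp
  moreover have "\<psi> e = 1" using insert.prems(1) by (intro char_unit) auto
  ultimately show ?case using * by simp
qed simp

definition span :: "('a \<Rightarrow> complex) set" where
  "span = {f. \<exists>A c. finite A \<and> A \<subseteq> C \<and> (\<forall>x\<in>X. f x = (\<Sum>\<chi>\<in>A. c \<chi> * \<chi> x))}"

lemma span_widen:
  assumes "finite A" "A \<subseteq> B" "finite B"
  shows "(\<Sum>\<chi>\<in>A. c \<chi> * \<chi> x) = (\<Sum>\<chi>\<in>B. (if \<chi> \<in> A then c \<chi> else 0) * (\<chi> x :: complex))"
proof -
  have "(\<Sum>\<chi>\<in>B. (if \<chi> \<in> A then c \<chi> else 0) * \<chi> x) = (\<Sum>\<chi>\<in>A. (if \<chi> \<in> A then c \<chi> else 0) * \<chi> x)"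
    using assms by (intro sum.mono_neutral_right) auto
  then show ?thesis by simp
qed

lemma span_cong: "f \<in> span \<Longrightarrow> (\<And>x. x \<in> X \<Longrightarrow> f' x = f x) \<Longrightarrow> f' \<in> span"
  unfolding span_def by auto

lemma span_add: assumes "f \<in> span" "f' \<in> span" shows "(\<lambda>x. f x + f' x) \<in> span"
proof -
  from assms obtain A c A' c' where A: "finite A" "A \<subseteq> C" "\<And>x. x \<in> X \<Longrightarrow> f x = (\<Sum>\<chi>\<in>A. c \<chi> * \<chi> x)"
    and A': "finite A'" "A' \<subseteq> C" "\<And>x. x \<in> X \<Longrightarrow> f' x = (\<Sum>\<chi>\<in>A'. c' \<chi> * \<chi> x)"
    unfolding span_def by blast
  have "f x + f' x = (\<Sum>\<chi>\<in>A \<union> A'. ((if \<chi> \<in> A then c \<chi> else 0) + (if \<chi> \<in> A' then c' \<chi> else 0)) * \<chi> x)"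
    if "x \<in> X" for x
    using A(3)[OF that] A'(3)[OF that] span_widen[of A "A \<union> A'" c x] span_widen[of A' "A \<union> A'" c' x] A(1) A'(1)
    by (simp add: distrib_right sum.distrib)
  then show ?thesis unfolding span_def using A A'
    by (intro CollectI exI[of _ "A \<union> A'"] exI[of _ "\<lambda>\<chi>. (if \<chi> \<in> A then c \<chi> else 0) + (if \<chi> \<in> A' then c' \<chi> else 0)"]) auto
qed

lemma span_scale: assumes "f \<in> span" shows "(\<lambda>x. a * f x) \<in> span"
proof -
  from assms obtain A c where A: "finite A" "A \<subseteq> C" "\<And>x. x \<in> X \<Longrightarrow> f x = (\<Sum>\<chi>\<in>A. c \<chi> * \<chi> x)"
    unfolding span_def by blast
  then show ?thesis unfolding span_def
    by (intro CollectI exI[of _ A] exI[of _ "\<lambda>\<chi>. a * c \<chi>"]) (auto simp: sum_distrib_left mult.assoc)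
qed

lemma span_char: "\<chi> \<in> C \<Longrightarrow> \<chi> \<in> span"
  unfolding span_def by (intro CollectI exI[of _ "{\<chi>}"] exI[of _ "\<lambda>_. 1"]) auto

lemma span_const: "(\<lambda>_. a) \<in> span"
  using span_cong[OF span_scale[OF span_char[OF char_one], of a]] by simp

lemma span_sum:
  assumes "finite I" "\<And>i. i \<in> I \<Longrightarrow> f i \<in> span"
  shows "(\<lambda>x. \<Sum>i\<in>I. f i x) \<in> span"
  using assms by (induction I rule: finite_induct) (auto intro: span_add span_const)

lemma span_mult: assumes "f \<in> span" "f' \<in> span" shows "(\<lambda>x. f x * f' x) \<in> span"
proof -
  from assms obtain A c A' c' where A: "finite A" "A \<subseteq> C" "\<And>x. x \<in> X \<Longrightarrow> f x = (\<Sum>\<chi>\<in>A. c \<chi> * \<chi> x)"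
    and A': "finite A'" "A' \<subseteq> C" "\<And>x. x \<in> X \<Longrightarrow> f' x = (\<Sum>\<chi>\<in>A'. c' \<chi> * \<chi> x)"
    unfolding span_def by blast
  have "(\<lambda>x. \<Sum>\<chi>\<in>A. \<Sum>\<psi>\<in>A'. (c \<chi> * c' \<psi>) * (\<lambda>x\<in>X. \<chi> x * \<psi> x) x) \<in> span"
    using A(1,2) A'(1,2) by (intro span_sum span_scale span_char char_prod) auto
  then show ?thesis
    by (rule span_cong) (auto simp: A(3) A'(3) sum_product intro!: sum.cong)
qed

lemma span_function_algebra:
  assumes "p \<in> function_algebra F" "\<And>f. f \<in> F \<Longrightarrow> f \<in> span"
  shows "p \<in> span"
  using assms by (induction rule: function_algebra.induct) (auto intro: span_const span_add span_mult)

text \<open>A matrix representation whose entries are spanned by characters splits into weight spaces;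
  \<open>P \<chi>\<close> is the projection to the weight space of \<open>\<chi>\<close>.\<close>

lemma weight_decomposition:
  assumes R: "\<And>x. x \<in> X \<Longrightarrow> R x \<in> carrier_mat m m"
    and mult: "\<And>x y. x \<in> X \<Longrightarrow> y \<in> X \<Longrightarrow> R (mul x y) = R x * R y"
    and one: "R e = 1\<^sub>m m"
    and entries: "\<And>i j. i < m \<Longrightarrow> j < m \<Longrightarrow> (\<lambda>x. R x $$ (i, j)) \<in> span"
  obtains A P where "finite A" "A \<subseteq> C" "\<And>\<chi>. P \<chi> \<in> carrier_mat m m"
    "\<And>x \<chi>. x \<in> X \<Longrightarrow> \<chi> \<in> A \<Longrightarrow> R x * P \<chi> = \<chi> x \<cdot>\<^sub>m P \<chi>"
    "\<And>x \<chi>. x \<in> X \<Longrightarrow> \<chi> \<in> A \<Longrightarrow> P \<chi> * R x = \<chi> x \<cdot>\<^sub>m P \<chi>"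
    "\<And>x i j. x \<in> X \<Longrightarrow> i < m \<Longrightarrow> j < m \<Longrightarrow> R x $$ (i, j) = (\<Sum>\<chi>\<in>A. \<chi> x * P \<chi> $$ (i, j))"
    "\<And>i j. i < m \<Longrightarrow> j < m \<Longrightarrow> (\<Sum>\<chi>\<in>A. P \<chi> $$ (i, j)) = 1\<^sub>m m $$ (i, j)"
proof -
  \<comment> \<open>Each matrix entry has its own finite set of characters with coefficients. They
    are chosen together as a pair and afterwards padded with zeros to one common set
    \<open>A\<close>.\<close>
  define Q where "Q i j q \<longleftrightarrow> finite (fst q) \<and> fst q \<subseteq> C \<and>
      (\<forall>x\<in>X. R x $$ (i, j) = (\<Sum>\<chi>\<in>fst q. snd q \<chi> * \<chi> x))" for i j and q :: "('a \<Rightarrow> complex) set \<times> _"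
  define F where "F i j = (SOME q. Q i j q)" for i j
  have Q: "Q i j (F i j)" if ij: "i < m" "j < m" for i j
  proof -
    obtain A c where "finite A" "A \<subseteq> C" "\<forall>x\<in>X. R x $$ (i, j) = (\<Sum>\<chi>\<in>A. c \<chi> * \<chi> x)"
      using entries[OF ij] unfolding span_def by blast
    then have "Q i j (A, c)" by (simp add: Q_def)
    then show ?thesis unfolding F_def by (rule someI)
  qed
  define B c where "B i j = fst (F i j)" and "c i j = snd (F i j)" for i j
  have B: "finite (B i j)" "B i j \<subseteq> C" "\<And>x. x \<in> X \<Longrightarrow> R x $$ (i, j) = (\<Sum>\<chi>\<in>B i j. c i j \<chi> * \<chi> x)"
    if "i < m" "j < m" for i j
    using Q[OF that] by (auto simp: Q_def B_def c_def)
  define A where "A = (\<Union>i<m. \<Union>j<m. B i j)"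
  define P where "P \<chi> = mat m m (\<lambda>(i, j). if \<chi> \<in> B i j then c i j \<chi> else 0)" for \<chi>
  have A: "finite A" "A \<subseteq> C" using B(1) B(2)[THEN subsetD] by (auto simp: A_def)
  have P: "P \<chi> \<in> carrier_mat m m" for \<chi> by (simp add: P_def)
  have ent: "R x $$ (i, j) = (\<Sum>\<chi>\<in>A. \<chi> x * P \<chi> $$ (i, j))" if "x \<in> X" "i < m" "j < m" for x i j
  proof -
    have "R x $$ (i, j) = (\<Sum>\<chi>\<in>A. (if \<chi> \<in> B i j then c i j \<chi> else 0) * \<chi> x)"
      unfolding B(3)[OF that(2,3,1)] using A(1) B(1)[OF that(2,3)] that
      by (intro span_widen) (auto simp: A_def)
    also have "\<dots> = (\<Sum>\<chi>\<in>A. \<chi> x * P \<chi> $$ (i, j))"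
      using that by (intro sum.cong) (auto simp: P_def)
    finally show ?thesis .
  qed
  \<comment> \<open>With \<open>x\<close> fixed, \<open>R (mul x y) = R x * R y\<close> is an
    identity between combinations of characters of \<open>y\<close>. Independence permits comparing
    the coefficients of \<open>\<chi>\<close>, and this is the eigenvector equation.\<close>
  have RP: "R x * P \<chi> = \<chi> x \<cdot>\<^sub>m P \<chi>" if x: "x \<in> X" and \<chi>: "\<chi> \<in> A" for x \<chi>
  proof (rule eq_matI)
    fix i j assume ij: "i < dim_row (\<chi> x \<cdot>\<^sub>m P \<chi>)" "j < dim_col (\<chi> x \<cdot>\<^sub>m P \<chi>)"
    then have ij: "i < m" "j < m" using P[of \<chi>] by auto
    have "\<forall>\<chi>\<in>A. (\<Sum>k<m. R x $$ (i, k) * P \<chi> $$ (k, j)) - \<chi> x * P \<chi> $$ (i, j) = 0"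
    proof (rule independent[OF A])
      fix y assume y: "y \<in> X"
      have "(\<Sum>\<chi>\<in>A. (\<chi> x * \<chi> y) * P \<chi> $$ (i, j)) = R (mul x y) $$ (i, j)"
        using A(2) x y ij by (subst ent) (auto intro!: closed sum.cong simp: char_mul)
      also have "\<dots> = (\<Sum>k<m. R x $$ (i, k) * R y $$ (k, j))"
        using R[OF x] R[OF y] ij by (auto simp: mult[OF x y] scalar_prod_def atLeast0LessThan intro!: sum.cong)
      also have "\<dots> = (\<Sum>k<m. \<Sum>\<chi>\<in>A. R x $$ (i, k) * (\<chi> y * P \<chi> $$ (k, j)))"
        using ent[OF y] ij by (intro sum.cong) (auto simp: sum_distrib_left)
      also have "\<dots> = (\<Sum>\<chi>\<in>A. (\<Sum>k<m. R x $$ (i, k) * P \<chi> $$ (k, j)) * \<chi> y)"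
        by (subst sum.swap) (simp add: sum_distrib_left sum_distrib_right algebra_simps)
      finally show "(\<Sum>\<chi>\<in>A. ((\<Sum>k<m. R x $$ (i, k) * P \<chi> $$ (k, j)) - \<chi> x * P \<chi> $$ (i, j)) * \<chi> y) = 0"
        by (simp add: left_diff_distrib sum_subtractf algebra_simps)
    qed
    then show "(R x * P \<chi>) $$ (i, j) = (\<chi> x \<cdot>\<^sub>m P \<chi>) $$ (i, j)"
      using R[OF x] P[of \<chi>] ij \<chi> by (auto simp: scalar_prod_def atLeast0LessThan)
  qed (use R[OF x] P[of \<chi>] in auto)
  \<comment> \<open>The mirror image, obtained from \<open>R (mul y x)\<close>.\<close>
  have PR: "P \<chi> * R x = \<chi> x \<cdot>\<^sub>m P \<chi>" if x: "x \<in> X" and \<chi>: "\<chi> \<in> A" for x \<chi>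
  proof (rule eq_matI)
    fix i j assume ij: "i < dim_row (\<chi> x \<cdot>\<^sub>m P \<chi>)" "j < dim_col (\<chi> x \<cdot>\<^sub>m P \<chi>)"
    then have ij: "i < m" "j < m" using P[of \<chi>] by auto
    have "\<forall>\<chi>\<in>A. (\<Sum>k<m. P \<chi> $$ (i, k) * R x $$ (k, j)) - \<chi> x * P \<chi> $$ (i, j) = 0"
    proof (rule independent[OF A])
      fix y assume y: "y \<in> X"
      have "(\<Sum>\<chi>\<in>A. (\<chi> y * \<chi> x) * P \<chi> $$ (i, j)) = R (mul y x) $$ (i, j)"
        using A(2) x y ij by (subst ent) (auto intro!: closed sum.cong simp: char_mul)
      also have "\<dots> = (\<Sum>k<m. R y $$ (i, k) * R x $$ (k, j))"
        using R[OF x] R[OF y] ij by (auto simp: mult[OF y x] scalar_prod_def atLeast0LessThan intro!: sum.cong)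
      also have "\<dots> = (\<Sum>k<m. \<Sum>\<chi>\<in>A. (\<chi> y * P \<chi> $$ (i, k)) * R x $$ (k, j))"
        using ent[OF y] ij by (intro sum.cong) (auto simp: sum_distrib_right)
      also have "\<dots> = (\<Sum>\<chi>\<in>A. (\<Sum>k<m. P \<chi> $$ (i, k) * R x $$ (k, j)) * \<chi> y)"
        by (subst sum.swap) (simp add: sum_distrib_left sum_distrib_right algebra_simps)
      finally show "(\<Sum>\<chi>\<in>A. ((\<Sum>k<m. P \<chi> $$ (i, k) * R x $$ (k, j)) - \<chi> x * P \<chi> $$ (i, j)) * \<chi> y) = 0"
        by (simp add: left_diff_distrib sum_subtractf algebra_simps)
    qed
    then show "(P \<chi> * R x) $$ (i, j) = (\<chi> x \<cdot>\<^sub>m P \<chi>) $$ (i, j)"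
      using R[OF x] P[of \<chi>] ij \<chi> by (auto simp: scalar_prod_def atLeast0LessThan)
  qed (use R[OF x] P[of \<chi>] in auto)
  have "(\<Sum>\<chi>\<in>A. P \<chi> $$ (i, j)) = 1\<^sub>m m $$ (i, j)" if "i < m" "j < m" for i j
    using ent[OF unit that] A(2) by (simp add: one char_unit subset_iff)
  with A P ent RP PR show thesis by (intro that[of A P])
qed

end

section \<open>Weights of a vector\<close>

lemma mult_mat_vec_index:
  assumes "A \<in> carrier_mat n m" "u \<in> carrier_vec m" "i < n"
  shows "(A *\<^sub>v u) $ i = (\<Sum>j<m. A $$ (i, j) * u $ j)"
  using assms by (auto simp: scalar_prod_def atLeast0LessThan intro!: sum.cong)

lemma mult_mat_index:
  assumes "A \<in> carrier_mat n m" "B \<in> carrier_mat m k" "i < n" "j < k"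
  shows "(A * B) $$ (i, j) = (\<Sum>l<m. A $$ (i, l) * B $$ (l, j))"
  using assms by (auto simp: scalar_prod_def atLeast0LessThan intro!: sum.cong)

lemma rational_rep_carrier:
  assumes "rational_rep n m \<rho>" "g \<in> carrier (SL n)"
  shows "\<rho> g \<in> carrier_mat m m"
  using assms by (auto simp: rational_rep_def hom_def carrier_GL)

lemma rational_rep_mult:
  assumes "rational_rep n m \<rho>" "g \<in> carrier (SL n)" "h \<in> carrier (SL n)"
  shows "\<rho> (g * h) = \<rho> g * \<rho> h"
  using assms by (auto simp: rational_rep_def hom_def)

text \<open>Multiplicativity makes the image of the identity idempotent, and an invertible
  idempotent is the identity.\<close>

lemma rational_rep_one:
  assumes "rational_rep n m \<rho>"
  shows "\<rho> (1\<^sub>m n) = 1\<^sub>m m"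
proof -
  let ?I = "\<rho> (1\<^sub>m n)"
  have I: "?I \<in> carrier_mat m m" "det ?I \<noteq> 0"
    using assms one_in_SL[of n] by (auto simp: rational_rep_def hom_def carrier_GL)
  have "det ?I * det ?I = det ?I"
    using rational_rep_mult[OF assms one_in_SL one_in_SL] det_mult[OF I(1) I(1)] by simp
  then have det: "det ?I = 1" using I(2) by simp
  then have adj: "adj_mat ?I \<in> carrier_mat m m" "adj_mat ?I * ?I = 1\<^sub>m m"
    using adj_mat[OF I(1)] by auto
  have "?I = (adj_mat ?I * ?I) * ?I" using adj I(1) by simp
  also have "\<dots> = adj_mat ?I * (?I * ?I)" using adj I(1) by (intro assoc_mult_mat) auto
  also have "?I * ?I = ?I" using rational_rep_mult[OF assms one_in_SL one_in_SL] by simp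
  finally show ?thesis using adj by simp
qed

lemma rational_rep_mult_vec:
  assumes "rational_rep n m \<rho>" "g \<in> carrier (SL n)" "h \<in> carrier (SL n)" "u \<in> carrier_vec m"
  shows "\<rho> (g * h) *\<^sub>v u = \<rho> g *\<^sub>v (\<rho> h *\<^sub>v u)"
  using assms by (simp add: rational_rep_mult rational_rep_carrier assoc_mult_mat_vec[of _ m m _ m])

lemma rational_rep_regular:
  assumes "rational_rep n m \<rho>" "i < m" "j < m"
  shows "regular_on n (carrier (SL n)) (\<lambda>g. \<rho> g $$ (i, j))"
  using assms by (auto simp: rational_rep_def)

text \<open>The components are \<open>P \<chi> *\<^sub>v u\<close> for the coefficient matrices
  \<open>P \<chi>\<close> of \<open>weight_decomposition\<close>, extended by zero to characters
  outside \<open>A\<close>; they add up to \<open>u\<close> because the \<open>P \<chi>\<close> add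
  up to the identity.\<close>

lemma weight_components_exist:
  assumes rep: "rational_rep n m \<rho>" and T: "T \<subseteq> carrier (SL n)"
    and fam: "character_family T (*) (1\<^sub>m n) (characters n T)"
    and span: "\<And>f. regular_on n T f \<Longrightarrow> f \<in> character_family.span T (characters n T)"
    and u: "u \<in> carrier_vec m"
  shows "\<exists>c. weight_components n T m \<rho> u c"
proof -
  interpret character_family T "(*)" "1\<^sub>m n" "characters n T" by (rule fam)
  obtain A P where A: "finite A" "A \<subseteq> characters n T" and P: "\<And>\<chi>. P \<chi> \<in> carrier_mat m m"
    and RP: "\<And>x \<chi>. x \<in> T \<Longrightarrow> \<chi> \<in> A \<Longrightarrow> \<rho> x * P \<chi> = \<chi> x \<cdot>\<^sub>m P \<chi>"
    and sum: "\<And>i j. i < m \<Longrightarrow> j < m \<Longrightarrow> (\<Sum>\<chi>\<in>A. P \<chi> $$ (i, j)) = 1\<^sub>m m $$ (i, j)"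
  proof (rule weight_decomposition[where R = \<rho> and m = m])
    fix i j assume "i < m" "j < m"
    then show "(\<lambda>x. \<rho> x $$ (i, j)) \<in> span"
      using rational_rep_regular[OF rep] regular_on_subset T by (blast intro: span)
  qed (use T rep in \<open>auto simp: rational_rep_one rational_rep_mult rational_rep_carrier subset_iff\<close>)
  define c where "c \<chi> = (if \<chi> \<in> A then P \<chi> *\<^sub>v u else 0\<^sub>v m)" for \<chi>
  have c: "c \<chi> \<in> carrier_vec m" for \<chi>
    using mult_mat_vec_carrier[OF P u] by (auto simp: c_def)
  have "c \<chi> \<in> weight_space T m \<rho> \<chi>" for \<chi>
  proof -
    have "\<rho> t *\<^sub>v c \<chi> = \<chi> t \<cdot>\<^sub>v c \<chi>" if t: "t \<in> T" for t
    proof (cases "\<chi> \<in> A")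
      case True
      have "\<rho> t *\<^sub>v (P \<chi> *\<^sub>v u) = (\<rho> t * P \<chi>) *\<^sub>v u"
        using P u t T rep by (subst assoc_mult_mat_vec[of _ m m _ m]) (auto intro: rational_rep_carrier)
      also have "\<dots> = \<chi> t \<cdot>\<^sub>v (P \<chi> *\<^sub>v u)" using RP[OF t True] P[of \<chi>] u by auto
      finally show ?thesis using True by (simp add: c_def)
    next
      case False
      have "\<rho> t \<in> carrier_mat m m" using rational_rep_carrier[OF rep, of t] t T by auto
      then show ?thesis using False by (auto simp: c_def intro!: eq_vecI)
    qed
    then show ?thesis using c by (simp add: weight_space_def)
  qed
  moreover have sub: "{\<chi> \<in> characters n T. c \<chi> \<noteq> 0\<^sub>v m} \<subseteq> A" by (auto simp: c_def)
  moreover have "u = finsum_vec TYPE(complex) m c {\<chi> \<in> characters n T. c \<chi> \<noteq> 0\<^sub>v m}" (is "u = ?s")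
  proof (rule eq_vecI)
    have s: "?s \<in> carrier_vec m" using c by (intro finsum_vec_closed) auto
    then show "dim_vec u = dim_vec ?s" using u by simp
    fix i assume "i < dim_vec ?s"
    then have i: "i < m" using s by simp
    have "?s $ i = (\<Sum>\<chi>\<in>{\<chi> \<in> characters n T. c \<chi> \<noteq> 0\<^sub>v m}. c \<chi> $ i)"
      using c finite_subset[OF sub A(1)] i by (intro index_finsum_vec) auto
    also have "\<dots> = (\<Sum>\<chi>\<in>A. c \<chi> $ i)"
      using A sub i by (intro sum.mono_neutral_left) auto
    also have "\<dots> = (\<Sum>\<chi>\<in>A. \<Sum>j<m. P \<chi> $$ (i, j) * u $ j)"
      using i by (intro sum.cong) (auto simp: c_def mult_mat_vec_index[OF P u])
    also have "\<dots> = (\<Sum>j<m. (\<Sum>\<chi>\<in>A. P \<chi> $$ (i, j)) * u $ j)"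
      by (subst sum.swap) (simp add: sum_distrib_right)
    also have "\<dots> = (1\<^sub>m m *\<^sub>v u) $ i"
      using i sum mult_mat_vec_index[OF one_carrier_mat u, of i] by simp
    finally show "u $ i = ?s $ i" using u by simp
  qed
  ultimately have "weight_components n T m \<rho> u c"
    unfolding weight_components_def using finite_subset[OF sub A(1)] by blast
  then show ?thesis by blast
qed

text \<open>Weights are detected by a separating family of weight functionals \<open>\<Sum>j<m. a s j * u $ j\<close>.\<close>

lemma weights_eq:
  assumes u: "u \<in> carrier_vec m" and ex: "\<exists>c. weight_components n T m \<rho> u c"
    and \<chi>: "\<And>s. s \<in> S \<Longrightarrow> \<chi> s \<in> characters n T"
    and eigen: "\<And>s x u. s \<in> S \<Longrightarrow> x \<in> T \<Longrightarrow> u \<in> carrier_vec m \<Longrightarrow>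
      (\<Sum>j<m. a s j * (\<rho> x *\<^sub>v u) $ j) = \<chi> s x * (\<Sum>j<m. a s j * u $ j)"
    and sep: "\<And>u. u \<in> carrier_vec m \<Longrightarrow> (\<And>s. s \<in> S \<Longrightarrow> (\<Sum>j<m. a s j * u $ j) = 0) \<Longrightarrow> u = 0\<^sub>v m"
  shows "weights n T m \<rho> u = {\<chi> s | s. s \<in> S \<and> (\<Sum>j<m. a s j * u $ j) \<noteq> 0}"
proof -
  have ext: "\<psi> = \<psi>'" if "\<psi> \<in> characters n T" "\<psi>' \<in> characters n T" "\<And>x. x \<in> T \<Longrightarrow> \<psi> x = \<psi>' x" for \<psi> \<psi>'
    using that extensionalityI[of \<psi> T \<psi>'] unfolding characters_def by blast
  \<comment> \<open>A functional with eigencharacter \<open>\<chi> s\<close> kills every component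
    of a different character: acting by a torus element where the characters differ scales its value
    by two different factors. So it sees only the component at \<open>\<chi> s\<close>.\<close>
  have key: "(\<Sum>j<m. a s j * u $ j) = (\<Sum>j<m. a s j * c (\<chi> s) $ j)" if c: "weight_components n T m \<rho> u c" and s: "s \<in> S" for c s
  proof -
    have cw: "c \<psi> \<in> carrier_vec m" "\<And>x. x \<in> T \<Longrightarrow> \<rho> x *\<^sub>v c \<psi> = \<psi> x \<cdot>\<^sub>v c \<psi>" if "\<psi> \<in> characters n T" for \<psi>
      using c that by (auto simp: weight_components_def weight_space_def)
    have other: "(\<Sum>j<m. a s j * c \<psi> $ j) = 0" if \<psi>: "\<psi> \<in> characters n T" "\<psi> \<noteq> \<chi> s" for \<psi>
    proof -
      obtain x where x: "x \<in> T" "\<psi> x \<noteq> \<chi> s x" using ext[OF \<psi>(1) \<chi>[OF s]] \<psi>(2) by blast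
      have "\<chi> s x * (\<Sum>j<m. a s j * c \<psi> $ j) = (\<Sum>j<m. a s j * (\<psi> x \<cdot>\<^sub>v c \<psi>) $ j)"
        using eigen[OF s x(1) cw(1)[OF \<psi>(1)]] cw(2)[OF \<psi>(1) x(1)] by simp
      also have "\<dots> = \<psi> x * (\<Sum>j<m. a s j * c \<psi> $ j)"
        using cw(1)[OF \<psi>(1)] by (auto simp: sum_distrib_left intro!: sum.cong)
      finally show ?thesis using x(2) by simp
    qed
    let ?F = "{\<psi> \<in> characters n T. c \<psi> \<noteq> 0\<^sub>v m}"
    have fin: "finite ?F" and us: "u = finsum_vec TYPE(complex) m c ?F"
      using c by (auto simp: weight_components_def)
    have "u $ j = (\<Sum>\<psi>\<in>?F. c \<psi> $ j)" if "j < m" for j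
      using arg_cong[OF us, of "\<lambda>u. u $ j"] index_finsum_vec[OF fin that, of c] cw(1) by auto
    then have "(\<Sum>j<m. a s j * u $ j) = (\<Sum>j<m. \<Sum>\<psi>\<in>?F. a s j * c \<psi> $ j)"
      by (intro sum.cong) (auto simp: sum_distrib_left)
    also have "\<dots> = (\<Sum>\<psi>\<in>?F. \<Sum>j<m. a s j * c \<psi> $ j)" by (rule sum.swap)
    also have "\<dots> = (\<Sum>\<psi>\<in>insert (\<chi> s) ?F. \<Sum>j<m. a s j * c \<psi> $ j)"
      using fin \<chi>[OF s] by (intro sum.mono_neutral_left) auto
    also have "\<dots> = (\<Sum>\<psi>\<in>{\<chi> s}. \<Sum>j<m. a s j * c \<psi> $ j)"
      using fin other by (intro sum.mono_neutral_right) auto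
    finally show ?thesis by simp
  qed
  show ?thesis
  proof (intro equalityI subsetI)
    fix \<psi> assume "\<psi> \<in> weights n T m \<rho> u"
    then obtain c where \<psi>: "\<psi> \<in> characters n T" and c: "weight_components n T m \<rho> u c" "c \<psi> \<noteq> 0\<^sub>v m"
      by (auto simp: weights_def)
    have cp: "c \<psi> \<in> carrier_vec m" "\<And>x. x \<in> T \<Longrightarrow> \<rho> x *\<^sub>v c \<psi> = \<psi> x \<cdot>\<^sub>v c \<psi>"
      using c \<psi> by (auto simp: weight_components_def weight_space_def)
    then obtain s where s: "s \<in> S" "(\<Sum>j<m. a s j * c \<psi> $ j) \<noteq> 0" using sep[of "c \<psi>"] c(2) by blast
    have "\<psi> = \<chi> s"
    proof (rule ext[OF \<psi> \<chi>[OF s(1)]])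
      fix x assume x: "x \<in> T"
      have "\<chi> s x * (\<Sum>j<m. a s j * c \<psi> $ j) = (\<Sum>j<m. a s j * (\<psi> x \<cdot>\<^sub>v c \<psi>) $ j)"
        using eigen[OF s(1) x cp(1)] cp(2)[OF x] by simp
      also have "\<dots> = \<psi> x * (\<Sum>j<m. a s j * c \<psi> $ j)"
        using cp(1) by (auto simp: sum_distrib_left intro!: sum.cong)
      finally show "\<psi> x = \<chi> s x" using s(2) by simp
    qed
    then show "\<psi> \<in> {\<chi> s | s. s \<in> S \<and> (\<Sum>j<m. a s j * u $ j) \<noteq> 0}"
      using s key[OF c(1) s(1)] by auto
  next
    fix \<psi> assume "\<psi> \<in> {\<chi> s | s. s \<in> S \<and> (\<Sum>j<m. a s j * u $ j) \<noteq> 0}"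
    then obtain s where s: "\<psi> = \<chi> s" "s \<in> S" "(\<Sum>j<m. a s j * u $ j) \<noteq> 0" by blast
    obtain c where c: "weight_components n T m \<rho> u c" using ex by blast
    have "c (\<chi> s) \<noteq> 0\<^sub>v m" using key[OF c s(2)] s(3) by auto
    then show "\<psi> \<in> weights n T m \<rho> u" using c s \<chi>[OF s(2)] by (auto simp: weights_def)
  qed
qed

section \<open>Maximal tori of SL(n)\<close>

lemma diagonal_mult_left:
  fixes A B :: "complex mat"
  assumes "A \<in> carrier_mat n n" "B \<in> carrier_mat n k" "diagonal_mat A" "i < n" "j < k"
  shows "(A * B) $$ (i, j) = A $$ (i, i) * B $$ (i, j)"
proof -
  have "(A * B) $$ (i, j) = (\<Sum>l<n. A $$ (i, l) * B $$ (l, j))" by (rule mult_mat_index) fact+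
  also have "\<dots> = (\<Sum>l\<in>{i}. A $$ (i, l) * B $$ (l, j))"
    using assms by (intro sum.mono_neutral_right) (auto simp: diagonal_mat_def)
  finally show ?thesis by simp
qed

definition conj_mat :: "nat \<Rightarrow> complex mat \<Rightarrow> complex mat \<Rightarrow> complex mat" where
  "conj_mat n g x = inv\<^bsub>SL n\<^esub> g * x * g"

text \<open>The conjugate by \<open>g\<close> of the diagonal torus; \<open>conj_mat n g x\<close>
  is the diagonal form of its element \<open>x\<close>.\<close>

definition conj_torus :: "nat \<Rightarrow> complex mat \<Rightarrow> complex mat set" where
  "conj_torus n g = {x \<in> carrier (SL n). diagonal_mat (conj_mat n g x)}"

text \<open>Natural exponents also cover negative powers, since on SL(n) the inverse of a diagonal
  entry is the product of the other diagonal entries.\<close>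

definition monomial_char :: "nat \<Rightarrow> complex mat \<Rightarrow> (nat \<Rightarrow> nat) \<Rightarrow> complex mat \<Rightarrow> complex" where
  "monomial_char n g \<alpha> = (\<lambda>x\<in>conj_torus n g. \<Prod>i<n. conj_mat n g x $$ (i, i) ^ \<alpha> i)"

context
  fixes n :: nat and g h :: "complex mat"
  assumes g: "g \<in> carrier (SL n)"
  defines "h \<equiv> inv\<^bsub>SL n\<^esub> g"
begin

lemma conj_carrier: "g \<in> carrier_mat n n" "h \<in> carrier_mat n n" "g * h = 1\<^sub>m n" "h * g = 1\<^sub>m n"
  "h \<in> carrier (SL n)"
  using g inv_SL[OF g] by (auto simp: h_def carrier_SL)

lemma conj_mat_eq: "conj_mat n g x = h * x * g"
  by (simp add: conj_mat_def h_def)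

lemma conj_mat_carrier: "x \<in> carrier_mat n n \<Longrightarrow> conj_mat n g x \<in> carrier_mat n n"
  using conj_carrier by (simp add: conj_mat_eq)

lemma conj_mat_mult:
  assumes "x \<in> carrier_mat n n" "y \<in> carrier_mat n n"
  shows "conj_mat n g (x * y) = conj_mat n g x * conj_mat n g y"
proof -
  have "(h * x * g) * (h * y * g) = h * x * (g * h) * y * g"
    using assms conj_carrier(1,2) by (simp add: assoc_mult_mat[of _ n n _ n _ n] del: assoc_mult_mat)
  then show ?thesis
    using assms conj_carrier
    by (simp add: assoc_mult_mat[of _ n n _ n _ n] conj_mat_eq del: assoc_mult_mat)
qed

lemma conj_mat_one: "conj_mat n g (1\<^sub>m n) = 1\<^sub>m n"
  using conj_carrier by (simp add: conj_mat_eq)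

lemma conj_mat_eq_iff:
  assumes "x \<in> carrier_mat n n" "d \<in> carrier_mat n n"
  shows "conj_mat n g x = d \<longleftrightarrow> x = g * d * h"
proof
  assume d: "conj_mat n g x = d"
  have "g * d * h = (g * h) * x * (g * h)"
    using assms conj_carrier(1,2) unfolding d[symmetric] conj_mat_eq
    by (simp add: assoc_mult_mat[of _ n n _ n _ n] del: assoc_mult_mat)
  then show "x = g * d * h" using assms conj_carrier by simp
next
  assume x: "x = g * d * h"
  have "h * x * g = (h * g) * d * (h * g)"
    using assms conj_carrier(1,2) unfolding x
    by (simp add: assoc_mult_mat[of _ n n _ n _ n] del: assoc_mult_mat)
  then show "conj_mat n g x = d" using assms conj_carrier by (simp add: conj_mat_eq)
qed

lemma conj_in_SL: "x \<in> carrier (SL n) \<Longrightarrow> conj_mat n g x \<in> carrier (SL n)"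
  using g conj_carrier(5) unfolding conj_mat_eq by (intro mult_in_SL)

lemma conj_torusD:
  assumes "x \<in> conj_torus n g"
  shows "x \<in> carrier (SL n)" "x \<in> carrier_mat n n" "conj_mat n g x \<in> carrier_mat n n" "diagonal_mat (conj_mat n g x)"
  using assms by (auto simp: conj_torus_def carrier_SL intro!: conj_mat_carrier)

lemma conj_torus_off_diag:
  "x \<in> conj_torus n g \<Longrightarrow> i < n \<Longrightarrow> j < n \<Longrightarrow> i \<noteq> j \<Longrightarrow> conj_mat n g x $$ (i, j) = 0"
  using conj_torusD(3,4)[of x] by (auto simp: diagonal_mat_def)

lemma conj_torusI:
  assumes "x \<in> carrier (SL n)" "\<And>i j. i < n \<Longrightarrow> j < n \<Longrightarrow> i \<noteq> j \<Longrightarrow> conj_mat n g x $$ (i, j) = 0"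
  shows "x \<in> conj_torus n g"
  using assms conj_mat_carrier[OF SL_carrier_mat[OF assms(1)]] by (auto simp: conj_torus_def diagonal_mat_def)

lemma conj_torus_mult_entry:
  assumes "x \<in> conj_torus n g" "y \<in> carrier_mat n n" "i < n" "j < n"
  shows "conj_mat n g (x * y) $$ (i, j) = conj_mat n g x $$ (i, i) * conj_mat n g y $$ (i, j)"
  unfolding conj_mat_mult[OF conj_torusD(2)[OF assms(1)] assms(2)]
  using conj_torusD[OF assms(1)] conj_mat_carrier[OF assms(2)] assms(2-4)
  by (intro diagonal_mult_left)

lemma conj_torus_subgroup: "subgroup (conj_torus n g) (SL n)"
proof
  show "conj_torus n g \<subseteq> carrier (SL n)" by (auto simp: conj_torus_def)
  show "\<one>\<^bsub>SL n\<^esub> \<in> conj_torus n g"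
    by (rule conj_torusI) (auto simp: one_in_SL conj_mat_one)
  fix x assume x: "x \<in> conj_torus n g"
  note xD = conj_torusD[OF x]
  show "x \<otimes>\<^bsub>SL n\<^esub> y \<in> conj_torus n g" if y: "y \<in> conj_torus n g" for y
  proof (rule conj_torusI)
    show "x \<otimes>\<^bsub>SL n\<^esub> y \<in> carrier (SL n)" using xD(1) conj_torusD(1)[OF y] by (simp add: mult_in_SL)
    fix i j assume "i < n" "j < n" "i \<noteq> j"
    then show "conj_mat n g (x \<otimes>\<^bsub>SL n\<^esub> y) $$ (i, j) = 0"
      using conj_torusD(2)[OF y] conj_torus_off_diag[OF y] conj_torus_mult_entry[OF x, of y i j] by simp
  qed
  let ?y = "inv\<^bsub>SL n\<^esub> x"
  have y: "?y \<in> carrier (SL n)" "x * ?y = 1\<^sub>m n" using inv_SL[OF xD(1)] by auto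
  have one: "conj_mat n g x $$ (i, i) * conj_mat n g ?y $$ (i, j) = (if i = j then 1 else 0)"
    if "i < n" "j < n" for i j
    using conj_torus_mult_entry[OF x, of ?y i j] y that conj_mat_one by (simp add: SL_carrier_mat)
  show "?y \<in> conj_torus n g"
  proof (rule conj_torusI[OF y(1)])
    fix i j assume "i < n" "j < n" "i \<noteq> j"
    with one[of i j] one[of i i] show "conj_mat n g ?y $$ (i, j) = 0" by auto
  qed
qed

lemma conj_torus_mult_closed: "x \<in> conj_torus n g \<Longrightarrow> y \<in> conj_torus n g \<Longrightarrow> x * y \<in> conj_torus n g"
  using subgroup.m_closed[OF conj_torus_subgroup] by simp

lemma conj_torus_diag_nonzero:
  assumes "x \<in> conj_torus n g" "i < n"
  shows "conj_mat n g x $$ (i, i) \<noteq> 0"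
proof
  assume "conj_mat n g x $$ (i, i) = 0"
  moreover have "conj_mat n g (x * inv\<^bsub>SL n\<^esub> x) $$ (i, i) = 1"
    using inv_SL[OF conj_torusD(1)[OF assms(1)]] assms(2) conj_mat_one by simp
  ultimately show False
    using conj_torus_mult_entry[OF assms(1) _ assms(2) assms(2)] inv_SL(1)[OF conj_torusD(1)[OF assms(1)]]
    by (simp add: SL_carrier_mat)
qed

lemma conj_torus_det:
  assumes "x \<in> conj_torus n g"
  shows "(\<Prod>i<n. conj_mat n g x $$ (i, i)) = 1"
proof -
  note x = conj_torusD[OF assms]
  have "upper_triangular (conj_mat n g x)"
    using x(3) conj_torus_off_diag[OF assms] by (auto simp: upper_triangular_def)
  then have "det (conj_mat n g x) = prod_list (diag_mat (conj_mat n g x))"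
    using x(3) by (intro det_upper_triangular)
  then show ?thesis
    using conj_in_SL[OF x(1)] by (auto simp: prod_list_diag_prod carrier_SL atLeast0LessThan)
qed

lemma conj_entry:
  assumes "x \<in> carrier_mat n n" "i < n" "j < n"
  shows "conj_mat n g x $$ (i, j) = (\<Sum>k<n. \<Sum>l<n. h $$ (i, k) * x $$ (k, l) * g $$ (l, j))"
proof -
  have "conj_mat n g x $$ (i, j) = (\<Sum>l<n. (h * x) $$ (i, l) * g $$ (l, j))"
    unfolding conj_mat_eq using assms conj_carrier by (intro mult_mat_index) auto
  also have "\<dots> = (\<Sum>l<n. \<Sum>k<n. h $$ (i, k) * x $$ (k, l) * g $$ (l, j))"
  proof (intro sum.cong refl)
    fix l assume "l \<in> {..<n}"
    then show "(h * x) $$ (i, l) * g $$ (l, j) = (\<Sum>k<n. h $$ (i, k) * x $$ (k, l) * g $$ (l, j))"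
      using mult_mat_index[OF conj_carrier(2) assms(1,2), of l] by (simp add: sum_distrib_right)
  qed
  finally show ?thesis by (subst sum.swap) simp
qed

lemma regular_on_conj_entry:
  assumes "i < n" "j < n" "T \<subseteq> carrier (SL n)"
  shows "regular_on n T (\<lambda>x. conj_mat n g x $$ (i, j))"
proof (rule regular_on_cong)
  show "regular_on n T (\<lambda>x. \<Sum>k<n. \<Sum>l<n. h $$ (i, k) * x $$ (k, l) * g $$ (l, j))"
    by (intro regular_on_sum regular_on_mult regular_on_const regular_on_entry) auto
qed (use assms conj_entry in \<open>auto simp: carrier_SL\<close>)

lemma monomial_char_in_characters: "monomial_char n g \<alpha> \<in> characters n (conj_torus n g)"
proof -
  have "monomial_char n g \<alpha> (x * y) = monomial_char n g \<alpha> x * monomial_char n g \<alpha> y"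
    if "x \<in> conj_torus n g" "y \<in> conj_torus n g" for x y
  proof -
    have "(\<Prod>i<n. conj_mat n g (x * y) $$ (i, i) ^ \<alpha> i) =
        (\<Prod>i<n. conj_mat n g x $$ (i, i) ^ \<alpha> i * conj_mat n g y $$ (i, i) ^ \<alpha> i)"
      using conj_torus_mult_entry[OF that(1) conj_torusD(2)[OF that(2)]]
      by (intro prod.cong refl) (simp add: power_mult_distrib)
    then show ?thesis
      using that conj_torus_mult_closed[OF that] by (simp add: monomial_char_def prod.distrib)
  qed
  moreover have "monomial_char n g \<alpha> x \<noteq> 0" if "x \<in> conj_torus n g" for x
    using that conj_torus_diag_nonzero by (simp add: monomial_char_def)
  ultimately have "monomial_char n g \<alpha> \<in> hom ((SL n)\<lparr>carrier := conj_torus n g\<rparr>) Gm"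
    by (intro homI) (simp_all add: Gm_def)
  moreover have "regular_on n (conj_torus n g) (monomial_char n g \<alpha>)"
  proof (rule regular_on_cong)
    show "regular_on n (conj_torus n g) (\<lambda>x. \<Prod>i<n. conj_mat n g x $$ (i, i) ^ \<alpha> i)"
      using conj_torusD by (intro regular_on_prod regular_on_power regular_on_conj_entry) auto
  qed (simp add: monomial_char_def)
  ultimately show ?thesis by (simp add: characters_def monomial_char_def)
qed

end

lemma characters_family:
  assumes "subgroup T (SL n)"
  shows "character_family T (*) (1\<^sub>m n) (characters n T)"
proof -
  have m: "x * y \<in> T" if "x \<in> T" "y \<in> T" for x y using subgroup.m_closed[OF assms that] by simp
  have one: "1\<^sub>m n \<in> T" using subgroup.one_closed[OF assms] by simp
  have iff: "\<chi> \<in> characters n T \<longleftrightarrow> (\<forall>x\<in>T. \<chi> x \<noteq> 0) \<and> (\<forall>x\<in>T. \<forall>y\<in>T. \<chi> (x * y) = \<chi> x * \<chi> y) \<and>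
      regular_on n T \<chi> \<and> \<chi> \<in> extensional T" for \<chi>
    unfolding characters_def hom_def Gm_def by auto
  have c1: "\<chi> (1\<^sub>m n) = 1" if "\<chi> \<in> characters n T" for \<chi>
  proof -
    have "\<chi> (1\<^sub>m n * 1\<^sub>m n) = \<chi> (1\<^sub>m n) * \<chi> (1\<^sub>m n)" "\<chi> (1\<^sub>m n) \<noteq> 0" using that one iff by blast+
    then show ?thesis by simp
  qed
  have "regular_on n T (\<lambda>x\<in>T. 1)"
    by (rule regular_on_cong[OF regular_on_const[of n T 1]]) simp
  then have o: "(\<lambda>x\<in>T. 1) \<in> characters n T" using m by (simp add: iff)
  have p: "(\<lambda>x\<in>T. \<chi> x * \<psi> x) \<in> characters n T" if "\<chi> \<in> characters n T" "\<psi> \<in> characters n T" for \<chi> \<psi>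
  proof -
    have "regular_on n T (\<lambda>x\<in>T. \<chi> x * \<psi> x)"
      by (rule regular_on_cong[OF regular_on_mult[of n T \<chi> \<psi>]]) (use that iff in auto)
    then show ?thesis using that m unfolding iff by auto
  qed
  show ?thesis
    by (unfold_locales) (use m one c1 o p iff in blast)+
qed

text \<open>Writing \<open>x = g * D * inv g\<close>, each entry of \<open>x\<close> is a fixed
  linear combination of the diagonal entries of \<open>D\<close>, which are characters. Regular
  functions are polynomials in the entries, and \<open>span\<close> is closed under
  products.\<close>

lemma regular_in_span_conj_torus:
  assumes g: "g \<in> carrier (SL n)" and f: "regular_on n (conj_torus n g) f"
  shows "f \<in> character_family.span (conj_torus n g) (characters n (conj_torus n g))"
proof -
  let ?T = "conj_torus n g" and ?h = "inv\<^bsub>SL n\<^esub> g"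
  interpret character_family ?T "(*)" "1\<^sub>m n" "characters n ?T"
    by (rule characters_family[OF conj_torus_subgroup[OF g]])
  have diag: "(\<lambda>x. conj_mat n g x $$ (k, k)) \<in> span" if "k < n" for k
  proof (rule span_cong[OF span_char[OF monomial_char_in_characters[OF g, of "\<lambda>i. if i = k then 1 else 0"]]])
    fix x assume "x \<in> ?T"
    then show "conj_mat n g x $$ (k, k) = monomial_char n g (\<lambda>i. if i = k then 1 else 0) x"
      using that by (simp add: monomial_char_def if_distrib[of "\<lambda>e. _ ^ e"] prod.delta cong: if_cong)
  qed
  have entry: "(\<lambda>x. x $$ (i, j)) \<in> span" if ij: "i < n" "j < n" for i j
  proof (rule span_cong)
    show "(\<lambda>x. \<Sum>k<n. (g $$ (i, k) * ?h $$ (k, j)) * conj_mat n g x $$ (k, k)) \<in> span"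
      using diag by (intro span_sum span_scale) auto
    fix x assume x: "x \<in> ?T"
    note xD = conj_torusD[OF g x] and c = conj_carrier[OF g]
    define D where "D = conj_mat n g x"
    have D: "D \<in> carrier_mat n n" "diagonal_mat D" using xD by (auto simp: D_def)
    have "x = g * D * ?h" using conj_mat_eq_iff[OF g xD(2,3)] by (simp add: D_def)
    also have "\<dots> = g * (D * ?h)" using D c by (intro assoc_mult_mat) auto
    finally have "x $$ (i, j) = (g * (D * ?h)) $$ (i, j)" by simp
    also have "\<dots> = (\<Sum>k<n. g $$ (i, k) * (D * ?h) $$ (k, j))"
      using D c ij by (intro mult_mat_index) auto
    also have "\<dots> = (\<Sum>k<n. (g $$ (i, k) * ?h $$ (k, j)) * D $$ (k, k))"
      using diagonal_mult_left[OF D(1) c(2) D(2)] ij by (intro sum.cong) simp_all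
    finally show "x $$ (i, j) = (\<Sum>k<n. (g $$ (i, k) * ?h $$ (k, j)) * conj_mat n g x $$ (k, k))"
      by (simp add: D_def)
  qed
  obtain p where p: "p \<in> poly_functions n" "\<And>x. x \<in> ?T \<Longrightarrow> f x = p x"
    using f unfolding regular_on_def by blast
  have "p \<in> span" using p(1) unfolding poly_functions_def
    by (rule span_function_algebra) (auto intro: entry)
  then show ?thesis by (rule span_cong) (rule p(2))
qed

lemma conj_torus_components_exist:
  assumes "rational_rep n m \<rho>" "g \<in> carrier (SL n)" "u \<in> carrier_vec m"
  shows "\<exists>c. weight_components n (conj_torus n g) m \<rho> u c"
  using assms conj_torusD(1)[OF assms(2)]
  by (intro weight_components_exist characters_family conj_torus_subgroup regular_in_span_conj_torus) auto

lemma det_2x2: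
  assumes A: "A \<in> carrier_mat 2 2"
  shows "det A = A $$ (0, 0) * A $$ (1, 1) - A $$ (0, 1) * A $$ (1, 0)"
proof -
  have "det (mat_delete A 0 0) = A $$ (1, 1)" "det (mat_delete A 0 1) = A $$ (1, 0)"
    using A by (subst det_single, auto simp: mat_delete_def)+
  then show ?thesis
    using laplace_expansion_row[OF A, of 0] by (simp add: numeral_2_eq_2 cofactor_def)
qed

section \<open>Algebraic tori and conjugates of the diagonal torus\<close>

lemma carrier_std_torus: "carrier (std_torus r) = {t \<in> carrier_vec r. \<forall>i<r. t $ i \<noteq> 0}"
  and mult_std_torus: "s \<otimes>\<^bsub>std_torus r\<^esub> t = vec r (\<lambda>i. s $ i * t $ i)"
  by (auto simp: std_torus_def)

text \<open>The rank is \<open>n - 1\<close>: all diagonal entries but the last are free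
  coordinates, and determinant one forces the last to be the inverse of their product.\<close>

lemma conj_torus_algebraic:
  assumes g: "g \<in> carrier (SL n)" and n: "0 < n"
  shows "algebraic_torus n (conj_torus n g)"
proof -
  obtain r where nr: "n = Suc r" using n by (cases n) auto
  let ?T = "conj_torus n g" and ?h = "inv\<^bsub>SL n\<^esub> g"
  define last where "last t = (\<Prod>k<r. inverse (t $ k))" for t :: "complex vec"
  define D where "D t = mat n n (\<lambda>(i, j). if i = j then if i < r then t $ i else last t else 0)" for t
  define \<phi> where "\<phi> t = g * D t * ?h" for t
  define \<psi> where "\<psi> x = vec r (\<lambda>i. conj_mat n g x $$ (i, i))" for x
  note c = conj_carrier[OF g]
  have D: "D t \<in> carrier_mat n n" "diagonal_mat (D t)" for t by (auto simp: D_def diagonal_mat_def)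
  have detD: "det (D t) = 1" if "t \<in> carrier (std_torus r)" for t
  proof -
    have "det (D t) = (\<Prod>i<n. D t $$ (i, i))"
      using D[of t] by (subst det_upper_triangular[of _ n]) (auto simp: D_def prod_list_diag_prod atLeast0LessThan)
    also have "\<dots> = (\<Prod>i<r. t $ i) * last t" by (simp add: D_def nr)
    also have "\<dots> = 1"
      using that by (simp add: last_def prod.distrib[symmetric] carrier_std_torus)
    finally show ?thesis .
  qed
  have \<phi>c: "\<phi> t \<in> carrier_mat n n" and conj\<phi>: "conj_mat n g (\<phi> t) = D t" for t
  proof -
    show "\<phi> t \<in> carrier_mat n n"
      unfolding \<phi>_def by (rule mult_carrier_mat[OF mult_carrier_mat[OF c(1) D(1)] c(2)])
    then show "conj_mat n g (\<phi> t) = D t" using conj_mat_eq_iff[OF g _ D(1)] by (simp add: \<phi>_def)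
  qed
  have \<phi>T: "\<phi> t \<in> ?T" if "t \<in> carrier (std_torus r)" for t
  proof (rule conj_torusI[OF g])
    show "\<phi> t \<in> carrier (SL n)"
      unfolding \<phi>_def using g c D detD[OF that] by (intro mult_in_SL) (auto simp: carrier_SL)
    fix i j assume "i < n" "j < n" "i \<noteq> j"
    then show "conj_mat n g (\<phi> t) $$ (i, j) = 0" unfolding conj\<phi> by (simp add: D_def)
  qed
  have \<psi>T: "\<psi> x \<in> carrier (std_torus r)" if "x \<in> ?T" for x
    using conj_torus_diag_nonzero[OF g that] by (auto simp: \<psi>_def carrier_std_torus nr)
  have D\<psi>: "D (\<psi> x) = conj_mat n g x" if x: "x \<in> ?T" for x
  proof (rule eq_matI)
    note xD = conj_torusD[OF g x]
    fix i j assume "i < dim_row (conj_mat n g x)" "j < dim_col (conj_mat n g x)"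
    then have ij: "i < n" "j < n" using xD by auto
    have "(\<Prod>i<r. conj_mat n g x $$ (i, i)) * conj_mat n g x $$ (r, r) = 1"
      using conj_torus_det[OF g x] by (simp add: nr)
    then have "conj_mat n g x $$ (r, r) = inverse (\<Prod>i<r. conj_mat n g x $$ (i, i))"
      by (metis inverse_unique)
    then have "last (\<psi> x) = conj_mat n g x $$ (r, r)"
      by (simp add: last_def \<psi>_def prod_inversef[symmetric])
    moreover have "j = r" if "\<not> j < r" using ij that nr by auto
    ultimately show "D (\<psi> x) $$ (i, j) = conj_mat n g x $$ (i, j)"
      using ij conj_torus_off_diag[OF g x ij] by (auto simp: D_def \<psi>_def)
  qed (use conj_torusD[OF g x] in \<open>auto simp: D_def\<close>)
  have \<phi>\<psi>: "\<phi> (\<psi> x) = x" if x: "x \<in> ?T" for x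
    using conj_mat_eq_iff[OF g conj_torusD(2)[OF g x] conj_torusD(3)[OF g x]] D\<psi>[OF x] by (simp add: \<phi>_def)
  have \<psi>\<phi>: "\<psi> (\<phi> t) = t" if "t \<in> carrier (std_torus r)" for t
    using that unfolding \<psi>_def conj\<phi> by (auto simp: D_def nr carrier_std_torus)
  have Dm: "D (s \<otimes>\<^bsub>std_torus r\<^esub> t) = D s * D t" for s t
  proof (rule eq_matI)
    fix i j assume "i < dim_row (D s * D t)" "j < dim_col (D s * D t)"
    then have ij: "i < n" "j < n" by (simp_all add: D_def)
    show "D (s \<otimes>\<^bsub>std_torus r\<^esub> t) $$ (i, j) = (D s * D t) $$ (i, j)"
      unfolding diagonal_mult_left[OF D(1) D(1) D(2) ij]
      using ij by (auto simp: D_def mult_std_torus last_def prod.distrib)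
  qed (auto simp: D_def)
  have hom: "\<phi> (s \<otimes>\<^bsub>std_torus r\<^esub> t) = \<phi> s * \<phi> t" for s t
  proof -
    have "conj_mat n g (\<phi> s * \<phi> t) = D s * D t" using conj_mat_mult[OF g \<phi>c \<phi>c] conj\<phi> by simp
    then show ?thesis
      using conj_mat_eq_iff[OF g mult_carrier_mat[OF \<phi>c \<phi>c] mult_carrier_mat[OF D(1) D(1)]]
      by (simp add: \<phi>_def[of "s \<otimes>\<^bsub>std_torus r\<^esub> t"] Dm)
  qed
  have bij: "bij_betw \<phi> (carrier (std_torus r)) ?T"
    by (rule bij_betw_byWitness[of _ \<psi>]) (use \<phi>T \<psi>T \<phi>\<psi> \<psi>\<phi> in auto)
  have iso: "\<phi> \<in> iso (std_torus r) ((SL n)\<lparr>carrier := ?T\<rparr>)"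
    using hom bij \<phi>T by (auto simp: iso_def hom_def)
  have inv: "inv_into (carrier (std_torus r)) \<phi> x = \<psi> x" if "x \<in> ?T" for x
    using bij_betw_imp_inj_on[OF bij] \<psi>T[OF that] \<phi>\<psi>[OF that] by (intro inv_into_f_eq)
  have reg: "regular_on n ?T (\<lambda>x. inv_into (carrier (std_torus r)) \<phi> x $ i)" if "i < r" for i
    by (rule regular_on_cong[OF regular_on_conj_entry[OF g, of i i]])
       (use that inv conj_torusD(1)[OF g] nr in \<open>auto simp: \<psi>_def\<close>)
  have laur: "\<exists>q\<in>laurent_functions r. \<forall>t\<in>carrier (std_torus r). \<phi> t $$ (i, j) = q t"
    if ij: "i < n" "j < n" for i j
  proof
    let ?q = "\<lambda>t. \<Sum>k<n. g $$ (i, k) * (if k < r then t $ k else last t) * ?h $$ (k, j)"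
    have gen: "(\<lambda>t. t $ k) \<in> laurent_functions r" "(\<lambda>t. inverse (t $ k)) \<in> laurent_functions r" if "k < r" for k
      using that unfolding laurent_functions_def by (blast intro: function_algebra.gen)+
    have last: "last \<in> laurent_functions r"
      using gen unfolding last_def[abs_def] laurent_functions_def by (intro function_algebra_prod) auto
    have "(\<lambda>t. if k < r then t $ k else last t) \<in> laurent_functions r" for k
      using gen[of k] last by (cases "k < r") (simp_all add: eta_contract_eq)
    then show "?q \<in> laurent_functions r"
      unfolding laurent_functions_def
      by (intro function_algebra_sum function_algebra.mult function_algebra.const) auto
    have "\<phi> t $$ (i, j) = ?q t" for t
    proof -
      have "\<phi> t = g * (D t * ?h)" using c D unfolding \<phi>_def by (intro assoc_mult_mat) auto
      then have "\<phi> t $$ (i, j) = (\<Sum>k<n. g $$ (i, k) * (D t * ?h) $$ (k, j))"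
        using mult_mat_index[OF c(1) mult_carrier_mat[OF D(1) c(2)] ij] by simp
      also have "\<dots> = (\<Sum>k<n. g $$ (i, k) * (D t $$ (k, k) * ?h $$ (k, j)))"
        using diagonal_mult_left[OF D(1) c(2) D(2)] ij by (intro sum.cong) simp_all
      also have "\<dots> = ?q t" by (intro sum.cong) (auto simp: D_def)
      finally show ?thesis .
    qed
    then show "\<forall>t\<in>carrier (std_torus r). \<phi> t $$ (i, j) = ?q t" by blast
  qed
  show ?thesis
    unfolding algebraic_torus_def using conj_torus_subgroup[OF g] iso reg laur by blast
qed

text \<open>The family consists of abstract characters. Among them are the coordinates and their
  inverses, which generate the Laurent functions, so \<open>span\<close> contains all of
  these.\<close>

lemma std_torus_characters:
  "character_family (carrier (std_torus r)) (\<lambda>s t. s \<otimes>\<^bsub>std_torus r\<^esub> t) (vec r (\<lambda>_. 1))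
     {\<chi> \<in> extensional (carrier (std_torus r)). \<chi> (vec r (\<lambda>_. 1)) = 1 \<and>
        (\<forall>s\<in>carrier (std_torus r). \<forall>t\<in>carrier (std_torus r). \<chi> (s \<otimes>\<^bsub>std_torus r\<^esub> t) = \<chi> s * \<chi> t)}"
    (is "character_family ?X ?mul ?e ?C")
proof -
  have m: "?mul s t \<in> ?X" if "s \<in> ?X" "t \<in> ?X" for s t
    using that by (auto simp: carrier_std_torus mult_std_torus)
  have e: "?e \<in> ?X" by (auto simp: carrier_std_torus)
  show ?thesis by unfold_locales (use m e in auto)
qed

text \<open>Expanding \<open>det 1\<close> along \<open>1 = \<Sum>\<chi>. P \<chi>\<close> row by row, some summand is non-zero; its rows are
  simultaneous left eigenvectors of the torus.\<close>

lemma algebraic_torus_subset_conj_torus: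
  assumes tor: "algebraic_torus n T" and n: "0 < n"
  shows "\<exists>g\<in>carrier (SL n). T \<subseteq> conj_torus n g"
proof -
  have sub: "T \<subseteq> carrier (SL n)" using tor by (auto simp: algebraic_torus_def subgroup_def)
  obtain r \<phi> where \<phi>: "\<phi> \<in> iso (std_torus r) ((SL n)\<lparr>carrier := T\<rparr>)"
    and laur: "\<And>i j. i < n \<Longrightarrow> j < n \<Longrightarrow> \<exists>q\<in>laurent_functions r. \<forall>t\<in>carrier (std_torus r). \<phi> t $$ (i, j) = q t"
    using tor unfolding algebraic_torus_def by blast
  let ?X = "carrier (std_torus r)"
  let ?C = "{\<chi> \<in> extensional ?X. \<chi> (vec r (\<lambda>_. 1)) = 1 \<and>
        (\<forall>s\<in>?X. \<forall>t\<in>?X. \<chi> (s \<otimes>\<^bsub>std_torus r\<^esub> t) = \<chi> s * \<chi> t)}"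
  interpret character_family ?X "\<lambda>s t. s \<otimes>\<^bsub>std_torus r\<^esub> t" "vec r (\<lambda>_. 1)" ?C
    by (rule std_torus_characters)
  have img: "\<phi> ` ?X = T" using \<phi> by (auto simp: iso_def bij_betw_def)
  have hom: "\<phi> (s \<otimes>\<^bsub>std_torus r\<^esub> t) = \<phi> s * \<phi> t" if "s \<in> ?X" "t \<in> ?X" for s t
    using \<phi> that by (auto simp: iso_def hom_def)
  have car: "\<phi> t \<in> carrier_mat n n" "\<phi> t \<in> carrier (SL n)" if "t \<in> ?X" for t
    using img that sub by (auto simp: SL_carrier_mat)
  have one: "\<phi> (vec r (\<lambda>_. 1)) = 1\<^sub>m n"
  proof -
    let ?E = "\<phi> (vec r (\<lambda>_. 1))"
    have E: "?E \<in> carrier (SL n)" using car unit by blast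
    have ee: "vec r (\<lambda>_. 1) \<otimes>\<^bsub>std_torus r\<^esub> vec r (\<lambda>_. 1) = vec r (\<lambda>_. 1)"
      by (auto simp: mult_std_torus)
    have "?E \<otimes>\<^bsub>SL n\<^esub> ?E = ?E" using hom[OF unit unit] ee by simp
    then show ?thesis using group.l_cancel_one[OF group_SL E E] by simp
  qed
  have laurent_span: "q \<in> span" if "q \<in> laurent_functions r" for q
    using that unfolding laurent_functions_def
  proof (rule span_function_algebra)
    fix f :: "complex vec \<Rightarrow> complex" assume "f \<in> {\<lambda>t. t $ i | i. i < r} \<union> {\<lambda>t. inverse (t $ i) | i. i < r}"
    then obtain i where i: "i < r" and f: "f = (\<lambda>t. t $ i) \<or> f = (\<lambda>t. inverse (t $ i))" by blast
    have "restrict f ?X \<in> ?C"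
      using f closed unit i by (elim disjE) (simp_all add: mult_std_torus)
    from span_char[OF this] show "f \<in> span" by (rule span_cong) simp
  qed
  obtain A P where A: "finite A" and P: "\<And>\<chi>. P \<chi> \<in> carrier_mat n n"
    and PR: "\<And>x \<chi>. x \<in> ?X \<Longrightarrow> \<chi> \<in> A \<Longrightarrow> P \<chi> * \<phi> x = \<chi> x \<cdot>\<^sub>m P \<chi>"
    and sum: "\<And>i j. i < n \<Longrightarrow> j < n \<Longrightarrow> (\<Sum>\<chi>\<in>A. P \<chi> $$ (i, j)) = 1\<^sub>m n $$ (i, j)"
  proof (rule weight_decomposition[where R = \<phi> and m = n])
    fix i j assume "i < n" "j < n"
    then obtain q where q: "q \<in> laurent_functions r" "\<forall>t\<in>?X. \<phi> t $$ (i, j) = q t" using laur by blast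
    show "(\<lambda>x. \<phi> x $$ (i, j)) \<in> span" by (rule span_cong[OF laurent_span[OF q(1)]]) (use q(2) in auto)
  qed (use car hom one in auto)
  \<comment> \<open>The multilinear expansion of the determinant takes summands indexed by natural
    numbers.\<close>
  obtain e where e: "bij_betw e {0..<card A} A" using ex_bij_betw_nat_finite[OF A] by blast
  define B where "B = {0..<card A}"
  have B: "finite B" "\<And>k. k \<in> B \<Longrightarrow> e k \<in> A" "\<And>F. (\<Sum>k\<in>B. F (e k)) = (\<Sum>\<chi>\<in>A. F \<chi> :: complex)"
    using e sum.reindex_bij_betw[OF e] by (auto simp: B_def bij_betw_def)
  let ?S = "{f. (\<forall>i\<in>{0..<n}. f i \<in> B) \<and> (\<forall>i. i \<notin> {0..<n} \<longrightarrow> f i = i)}"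
  let ?R = "\<lambda>i k. row (P (e k)) i"
  have R: "?R i k \<in> carrier_vec n" for i k using P[of "e k"] by (metis row_carrier_vec carrier_matD(2) row_carrier)
  have "1\<^sub>m n = mat\<^sub>r n n (\<lambda>i. finsum_vec TYPE(complex) n (?R i) B)"
  proof (rule eq_matI)
    fix i j assume ij: "i < dim_row (mat\<^sub>r n n (\<lambda>i. finsum_vec TYPE(complex) n (?R i) B))"
      "j < dim_col (mat\<^sub>r n n (\<lambda>i. finsum_vec TYPE(complex) n (?R i) B))"
    then have ij: "i < n" "j < n" by auto
    have "finsum_vec TYPE(complex) n (?R i) B $ j = (\<Sum>k\<in>B. ?R i k $ j)"
      using B(1) ij R by (intro index_finsum_vec) auto
    also have "\<dots> = (\<Sum>k\<in>B. P (e k) $$ (i, j))"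
    proof (intro sum.cong refl)
      fix k show "row (P (e k)) i $ j = P (e k) $$ (i, j)" using P[of "e k"] ij by auto
    qed
    also have "\<dots> = (\<Sum>\<chi>\<in>A. P \<chi> $$ (i, j))" by (rule B(3))
    finally show "1\<^sub>m n $$ (i, j) = mat\<^sub>r n n (\<lambda>i. finsum_vec TYPE(complex) n (?R i) B) $$ (i, j)"
      using sum[OF ij] ij by simp
  qed auto
  then have "1 = det (mat\<^sub>r n n (\<lambda>i. finsum_vec TYPE(complex) n (?R i) B))"
    using det_one[of n, where 'a = complex] by simp
  also have "\<dots> = (\<Sum>f\<in>?S. det (mat\<^sub>r n n (\<lambda>i. ?R i (f i))))"
    using B(1) R by (intro det_linear_rows_sum) auto
  finally have "(\<Sum>f\<in>?S. det (mat\<^sub>r n n (\<lambda>i. ?R i (f i)))) \<noteq> 0" by simp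
  then obtain f' where f': "f' \<in> ?S" "det (mat\<^sub>r n n (\<lambda>i. ?R i (f' i))) \<noteq> 0"
    by (rule sum.not_neutral_contains_not_neutral)
  define f where "f i = e (f' i)" for i
  have f: "f i \<in> A" if "i < n" for i using f'(1) that B(2) by (simp add: f_def)
  define H where "H = mat\<^sub>r n n (\<lambda>i. row (P (f i)) i)"
  have H: "H \<in> carrier_mat n n" "det H \<noteq> 0" using f'(2) by (auto simp: H_def f_def)
  have Hent: "H $$ (i, j) = P (f i) $$ (i, j)" if "i < n" "j < n" for i j
    using that P[of "f i"] by (auto simp: H_def)
  \<comment> \<open>Scaling one row brings the determinant to one and keeps every row a left
    eigenvector. The conjugating matrix is then the inverse of \<open>h\<close>, since
    \<open>h * x = E * h\<close> with \<open>E\<close> diagonal.\<close>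
  define h where "h = multrow 0 (inverse (det H)) H"
  have h: "h \<in> carrier (SL n)"
    using H det_multrow[OF n H(1)] by (simp add: h_def carrier_SL)
  have hent: "h $$ (i, j) = (if i = 0 then inverse (det H) else 1) * P (f i) $$ (i, j)" if "i < n" "j < n" for i j
    using that H by (auto simp: h_def Hent[symmetric])
  let ?g = "inv\<^bsub>SL n\<^esub> h"
  have g: "?g \<in> carrier (SL n)" "inv\<^bsub>SL n\<^esub> ?g = h"
    using inv_SL(1)[OF h] group.inv_inv[OF group_SL h] by auto
  have "T \<subseteq> conj_torus n ?g"
  proof
    fix x assume x: "x \<in> T"
    then obtain t where t: "t \<in> ?X" "x = \<phi> t" using img by auto
    have xc: "x \<in> carrier_mat n n" using car t by auto
    have hc: "h \<in> carrier_mat n n" and gc: "?g \<in> carrier_mat n n" using h g by (auto simp: SL_carrier_mat)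
    define E where "E = mat n n (\<lambda>(i, j). if i = j then f i t else 0 :: complex)"
    have E: "E \<in> carrier_mat n n" "diagonal_mat E" by (auto simp: E_def diagonal_mat_def)
    have "h * x = E * h"
    proof (rule eq_matI)
      fix i j assume "i < dim_row (E * h)" "j < dim_col (E * h)"
      then have ij: "i < n" "j < n" using E hc by auto
      have "(h * x) $$ (i, j) = (\<Sum>k<n. h $$ (i, k) * x $$ (k, j))"
        using hc xc ij by (intro mult_mat_index) auto
      also have "\<dots> = (if i = 0 then inverse (det H) else 1) * (\<Sum>k<n. P (f i) $$ (i, k) * x $$ (k, j))"
        using ij by (simp add: hent sum_distrib_left mult.assoc)
      also have "(\<Sum>k<n. P (f i) $$ (i, k) * x $$ (k, j)) = (P (f i) * x) $$ (i, j)"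
        using P xc ij by (intro mult_mat_index[symmetric]) auto
      also have "\<dots> = f i t * P (f i) $$ (i, j)"
        using PR[OF t(1), of "f i"] f ij P[of "f i"] t(2) by auto
      also have "(if i = 0 then inverse (det H) else 1) * \<dots> = E $$ (i, i) * h $$ (i, j)"
        using ij by (simp add: E_def hent)
      also have "\<dots> = (E * h) $$ (i, j)" using diagonal_mult_left[OF E(1) hc E(2) ij] by simp
      finally show "(h * x) $$ (i, j) = (E * h) $$ (i, j)" .
    qed (use E hc xc in auto)
    then have "conj_mat n ?g x = E * h * ?g" by (simp add: conj_mat_def g)
    also have "\<dots> = E * (h * ?g)" using E hc gc by (intro assoc_mult_mat) auto
    also have "\<dots> = E" using inv_SL(2)[OF h] E by simp
    finally show "x \<in> conj_torus n ?g" using x sub E by (auto simp: conj_torus_def)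
  qed
  then show ?thesis using g by blast
qed

lemma maximal_torus_eq_conj_torus:
  assumes "maximal_torus n T" "0 < n"
  obtains g where "g \<in> carrier (SL n)" "T = conj_torus n g"
proof -
  have alg: "algebraic_torus n T" using assms by (simp add: maximal_torus_def)
  obtain g where g: "g \<in> carrier (SL n)" "T \<subseteq> conj_torus n g"
    using algebraic_torus_subset_conj_torus[OF alg assms(2)] by blast
  have "T = conj_torus n g"
    using assms conj_torus_algebraic[OF g(1)] g(2) unfolding maximal_torus_def by blast
  then show thesis using that g by blast
qed

text \<open>A torus is commutative, so a larger one centralises a conjugate of
  \<open>diag(2, 1/2)\<close>, and distinct eigenvalues force its elements to be diagonal in the
  same basis. This is what allows the hypothesis of numerical semistability to be applied to every
  conjugate of the diagonal torus of SL(2).\<close>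

lemma conj_torus_maximal_2:
  assumes g: "g \<in> carrier (SL 2)"
  shows "maximal_torus 2 (conj_torus 2 g)"
proof -
  have "T = conj_torus 2 g" if T: "algebraic_torus 2 T" "conj_torus 2 g \<subseteq> T" for T
  proof (rule antisym[OF _ T(2)], rule subsetI)
    fix x assume x: "x \<in> T"
    have xS: "x \<in> carrier (SL 2)" using x T(1) by (auto simp: algebraic_torus_def subgroup_def)
    \<comment> \<open>Any diagonal matrix of determinant one with distinct eigenvalues would
      serve.\<close>
    define d :: "complex mat" where "d = mat 2 2 (\<lambda>(i, j). if i = j then if i = 0 then 2 else 1/2 else 0)"
    define y where "y = g * d * inv\<^bsub>SL 2\<^esub> g"
    have d: "d \<in> carrier_mat 2 2" "det d = 1" by (auto simp: d_def det_2x2)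
    note c = conj_carrier[OF g]
    have yS: "y \<in> carrier (SL 2)"
      unfolding y_def using g c d by (intro mult_in_SL) (auto simp: carrier_SL)
    have yc: "conj_mat 2 g y = d"
      using conj_mat_eq_iff[OF g SL_carrier_mat[OF yS] d(1)] by (simp add: y_def)
    have yT: "y \<in> conj_torus 2 g" using yS by (auto simp: conj_torus_def yc d_def diagonal_mat_def)
    obtain r \<phi> where \<phi>: "\<phi> \<in> iso (std_torus r) ((SL 2)\<lparr>carrier := T\<rparr>)"
      using T(1) unfolding algebraic_torus_def by blast
    have "y \<in> \<phi> ` carrier (std_torus r)" "x \<in> \<phi> ` carrier (std_torus r)"
      using \<phi> x yT T(2) by (auto simp: iso_def bij_betw_def)
    then obtain s t where st: "s \<in> carrier (std_torus r)" "t \<in> carrier (std_torus r)" "x = \<phi> s" "y = \<phi> t" by blast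
    have "s \<otimes>\<^bsub>std_torus r\<^esub> t = t \<otimes>\<^bsub>std_torus r\<^esub> s" by (auto simp: mult_std_torus mult.commute)
    moreover have "\<phi> (s \<otimes>\<^bsub>std_torus r\<^esub> t) = x * y" "\<phi> (t \<otimes>\<^bsub>std_torus r\<^esub> s) = y * x"
      using \<phi> st by (auto simp: iso_def hom_def)
    ultimately have "x * y = y * x" by simp
    then have "conj_mat 2 g x * d = d * conj_mat 2 g x"
      using conj_mat_mult[OF g SL_carrier_mat[OF xS] SL_carrier_mat[OF yS]]
        conj_mat_mult[OF g SL_carrier_mat[OF yS] SL_carrier_mat[OF xS]] yc by simp
    moreover define M where "M = conj_mat 2 g x"
    ultimately have M: "M * d = d * M" by simp
    have Mc: "M \<in> carrier_mat 2 2" using conj_mat_carrier[OF g SL_carrier_mat[OF xS]] by (simp add: M_def)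
    have off: "M $$ (i, j) = 0" if ij: "i < 2" "j < 2" "i \<noteq> j" for i j
    proof -
      have "(M * d) $$ (i, j) = (d * M) $$ (i, j)" using M by simp
      then have "M $$ (i, 0) * d $$ (0, j) + M $$ (i, 1) * d $$ (1, j) =
          d $$ (i, 0) * M $$ (0, j) + d $$ (i, 1) * M $$ (1, j)"
        using Mc d(1) ij by (simp only: mult_mat_index[of _ 2 2 _ 2]) (simp add: numeral_2_eq_2)
      moreover have "i = 0 \<and> j = 1 \<or> i = 1 \<and> j = 0" using ij by auto
      ultimately show ?thesis by (auto simp: d_def)
    qed
    show "x \<in> conj_torus 2 g" by (rule conj_torusI[OF g xS]) (use off in \<open>auto simp: M_def\<close>)
  qed
  then show ?thesis using conj_torus_algebraic[OF g] by (simp add: maximal_torus_def)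
qed

section \<open>Weight polytopes\<close>

lemma has_vector_derivative_unique:
  fixes f :: "real \<Rightarrow> complex"
  assumes "(f has_vector_derivative d) (at 0)" "(f has_vector_derivative d') (at 0)"
  shows "d = d'"
proof -
  have "(\<lambda>x. x *\<^sub>R d) = (\<lambda>x. x *\<^sub>R d')"
    using assms unfolding has_vector_derivative_def by (rule has_derivative_unique)
  from fun_cong[OF this, of 1] show ?thesis by simp
qed

lemma has_vector_derivative_power_at_one:
  fixes f :: "real \<Rightarrow> complex"
  assumes "(f has_vector_derivative d) (at 0)" "f 0 = 1"
  shows "((\<lambda>s. f s ^ k) has_vector_derivative (of_nat k * d)) (at 0)"
proof (induction k)
  case (Suc k)
  have "((\<lambda>s. f s * f s ^ k) has_vector_derivative (f 0 * (of_nat k * d) + d * f 0 ^ k)) (at 0)"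
    by (intro has_vector_derivative_mult assms(1) Suc)
  then show ?case using assms(2) by (simp add: algebra_simps)
qed simp

lemma has_vector_derivative_prod_at_one:
  fixes f :: "'i \<Rightarrow> real \<Rightarrow> complex"
  assumes "finite I" "\<And>i. i \<in> I \<Longrightarrow> (f i has_vector_derivative d i) (at 0)" "\<And>i. i \<in> I \<Longrightarrow> f i 0 = 1"
  shows "((\<lambda>s. \<Prod>i\<in>I. f i s) has_vector_derivative (\<Sum>i\<in>I. d i)) (at 0)"
  using assms
proof (induction I rule: finite_induct)
  case (insert i I)
  have "((\<lambda>s. f i s * (\<Prod>i\<in>I. f i s)) has_vector_derivative
      (f i 0 * (\<Sum>i\<in>I. d i) + d i * (\<Prod>i\<in>I. f i 0))) (at 0)"
    using insert by (intro has_vector_derivative_mult) auto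
  then show ?case using insert by (simp add: algebra_simps)
qed simp

text \<open>All diagonal entries are 1 at the identity, so the product rule leaves a weighted sum of
  their derivatives. Membership in \<open>Lie\<close> supplies a tangent curve, without which the
  definite description would not determine a value.\<close>

lemma differential_monomial_char:
  assumes g: "g \<in> carrier (SL n)" and X: "X \<in> Lie n (conj_torus n g)"
  shows "differential n (conj_torus n g) (monomial_char n g \<alpha>) X =
    (\<Sum>i<n. of_nat (\<alpha> i) * conj_mat n g X $$ (i, i))"
proof -
  let ?T = "conj_torus n g" and ?d = "\<Sum>i<n. of_nat (\<alpha> i) * conj_mat n g X $$ (i, i)"
  have Xc: "X \<in> carrier_mat n n" using X by (simp add: Lie_def)
  have der: "((\<lambda>s. monomial_char n g \<alpha> (\<gamma> s)) has_vector_derivative ?d) (at 0)"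
    if \<gamma>: "tangent_curve n ?T X \<gamma>" for \<gamma>
  proof -
    have \<gamma>T: "\<gamma> s \<in> ?T" for s using \<gamma> by (simp add: tangent_curve_def)
    have 0: "\<gamma> 0 = 1\<^sub>m n" using \<gamma> by (simp add: tangent_curve_def)
    have entry: "((\<lambda>s. conj_mat n g (\<gamma> s) $$ (i, i)) has_vector_derivative conj_mat n g X $$ (i, i)) (at 0)"
      if i: "i < n" for i
    proof -
      let ?h = "inv\<^bsub>SL n\<^esub> g"
      have "((\<lambda>s. \<Sum>k<n. \<Sum>l<n. ?h $$ (i, k) * \<gamma> s $$ (k, l) * g $$ (l, i)) has_vector_derivative
          (\<Sum>k<n. \<Sum>l<n. ?h $$ (i, k) * X $$ (k, l) * g $$ (l, i))) (at 0)"
        using \<gamma> by (intro has_vector_derivative_sum has_vector_derivative_mult_left has_vector_derivative_mult_right)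
          (auto simp: tangent_curve_def)
      then show ?thesis
        using conj_entry[OF g conj_torusD(2)[OF g \<gamma>T] i i] conj_entry[OF g Xc i i] by simp
    qed
    have "((\<lambda>s. \<Prod>i<n. conj_mat n g (\<gamma> s) $$ (i, i) ^ \<alpha> i) has_vector_derivative ?d) (at 0)"
      using entry conj_mat_one[OF g] 0
      by (intro has_vector_derivative_prod_at_one has_vector_derivative_power_at_one) auto
    then show ?thesis using \<gamma>T by (simp add: monomial_char_def)
  qed
  obtain \<gamma> where \<gamma>: "tangent_curve n ?T X \<gamma>" using X by (auto simp: Lie_def)
  show ?thesis unfolding differential_def
  proof (rule the_equality)
    show "\<forall>\<gamma>. tangent_curve n ?T X \<gamma> \<longrightarrow>
        ((\<lambda>s. monomial_char n g \<alpha> (\<gamma> s)) has_vector_derivative ?d) (at 0)" using der by blast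
    fix d assume "\<forall>\<gamma>. tangent_curve n ?T X \<gamma> \<longrightarrow>
        ((\<lambda>s. monomial_char n g \<alpha> (\<gamma> s)) has_vector_derivative d) (at 0)"
    then show "d = ?d" using der[OF \<gamma>] \<gamma> by (blast intro: has_vector_derivative_unique)
  qed
qed

lemma weight_polytope_convex:
  assumes "finite I" "\<And>i. i \<in> I \<Longrightarrow> p i \<in> weight_polytope n T m \<rho> u" "\<And>i. i \<in> I \<Longrightarrow> 0 \<le> b i" "(\<Sum>i\<in>I. b i) = (1 :: real)"
  shows "(\<lambda>X\<in>Lie n T. \<Sum>i\<in>I. complex_of_real (b i) * p i X) \<in> weight_polytope n T m \<rho> u"
proof -
  let ?W = "weights n T m \<rho> u"
  define Q where "Q i a \<longleftrightarrow> p i = (\<lambda>X\<in>Lie n T. \<Sum>\<chi>\<in>?W. complex_of_real (a \<chi>) * differential n T \<chi> X) \<and>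
      (\<forall>\<chi>\<in>?W. 0 \<le> a \<chi>) \<and> (\<Sum>\<chi>\<in>?W. a \<chi>) = (1 :: real)" for i a
  have "\<forall>i\<in>I. \<exists>a. Q i a"
    using assms(2) unfolding weight_polytope_def Q_def by blast
  then obtain a where "\<forall>i\<in>I. Q i (a i)" by (rule bchoice[THEN exE])
  then have a: "\<And>i. i \<in> I \<Longrightarrow> p i = (\<lambda>X\<in>Lie n T. \<Sum>\<chi>\<in>?W. complex_of_real (a i \<chi>) * differential n T \<chi> X)"
     "\<And>i \<chi>. i \<in> I \<Longrightarrow> \<chi> \<in> ?W \<Longrightarrow> 0 \<le> a i \<chi>" "\<And>i. i \<in> I \<Longrightarrow> (\<Sum>\<chi>\<in>?W. a i \<chi>) = (1 :: real)"
    unfolding Q_def by blast+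
  let ?c = "\<lambda>\<chi>. \<Sum>i\<in>I. b i * a i \<chi>"
  have 1: "(\<lambda>X\<in>Lie n T. \<Sum>i\<in>I. complex_of_real (b i) * p i X) =
     (\<lambda>X\<in>Lie n T. \<Sum>\<chi>\<in>?W. complex_of_real (?c \<chi>) * differential n T \<chi> X)"
  proof (rule restrict_ext)
    fix X assume "X \<in> Lie n T"
    then have "(\<Sum>i\<in>I. complex_of_real (b i) * p i X) =
        (\<Sum>i\<in>I. \<Sum>\<chi>\<in>?W. complex_of_real (b i * a i \<chi>) * differential n T \<chi> X)"
      using a(1) by (intro sum.cong) (auto simp: sum_distrib_left mult.assoc)
    also have "\<dots> = (\<Sum>\<chi>\<in>?W. complex_of_real (?c \<chi>) * differential n T \<chi> X)"
      by (subst sum.swap) (simp add: sum_distrib_right)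
    finally show "(\<Sum>i\<in>I. complex_of_real (b i) * p i X) =
      (\<Sum>\<chi>\<in>?W. complex_of_real (?c \<chi>) * differential n T \<chi> X)" .
  qed
  have "(\<Sum>\<chi>\<in>?W. ?c \<chi>) = (\<Sum>i\<in>I. b i * (\<Sum>\<chi>\<in>?W. a i \<chi>))"
    by (subst sum.swap) (simp add: sum_distrib_left)
  also have "\<dots> = 1" using a(3) assms(4) by simp
  finally have 2: "(\<Sum>\<chi>\<in>?W. ?c \<chi>) = 1" .
  have 3: "\<forall>\<chi>\<in>?W. 0 \<le> ?c \<chi>" using a(2) assms(3) by (auto intro!: sum_nonneg)
  show ?thesis unfolding 1 weight_polytope_def using 2 3 by (intro CollectI exI[of _ ?c]) simp
qed

definition weight_point :: "nat \<Rightarrow> complex mat set \<Rightarrow> (complex mat \<Rightarrow> complex) \<Rightarrow> complex mat \<Rightarrow> complex" where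
  "weight_point n T \<chi> = (\<lambda>X\<in>Lie n T. differential n T \<chi> X)"

lemma weight_point_in_polytope:
  assumes "finite (weights n T m \<rho> u)" "\<chi> \<in> weights n T m \<rho> u"
  shows "weight_point n T \<chi> \<in> weight_polytope n T m \<rho> u"
proof -
  let ?W = "weights n T m \<rho> u" and ?a = "\<lambda>\<psi>. if \<psi> = \<chi> then 1 else 0 :: real"
  have "weight_point n T \<chi> = (\<lambda>X\<in>Lie n T. \<Sum>\<psi>\<in>?W. complex_of_real (?a \<psi>) * differential n T \<psi> X)"
    unfolding weight_point_def
  proof (rule restrict_ext)
    fix X
    have "(\<Sum>\<psi>\<in>?W. complex_of_real (?a \<psi>) * differential n T \<psi> X) =
        (\<Sum>\<psi>\<in>?W. if \<psi> = \<chi> then differential n T \<psi> X else 0)" by (intro sum.cong) auto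
    then show "differential n T \<chi> X = (\<Sum>\<psi>\<in>?W. complex_of_real (?a \<psi>) * differential n T \<psi> X)"
      using assms by simp
  qed
  moreover have "(\<forall>\<psi>\<in>?W. 0 \<le> ?a \<psi>) \<and> (\<Sum>\<psi>\<in>?W. ?a \<psi>) = 1" using assms by simp
  ultimately show ?thesis unfolding weight_polytope_def by (intro CollectI exI[of _ ?a]) simp
qed

lemma weight_polytope_subset:
  assumes "finite (weights n T m \<rho> v)"
    "\<And>\<chi>. \<chi> \<in> weights n T m \<rho> v \<Longrightarrow> weight_point n T \<chi> \<in> weight_polytope n T k \<sigma> w"
  shows "weight_polytope n T m \<rho> v \<subseteq> weight_polytope n T k \<sigma> w"
proof
  fix f assume "f \<in> weight_polytope n T m \<rho> v"
  then obtain a where f: "f = (\<lambda>X\<in>Lie n T. \<Sum>\<chi>\<in>weights n T m \<rho> v. complex_of_real (a \<chi>) * differential n T \<chi> X)"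
    and a: "\<forall>\<chi>\<in>weights n T m \<rho> v. 0 \<le> a \<chi>" "(\<Sum>\<chi>\<in>weights n T m \<rho> v. a \<chi>) = (1 :: real)"
    unfolding weight_polytope_def by blast
  have "f = (\<lambda>X\<in>Lie n T. \<Sum>\<chi>\<in>weights n T m \<rho> v. complex_of_real (a \<chi>) * weight_point n T \<chi> X)"
    unfolding f by (auto simp: weight_point_def intro!: restrict_ext)
  also have "\<dots> \<in> weight_polytope n T k \<sigma> w"
    using assms a by (intro weight_polytope_convex) auto
  finally show "f \<in> weight_polytope n T k \<sigma> w" .
qed

text \<open>Differentials are linear in the exponents, so the mean of two exponents gives the mean
  of two points. With equal end points it also transfers membership between exponents that agree
  below \<open>n\<close>.\<close>

lemma weight_polytope_midpoint:
  assumes g: "g \<in> carrier (SL n)" and T: "T = conj_torus n g"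
    and "weight_point n T (monomial_char n g \<beta>) \<in> weight_polytope n T m \<rho> u"
    and "weight_point n T (monomial_char n g \<gamma>) \<in> weight_polytope n T m \<rho> u"
    and mid: "\<And>i. i < n \<Longrightarrow> 2 * \<alpha> i = \<beta> i + \<gamma> i"
  shows "weight_point n T (monomial_char n g \<alpha>) \<in> weight_polytope n T m \<rho> u"
proof -
  \<comment> \<open>The two end points are indexed by booleans, each with coefficient 1/2.\<close>
  let ?p = "\<lambda>i :: bool. weight_point n T (monomial_char n g (if i then \<beta> else \<gamma>))"
  have *: "complex_of_nat (\<beta> i) + of_nat (\<gamma> i) = 2 * of_nat (\<alpha> i)" if "i < n" for i
    using mid[OF that] by (metis of_nat_add of_nat_mult of_nat_numeral)
  have "weight_point n T (monomial_char n g \<alpha>) X = (\<Sum>i\<in>UNIV. complex_of_real (1/2) * ?p i X)" if X: "X \<in> Lie n T" for X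
  proof -
    have "(\<Sum>i\<in>UNIV. complex_of_real (1/2) * ?p i X) =
        (\<Sum>i<n. (1/2) * ((complex_of_nat (\<beta> i) + of_nat (\<gamma> i)) * conj_mat n g X $$ (i, i)))"
      using X by (simp add: UNIV_bool weight_point_def T differential_monomial_char[OF g] distrib_right sum.distrib sum_distrib_left sum_divide_distrib add_divide_distrib)
    also have "\<dots> = weight_point n T (monomial_char n g \<alpha>) X"
      using X by (simp add: weight_point_def T differential_monomial_char[OF g] *)
    finally show ?thesis by simp
  qed
  then have "weight_point n T (monomial_char n g \<alpha>) = (\<lambda>X\<in>Lie n T. \<Sum>i\<in>UNIV. complex_of_real (1/2) * ?p i X)"
    by (intro ext) (auto simp: weight_point_def)
  also have "\<dots> \<in> weight_polytope n T m \<rho> u"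
    using assms(3,4) by (intro weight_polytope_convex) auto
  finally show ?thesis .
qed

section \<open>Closures of orbits in projective space\<close>

lemma continuous_map_vec_index:
  "i < N \<Longrightarrow> continuous_map (vec_topology N) euclidean (\<lambda>x. x $ i)"
proof -
  assume i: "i < N"
  have "continuous_map (vec_topology N) euclidean ((\<lambda>f. f i) \<circ> (\<lambda>x. \<lambda>i\<in>{..<N}. x $ i))"
    unfolding vec_topology_def using i
    by (intro continuous_map_pullback continuous_map_product_projection) auto
  then show ?thesis
    by (rule continuous_map_eq) (use i in auto)
qed

lemma proj_point_eqD:
  assumes "proj_point x = proj_point y"
  obtains c where "c \<noteq> 0" "y = c \<cdot>\<^sub>v x"
proof -
  have "y = 1 \<cdot>\<^sub>v y" by auto
  then have "y \<in> proj_point y" unfolding proj_point_def by (metis (mono_tags, lifting) mem_Collect_eq zero_neq_one)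
  then have "y \<in> proj_point x" using assms by simp
  then show thesis using that unfolding proj_point_def by blast
qed

lemma proj_point_scale:
  assumes "c \<noteq> 0"
  shows "proj_point (c \<cdot>\<^sub>v x) = proj_point x"
proof (intro equalityI subsetI)
  fix y assume "y \<in> proj_point (c \<cdot>\<^sub>v x)"
  then obtain d where "d \<noteq> 0" "y = d \<cdot>\<^sub>v (c \<cdot>\<^sub>v x)" by (auto simp: proj_point_def)
  then show "y \<in> proj_point x" using assms
    by (auto simp: proj_point_def smult_smult_assoc intro!: exI[of _ "d * c"])
next
  fix y assume "y \<in> proj_point x"
  then obtain d where "d \<noteq> 0" "y = d \<cdot>\<^sub>v x" by (auto simp: proj_point_def)
  then show "y \<in> proj_point (c \<cdot>\<^sub>v x)" using assms
    by (auto simp: proj_point_def smult_smult_assoc intro!: exI[of _ "d / c"])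
qed

text \<open>By \<open>scale\<close>, used for a scalar and for its inverse, positivity of
  \<open>f\<close> depends only on the projective point. The complement therefore pulls back to the
  open set where \<open>f\<close> is positive, and openness in the quotient is read off
  upstairs.\<close>

lemma closedin_proj_topology:
  assumes f: "continuous_map (vec_topology N) euclideanreal f"
    and scale: "\<And>c x. c \<noteq> 0 \<Longrightarrow> x \<in> carrier_vec N \<Longrightarrow> f (c \<cdot>\<^sub>v x) > 0 \<Longrightarrow> f x > 0"
  shows "closedin (proj_topology N) (proj_point ` {x \<in> carrier_vec N - {0\<^sub>v N}. f x \<le> 0})"
proof -
  let ?X = "carrier_vec N - {0\<^sub>v N} :: complex vec set"
  let ?K = "proj_point ` {x \<in> ?X. f x \<le> 0}"
  have mem: "proj_point x \<in> proj_point ` ?X - ?K \<longleftrightarrow> f x > 0" if x: "x \<in> ?X" for x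
  proof
    assume "proj_point x \<in> proj_point ` ?X - ?K"
    then have "x \<notin> {x \<in> ?X. f x \<le> 0}" using imageI[of x _ proj_point] by (rule_tac notI, elim DiffE, elim notE)
    then show "f x > 0" using x by auto
  next
    assume fx: "f x > 0"
    have "proj_point x \<notin> ?K"
    proof
      assume "proj_point x \<in> ?K"
      then obtain y where y: "y \<in> ?X" "f y \<le> 0" "proj_point x = proj_point y" by blast
      obtain c where c: "c \<noteq> 0" "x = c \<cdot>\<^sub>v y" using proj_point_eqD[OF y(3)[symmetric]] .
      have "f y > 0" using scale[OF c(1), of y] c(2) fx y(1) by simp
      then show False using y(2) by simp
    qed
    then show "proj_point x \<in> proj_point ` ?X - ?K" using x by blast
  qed
  have "openin (vec_topology N) {x \<in> topspace (vec_topology N). f x \<in> {0<..}}"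
    using f by (rule openin_continuous_map_preimage) auto
  then have "openin (subtopology (vec_topology N) ?X) ({x \<in> carrier_vec N. f x \<in> {0<..}} \<inter> ?X)"
    by (auto simp: openin_subtopology)
  also have "{x \<in> carrier_vec N. f x \<in> {0<..}} \<inter> ?X = {x \<in> ?X. proj_point x \<in> proj_point ` ?X - ?K}"
    using mem by auto
  finally have "openin (proj_topology N) (proj_point ` ?X - ?K)"
    by (auto simp: openin_proj_topology)
  then show ?thesis unfolding closedin_def by auto
qed

section \<open>Norm bounds, limits and semistability\<close>

lemma norm_smult_sum:
  fixes x :: "complex vec"
  assumes "x \<in> carrier_vec N" "I \<subseteq> {..<N}"
  shows "(\<Sum>i\<in>I. cmod ((c \<cdot>\<^sub>v x) $ i)) = cmod c * (\<Sum>i\<in>I. cmod (x $ i))"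
proof -
  have "cmod ((c \<cdot>\<^sub>v x) $ i) = cmod c * cmod (x $ i)" if "i \<in> I" for i
    using assms that by (auto simp: norm_mult)
  then show ?thesis by (simp add: sum_distrib_left)
qed

definition vnorm :: "complex vec \<Rightarrow> real" where
  "vnorm x = (\<Sum>i<dim_vec x. cmod (x $ i))"

lemma vnorm_nonneg: "0 \<le> vnorm x"
  by (simp add: vnorm_def sum_nonneg)

text \<open>The condition that the first half of a vector is at most \<open>B\<close> times its
  second half is closed and holds on the first orbit, hence on its closure. On the closure of the
  second orbit the second half is zero. A common point would have both halves zero.\<close>

lemma semistable_of_bound:
  assumes rho: "\<And>g. g \<in> carrier (SL n) \<Longrightarrow> \<rho> g *\<^sub>v v \<in> carrier_vec m"
    and sigma: "\<And>g. g \<in> carrier (SL n) \<Longrightarrow> \<sigma> g *\<^sub>v w \<in> carrier_vec k"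
    and nz: "\<And>g. g \<in> carrier (SL n) \<Longrightarrow> \<rho> g *\<^sub>v v \<noteq> 0\<^sub>v m"
    and bound: "\<And>g. g \<in> carrier (SL n) \<Longrightarrow> vnorm (\<rho> g *\<^sub>v v) \<le> B * vnorm (\<sigma> g *\<^sub>v w)"
  shows "semistable n m \<rho> k \<sigma> v w"
proof -
  let ?X = "carrier_vec (m + k) - {0\<^sub>v (m + k)} :: complex vec set"
  let ?a = "\<lambda>x :: complex vec. \<Sum>i<m. cmod (x $ i)" and ?b = "\<lambda>x :: complex vec. \<Sum>i\<in>{m..<m+k}. cmod (x $ i)"
  let ?K1 = "proj_point ` {x \<in> ?X. ?a x - B * ?b x \<le> 0}" and ?K2 = "proj_point ` {x \<in> ?X. ?b x \<le> 0}"
  have cmod_c: "continuous_map (vec_topology (m + k)) euclideanreal (\<lambda>x. cmod (x $ i))" if "i < m + k" for i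
    using continuous_map_vec_index[OF that] by (intro continuous_intros) auto
  have a: "continuous_map (vec_topology (m + k)) euclideanreal ?a"
    and b: "continuous_map (vec_topology (m + k)) euclideanreal ?b"
    by (intro continuous_map_sum cmod_c, auto)+
  have sa: "?a (c \<cdot>\<^sub>v x) = cmod c * ?a x" "?b (c \<cdot>\<^sub>v x) = cmod c * ?b x" if "x \<in> carrier_vec (m + k)" for c x
    by (rule norm_smult_sum[OF that], force)+
  have K1: "closedin (proj_topology (m + k)) ?K1"
  proof (rule closedin_proj_topology)
    show "continuous_map (vec_topology (m + k)) euclideanreal (\<lambda>x. ?a x - B * ?b x)"
      using a b by (intro continuous_map_diff continuous_map_real_mult_left)
    fix c :: complex and x :: "complex vec" assume "c \<noteq> 0" "x \<in> carrier_vec (m + k)" "0 < ?a (c \<cdot>\<^sub>v x) - B * ?b (c \<cdot>\<^sub>v x)"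
    then have "0 < cmod c * (?a x - B * ?b x)" using sa by (simp add: algebra_simps)
    then show "0 < ?a x - B * ?b x" using \<open>c \<noteq> 0\<close> by (simp add: zero_less_mult_iff)
  qed
  have K2: "closedin (proj_topology (m + k)) ?K2"
  proof (rule closedin_proj_topology[OF b])
    fix c :: complex and x :: "complex vec" assume "c \<noteq> 0" "x \<in> carrier_vec (m + k)" "0 < ?b (c \<cdot>\<^sub>v x)"
    then show "0 < ?b x" using sa by (simp add: zero_less_mult_iff)
  qed
  have app: "x @\<^sub>v y \<in> ?X" "?a (x @\<^sub>v y) = vnorm x" "?b (x @\<^sub>v y) = vnorm y"
    if "x \<in> carrier_vec m" "y \<in> carrier_vec k" "x \<noteq> 0\<^sub>v m" for x y
  proof -
    show "?a (x @\<^sub>v y) = vnorm x" using that by (auto simp: vnorm_def intro!: sum.cong)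
    have "?b (x @\<^sub>v y) = (\<Sum>i<k. cmod ((x @\<^sub>v y) $ (m + i)))"
      by (rule sum.reindex_bij_witness[of _ "\<lambda>i. m + i" "\<lambda>i. i - m"]) auto
    then show "?b (x @\<^sub>v y) = vnorm y" using that by (auto simp: vnorm_def intro!: sum.cong)
    have "0\<^sub>v (m + k) = 0\<^sub>v m @\<^sub>v (0\<^sub>v k :: complex vec)" by auto
    then show "x @\<^sub>v y \<in> ?X" using that append_vec_eq[of x m "0\<^sub>v m" y "0\<^sub>v k"] by auto
  qed
  have s1: "pair_orbit n \<rho> \<sigma> v w \<subseteq> ?K1"
  proof
    fix p assume "p \<in> pair_orbit n \<rho> \<sigma> v w"
    then obtain g where g: "g \<in> carrier (SL n)" "p = proj_point ((\<rho> g *\<^sub>v v) @\<^sub>v (\<sigma> g *\<^sub>v w))"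
      by (auto simp: pair_orbit_def)
    then show "p \<in> ?K1"
      using app[OF rho[OF g(1)] sigma[OF g(1)] nz[OF g(1)]] bound[OF g(1)]
      unfolding g(2) by (intro imageI CollectI) simp
  qed
  have s2: "pair_orbit n \<rho> \<sigma> v (0\<^sub>v k) \<subseteq> ?K2"
  proof
    fix p assume "p \<in> pair_orbit n \<rho> \<sigma> v (0\<^sub>v k)"
    then obtain g where g: "g \<in> carrier (SL n)" "p = proj_point ((\<rho> g *\<^sub>v v) @\<^sub>v (\<sigma> g *\<^sub>v 0\<^sub>v k))"
      by (auto simp: pair_orbit_def)
    have d: "dim_row (\<sigma> g) = k" using carrier_vecD[OF sigma[OF g(1)]] by simp
    then have z: "\<sigma> g *\<^sub>v 0\<^sub>v k \<in> carrier_vec k" by (intro carrier_vecI) simp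
    have z': "vnorm (\<sigma> g *\<^sub>v 0\<^sub>v k) = 0"
      by (auto simp: vnorm_def scalar_prod_def)
    then show "p \<in> ?K2"
      using app[OF rho[OF g(1)] z nz[OF g(1)]] z' unfolding g(2) by (intro imageI CollectI) simp
  qed
  have "?K1 \<inter> ?K2 = {}"
  proof (rule ccontr)
    assume "?K1 \<inter> ?K2 \<noteq> {}"
    then obtain x y where x: "x \<in> ?X" "?a x - B * ?b x \<le> 0" and y: "y \<in> ?X" "?b y \<le> 0" and eq: "proj_point x = proj_point y"
      by blast
    obtain c where c: "c \<noteq> 0" "x = c \<cdot>\<^sub>v y" using proj_point_eqD[OF eq[symmetric]] .
    have "?b y = 0" using y(2) by (intro antisym sum_nonneg) auto
    moreover have "?b (c \<cdot>\<^sub>v y) = cmod c * ?b y" using y(1) by (intro sa(2)) simp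
    ultimately have "?b x = 0" by (simp only: c(2) mult_zero_right)
    moreover from this have "?a x = 0" using x(2) by (intro antisym sum_nonneg) auto
    ultimately have "x $ i = 0" if "i < m + k" for i
      using that by (cases "i < m") (auto simp: sum_nonneg_eq_0_iff)
    then have "x = 0\<^sub>v (m + k)" using x(1) by (intro eq_vecI) auto
    then show False using x by simp
  qed
  moreover have "proj_topology (m + k) closure_of pair_orbit n \<rho> \<sigma> v w \<subseteq> ?K1"
    using s1 K1 by (rule closure_of_minimal)
  moreover have "proj_topology (m + k) closure_of pair_orbit n \<rho> \<sigma> v (0\<^sub>v k) \<subseteq> ?K2"
    using s2 K2 by (rule closure_of_minimal)
  ultimately show ?thesis unfolding semistable_def by (metis (no_types, lifting) Int_mono subset_empty)
qed

lemma limit_in_closure_of: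
  fixes x :: "nat \<Rightarrow> complex vec"
  assumes x: "\<And>l. x l \<in> carrier_vec N" "\<And>l. proj_point (x l) \<in> A"
    and y: "y \<in> carrier_vec N" "y \<noteq> 0\<^sub>v N" and lim: "\<And>i. i < N \<Longrightarrow> (\<lambda>l. x l $ i) \<longlonglongrightarrow> y $ i"
  shows "proj_point y \<in> proj_topology N closure_of A"
  unfolding in_closure_of
proof (intro conjI allI impI)
  let ?X = "carrier_vec N - {0\<^sub>v N} :: complex vec set"
  show "proj_point y \<in> topspace (proj_topology N)" using y by auto
  fix S assume S: "proj_point y \<in> S \<and> openin (proj_topology N) S"
  let ?F = "\<lambda>x :: complex vec. \<lambda>i\<in>{..<N}. x $ i"
  have "openin (subtopology (vec_topology N) ?X) {x \<in> ?X. proj_point x \<in> S}"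
    using S by (simp add: openin_proj_topology)
  then obtain V where V: "openin (vec_topology N) V" "{x \<in> ?X. proj_point x \<in> S} = V \<inter> ?X"
    by (auto simp: openin_subtopology)
  then obtain W where W: "openin (product_topology (\<lambda>_. euclidean) {..<N}) W" "V = ?F -` W \<inter> carrier_vec N"
    by (auto simp: vec_topology_def openin_pullback_topology)
  have "limitin (product_topology (\<lambda>_. euclidean) {..<N}) (\<lambda>l. ?F (x l)) (?F y) sequentially"
    unfolding limitin_componentwise using lim by auto
  moreover have "?F y \<in> W" using V(2) W(2) S y by blast
  ultimately have ev: "\<forall>\<^sub>F l in sequentially. ?F (x l) \<in> W" using W(1) unfolding limitin_def by blast
  \<comment> \<open>Openness upstairs is relative to the nonzero vectors, so \<open>x l\<close> has
    to avoid 0. It does so eventually, because some coordinate of the limit is nonzero.\<close>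
  obtain i where i: "i < N" "y $ i \<noteq> 0" using y by (metis carrier_vecD eq_vecI index_zero_vec)
  have "\<forall>\<^sub>F l in sequentially. x l $ i \<noteq> 0" by (rule tendsto_imp_eventually_ne[OF lim[OF i(1)] i(2)])
  with ev have "\<forall>\<^sub>F l in sequentially. ?F (x l) \<in> W \<and> x l $ i \<noteq> 0" by eventually_elim auto
  then obtain l where l: "?F (x l) \<in> W" "x l $ i \<noteq> 0" using eventually_happens'[OF sequentially_bot] by blast
  then have "x l \<in> V \<inter> ?X" using W(2) x(1) i(1) by auto
  then have "proj_point (x l) \<in> S" using V(2) by blast
  then show "\<exists>p. p \<in> A \<and> p \<in> S" using x(2) by blast
qed

text \<open>It suffices to let a sequence of scaled translates of \<open>(v, w)\<close> converge to some \<open>(y, 0)\<close>.\<close>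

lemma not_semistable_of_limit:
  assumes g: "\<And>l. g l \<in> carrier (SL n)" and c: "\<And>l. c l \<noteq> (0 :: complex)"
    and rho: "\<And>g. g \<in> carrier (SL n) \<Longrightarrow> \<rho> g *\<^sub>v v \<in> carrier_vec m"
    and sigma: "\<And>g. g \<in> carrier (SL n) \<Longrightarrow> \<sigma> g \<in> carrier_mat k k" and w: "w \<in> carrier_vec k"
    and y: "y \<in> carrier_vec m" "y \<noteq> 0\<^sub>v m"
    and lim: "\<And>i. i < m \<Longrightarrow> (\<lambda>l. c l * (\<rho> (g l) *\<^sub>v v) $ i) \<longlonglongrightarrow> y $ i"
    and lim0: "\<And>i. i < k \<Longrightarrow> (\<lambda>l. c l * (\<sigma> (g l) *\<^sub>v w) $ i) \<longlonglongrightarrow> 0"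
  shows "\<not> semistable n m \<rho> k \<sigma> v w"
proof -
  \<comment> \<open>Used with \<open>u = w\<close> and with \<open>u = 0\<close>, where the second
    limit is trivial; both closures then contain the same point.\<close>
  have in_closure: "proj_point (y @\<^sub>v 0\<^sub>v k) \<in> proj_topology (m + k) closure_of pair_orbit n \<rho> \<sigma> v u"
    if u: "u \<in> carrier_vec k" and ulim: "\<And>i. i < k \<Longrightarrow> (\<lambda>l. c l * (\<sigma> (g l) *\<^sub>v u) $ i) \<longlonglongrightarrow> 0" for u
  proof (rule limit_in_closure_of[where x = "\<lambda>l. c l \<cdot>\<^sub>v ((\<rho> (g l) *\<^sub>v v) @\<^sub>v (\<sigma> (g l) *\<^sub>v u))"])
    have r: "\<rho> (g l) *\<^sub>v v \<in> carrier_vec m" and s: "\<sigma> (g l) *\<^sub>v u \<in> carrier_vec k" for l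
      using rho[OF g] mult_mat_vec_carrier[OF sigma[OF g] u] by auto
    show "c l \<cdot>\<^sub>v ((\<rho> (g l) *\<^sub>v v) @\<^sub>v (\<sigma> (g l) *\<^sub>v u)) \<in> carrier_vec (m + k)" for l
      using r s by (intro smult_carrier_vec[THEN iffD2] append_carrier_vec)
    show "proj_point (c l \<cdot>\<^sub>v ((\<rho> (g l) *\<^sub>v v) @\<^sub>v (\<sigma> (g l) *\<^sub>v u))) \<in> pair_orbit n \<rho> \<sigma> v u" for l
      unfolding proj_point_scale[OF c] pair_orbit_def using g by blast
    show "y @\<^sub>v 0\<^sub>v k \<in> carrier_vec (m + k)" using y by (intro append_carrier_vec) auto
    have "0\<^sub>v (m + k) = 0\<^sub>v m @\<^sub>v (0\<^sub>v k :: complex vec)" by auto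
    then show "y @\<^sub>v 0\<^sub>v k \<noteq> 0\<^sub>v (m + k)" using y append_vec_eq[of y m "0\<^sub>v m" "0\<^sub>v k" "0\<^sub>v k"] by auto
    fix i assume i: "i < m + k"
    have e: "(c l \<cdot>\<^sub>v ((\<rho> (g l) *\<^sub>v v) @\<^sub>v (\<sigma> (g l) *\<^sub>v u))) $ i =
        (if i < m then c l * (\<rho> (g l) *\<^sub>v v) $ i else c l * (\<sigma> (g l) *\<^sub>v u) $ (i - m))" for l
      using r[of l, THEN carrier_vecD] s[of l, THEN carrier_vecD] i by simp
    show "(\<lambda>l. (c l \<cdot>\<^sub>v ((\<rho> (g l) *\<^sub>v v) @\<^sub>v (\<sigma> (g l) *\<^sub>v u))) $ i) \<longlonglongrightarrow> (y @\<^sub>v 0\<^sub>v k) $ i"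
      unfolding e using lim[of i] ulim[of "i - m"] i y(1) by (cases "i < m") auto
  qed
  have "\<sigma> (g l) *\<^sub>v 0\<^sub>v k = 0\<^sub>v k" for l using sigma[OF g, of l] by (auto intro!: eq_vecI)
  then show ?thesis
    using in_closure[OF w lim0] in_closure[of "0\<^sub>v k"] unfolding semistable_def by auto
qed

lemma subspace_vecI:
  fixes U :: "complex vec set"
  assumes "U \<subseteq> carrier_vec m" "0\<^sub>v m \<in> U" "\<And>x y. x \<in> U \<Longrightarrow> y \<in> U \<Longrightarrow> x + y \<in> U"
    "\<And>c x. x \<in> U \<Longrightarrow> c \<cdot>\<^sub>v x \<in> U"
  shows "VectorSpace.subspace class_ring U (module_vec TYPE(complex) m)"
  unfolding VectorSpace.subspace_def submodule_def
  using assms vec_vs[where 'a = complex and n = m] vec_module[where 'a = complex and n = m]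
  by (auto simp: module_vec_simps)

lemma subspace_vecD:
  fixes U :: "complex vec set"
  assumes "VectorSpace.subspace class_ring U (module_vec TYPE(complex) m)"
  shows "U \<subseteq> carrier_vec m" "0\<^sub>v m \<in> U" "\<And>x y. x \<in> U \<Longrightarrow> y \<in> U \<Longrightarrow> x + y \<in> U"
    "\<And>c x. x \<in> U \<Longrightarrow> c \<cdot>\<^sub>v x \<in> U"
  using assms unfolding VectorSpace.subspace_def submodule_def
  by (auto simp: module_vec_simps class_ring_simps)

section \<open>Representations of SL(2)\<close>

definition mat2 :: "complex \<Rightarrow> complex \<Rightarrow> complex \<Rightarrow> complex \<Rightarrow> complex mat" where
  "mat2 a b c d = mat 2 2 (\<lambda>(i, j). if i = 0 then if j = 0 then a else b else if j = 0 then c else d)"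

lemma mat2_carrier [simp]: "mat2 a b c d \<in> carrier_mat 2 2"
  by (simp add: mat2_def)

lemma mat2_entries [simp]:
  "mat2 a b c d $$ (0, 0) = a" "mat2 a b c d $$ (0, Suc 0) = b"
  "mat2 a b c d $$ (Suc 0, 0) = c" "mat2 a b c d $$ (Suc 0, Suc 0) = d"
  by (simp_all add: mat2_def)

lemma mult_mat_zero_vec: "A \<in> carrier_mat n k \<Longrightarrow> A *\<^sub>v 0\<^sub>v k = (0\<^sub>v n :: complex vec)"
  by (rule eq_vecI) (auto simp: scalar_prod_def)

lemma mat2_eqI:
  assumes "A \<in> carrier_mat 2 2" "A $$ (0, 0) = a" "A $$ (0, 1) = b" "A $$ (1, 0) = c" "A $$ (1, 1) = d"
  shows "A = mat2 a b c d"
proof (rule eq_matI)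
  fix i j assume "i < dim_row (mat2 a b c d)" "j < dim_col (mat2 a b c d)"
  then have "i = 0 \<or> i = 1" "j = 0 \<or> j = 1" by (auto simp: mat2_def)
  then show "A $$ (i, j) = mat2 a b c d $$ (i, j)" using assms by auto
qed (use assms(1) in \<open>auto simp: mat2_def\<close>)

lemma mat2_eta: "A \<in> carrier_mat 2 2 \<Longrightarrow> A = mat2 (A $$ (0, 0)) (A $$ (0, 1)) (A $$ (1, 0)) (A $$ (1, 1))"
  by (rule mat2_eqI) auto

lemma mat2_mult:
  "mat2 a b c d * mat2 a' b' c' d' = mat2 (a * a' + b * c') (a * b' + b * d') (c * a' + d * c') (c * b' + d * d')"
proof -
  let ?A = "mat2 a b c d" and ?B = "mat2 a' b' c' d'"
  have "(?A * ?B) $$ (i, j) = ?A $$ (i, 0) * ?B $$ (0, j) + ?A $$ (i, 1) * ?B $$ (1, j)" if "i < 2" "j < 2" for i j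
    using mult_mat_index[OF mat2_carrier mat2_carrier that, of a b c d a' b' c' d'] by (simp add: numeral_2_eq_2)
  then show ?thesis
    using mult_carrier_mat[OF mat2_carrier mat2_carrier] by (intro mat2_eqI) (simp_all del: index_mult_mat)
qed

lemma det_mat2: "det (mat2 a b c d) = a * d - b * c"
  by (simp add: det_2x2)

lemma mat2_in_SL: "mat2 a b c d \<in> carrier (SL 2) \<longleftrightarrow> a * d - b * c = 1"
  by (simp add: carrier_SL det_mat2)

lemma one_mat2: "1\<^sub>m 2 = mat2 1 0 0 1"
  by (rule mat2_eqI) auto

lemma SL2_cases:
  assumes "g \<in> carrier (SL 2)"
  obtains a b c d where "g = mat2 a b c d" "a * d - b * c = 1"
  using mat2_eta[OF SL_carrier_mat[OF assms]] assms mat2_in_SL by metis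

lemma inv_mat2:
  assumes "a * d - b * c = 1"
  shows "inv\<^bsub>SL 2\<^esub> (mat2 a b c d) = mat2 d (- b) (- c) a"
proof (rule group.inv_equality[OF group_SL])
  show "mat2 d (- b) (- c) a \<otimes>\<^bsub>SL 2\<^esub> mat2 a b c d = \<one>\<^bsub>SL 2\<^esub>"
    using assms by (simp add: mat2_mult one_mat2 algebra_simps)
qed (use assms in \<open>auto simp: mat2_in_SL algebra_simps\<close>)

definition dg :: "complex \<Rightarrow> complex mat" where "dg t = mat2 t 0 0 (inverse t)"
definition up :: "complex \<Rightarrow> complex mat" where "up z = mat2 1 z 0 1"
definition lo :: "complex \<Rightarrow> complex mat" where "lo z = mat2 1 0 z 1"

lemma dg_SL: "t \<noteq> 0 \<Longrightarrow> dg t \<in> carrier (SL 2)"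
  and up_SL: "up z \<in> carrier (SL 2)" and lo_SL: "lo z \<in> carrier (SL 2)"
  by (simp_all add: dg_def up_def lo_def mat2_in_SL)

lemma dg_mult: "t \<noteq> 0 \<Longrightarrow> s \<noteq> 0 \<Longrightarrow> dg (s * t) = dg s * dg t"
  by (simp add: dg_def mat2_mult)

text \<open>Conjugation by the torus multiplies a unipotent coordinate by the value of a root,
  \<open>t^2\<close> or its inverse. This is the source of the homogeneity in \<open>z\<close> used
  below.\<close>

lemma up_scale: "t \<noteq> 0 \<Longrightarrow> up (t\<^sup>2) = dg t * (up 1 * dg (inverse t))"
  and lo_scale: "t \<noteq> 0 \<Longrightarrow> lo (t\<^sup>2) = dg (inverse t) * (lo 1 * dg t)"
  by (simp_all add: dg_def up_def lo_def mat2_mult power2_eq_square)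

lemma powi_character_family:
  "character_family {t :: complex. t \<noteq> 0} (*) 1 (range (\<lambda>k :: int. \<lambda>t\<in>{t. t \<noteq> 0}. t powi k))"
proof
  fix \<chi> \<psi> assume "\<chi> \<in> range (\<lambda>k :: int. \<lambda>t\<in>{t :: complex. t \<noteq> 0}. t powi k)"
    "\<psi> \<in> range (\<lambda>k :: int. \<lambda>t\<in>{t :: complex. t \<noteq> 0}. t powi k)"
  then obtain k l where "\<chi> = (\<lambda>t\<in>{t :: complex. t \<noteq> 0}. t powi k)" "\<psi> = (\<lambda>t\<in>{t :: complex. t \<noteq> 0}. t powi l)"
    by blast
  then have "(\<lambda>t\<in>{t. t \<noteq> 0}. \<chi> t * \<psi> t) = (\<lambda>t\<in>{t. t \<noteq> 0}. t powi (k + l))"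
    by (auto simp: power_int_add intro!: restrict_ext)
  then show "(\<lambda>t\<in>{t. t \<noteq> 0}. \<chi> t * \<psi> t) \<in> range (\<lambda>k :: int. \<lambda>t\<in>{t. t \<noteq> 0}. t powi k)" by blast
next
  have "(\<lambda>t\<in>{t :: complex. t \<noteq> 0}. 1) = (\<lambda>t\<in>{t. t \<noteq> 0}. t powi 0)" by simp
  then show "(\<lambda>t\<in>{t :: complex. t \<noteq> 0}. 1) \<in> range (\<lambda>k :: int. \<lambda>t\<in>{t. t \<noteq> 0}. t powi k)" by blast
qed (auto simp: power_int_mult_distrib)

text \<open>\<open>P k\<close> projects to the weight-\<open>k\<close> space of the diagonal torus.
  \<open>K\<close> may contain integers with \<open>P k = 0\<close>, so highest weights are taken
  below as maxima over those \<open>k\<close> at which a component is nonzero.\<close>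

locale sl2_rep =
  fixes m :: nat and \<rho> :: "complex mat \<Rightarrow> complex mat" and K :: "int set" and P :: "int \<Rightarrow> complex mat"
  assumes rep: "rational_rep 2 m \<rho>" and finite_K: "finite K"
    and P_carrier: "P k \<in> carrier_mat m m"
    and RP: "t \<noteq> 0 \<Longrightarrow> k \<in> K \<Longrightarrow> \<rho> (dg t) * P k = (t powi k) \<cdot>\<^sub>m P k"
    and PR: "t \<noteq> 0 \<Longrightarrow> k \<in> K \<Longrightarrow> P k * \<rho> (dg t) = (t powi k) \<cdot>\<^sub>m P k"
    and sum_P: "i < m \<Longrightarrow> j < m \<Longrightarrow> (\<Sum>k\<in>K. P k $$ (i, j)) = 1\<^sub>m m $$ (i, j)"

lemma sl2_rep_exists:
  assumes "rational_rep 2 m \<rho>"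
  shows "\<exists>K P. sl2_rep m \<rho> K P"
proof -
  let ?X = "{t :: complex. t \<noteq> 0}"
  let ?\<chi> = "\<lambda>k :: int. \<lambda>t\<in>?X. t powi k"
  define C where "C = range ?\<chi>"
  interpret character_family ?X "(*)" 1 C unfolding C_def by (rule powi_character_family)
  have \<chi>: "?\<chi> k \<in> C" for k unfolding C_def by (rule rangeI[of ?\<chi> k])
  have id: "(\<lambda>t. t) \<in> span" by (rule span_cong[OF span_char[OF \<chi>[of 1]]]) simp
  have inv: "(\<lambda>t. inverse t) \<in> span" by (rule span_cong[OF span_char[OF \<chi>[of "-1"]]]) (simp add: power_int_minus)
  have entries: "(\<lambda>t. \<rho> (dg t) $$ (i, j)) \<in> span" if ij: "i < m" "j < m" for i j
  proof -
    obtain p where p: "p \<in> poly_functions 2" "\<And>g. g \<in> carrier (SL 2) \<Longrightarrow> \<rho> g $$ (i, j) = p g"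
      using rational_rep_regular[OF assms ij] unfolding regular_on_def by blast
    have "(\<lambda>t. p (dg t)) \<in> span"
      using p(1) unfolding poly_functions_def
    proof (induction rule: function_algebra.induct)
      case (gen f)
      then obtain i j where "i < 2" "j < 2" "f = (\<lambda>g. g $$ (i, j))" by blast
      moreover from this have "i = 0 \<or> i = Suc 0" "j = 0 \<or> j = Suc 0" by auto
      ultimately show ?case using id inv span_const[of 0] by (elim disjE) (simp_all add: dg_def)
    qed (simp_all add: span_const span_add span_mult)
    then show ?thesis by (rule span_cong) (use p(2) dg_SL in auto)
  qed
  obtain A P where A: "finite A" "A \<subseteq> C" and P: "\<And>\<chi>. P \<chi> \<in> carrier_mat m m"
    and RP: "\<And>x \<chi>. x \<in> ?X \<Longrightarrow> \<chi> \<in> A \<Longrightarrow> \<rho> (dg x) * P \<chi> = \<chi> x \<cdot>\<^sub>m P \<chi>"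
    and PR: "\<And>x \<chi>. x \<in> ?X \<Longrightarrow> \<chi> \<in> A \<Longrightarrow> P \<chi> * \<rho> (dg x) = \<chi> x \<cdot>\<^sub>m P \<chi>"
    and sum: "\<And>i j. i < m \<Longrightarrow> j < m \<Longrightarrow> (\<Sum>\<chi>\<in>A. P \<chi> $$ (i, j)) = 1\<^sub>m m $$ (i, j)"
  proof (rule weight_decomposition[where R = "\<lambda>t. \<rho> (dg t)" and m = m])
    show "\<rho> (dg 1) = 1\<^sub>m m" using rational_rep_one[OF assms] by (simp add: dg_def one_mat2)
  qed (use entries dg_SL dg_mult assms in \<open>auto simp: rational_rep_carrier rational_rep_mult\<close>)
  \<comment> \<open>Characters are relabelled by their exponents, which are told apart by evaluating
    at 2.\<close>
  have inj: "inj ?\<chi>"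
  proof (rule injI)
    fix k l assume "?\<chi> k = ?\<chi> l"
    then have "?\<chi> k 2 = ?\<chi> l 2" by simp
    then have "cmod (2 powi k) = cmod (2 powi l)" by simp
    then have "(2 :: real) powi k = 2 powi l" by (simp add: norm_power_int)
    then show "k = l" 
      using power_int_strict_increasing[of k l "2 :: real"] power_int_strict_increasing[of l k "2 :: real"]
      by (cases k l rule: linorder_cases) auto
  qed
  define K where "K = ?\<chi> -` A"
  have bij: "bij_betw ?\<chi> K A"
    using inj A(2) unfolding K_def C_def bij_betw_def inj_on_def by fast
  have "sl2_rep m \<rho> K (\<lambda>k. P (?\<chi> k))"
  proof
    show "finite K" using bij A(1) bij_betw_finite by blast
    show "(\<Sum>k\<in>K. P (?\<chi> k) $$ (i, j)) = 1\<^sub>m m $$ (i, j)" if "i < m" "j < m" for i j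
      using sum[OF that] sum.reindex_bij_betw[OF bij, of "\<lambda>\<chi>. P \<chi> $$ (i, j)"] by simp
  qed (use assms P RP PR in \<open>auto simp: K_def\<close>)
  then show ?thesis by blast
qed

text \<open>Every nonzero number is a square, so the scaling law determines \<open>f\<close> away
  from 0, and continuity excludes negative degrees and settles the value at 0. Passing to moduli
  avoids choosing a square root of \<open>z\<close> when \<open>e\<close> is odd.\<close>

lemma homogeneous_function:
  fixes f :: "complex \<Rightarrow> complex"
  assumes cont: "isCont f 0" and scale: "\<And>t. t \<noteq> 0 \<Longrightarrow> f (t\<^sup>2) = t powi e * f 1"
  shows "cmod (f z) = (if e < 0 then 0 else sqrt (cmod z) ^ nat e * cmod (f 1))"
proof -
  define s where "s l = complex_of_real (inverse (real (Suc l)))" for l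
  have "(\<lambda>l. complex_of_real (inverse (real (Suc l)))) \<longlonglongrightarrow> complex_of_real 0"
    by (rule tendsto_of_real[OF LIMSEQ_inverse_real_of_nat])
  then have s: "s \<longlonglongrightarrow> 0" unfolding s_def of_real_0 .
  have s0: "s l \<noteq> 0" for l by (simp add: s_def del: of_nat_Suc)
  have "(\<lambda>l. (s l)\<^sup>2) \<longlonglongrightarrow> 0\<^sup>2" using s by (rule tendsto_power)
  then have "(\<lambda>l. (s l)\<^sup>2) \<longlonglongrightarrow> 0" by simp
  then have lim: "(\<lambda>l. f ((s l)\<^sup>2)) \<longlonglongrightarrow> f 0" by (rule isCont_tendsto_compose[OF cont])
  show ?thesis
  proof (cases "e < 0")
    case True
    \<comment> \<open>In negative degree the constant \<open>f 1\<close> equals values of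
      \<open>f\<close> near 0 multiplied by a positive power of \<open>s l\<close>, and this product
      tends to 0.\<close>
    have "(\<lambda>l. s l ^ nat (- e) * f ((s l)\<^sup>2)) \<longlonglongrightarrow> 0 ^ nat (- e) * f 0"
      by (intro tendsto_mult tendsto_power s lim)
    moreover have "s l ^ nat (- e) * f ((s l)\<^sup>2) = f 1" for l
      using True s0[of l] by (simp add: scale power_int_def field_simps)
    moreover have "0 ^ nat (- e) = (0 :: complex)" using True by (simp add: zero_power)
    ultimately have "(\<lambda>l :: nat. f 1) \<longlonglongrightarrow> 0" by simp
    then have f1: "f 1 = 0" by (simp add: LIMSEQ_const_iff)
    then have "f ((s l)\<^sup>2) = 0" for l using scale[OF s0] by simp
    then have "f 0 = 0" using lim by (simp add: LIMSEQ_const_iff)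
    moreover have "f z = 0" if "z \<noteq> 0"
      using scale[of "csqrt z"] f1 that by simp
    ultimately show ?thesis using True by auto
  next
    case False
    show ?thesis
    proof (cases "z = 0")
      case True
      have "(\<lambda>l. s l ^ nat e * f 1) \<longlonglongrightarrow> 0 ^ nat e * f 1" by (intro tendsto_mult tendsto_power s tendsto_const)
      moreover have "s l ^ nat e * f 1 = f ((s l)\<^sup>2)" for l
        using False scale[OF s0] by (simp add: power_int_def)
      ultimately have "f 0 = 0 ^ nat e * f 1" using lim LIMSEQ_unique by simp
      then show ?thesis using True False by (simp add: norm_mult norm_power)
    next
      case z: False
      have "cmod (f z) = cmod (csqrt z) ^ nat e * cmod (f 1)"
        using scale[of "csqrt z"] z False by (simp add: norm_mult norm_power power_int_def)
      moreover have "cmod (csqrt z) = sqrt (cmod z)"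
        by (metis norm_ge_zero norm_power power2_csqrt real_sqrt_unique)
      ultimately show ?thesis using False by simp
    qed
  qed
qed

context sl2_rep
begin

lemma rho_carrier: "g \<in> carrier (SL 2) \<Longrightarrow> \<rho> g \<in> carrier_mat m m"
  using rational_rep_carrier[OF rep] .

lemma rho_vec: "g \<in> carrier (SL 2) \<Longrightarrow> u \<in> carrier_vec m \<Longrightarrow> \<rho> g *\<^sub>v u \<in> carrier_vec m"
  using mult_mat_vec_carrier[OF rho_carrier] .

lemma P_vec: "u \<in> carrier_vec m \<Longrightarrow> P k *\<^sub>v u \<in> carrier_vec m"
  using mult_mat_vec_carrier[OF P_carrier] .

lemma rho_mult: "g \<in> carrier (SL 2) \<Longrightarrow> h \<in> carrier (SL 2) \<Longrightarrow> u \<in> carrier_vec m \<Longrightarrow>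
    \<rho> (g * h) *\<^sub>v u = \<rho> g *\<^sub>v (\<rho> h *\<^sub>v u)"
  by (rule rational_rep_mult_vec[OF rep])

lemma rho_inv: "g \<in> carrier (SL 2) \<Longrightarrow> u \<in> carrier_vec m \<Longrightarrow> \<rho> (inv\<^bsub>SL 2\<^esub> g) *\<^sub>v (\<rho> g *\<^sub>v u) = u"
  using rho_mult[of "inv\<^bsub>SL 2\<^esub> g" g u] inv_SL[of g 2] rational_rep_one[OF rep] by simp

lemma rho_nonzero: "g \<in> carrier (SL 2) \<Longrightarrow> u \<in> carrier_vec m \<Longrightarrow> u \<noteq> 0\<^sub>v m \<Longrightarrow> \<rho> g *\<^sub>v u \<noteq> 0\<^sub>v m"
  using rho_inv[of g u] mult_mat_zero_vec[OF rho_carrier[OF inv_SL(1)[of g 2]]] by auto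

lemma sum_P_vec:
  assumes "u \<in> carrier_vec m" "i < m"
  shows "u $ i = (\<Sum>k\<in>K. (P k *\<^sub>v u) $ i)"
proof -
  have "(\<Sum>k\<in>K. (P k *\<^sub>v u) $ i) = (\<Sum>k\<in>K. \<Sum>j<m. P k $$ (i, j) * u $ j)"
    using mult_mat_vec_index[OF P_carrier assms] by simp
  also have "\<dots> = (\<Sum>j<m. 1\<^sub>m m $$ (i, j) * u $ j)"
    using sum_P[OF assms(2)] by (subst sum.swap) (simp add: sum_distrib_right[symmetric])
  also have "\<dots> = u $ i"
    using mult_mat_vec_index[OF one_carrier_mat assms] assms by simp
  finally show ?thesis by simp
qed

lemma P_zero_imp_zero:
  assumes "u \<in> carrier_vec m" "\<And>k. k \<in> K \<Longrightarrow> P k *\<^sub>v u = 0\<^sub>v m"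
  shows "u = 0\<^sub>v m"
  using assms sum_P_vec[OF assms(1)] by (intro eq_vecI) auto

lemma mat_sum_P:
  assumes M: "M \<in> carrier_mat m m" and u: "u \<in> carrier_vec m" and i: "i < m"
  shows "(M *\<^sub>v u) $ i = (\<Sum>k\<in>K. (M *\<^sub>v (P k *\<^sub>v u)) $ i)"
proof -
  have "(\<Sum>k\<in>K. (M *\<^sub>v (P k *\<^sub>v u)) $ i) = (\<Sum>k\<in>K. \<Sum>j<m. M $$ (i, j) * (P k *\<^sub>v u) $ j)"
    using mult_mat_vec_index[OF M P_vec[OF u] i] by simp
  also have "\<dots> = (\<Sum>j<m. M $$ (i, j) * u $ j)"
    using sum_P_vec[OF u] by (subst sum.swap) (simp add: sum_distrib_left[symmetric])
  finally show ?thesis using mult_mat_vec_index[OF M u i] by simp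
qed

lemma P_torus:
  assumes "t \<noteq> 0" "k \<in> K" "u \<in> carrier_vec m"
  shows "P k *\<^sub>v (\<rho> (dg t) *\<^sub>v u) = (t powi k) \<cdot>\<^sub>v (P k *\<^sub>v u)"
proof -
  have "P k *\<^sub>v (\<rho> (dg t) *\<^sub>v u) = (P k * \<rho> (dg t)) *\<^sub>v u"
    using assoc_mult_mat_vec[OF P_carrier rho_carrier[OF dg_SL[OF assms(1)]] assms(3)] by simp
  then show ?thesis using PR[OF assms(1,2)] P_carrier[of k] assms(3) by auto
qed

lemma torus_P:
  assumes "t \<noteq> 0" "k \<in> K" "u \<in> carrier_vec m"
  shows "\<rho> (dg t) *\<^sub>v (P k *\<^sub>v u) = (t powi k) \<cdot>\<^sub>v (P k *\<^sub>v u)"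
proof -
  have "\<rho> (dg t) *\<^sub>v (P k *\<^sub>v u) = (\<rho> (dg t) * P k) *\<^sub>v u"
    using assoc_mult_mat_vec[OF rho_carrier[OF dg_SL[OF assms(1)]] P_carrier assms(3)] by simp
  then show ?thesis using RP[OF assms(1,2)] P_carrier[of k] assms(3) by auto
qed

text \<open>Entries of a rational representation are polynomials in the entries of the group
  element, hence continuous along continuous curves.\<close>

lemma continuous_coordinate:
  assumes \<gamma>: "\<And>z. \<gamma> z \<in> carrier (SL 2)" "\<And>i j. i < 2 \<Longrightarrow> j < 2 \<Longrightarrow> continuous_on UNIV (\<lambda>z :: complex. \<gamma> z $$ (i, j))"
    and "M \<in> carrier_mat m m" "u \<in> carrier_vec m" "i < m"
  shows "isCont (\<lambda>z. (M *\<^sub>v (\<rho> (\<gamma> z) *\<^sub>v u)) $ i) x"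
proof -
  have entry: "continuous_on UNIV (\<lambda>z. \<rho> (\<gamma> z) $$ (k, j))" if kj: "k < m" "j < m" for k j
  proof -
    obtain p where p: "p \<in> poly_functions 2" "\<And>g. g \<in> carrier (SL 2) \<Longrightarrow> \<rho> g $$ (k, j) = p g"
      using rational_rep_regular[OF rep kj] unfolding regular_on_def by blast
    have "continuous_on UNIV (\<lambda>z. p (\<gamma> z))"
      using p(1) unfolding poly_functions_def
      by (induction rule: function_algebra.induct) (auto intro!: continuous_intros \<gamma>(2))
    then show ?thesis using p(2)[OF \<gamma>(1)] by simp
  qed
  have "continuous_on UNIV (\<lambda>z. \<Sum>k<m. M $$ (i, k) * (\<Sum>j<m. \<rho> (\<gamma> z) $$ (k, j) * u $ j))"
    by (intro continuous_intros entry) auto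
  moreover have "(M *\<^sub>v (\<rho> (\<gamma> z) *\<^sub>v u)) $ i = (\<Sum>k<m. M $$ (i, k) * (\<Sum>j<m. \<rho> (\<gamma> z) $$ (k, j) * u $ j))" for z
    using mult_mat_vec_index[OF assms(3) rho_vec[OF \<gamma>(1) assms(4)] assms(5)]
      mult_mat_vec_index[OF rho_carrier[OF \<gamma>(1)] assms(4)] by simp
  ultimately show ?thesis by (simp add: continuous_on_eq_continuous_at)
qed

section \<open>Homogeneity of unipotent elements between weight spaces\<close>

lemma up_entries_continuous: "i < 2 \<Longrightarrow> j < 2 \<Longrightarrow> continuous_on UNIV (\<lambda>z. up z $$ (i, j))"
  and lo_entries_continuous: "i < 2 \<Longrightarrow> j < 2 \<Longrightarrow> continuous_on UNIV (\<lambda>z. lo z $$ (i, j))"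
  by (cases "i = 0"; cases "j = 0"; simp add: up_def lo_def mat2_def)+

text \<open>In \<open>up (t^2) = dg t * up 1 * dg (1/t)\<close> the right torus factor acts on a
  vector of weight \<open>c\<close> by \<open>t powi (- c)\<close>, and the left one on the
  component of weight \<open>b\<close> by \<open>t powi b\<close>. So the block from
  \<open>c\<close> to \<open>b\<close> is homogeneous of degree \<open>b - c\<close> in the square
  root of \<open>z\<close>.\<close>

lemma up_homogeneous:
  assumes bc: "b \<in> K" "c \<in> K" and u: "u \<in> carrier_vec m" and i: "i < m"
  shows "cmod ((P b *\<^sub>v (\<rho> (up z) *\<^sub>v (P c *\<^sub>v u))) $ i) =
    (if b < c then 0 else sqrt (cmod z) ^ nat (b - c) * cmod ((P b *\<^sub>v (\<rho> (up 1) *\<^sub>v (P c *\<^sub>v u))) $ i))"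
proof -
  let ?f = "\<lambda>z. (P b *\<^sub>v (\<rho> (up z) *\<^sub>v (P c *\<^sub>v u))) $ i"
  have "cmod (?f z) = (if b - c < 0 then 0 else sqrt (cmod z) ^ nat (b - c) * cmod (?f 1))"
  proof (rule homogeneous_function)
    show "isCont ?f 0"
      using up_SL up_entries_continuous P_carrier P_vec[OF u] i by (rule continuous_coordinate)
    fix t :: complex assume t: "t \<noteq> 0"
    have d: "dg t \<in> carrier (SL 2)" "dg (inverse t) \<in> carrier (SL 2)" using t by (auto intro!: dg_SL)
    have "\<rho> (up (t\<^sup>2)) *\<^sub>v (P c *\<^sub>v u) = \<rho> (dg t) *\<^sub>v (\<rho> (up 1) *\<^sub>v (\<rho> (dg (inverse t)) *\<^sub>v (P c *\<^sub>v u)))"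
      using d up_SL u unfolding up_scale[OF t] by (simp add: rho_mult mult_in_SL P_vec)
    also have "\<rho> (dg (inverse t)) *\<^sub>v (P c *\<^sub>v u) = (inverse t powi c) \<cdot>\<^sub>v (P c *\<^sub>v u)"
      using t bc u by (intro torus_P) auto
    also have "\<rho> (up 1) *\<^sub>v \<dots> = (inverse t powi c) \<cdot>\<^sub>v (\<rho> (up 1) *\<^sub>v (P c *\<^sub>v u))"
      by (rule mult_mat_vec[OF rho_carrier[OF up_SL] P_vec[OF u]])
    also have "\<rho> (dg t) *\<^sub>v \<dots> = (inverse t powi c) \<cdot>\<^sub>v (\<rho> (dg t) *\<^sub>v (\<rho> (up 1) *\<^sub>v (P c *\<^sub>v u)))"
      by (rule mult_mat_vec[OF rho_carrier[OF d(1)] rho_vec[OF up_SL P_vec[OF u]]])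
    also have "P b *\<^sub>v \<dots> = (inverse t powi c) \<cdot>\<^sub>v (P b *\<^sub>v (\<rho> (dg t) *\<^sub>v (\<rho> (up 1) *\<^sub>v (P c *\<^sub>v u))))"
      by (rule mult_mat_vec[OF P_carrier rho_vec[OF d(1) rho_vec[OF up_SL P_vec[OF u]]]])
    also have "P b *\<^sub>v (\<rho> (dg t) *\<^sub>v (\<rho> (up 1) *\<^sub>v (P c *\<^sub>v u))) = (t powi b) \<cdot>\<^sub>v (P b *\<^sub>v (\<rho> (up 1) *\<^sub>v (P c *\<^sub>v u)))"
      by (rule P_torus[OF t bc(1) rho_vec[OF up_SL P_vec[OF u]]])
    finally show "?f (t\<^sup>2) = t powi (b - c) * ?f 1"
      using i P_carrier[of b] t by (simp add: power_int_diff power_int_inverse divide_inverse)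
  qed
  then show ?thesis by simp
qed

text \<open>The same scaling with the sign reversed: the degree is \<open>c - b\<close>, negative
  here, and no continuous function other than 0 has negative degree.\<close>

lemma lo_lowers:
  assumes bc: "b \<in> K" "c \<in> K" "c < b" and u: "u \<in> carrier_vec m"
  shows "P b *\<^sub>v (\<rho> (lo z) *\<^sub>v (P c *\<^sub>v u)) = 0\<^sub>v m"
proof (rule eq_vecI)
  fix i assume "i < dim_vec (0\<^sub>v m :: complex vec)"
  then have i: "i < m" by simp
  let ?f = "\<lambda>z. (P b *\<^sub>v (\<rho> (lo z) *\<^sub>v (P c *\<^sub>v u))) $ i"
  have "cmod (?f z) = (if c - b < 0 then 0 else sqrt (cmod z) ^ nat (c - b) * cmod (?f 1))"
  proof (rule homogeneous_function)
    show "isCont ?f 0"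
      using lo_SL lo_entries_continuous P_carrier P_vec[OF u] i by (rule continuous_coordinate)
    fix t :: complex assume t: "t \<noteq> 0"
    have d: "dg t \<in> carrier (SL 2)" "dg (inverse t) \<in> carrier (SL 2)" using t by (auto intro!: dg_SL)
    have "\<rho> (lo (t\<^sup>2)) *\<^sub>v (P c *\<^sub>v u) = \<rho> (dg (inverse t)) *\<^sub>v (\<rho> (lo 1) *\<^sub>v (\<rho> (dg t) *\<^sub>v (P c *\<^sub>v u)))"
      using d lo_SL u unfolding lo_scale[OF t] by (simp add: rho_mult mult_in_SL P_vec)
    also have "\<rho> (dg t) *\<^sub>v (P c *\<^sub>v u) = (t powi c) \<cdot>\<^sub>v (P c *\<^sub>v u)"
      using t bc u by (intro torus_P) auto
    also have "\<rho> (lo 1) *\<^sub>v \<dots> = (t powi c) \<cdot>\<^sub>v (\<rho> (lo 1) *\<^sub>v (P c *\<^sub>v u))"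
      by (rule mult_mat_vec[OF rho_carrier[OF lo_SL] P_vec[OF u]])
    also have "\<rho> (dg (inverse t)) *\<^sub>v \<dots> = (t powi c) \<cdot>\<^sub>v (\<rho> (dg (inverse t)) *\<^sub>v (\<rho> (lo 1) *\<^sub>v (P c *\<^sub>v u)))"
      by (rule mult_mat_vec[OF rho_carrier[OF d(2)] rho_vec[OF lo_SL P_vec[OF u]]])
    also have "P b *\<^sub>v \<dots> = (t powi c) \<cdot>\<^sub>v (P b *\<^sub>v (\<rho> (dg (inverse t)) *\<^sub>v (\<rho> (lo 1) *\<^sub>v (P c *\<^sub>v u))))"
      by (rule mult_mat_vec[OF P_carrier rho_vec[OF d(2) rho_vec[OF lo_SL P_vec[OF u]]]])
    also have "P b *\<^sub>v (\<rho> (dg (inverse t)) *\<^sub>v (\<rho> (lo 1) *\<^sub>v (P c *\<^sub>v u))) = (inverse t powi b) \<cdot>\<^sub>v (P b *\<^sub>v (\<rho> (lo 1) *\<^sub>v (P c *\<^sub>v u)))"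
      using t by (intro P_torus[OF _ bc(1) rho_vec[OF lo_SL P_vec[OF u]]]) simp
    finally show "?f (t\<^sup>2) = t powi (c - b) * ?f 1"
      using i P_carrier[of b] t by (simp add: power_int_diff power_int_inverse divide_inverse)
  qed
  then show "?f z = 0\<^sub>v m $ i" using bc(3) i by simp
qed (use P_carrier[of b] in auto)

text \<open>Big cell: \<open>g = lo y * dg a * up z\<close> when \<open>a = g $$ (0, 0) \<noteq> 0\<close>.\<close>

lemma top_weight_invariant:
  assumes irr: "irreducible_rep 2 m \<rho>" and u: "u \<in> carrier_vec m" "u \<noteq> 0\<^sub>v m"
    and top: "\<And>k z. k \<in> K \<Longrightarrow> d < k \<Longrightarrow> P k *\<^sub>v (\<rho> (up z) *\<^sub>v u) = 0\<^sub>v m"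
    and k: "k \<in> K" "d < k" and x: "x \<in> carrier_vec m"
  shows "P k *\<^sub>v x = 0\<^sub>v m"
proof -
  \<comment> \<open>The vectors none of whose translates has a component above \<open>d\<close> form
    an invariant subspace. Once \<open>u\<close> is known to lie in it, irreducibility makes it the
    whole space, and \<open>g = 1\<close> gives the claim.\<close>
  let ?U = "{x \<in> carrier_vec m. \<forall>g\<in>carrier (SL 2). \<forall>k\<in>K. d < k \<longrightarrow> P k *\<^sub>v (\<rho> g *\<^sub>v x) = 0\<^sub>v m}"
  have cell: "P k *\<^sub>v (\<rho> g *\<^sub>v u) = 0\<^sub>v m" if g: "g \<in> carrier (SL 2)" "g $$ (0, 0) \<noteq> 0" and k: "k \<in> K" "d < k" for g k
  proof -
    obtain a b c e where abce: "g = mat2 a b c e" "a * e - b * c = 1" using SL2_cases[OF g(1)] .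
    have a: "a \<noteq> 0" using g(2) abce by simp
    have e: "e = (1 + b * c) / a" using abce(2) a by (simp add: field_simps)
    have dec: "g = lo (c / a) * (dg a * up (b / a))"
      using a by (simp add: abce(1) e lo_def dg_def up_def mat2_mult field_simps)
    have D: "dg a \<in> carrier (SL 2)" using a by (rule dg_SL)
    let ?y = "\<rho> (dg a) *\<^sub>v (\<rho> (up (b / a)) *\<^sub>v u)"
    have y: "?y \<in> carrier_vec m" using D up_SL u by (intro rho_vec)
    have yP: "P l *\<^sub>v ?y = 0\<^sub>v m" if "l \<in> K" "d < l" for l
      unfolding P_torus[OF a that(1) rho_vec[OF up_SL u(1)]] top[OF that] by auto
    have "\<rho> g *\<^sub>v u = \<rho> (lo (c / a)) *\<^sub>v ?y"
      unfolding dec using D up_SL lo_SL u by (simp add: rho_mult mult_in_SL)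
    moreover have "P k *\<^sub>v (\<rho> (lo (c / a)) *\<^sub>v ?y) = 0\<^sub>v m"
    proof (rule eq_vecI)
      fix i assume "i < dim_vec (0\<^sub>v m :: complex vec)"
      then have i: "i < m" by simp
      have M: "P k * \<rho> (lo (c / a)) \<in> carrier_mat m m" using P_carrier rho_carrier[OF lo_SL] by (rule mult_carrier_mat)
      have assoc: "(P k * \<rho> (lo (c / a))) *\<^sub>v x = P k *\<^sub>v (\<rho> (lo (c / a)) *\<^sub>v x)" if "x \<in> carrier_vec m" for x
        using P_carrier rho_carrier[OF lo_SL] that by (rule assoc_mult_mat_vec)
      have "(P k *\<^sub>v (\<rho> (lo (c / a)) *\<^sub>v ?y)) $ i = (\<Sum>l\<in>K. (P k *\<^sub>v (\<rho> (lo (c / a)) *\<^sub>v (P l *\<^sub>v ?y))) $ i)"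
        using mat_sum_P[OF M y i] assoc[OF y] assoc[OF P_vec[OF y]] by simp
      \<comment> \<open>A lower unipotent never raises weights: components of \<open>?y\<close>
        below \<open>k\<close> cannot reach \<open>k\<close>, and those at or above \<open>k\<close>
        are zero because \<open>d < k\<close>.\<close>
      also have "\<dots> = 0"
      proof (rule sum.neutral, rule ballI)
        fix l assume l: "l \<in> K"
        have "P k *\<^sub>v (\<rho> (lo (c / a)) *\<^sub>v (P l *\<^sub>v ?y)) = 0\<^sub>v m"
        proof (cases "l < k")
          case True
          then show ?thesis using k(1) l y by (intro lo_lowers)
        next
          case False
          then have "P l *\<^sub>v ?y = 0\<^sub>v m" using l k by (intro yP) auto
          then show ?thesis
            using mult_mat_zero_vec[OF rho_carrier[OF lo_SL, of "c / a"]] mult_mat_zero_vec[OF P_carrier[of k]] by simp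
        qed
        then show "(P k *\<^sub>v (\<rho> (lo (c / a)) *\<^sub>v (P l *\<^sub>v ?y))) $ i = 0" using i by simp
      qed
      finally show "(P k *\<^sub>v (\<rho> (lo (c / a)) *\<^sub>v ?y)) $ i = 0\<^sub>v m $ i" using i by simp
    qed (use P_carrier[of k] in auto)
    ultimately show ?thesis by simp
  qed
  have "P k *\<^sub>v (\<rho> g *\<^sub>v u) = 0\<^sub>v m" if g: "g \<in> carrier (SL 2)" and k: "k \<in> K" "d < k" for g k
  proof (cases "g $$ (0, 0) = 0")
    case True
    obtain a b c e where abce: "g = mat2 a b c e" "a * e - b * c = 1" using SL2_cases[OF g] .
    have a: "a = 0" using True abce by simp
    then have b: "b \<noteq> 0" using abce(2) by auto
    \<comment> \<open>Outside the big cell, \<open>g * lo z\<close> has the corner entry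
      \<open>b * z\<close>, so it lies in the cell for every nonzero \<open>z\<close>; continuity at
      0 recovers \<open>g\<close>.\<close>
    have gl: "g * lo z = mat2 (b * z) b (c + e * z) e" for z by (simp add: abce(1) a lo_def mat2_mult)
    have glS: "g * lo z \<in> carrier (SL 2)" for z using g lo_SL by (rule mult_in_SL)
    have cont: "continuous_on UNIV (\<lambda>z. (g * lo z) $$ (i, j))" if "i < 2" "j < 2" for i j
      unfolding gl using that by (cases "i = 0"; cases "j = 0") (auto simp: mat2_def intro!: continuous_intros)
    show ?thesis
    proof (rule eq_vecI)
      fix i assume "i < dim_vec (0\<^sub>v m :: complex vec)"
      then have i: "i < m" by simp
      let ?f = "\<lambda>z. (P k *\<^sub>v (\<rho> (g * lo z) *\<^sub>v u)) $ i"
      have "isCont ?f 0" using glS cont P_carrier u(1) i by (rule continuous_coordinate)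
      then have "?f \<midarrow>0\<rightarrow> ?f 0" by (simp add: isCont_def)
      moreover have "\<forall>\<^sub>F z in at 0. ?f z = 0"
        using cell[OF glS _ k] b i unfolding eventually_at_filter by (auto simp: gl intro!: always_eventually)
      ultimately have "?f 0 = 0" using LIM_unique[OF _ tendsto_eventually] by blast
      moreover have "g * lo 0 = g" using SL_carrier_mat[OF g] by (simp add: lo_def one_mat2[symmetric])
      ultimately show "(P k *\<^sub>v (\<rho> g *\<^sub>v u)) $ i = 0\<^sub>v m $ i" using i by simp
    qed (use P_carrier[of k] in auto)
  qed (use cell g k in blast)
  then have uU: "u \<in> ?U" using u by blast
  have inv: "\<rho> g *\<^sub>v x \<in> ?U" if g: "g \<in> carrier (SL 2)" and x: "x \<in> ?U" for g x
  proof -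
    have "\<rho> h *\<^sub>v (\<rho> g *\<^sub>v x) = \<rho> (h * g) *\<^sub>v x" if "h \<in> carrier (SL 2)" for h
      using that g x by (simp add: rho_mult)
    moreover have "h * g \<in> carrier (SL 2)" if "h \<in> carrier (SL 2)" for h using that g by (rule mult_in_SL)
    ultimately show ?thesis using x rho_vec[OF g] by auto
  qed
  have lin: "P k *\<^sub>v (\<rho> g *\<^sub>v (x + y)) = P k *\<^sub>v (\<rho> g *\<^sub>v x) + P k *\<^sub>v (\<rho> g *\<^sub>v y)"
      "P k *\<^sub>v (\<rho> g *\<^sub>v (c \<cdot>\<^sub>v x)) = c \<cdot>\<^sub>v (P k *\<^sub>v (\<rho> g *\<^sub>v x))"
    if "g \<in> carrier (SL 2)" "x \<in> carrier_vec m" "y \<in> carrier_vec m" for k g x y c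
    using that mult_add_distrib_mat_vec[OF rho_carrier[OF that(1)] that(2,3)] mult_add_distrib_mat_vec[OF P_carrier rho_vec[OF that(1,2)] rho_vec[OF that(1,3)]]
      mult_mat_vec[OF rho_carrier[OF that(1)] that(2)] mult_mat_vec[OF P_carrier rho_vec[OF that(1,2)]] by simp_all
  have zero: "P k *\<^sub>v (\<rho> g *\<^sub>v 0\<^sub>v m) = 0\<^sub>v m" if "g \<in> carrier (SL 2)" for k g
    using mult_mat_zero_vec[OF rho_carrier[OF that]] mult_mat_zero_vec[OF P_carrier[of k]] by simp
  have "VectorSpace.subspace class_ring ?U (module_vec TYPE(complex) m)"
    by (rule subspace_vecI) (use lin zero in auto)
  then have "?U = {0\<^sub>v m} \<or> ?U = carrier_vec m"
    using irr inv unfolding irreducible_rep_def by blast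
  then have "?U = carrier_vec m" using uU u(2) by blast
  then have "P k *\<^sub>v (\<rho> (1\<^sub>m 2) *\<^sub>v x) = 0\<^sub>v m" using x k one_in_SL[of 2] by blast
  then show ?thesis using rational_rep_one[OF rep] x by simp
qed

end

section \<open>Norm estimates for SL(2)\<close>

lemma vec_eq_zeroI: "x \<in> carrier_vec m \<Longrightarrow> (\<And>i. i < m \<Longrightarrow> x $ i = 0) \<Longrightarrow> x = 0\<^sub>v m"
  by (rule eq_vecI) auto

lemma cmod_le_vnorm: "x \<in> carrier_vec m \<Longrightarrow> i < m \<Longrightarrow> cmod (x $ i) \<le> vnorm x"
  unfolding vnorm_def by (intro member_le_sum) auto

lemma vnorm_le: "x \<in> carrier_vec m \<Longrightarrow> (\<And>i. i < m \<Longrightarrow> cmod (x $ i) \<le> B) \<Longrightarrow> vnorm x \<le> real m * B"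
  unfolding vnorm_def using sum_bounded_above[of "{..<m}" "\<lambda>i. cmod (x $ i)" B] by auto

lemma vnorm_smult: "x \<in> carrier_vec m \<Longrightarrow> vnorm (c \<cdot>\<^sub>v x) = cmod c * vnorm x"
  unfolding vnorm_def by (simp add: norm_mult sum_distrib_left)

lemma vnorm_mult_mat_vec:
  assumes A: "A \<in> carrier_mat m m" and u: "u \<in> carrier_vec m"
    and B: "\<And>i j. i < m \<Longrightarrow> j < m \<Longrightarrow> cmod (A $$ (i, j)) \<le> B"
  shows "vnorm (A *\<^sub>v u) \<le> real m * B * vnorm u"
proof -
  have "cmod ((A *\<^sub>v u) $ i) \<le> B * vnorm u" if i: "i < m" for i
  proof -
    have "cmod ((A *\<^sub>v u) $ i) \<le> (\<Sum>j<m. cmod (A $$ (i, j) * u $ j))"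
      unfolding mult_mat_vec_index[OF A u i] by (rule norm_sum)
    also have "\<dots> \<le> (\<Sum>j<m. B * cmod (u $ j))"
      using B[OF i] by (intro sum_mono) (auto simp: norm_mult intro!: mult_right_mono)
    also have "\<dots> = B * vnorm u" using u by (simp add: vnorm_def sum_distrib_left)
    finally show ?thesis .
  qed
  then show ?thesis using vnorm_le[OF mult_mat_vec_carrier[OF A u]] by (simp add: mult.assoc)
qed

lemma vnorm_mat_bound:
  assumes A: "A \<in> carrier_mat m m"
  obtains C where "0 \<le> C" "\<And>u. u \<in> carrier_vec m \<Longrightarrow> vnorm (A *\<^sub>v u) \<le> C * vnorm u"
proof
  let ?B = "\<Sum>i<m. \<Sum>j<m. cmod (A $$ (i, j))"
  show "0 \<le> real m * ?B" by (intro mult_nonneg_nonneg sum_nonneg) auto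
  fix u :: "complex vec" assume "u \<in> carrier_vec m"
  then show "vnorm (A *\<^sub>v u) \<le> real m * ?B * vnorm u"
  proof (rule vnorm_mult_mat_vec[OF A])
    fix i j assume ij: "i < m" "j < m"
    have "cmod (A $$ (i, j)) \<le> (\<Sum>j<m. cmod (A $$ (i, j)))" using ij by (intro member_le_sum) auto
    also have "\<dots> \<le> ?B" using ij by (intro member_le_sum[of i _ "\<lambda>i. \<Sum>j<m. cmod (A $$ (i, j))"]) (auto intro: sum_nonneg)
    finally show "cmod (A $$ (i, j)) \<le> ?B" .
  qed
qed

lemma poly_functions_bounded:
  assumes "p \<in> poly_functions n"
  shows "\<exists>B. \<forall>g. (\<forall>i<n. \<forall>j<n. cmod (g $$ (i, j)) \<le> 1) \<longrightarrow> cmod (p g) \<le> B"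
  using assms unfolding poly_functions_def
proof (induction rule: function_algebra.induct)
  case (add f g)
  then obtain B B' where B: "\<And>x. (\<forall>i<n. \<forall>j<n. cmod (x $$ (i, j)) \<le> 1) \<Longrightarrow> cmod (f x) \<le> B"
    "\<And>x. (\<forall>i<n. \<forall>j<n. cmod (x $$ (i, j)) \<le> 1) \<Longrightarrow> cmod (g x) \<le> B'" by blast
  show ?case by (rule exI[of _ "B + B'"]) (use B in \<open>blast intro: norm_triangle_mono\<close>)
next
  case (mult f g)
  then obtain B B' where B: "\<And>x. (\<forall>i<n. \<forall>j<n. cmod (x $$ (i, j)) \<le> 1) \<Longrightarrow> cmod (f x) \<le> B"
    "\<And>x. (\<forall>i<n. \<forall>j<n. cmod (x $$ (i, j)) \<le> 1) \<Longrightarrow> cmod (g x) \<le> B'" by blast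
  show ?case
  proof (intro exI[of _ "B * B'"] allI impI)
    fix x :: "complex mat" assume x: "\<forall>i<n. \<forall>j<n. cmod (x $$ (i, j)) \<le> 1"
    show "cmod (f x * g x) \<le> B * B'"
      unfolding norm_mult using B(1)[OF x] B(2)[OF x] by (intro mult_mono) (auto intro: order_trans[OF norm_ge_zero])
  qed
qed auto

context sl2_rep
begin

text \<open>Meant for the unitary factor of the Iwasawa decomposition and for its inverse, whose
  entries have modulus at most one.\<close>

lemma rho_compact_bound:
  obtains C where "0 \<le> C" "\<And>g u. g \<in> carrier (SL 2) \<Longrightarrow> (\<forall>i<2. \<forall>j<2. cmod (g $$ (i, j)) \<le> 1) \<Longrightarrow>
    u \<in> carrier_vec m \<Longrightarrow> vnorm (\<rho> g *\<^sub>v u) \<le> C * vnorm u"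
proof -
  have "\<exists>B. \<forall>g\<in>carrier (SL 2). (\<forall>i<2. \<forall>j<2. cmod (g $$ (i, j)) \<le> 1) \<longrightarrow> cmod (\<rho> g $$ (i, j)) \<le> B"
    if ij: "i < m" "j < m" for i j
  proof -
    obtain p where p: "p \<in> poly_functions 2" "\<And>g. g \<in> carrier (SL 2) \<Longrightarrow> \<rho> g $$ (i, j) = p g"
      using rational_rep_regular[OF rep ij] unfolding regular_on_def by blast
    obtain B where "\<forall>g. (\<forall>i<2. \<forall>j<2. cmod (g $$ (i, j)) \<le> 1) \<longrightarrow> cmod (p g) \<le> B"
      using poly_functions_bounded[OF p(1)] by blast
    then show ?thesis using p(2) by (intro exI[of _ B]) simp
  qed
  then obtain B where B: "\<And>i j g. i < m \<Longrightarrow> j < m \<Longrightarrow> g \<in> carrier (SL 2) \<Longrightarrow>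
      (\<forall>i<2. \<forall>j<2. cmod (g $$ (i, j)) \<le> 1) \<Longrightarrow> cmod (\<rho> g $$ (i, j)) \<le> B i j"
    by metis
  let ?B = "\<Sum>i<m. \<Sum>j<m. \<bar>B i j\<bar>"
  show thesis
  proof
    show "0 \<le> real m * ?B" by (intro mult_nonneg_nonneg sum_nonneg) auto
    fix g and u :: "complex vec" assume g: "g \<in> carrier (SL 2)" "\<forall>i<2. \<forall>j<2. cmod (g $$ (i, j)) \<le> 1" and u: "u \<in> carrier_vec m"
    show "vnorm (\<rho> g *\<^sub>v u) \<le> real m * ?B * vnorm u"
    proof (rule vnorm_mult_mat_vec[OF rho_carrier[OF g(1)] u])
      fix i j assume ij: "i < m" "j < m"
      have "cmod (\<rho> g $$ (i, j)) \<le> \<bar>B i j\<bar>" using B[OF ij g] by simp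
      also have "\<dots> \<le> (\<Sum>j<m. \<bar>B i j\<bar>)" using ij by (intro member_le_sum) auto
      also have "\<dots> \<le> ?B" using ij by (intro member_le_sum[of i _ "\<lambda>i. \<Sum>j<m. \<bar>B i j\<bar>"]) (auto intro: sum_nonneg)
      finally show "cmod (\<rho> g $$ (i, j)) \<le> ?B" .
    qed
  qed
qed

section \<open>Size of weight components along upper unipotents\<close>

lemma up_coordinate_sum:
  assumes "u \<in> carrier_vec m" "i < m"
  shows "(P b *\<^sub>v (\<rho> (up z) *\<^sub>v u)) $ i = (\<Sum>c\<in>K. (P b *\<^sub>v (\<rho> (up z) *\<^sub>v (P c *\<^sub>v u))) $ i)"
proof -
  have assoc: "(P b * \<rho> (up z)) *\<^sub>v x = P b *\<^sub>v (\<rho> (up z) *\<^sub>v x)" if "x \<in> carrier_vec m" for x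
    using P_carrier rho_carrier[OF up_SL] that by (rule assoc_mult_mat_vec)
  show ?thesis
    using mat_sum_P[OF mult_carrier_mat[OF P_carrier rho_carrier[OF up_SL]] assms, of b z]
    unfolding assoc[OF assms(1)] assoc[OF P_vec[OF assms(1)]] .
qed

text \<open>A component of weight \<open>c \<le> M\<close> reaches weight \<open>b\<close> with
  order \<open>b - c \<ge> b - M\<close> in the small quantity \<open>sqrt (cmod z)\<close>. For
  \<open>b \<le> M\<close> the exponent \<open>nat (b - M)\<close> is 0 and the claim is plain
  boundedness.\<close>

lemma up_upper_bound:
  assumes u: "u \<in> carrier_vec m" and M: "\<And>c. c \<in> K \<Longrightarrow> M < c \<Longrightarrow> P c *\<^sub>v u = 0\<^sub>v m"
  obtains B where "0 \<le> B" "\<And>b z i. b \<in> K \<Longrightarrow> cmod z \<le> 1 \<Longrightarrow> i < m \<Longrightarrow>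
    cmod ((P b *\<^sub>v (\<rho> (up z) *\<^sub>v u)) $ i) \<le> B * sqrt (cmod z) ^ nat (b - M)"
proof -
  define F where "F b c i = cmod ((P b *\<^sub>v (\<rho> (up 1) *\<^sub>v (P c *\<^sub>v u))) $ i)" for b c i
  define B where "B = (\<Sum>b\<in>K. \<Sum>i<m. \<Sum>c\<in>K. F b c i)"
  have F0: "0 \<le> F b c i" for b c i by (simp add: F_def)
  show thesis
  proof
    show "0 \<le> B" unfolding B_def by (intro sum_nonneg F0)
    fix b z i assume b: "b \<in> K" and z: "cmod z \<le> 1" and i: "i < m"
    let ?r = "sqrt (cmod z)"
    have r: "0 \<le> ?r" "?r \<le> 1" using z by auto
    have "cmod ((P b *\<^sub>v (\<rho> (up z) *\<^sub>v u)) $ i) \<le> (\<Sum>c\<in>K. cmod ((P b *\<^sub>v (\<rho> (up z) *\<^sub>v (P c *\<^sub>v u))) $ i))"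
      unfolding up_coordinate_sum[OF u i] by (rule norm_sum)
    also have "\<dots> \<le> (\<Sum>c\<in>K. F b c i * ?r ^ nat (b - M))"
    proof (rule sum_mono)
      fix c assume c: "c \<in> K"
      show "cmod ((P b *\<^sub>v (\<rho> (up z) *\<^sub>v (P c *\<^sub>v u))) $ i) \<le> F b c i * ?r ^ nat (b - M)"
      proof (cases "M < c \<or> b < c")
        case True
        then have "cmod ((P b *\<^sub>v (\<rho> (up z) *\<^sub>v (P c *\<^sub>v u))) $ i) = 0"
        proof
          assume "M < c"
          then show ?thesis
            using M[OF c] mult_mat_zero_vec[OF rho_carrier[OF up_SL[of z]]] mult_mat_zero_vec[OF P_carrier[of b]] i by simp
        qed (use up_homogeneous[OF b c u i, of z] in simp)
        then show ?thesis using F0 r by simp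
      next
        case False
        then have "?r ^ nat (b - c) \<le> ?r ^ nat (b - M)" using r by (intro power_decreasing) auto
        then show ?thesis
          using False up_homogeneous[OF b c u i, of z] F0[of b c i] by (simp add: F_def mult.commute mult_right_mono)
      qed
    qed
    also have "\<dots> = (\<Sum>c\<in>K. F b c i) * ?r ^ nat (b - M)" by (simp add: sum_distrib_right)
    also have "\<dots> \<le> B * ?r ^ nat (b - M)"
    proof (rule mult_right_mono)
      have "(\<Sum>c\<in>K. F b c i) \<le> (\<Sum>i<m. \<Sum>c\<in>K. F b c i)"
        using i by (intro member_le_sum[of i _ "\<lambda>i. \<Sum>c\<in>K. F b c i"] sum_nonneg F0) auto
      also have "\<dots> \<le> B" unfolding B_def
        using b finite_K by (intro member_le_sum[of b _ "\<lambda>b. \<Sum>i<m. \<Sum>c\<in>K. F b c i"] sum_nonneg F0) auto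
      finally show "(\<Sum>c\<in>K. F b c i) \<le> B" .
    qed (use r in simp)
    finally show "cmod ((P b *\<^sub>v (\<rho> (up z) *\<^sub>v u)) $ i) \<le> B * ?r ^ nat (b - M)" .
  qed
qed

text \<open>The component of weight \<open>M\<close> contributes the term of lowest order. Weights
  are integers, so every other term has at least one further factor \<open>sqrt (cmod z)\<close>,
  and near 0 these terms cancel at most half of the leading one.\<close>

lemma up_lower_bound:
  assumes u: "u \<in> carrier_vec m" and M: "\<And>c. c \<in> K \<Longrightarrow> M < c \<Longrightarrow> P c *\<^sub>v u = 0\<^sub>v m" "M \<in> K"
    and b: "b \<in> K" "M \<le> b" and nz: "P b *\<^sub>v (\<rho> (up 1) *\<^sub>v (P M *\<^sub>v u)) \<noteq> 0\<^sub>v m"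
  obtains \<delta> \<kappa> where "0 < \<delta>" "0 < \<kappa>" "\<And>z. cmod z < \<delta> \<Longrightarrow>
    \<kappa> * sqrt (cmod z) ^ nat (b - M) \<le> vnorm (P b *\<^sub>v (\<rho> (up z) *\<^sub>v u))"
proof -
  let ?x = "P b *\<^sub>v (\<rho> (up 1) *\<^sub>v (P M *\<^sub>v u))"
  have xc: "?x \<in> carrier_vec m" by (intro P_vec rho_vec up_SL u)
  have "\<exists>i<m. ?x $ i \<noteq> 0"
  proof (rule ccontr)
    assume "\<not> ?thesis"
    then have "?x = 0\<^sub>v m" using xc by (intro vec_eq_zeroI) auto
    with nz show False ..
  qed
  then obtain i where i: "i < m" "?x $ i \<noteq> 0" by blast
  define F where "F c = cmod ((P b *\<^sub>v (\<rho> (up 1) *\<^sub>v (P c *\<^sub>v u))) $ i)" for c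
  have F0: "0 \<le> F c" for c by (simp add: F_def)
  have FM: "0 < F M" using i by (simp add: F_def)
  define S where "S = (\<Sum>c\<in>K - {M}. F c)"
  have S0: "0 \<le> S" unfolding S_def by (intro sum_nonneg F0)
  \<comment> \<open>For \<open>sqrt (cmod z) \<le> \<eta>\<close> the remaining terms add up to at
    most half of the leading one; \<open>S + 1\<close> keeps the quotient meaningful when
    \<open>S = 0\<close>. The radius in \<open>z\<close> is accordingly
    \<open>\<eta>\<^sup>2\<close>.\<close>
  define \<eta> where "\<eta> = min 1 (F M / (2 * (S + 1)))"
  have \<eta>: "0 < \<eta>" "\<eta> \<le> 1" "\<eta> * S \<le> F M / 2"
  proof -
    show "0 < \<eta>" "\<eta> \<le> 1" using FM S0 by (auto simp: \<eta>_def)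
    have "\<eta> * S \<le> F M / (2 * (S + 1)) * (S + 1)" using FM S0 by (intro mult_mono) (auto simp: \<eta>_def)
    also have "\<dots> = F M / 2" using S0 by (simp add: field_simps)
    finally show "\<eta> * S \<le> F M / 2" .
  qed
  show thesis
  proof
    show "0 < \<eta>\<^sup>2" "0 < F M / 2" using \<eta> FM by auto
    fix z assume z: "cmod z < \<eta>\<^sup>2"
    let ?r = "sqrt (cmod z)" and ?N = "nat (b - M)"
    have r: "0 \<le> ?r" "?r \<le> \<eta>" "?r \<le> 1"
    proof -
      show "0 \<le> ?r" by simp
      show "?r \<le> \<eta>" using z \<eta> by (intro real_le_lsqrt) auto
      then show "?r \<le> 1" using \<eta>(2) by (rule order_trans)
    qed
    let ?f = "\<lambda>c. (P b *\<^sub>v (\<rho> (up z) *\<^sub>v (P c *\<^sub>v u))) $ i"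
    have "(P b *\<^sub>v (\<rho> (up z) *\<^sub>v u)) $ i = ?f M + (\<Sum>c\<in>K - {M}. ?f c)"
      unfolding up_coordinate_sum[OF u i(1)] using finite_K M(2) by (rule sum.remove)
    moreover have "cmod (\<Sum>c\<in>K - {M}. ?f c) \<le> ?r ^ ?N * (F M / 2)"
    proof -
      have "cmod (\<Sum>c\<in>K - {M}. ?f c) \<le> (\<Sum>c\<in>K - {M}. ?r ^ Suc ?N * F c)"
      proof (rule sum_norm_le)
        fix c assume c: "c \<in> K - {M}"
        show "cmod (?f c) \<le> ?r ^ Suc ?N * F c"
        proof (cases "M < c")
          case True
          then show ?thesis
            using M(1)[of c] c mult_mat_zero_vec[OF rho_carrier[OF up_SL[of z]]] mult_mat_zero_vec[OF P_carrier[of b]] i F0 r by simp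
        next
          case False
          then have "?r ^ nat (b - c) \<le> ?r ^ Suc ?N" using r c b by (intro power_decreasing) auto
          then show ?thesis
            using False up_homogeneous[OF b(1) _ u i(1), of c z] c F0[of c] b(2) by (simp add: F_def mult_right_mono)
        qed
      qed
      also have "\<dots> = ?r ^ ?N * (?r * S)" by (simp add: S_def sum_distrib_left mult.assoc mult.left_commute)
      also have "\<dots> \<le> ?r ^ ?N * (F M / 2)"
        using r S0 \<eta>(3) by (intro mult_left_mono order_trans[OF mult_right_mono[of ?r \<eta> S]]) auto
      finally show ?thesis .
    qed
    moreover have "cmod (?f M) = ?r ^ ?N * F M"
      using up_homogeneous[OF b(1) M(2) u i(1), of z] b(2) by (simp add: F_def)
    ultimately have "?r ^ ?N * F M - ?r ^ ?N * (F M / 2) \<le> cmod ((P b *\<^sub>v (\<rho> (up z) *\<^sub>v u)) $ i)"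
      by (smt (verit) norm_diff_ineq)
    also have "\<dots> \<le> vnorm (P b *\<^sub>v (\<rho> (up z) *\<^sub>v u))"
      by (intro cmod_le_vnorm[OF P_vec[OF rho_vec[OF up_SL u]] i(1)])
    finally show "F M / 2 * ?r ^ ?N \<le> vnorm (P b *\<^sub>v (\<rho> (up z) *\<^sub>v u))" by (simp add: algebra_simps)
  qed
qed

text \<open>At \<open>z = 0\<close>, where \<open>up z\<close> is the identity, the blocks from
  \<open>M\<close> to other weights vanish by homogeneity, while the block from \<open>M\<close> to
  \<open>M\<close> has modulus independent of \<open>z\<close>. If it vanished at 1, nothing of
  \<open>P M *\<^sub>v u\<close> would remain.\<close>

lemma up_leading_nonzero:
  assumes u: "u \<in> carrier_vec m" and M: "M \<in> K" "P M *\<^sub>v u \<noteq> 0\<^sub>v m"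
  shows "P M *\<^sub>v (\<rho> (up 1) *\<^sub>v (P M *\<^sub>v u)) \<noteq> 0\<^sub>v m"
proof
  assume 0: "P M *\<^sub>v (\<rho> (up 1) *\<^sub>v (P M *\<^sub>v u)) = 0\<^sub>v m"
  have id: "\<rho> (up 0) *\<^sub>v x = x" if "x \<in> carrier_vec m" for x
    using that rational_rep_one[OF rep] by (simp add: up_def one_mat2[symmetric])
  have "(P b *\<^sub>v (P M *\<^sub>v u)) $ i = 0" if "b \<in> K" "i < m" for b i
    using up_homogeneous[OF that(1) M(1) u that(2), of 0] id[OF P_vec[OF u]] 0 that
    by (cases "b = M") (auto split: if_splits simp: zero_power)
  then have "(P M *\<^sub>v u) $ i = 0" if "i < m" for i
    using sum_P_vec[OF P_vec[OF u] that] that by simp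
  then have "P M *\<^sub>v u = 0\<^sub>v m" by (rule vec_eq_zeroI[OF P_vec[OF u]])
  with M(2) show False ..
qed

lemma torus_coordinate:
  assumes "0 < s" "b \<in> K" "u \<in> carrier_vec m" "g \<in> carrier (SL 2)"
  shows "P b *\<^sub>v (\<rho> (dg (complex_of_real s) * g) *\<^sub>v u) = (of_real s powi b) \<cdot>\<^sub>v (P b *\<^sub>v (\<rho> g *\<^sub>v u))"
  using assms dg_SL[of "of_real s"] P_torus[of "of_real s" b "\<rho> g *\<^sub>v u"] rho_vec by (simp add: rho_mult)

end

text \<open>The comparison of highest weights that numerical semistability provides for all conjugates of
  the diagonal torus.\<close>

definition dominated ::
  "(complex mat \<Rightarrow> complex mat) \<Rightarrow> int set \<Rightarrow> (int \<Rightarrow> complex mat) \<Rightarrow> nat \<Rightarrow> complex vec \<Rightarrow>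
   (complex mat \<Rightarrow> complex mat) \<Rightarrow> int set \<Rightarrow> (int \<Rightarrow> complex mat) \<Rightarrow> nat \<Rightarrow> complex vec \<Rightarrow> bool" where
  "dominated \<rho> K P m v \<sigma> L Q k w \<longleftrightarrow>
     (\<forall>g\<in>carrier (SL 2). \<forall>b\<in>K. P b *\<^sub>v (\<rho> g *\<^sub>v v) \<noteq> 0\<^sub>v m \<longrightarrow>
        (\<exists>l\<in>L. b \<le> l \<and> Q l *\<^sub>v (\<sigma> g *\<^sub>v w) \<noteq> 0\<^sub>v k))"

lemma dominated_translate:
  assumes "sl2_rep m \<rho> K P" "sl2_rep k \<sigma> L Q" "v \<in> carrier_vec m" "w \<in> carrier_vec k"
    "dominated \<rho> K P m v \<sigma> L Q k w" "h \<in> carrier (SL 2)"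
  shows "dominated \<rho> K P m (\<rho> h *\<^sub>v v) \<sigma> L Q k (\<sigma> h *\<^sub>v w)"
  unfolding dominated_def
proof
  fix g assume g: "g \<in> carrier (SL 2)"
  show "\<forall>b\<in>K. P b *\<^sub>v (\<rho> g *\<^sub>v (\<rho> h *\<^sub>v v)) \<noteq> 0\<^sub>v m \<longrightarrow>
        (\<exists>l\<in>L. b \<le> l \<and> Q l *\<^sub>v (\<sigma> g *\<^sub>v (\<sigma> h *\<^sub>v w)) \<noteq> 0\<^sub>v k)"
    using assms(5) mult_in_SL[OF g assms(6)]
    unfolding dominated_def sl2_rep.rho_mult[OF assms(1) g assms(6,3), symmetric]
      sl2_rep.rho_mult[OF assms(2) g assms(6,4), symmetric] by blast
qed

text \<open>Lets the two weights \<open>M\<close> and \<open>d\<close> bound all weights between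
  them, whether \<open>s * r\<close> is small or large.\<close>

lemma power_le_one_add_power:
  fixes x :: real
  assumes "0 \<le> x" "a \<le> n"
  shows "x ^ a \<le> 1 + x ^ n"
proof (cases "x \<le> 1")
  case True
  then have "x ^ a \<le> 1" using assms by (simp add: power_le_one)
  then show ?thesis using assms by (simp add: add_increasing2)
next
  case False
  then have "x ^ a \<le> x ^ n" using assms by (intro power_increasing) auto
  then show ?thesis by simp
qed

text \<open>The quantity \<open>E\<close> adds up two lower bounds for the translate of
  \<open>w\<close>, coming from its components of weights \<open>M\<close> and \<open>d\<close>. A
  component of \<open>v\<close> of weight \<open>b\<close> between them is at most a constant times
  \<open>s powi M * (s * r) ^ nat (b - M)\<close>, an intermediate power. Below \<open>M\<close> the
  inequality \<open>1 \<le> s\<close> is enough, and above \<open>d\<close> domination leaves no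
  component.\<close>

lemma local_bound:
  assumes V: "sl2_rep m \<rho> K P" and W: "sl2_rep k \<sigma> L Q" and irr: "irreducible_rep 2 k \<sigma>"
    and v: "v \<in> carrier_vec m" and w: "w \<in> carrier_vec k" "w \<noteq> 0\<^sub>v k"
    and dom: "dominated \<rho> K P m v \<sigma> L Q k w"
  shows "\<exists>\<delta>>0. \<exists>B\<ge>0. \<forall>z s. cmod z < \<delta> \<longrightarrow> 1 \<le> s \<longrightarrow>
    vnorm (\<rho> (dg (complex_of_real s) * up z) *\<^sub>v v) \<le> B * vnorm (\<sigma> (dg (complex_of_real s) * up z) *\<^sub>v w)"
proof -
  interpret V: sl2_rep m \<rho> K P by (rule V)
  interpret W: sl2_rep k \<sigma> L Q by (rule W)
  define M where "M = Max {l \<in> L. Q l *\<^sub>v w \<noteq> 0\<^sub>v k}"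
  define d where "d = Max {l \<in> L. \<exists>x\<in>carrier_vec k. Q l *\<^sub>v x \<noteq> 0\<^sub>v k}"
  have fin: "finite {l \<in> L. Q l *\<^sub>v w \<noteq> 0\<^sub>v k}" "finite {l \<in> L. \<exists>x\<in>carrier_vec k. Q l *\<^sub>v x \<noteq> 0\<^sub>v k}"
    using W.finite_K by auto
  have ne: "{l \<in> L. Q l *\<^sub>v w \<noteq> 0\<^sub>v k} \<noteq> {}" using W.P_zero_imp_zero[OF w(1)] w(2) by blast
  then have ne': "{l \<in> L. \<exists>x\<in>carrier_vec k. Q l *\<^sub>v x \<noteq> 0\<^sub>v k} \<noteq> {}" using w(1) by blast
  have M: "M \<in> L" "Q M *\<^sub>v w \<noteq> 0\<^sub>v k" using Max_in[OF fin(1) ne] by (auto simp: M_def)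
  have Mtop: "Q l *\<^sub>v w = 0\<^sub>v k" if "l \<in> L" "M < l" for l
    using Max_ge[OF fin(1), of l] that by (fastforce simp: M_def)
  have d: "d \<in> L" "\<exists>x\<in>carrier_vec k. Q d *\<^sub>v x \<noteq> 0\<^sub>v k" using Max_in[OF fin(2) ne'] by (auto simp: d_def)
  have dtop: "Q l *\<^sub>v x = 0\<^sub>v k" if "l \<in> L" "d < l" "x \<in> carrier_vec k" for l x
    using Max_ge[OF fin(2), of l] that by (fastforce simp: d_def)
  have Md: "M \<le> d" using dtop[OF M(1) _ w(1)] M(2) by force
  \<comment> \<open>Irreducibility enters here. If this block vanished, no \<open>up z\<close> could
    carry the component of weight \<open>M\<close> to weight \<open>d\<close>. Since weights are
    integers, \<open>d\<close> lies above the bound \<open>d - 1\<close>, and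
    \<open>top_weight_invariant\<close> would remove weight \<open>d\<close> from the whole
    representation.\<close>
  have nzd: "Q d *\<^sub>v (\<sigma> (up 1) *\<^sub>v (Q M *\<^sub>v w)) \<noteq> 0\<^sub>v k"
  proof
    assume 0: "Q d *\<^sub>v (\<sigma> (up 1) *\<^sub>v (Q M *\<^sub>v w)) = 0\<^sub>v k"
    have "Q l *\<^sub>v (\<sigma> (up z) *\<^sub>v (Q M *\<^sub>v w)) = 0\<^sub>v k" if l: "l \<in> L" "d - 1 < l" for l z
    proof (cases "l = d")
      case True
      show ?thesis
      proof (rule eq_vecI)
        fix i assume "i < dim_vec (0\<^sub>v k :: complex vec)"
        then show "(Q l *\<^sub>v (\<sigma> (up z) *\<^sub>v (Q M *\<^sub>v w))) $ i = 0\<^sub>v k $ i"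
          using W.up_homogeneous[OF l(1) M(1) w(1), of i z] 0 True by (auto split: if_splits)
      qed (use W.P_carrier[of l] in auto)
    next
      case False
      then show ?thesis using l by (intro dtop W.rho_vec up_SL W.P_vec w(1)) auto
    qed
    then have "Q d *\<^sub>v x = 0\<^sub>v k" if "x \<in> carrier_vec k" for x
      using W.top_weight_invariant[OF irr W.P_vec[OF w(1)] M(2), of "d - 1" d x] d(1) that by auto
    then show False using d(2) by blast
  qed
  \<comment> \<open>Domination at the identity compares \<open>v\<close> with \<open>w\<close>
    itself. Domination at \<open>up z\<close>, in the next statement, compares it with all weights
    of the target.\<close>
  have vM: "P c *\<^sub>v v = 0\<^sub>v m" if c: "c \<in> K" "M < c" for c
  proof (rule ccontr)
    assume "P c *\<^sub>v v \<noteq> 0\<^sub>v m"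
    then have "P c *\<^sub>v (\<rho> (1\<^sub>m 2) *\<^sub>v v) \<noteq> 0\<^sub>v m" using rational_rep_one[OF V.rep] v by simp
    then obtain l where l: "l \<in> L" "c \<le> l" "Q l *\<^sub>v (\<sigma> (1\<^sub>m 2) *\<^sub>v w) \<noteq> 0\<^sub>v k"
      using dom c one_in_SL[of 2] unfolding dominated_def by blast
    then show False using Mtop[of l] c rational_rep_one[OF W.rep] w by simp
  qed
  have vd: "P b *\<^sub>v (\<rho> (up z) *\<^sub>v v) = 0\<^sub>v m" if b: "b \<in> K" "d < b" for b z
  proof (rule ccontr)
    assume "P b *\<^sub>v (\<rho> (up z) *\<^sub>v v) \<noteq> 0\<^sub>v m"
    then obtain l where l: "l \<in> L" "b \<le> l" "Q l *\<^sub>v (\<sigma> (up z) *\<^sub>v w) \<noteq> 0\<^sub>v k"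
      using dom b up_SL[of z] unfolding dominated_def by blast
    then show False using dtop[of l "\<sigma> (up z) *\<^sub>v w"] b W.rho_vec[OF up_SL w(1)] by simp
  qed
  obtain B where B: "0 \<le> B" "\<And>b z i. b \<in> K \<Longrightarrow> cmod z \<le> 1 \<Longrightarrow> i < m \<Longrightarrow>
    cmod ((P b *\<^sub>v (\<rho> (up z) *\<^sub>v v)) $ i) \<le> B * sqrt (cmod z) ^ nat (b - M)"
    using V.up_upper_bound[OF v vM] by blast
  obtain \<delta>1 \<kappa>1 where 1: "0 < \<delta>1" "0 < \<kappa>1" "\<And>z. cmod z < \<delta>1 \<Longrightarrow>
    \<kappa>1 * sqrt (cmod z) ^ nat (M - M) \<le> vnorm (Q M *\<^sub>v (\<sigma> (up z) *\<^sub>v w))"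
    using W.up_lower_bound[OF w(1) Mtop M(1) M(1) order_refl W.up_leading_nonzero[OF w(1) M]] by blast
  obtain \<delta>2 \<kappa>2 where 2: "0 < \<delta>2" "0 < \<kappa>2" "\<And>z. cmod z < \<delta>2 \<Longrightarrow>
    \<kappa>2 * sqrt (cmod z) ^ nat (d - M) \<le> vnorm (Q d *\<^sub>v (\<sigma> (up z) *\<^sub>v w))"
    using W.up_lower_bound[OF w(1) Mtop M(1) d(1) Md nzd] by blast
  obtain C1 where C1: "0 \<le> C1" "\<And>u. u \<in> carrier_vec k \<Longrightarrow> vnorm (Q M *\<^sub>v u) \<le> C1 * vnorm u"
    using vnorm_mat_bound[OF W.P_carrier] by blast
  obtain C2 where C2: "0 \<le> C2" "\<And>u. u \<in> carrier_vec k \<Longrightarrow> vnorm (Q d *\<^sub>v u) \<le> C2 * vnorm u"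
    using vnorm_mat_bound[OF W.P_carrier] by blast
  let ?A = "real m * (real (card K) * B)" and ?D = "C1 / \<kappa>1 + C2 / \<kappa>2"
  have "vnorm (\<rho> (dg (complex_of_real s) * up z) *\<^sub>v v) \<le> ?A * ?D * vnorm (\<sigma> (dg (complex_of_real s) * up z) *\<^sub>v w)"
    if z: "cmod z < min 1 (min \<delta>1 \<delta>2)" and s: "1 \<le> s" for z s
  proof -
    define r where "r = sqrt (cmod z)"
    define N where "N = nat (d - M)"
    define E where "E = s powi M + s powi d * r ^ N"
    have r: "0 \<le> r" by (simp add: r_def)
    have s0: "0 < s" using s by simp
    have shift: "s powi b = s powi M * s ^ nat (b - M)" if "M \<le> b" for b
      using s0 that power_int_add[of s M "b - M"] by (simp add: power_int_def)
    have E: "E = s powi M * (1 + (s * r) ^ N)"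
      unfolding E_def shift[OF Md] N_def[symmetric] by (simp add: power_mult_distrib algebra_simps)
    have G: "dg (complex_of_real s) * up z \<in> carrier (SL 2)"
      using s0 by (intro mult_in_SL dg_SL up_SL) simp
    let ?x = "\<rho> (dg (complex_of_real s) * up z) *\<^sub>v v" and ?y = "\<sigma> (dg (complex_of_real s) * up z) *\<^sub>v w"
    have x: "?x \<in> carrier_vec m" and y: "?y \<in> carrier_vec k"
      using V.rho_vec[OF G v] W.rho_vec[OF G w(1)] by auto
    have "vnorm ?x \<le> real m * (real (card K) * (B * E))"
    proof (rule vnorm_le[OF x])
      fix i assume i: "i < m"
      have "cmod (?x $ i) \<le> (\<Sum>b\<in>K. cmod ((P b *\<^sub>v ?x) $ i))"
        unfolding V.sum_P_vec[OF x i] by (rule norm_sum)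
      also have "\<dots> \<le> real (card K) * (B * E)"
      proof (rule sum_bounded_above)
        fix b assume b: "b \<in> K"
        have e: "cmod ((P b *\<^sub>v ?x) $ i) = s powi b * cmod ((P b *\<^sub>v (\<rho> (up z) *\<^sub>v v)) $ i)"
          unfolding V.torus_coordinate[OF s0 b v up_SL] using V.P_carrier[of b] i s0
          by (simp add: norm_mult norm_power_int)
        show "cmod ((P b *\<^sub>v ?x) $ i) \<le> B * E"
        proof (cases "d < b")
          case True
          then show ?thesis unfolding e vd[OF b True] using i B(1) E r s0 by simp
        next
          case False
          have "s powi b * r ^ nat (b - M) \<le> E"
          proof (cases "b \<le> M")
            case True
            then have "s powi b * r ^ nat (b - M) = s powi b" by simp
            also have "\<dots> \<le> s powi M" using True s by (intro power_int_increasing) auto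
            also have "\<dots> \<le> E" using r s0 by (simp add: E_def)
            finally show ?thesis .
          next
            case b: False
            then have "M \<le> b" by simp
            then have "s powi b * r ^ nat (b - M) = s powi M * (s * r) ^ nat (b - M)"
              using shift[of b] by (simp add: power_mult_distrib)
            also have "\<dots> \<le> s powi M * (1 + (s * r) ^ N)"
              using s0 r False by (intro mult_left_mono power_le_one_add_power) (auto simp: N_def)
            finally show ?thesis by (simp add: E)
          qed
          then have "B * (s powi b * r ^ nat (b - M)) \<le> B * E" using B(1) by (rule mult_left_mono)
          moreover have "s powi b * cmod ((P b *\<^sub>v (\<rho> (up z) *\<^sub>v v)) $ i) \<le> s powi b * (B * r ^ nat (b - M))"
            using B(2)[OF b _ i, of z] z s0 by (intro mult_left_mono) (auto simp: r_def)
          ultimately show ?thesis unfolding e by (simp add: algebra_simps)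
        qed
      qed
      finally show "cmod (?x $ i) \<le> real (card K) * (B * E)" .
    qed
    then have upper: "vnorm ?x \<le> ?A * E" by (simp add: mult.assoc)
    have low: "s powi b * vnorm (Q b *\<^sub>v (\<sigma> (up z) *\<^sub>v w)) = vnorm (Q b *\<^sub>v ?y)" if "b \<in> L" for b
      unfolding W.torus_coordinate[OF s0 that w(1) up_SL]
      using s0 by (simp add: vnorm_smult[OF W.P_vec[OF W.rho_vec[OF up_SL w(1)]]] norm_power_int)
    have "s powi M * \<kappa>1 \<le> s powi M * vnorm (Q M *\<^sub>v (\<sigma> (up z) *\<^sub>v w))"
      using 1(3)[of z] z s0 by (intro mult_left_mono) auto
    also have "\<dots> \<le> C1 * vnorm ?y" using low[OF M(1)] C1(2)[OF y] by simp
    finally have l1: "s powi M \<le> C1 / \<kappa>1 * vnorm ?y" using 1(2) by (simp add: field_simps)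
    have "s powi d * (\<kappa>2 * r ^ N) \<le> s powi d * vnorm (Q d *\<^sub>v (\<sigma> (up z) *\<^sub>v w))"
      using 2(3)[of z] z s0 by (intro mult_left_mono) (auto simp: r_def N_def)
    also have "\<dots> \<le> C2 * vnorm ?y" using low[OF d(1)] C2(2)[OF y] by simp
    finally have l2: "s powi d * r ^ N \<le> C2 / \<kappa>2 * vnorm ?y" using 2(2) by (simp add: field_simps)
    have "E \<le> ?D * vnorm ?y" using l1 l2 by (simp add: E_def algebra_simps)
    then have "?A * E \<le> ?A * (?D * vnorm ?y)" using B(1) by (intro mult_left_mono) auto
    then show ?thesis using upper by (simp add: mult.assoc)
  qed
  moreover have "0 \<le> ?A * ?D" using B(1) C1(1) C2(1) 1(2) 2(2) by (intro mult_nonneg_nonneg add_nonneg_nonneg) auto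
  moreover have "0 < min 1 (min \<delta>1 \<delta>2)" using 1(1) 2(1) by simp
  ultimately show ?thesis by blast
qed

text \<open>The bound near \<open>y\<close> is the local bound near 0 for the pair translated by
  \<open>up y\<close>, because \<open>G s (z - y) * up y = G s z\<close>. It is already uniform in
  the unbounded parameter \<open>s\<close>, so compactness is needed in \<open>z\<close>
  alone.\<close>

lemma uniform_bound:
  assumes V: "sl2_rep m \<rho> K P" and W: "sl2_rep k \<sigma> L Q" and irr: "irreducible_rep 2 k \<sigma>"
    and v: "v \<in> carrier_vec m" and w: "w \<in> carrier_vec k" "w \<noteq> 0\<^sub>v k"
    and dom: "dominated \<rho> K P m v \<sigma> L Q k w"
  shows "\<exists>B\<ge>0. \<forall>z s. cmod z \<le> 1 \<longrightarrow> 1 \<le> s \<longrightarrow>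
    vnorm (\<rho> (dg (complex_of_real s) * up z) *\<^sub>v v) \<le> B * vnorm (\<sigma> (dg (complex_of_real s) * up z) *\<^sub>v w)"
proof -
  interpret V: sl2_rep m \<rho> K P by (rule V)
  interpret W: sl2_rep k \<sigma> L Q by (rule W)
  define G where "G s z = dg (complex_of_real s) * up z" for s z
  have near: "\<exists>\<delta>>0. \<exists>B\<ge>0. \<forall>z s. cmod (z - y) < \<delta> \<longrightarrow> 1 \<le> s \<longrightarrow>
      vnorm (\<rho> (G s z) *\<^sub>v v) \<le> B * vnorm (\<sigma> (G s z) *\<^sub>v w)" for y
  proof -
    obtain \<delta> B where *: "\<delta> > 0" "B \<ge> 0" "\<And>z s. cmod z < \<delta> \<Longrightarrow> 1 \<le> s \<Longrightarrow>
      vnorm (\<rho> (G s z) *\<^sub>v (\<rho> (up y) *\<^sub>v v)) \<le> B * vnorm (\<sigma> (G s z) *\<^sub>v (\<sigma> (up y) *\<^sub>v w))"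
      using local_bound[OF V W irr V.rho_vec[OF up_SL v] W.rho_vec[OF up_SL w(1)] W.rho_nonzero[OF up_SL w]
          dominated_translate[OF V W v w(1) dom up_SL]] unfolding G_def by blast
    have "\<rho> (G s (z - y)) *\<^sub>v (\<rho> (up y) *\<^sub>v v) = \<rho> (G s z) *\<^sub>v v"
      "\<sigma> (G s (z - y)) *\<^sub>v (\<sigma> (up y) *\<^sub>v w) = \<sigma> (G s z) *\<^sub>v w" if "1 \<le> s" for z s
    proof -
      have S: "G s (z - y) \<in> carrier (SL 2)" unfolding G_def using that by (intro mult_in_SL dg_SL up_SL) auto
      have "G s (z - y) * up y = G s z" by (simp add: G_def dg_def up_def mat2_mult algebra_simps)
      then show "\<rho> (G s (z - y)) *\<^sub>v (\<rho> (up y) *\<^sub>v v) = \<rho> (G s z) *\<^sub>v v"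
        "\<sigma> (G s (z - y)) *\<^sub>v (\<sigma> (up y) *\<^sub>v w) = \<sigma> (G s z) *\<^sub>v w"
        using V.rho_mult[OF S up_SL v, of y] W.rho_mult[OF S up_SL w(1), of y] by simp_all
    qed
    then show ?thesis using * by metis
  qed
  then obtain \<delta> B where \<delta>: "\<And>y. \<delta> y > 0" and B: "\<And>y. B y \<ge> 0"
    and bound: "\<And>y z s. cmod (z - y) < \<delta> y \<Longrightarrow> 1 \<le> s \<Longrightarrow>
      vnorm (\<rho> (G s z) *\<^sub>v v) \<le> B y * vnorm (\<sigma> (G s z) *\<^sub>v w)"
    by metis
  \<comment> \<open>A closed square that contains the unit disc, as the continuous image of a
    product of intervals.\<close>
  define S where "S = (\<lambda>p. complex_of_real (fst p) + \<i> * complex_of_real (snd p)) ` ({-1..1} \<times> {-1..1})"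
  have "compact S"
    unfolding S_def by (intro compact_continuous_image compact_Times compact_Icc continuous_intros)
  moreover have "open {z. cmod (z - y) < \<delta> y}" for y
    by (intro open_Collect_less continuous_intros)
  moreover have "S \<subseteq> (\<Union>y\<in>UNIV. {z. cmod (z - y) < \<delta> y})"
  proof
    fix x show "x \<in> (\<Union>y\<in>UNIV. {z. cmod (z - y) < \<delta> y})" by (rule UN_I[of x]) (simp_all add: \<delta>)
  qed
  ultimately obtain D where "D \<subseteq> UNIV" and D: "finite D" "S \<subseteq> (\<Union>y\<in>D. {z. cmod (z - y) < \<delta> y})"
    by (rule compactE_image)
  have "vnorm (\<rho> (G s z) *\<^sub>v v) \<le> (\<Sum>y\<in>D. B y) * vnorm (\<sigma> (G s z) *\<^sub>v w)" if z: "cmod z \<le> 1" and s: "1 \<le> s" for z s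
  proof -
    have "\<bar>Re z\<bar> \<le> 1" "\<bar>Im z\<bar> \<le> 1" using z abs_Re_le_cmod[of z] abs_Im_le_cmod[of z] by linarith+
    then have "(Re z, Im z) \<in> {-1..1} \<times> {-1..1}" by auto
    moreover have "z = complex_of_real (fst (Re z, Im z)) + \<i> * complex_of_real (snd (Re z, Im z))"
      by (simp add: complex_eq)
    ultimately have "z \<in> S" unfolding S_def by (rule rev_image_eqI)
    then obtain y where y: "y \<in> D" "cmod (z - y) < \<delta> y" using D(2) by blast
    have "vnorm (\<rho> (G s z) *\<^sub>v v) \<le> B y * vnorm (\<sigma> (G s z) *\<^sub>v w)" by (rule bound[OF y(2) s])
    also have "\<dots> \<le> (\<Sum>y\<in>D. B y) * vnorm (\<sigma> (G s z) *\<^sub>v w)"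
      using D(1) y(1) B by (intro mult_right_mono member_le_sum vnorm_nonneg) auto
    finally show ?thesis .
  qed
  moreover have "0 \<le> (\<Sum>y\<in>D. B y)" using B by (rule sum_nonneg)
  ultimately show ?thesis unfolding G_def by blast
qed

text \<open>The Iwasawa decomposition \<open>g = \<kappa> * dg s * up z\<close> has \<open>s \<ge> 1\<close> and \<open>\<bar>z\<bar> \<le> 1\<close> as soon as the first
  column of \<open>g\<close> is at least as long as the second, which a Weyl element on the right achieves.\<close>

lemma iwasawa_longer_column:
  assumes det: "a * d - b * c = 1" and le: "(cmod b)\<^sup>2 + (cmod d)\<^sup>2 \<le> (cmod a)\<^sup>2 + (cmod c)\<^sup>2"
  obtains \<kappa> s z where "\<kappa> \<in> carrier (SL 2)" "\<forall>i<2. \<forall>j<2. cmod (\<kappa> $$ (i, j)) \<le> 1"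
    "\<forall>i<2. \<forall>j<2. cmod ((inv\<^bsub>SL 2\<^esub> \<kappa>) $$ (i, j)) \<le> 1" "1 \<le> s" "cmod z \<le> 1"
    "mat2 a b c d = \<kappa> * (dg (complex_of_real s) * up z)"
proof -
  define A where "A = (cmod a)\<^sup>2 + (cmod c)\<^sup>2"
  define D where "D = (cmod b)\<^sup>2 + (cmod d)\<^sup>2"
  define e where "e = cnj a * b + cnj c * d"
  \<comment> \<open>Lagrange's identity for the two columns: \<open>e\<close> is their Hermitian
    product, and \<open>A\<close> and \<open>D\<close> are their squared lengths.\<close>
  have "complex_of_real ((cmod e)\<^sup>2 + (cmod (a * d - b * c))\<^sup>2) = complex_of_real (A * D)"
    unfolding A_def D_def e_def of_real_add of_real_mult complex_norm_square by (simp add: algebra_simps)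
  then have AD: "(cmod e)\<^sup>2 + 1 = A * D" using det by (simp only: of_real_eq_iff) simp
  have D0: "0 \<le> D" "D \<le> A" using le by (simp_all add: A_def D_def)
  have "1 \<le> A * D" using AD by (smt (verit) zero_le_power2)
  also have "\<dots> \<le> A * A" using D0 by (intro mult_left_mono) auto
  finally have A1: "1 \<le> A" using D0 by (smt (verit) mult_le_one mult_strict_mono)
  define s where "s = sqrt A"
  have s1: "1 \<le> s" using A1 by (simp add: s_def)
  have ss: "s * s = A" using A1 by (simp add: s_def)
  \<comment> \<open>Gram-Schmidt: \<open>z\<close> is the coefficient of the second column along the
    first, and \<open>\<kappa>\<close> is the special unitary matrix whose first column is the
    normalised first column of the given matrix.\<close>
  define z where "z = e / complex_of_real A"
  define \<kappa> where "\<kappa> = mat2 (a / s) (- cnj c / s) (c / s) (cnj a / s)"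
  have Ac: "complex_of_real A = a * cnj a + c * cnj c"
    unfolding A_def of_real_add complex_norm_square ..
  have sc: "complex_of_real s * complex_of_real s = complex_of_real A" by (simp only: of_real_mult[symmetric] ss)
  have s0: "complex_of_real s \<noteq> 0" "complex_of_real A \<noteq> 0" using s1 A1 by auto
  have k1: "(a / s) * (cnj a / s) - (- cnj c / s) * (c / s) = 1"
  proof -
    have "(a / s) * (cnj a / s) - (- cnj c / s) * (c / s) = (a * cnj a + c * cnj c) / (complex_of_real s * complex_of_real s)"
      by (simp add: add_divide_distrib mult.commute)
    then show ?thesis using s0 by (simp only: sc Ac[symmetric]) simp
  qed
  have "cmod a \<le> s" "cmod c \<le> s" unfolding s_def by (rule real_le_rsqrt, simp add: A_def)+
  then have small: "cmod (a / s) \<le> 1" "cmod (c / s) \<le> 1" "cmod (cnj a / s) \<le> 1" "cmod (cnj c / s) \<le> 1"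
    using s1 by (simp_all add: norm_divide divide_le_eq)
  show thesis
  proof
    show "\<kappa> \<in> carrier (SL 2)" unfolding \<kappa>_def mat2_in_SL by (rule k1)
    show "\<forall>i<2. \<forall>j<2. cmod (\<kappa> $$ (i, j)) \<le> 1"
      using small by (simp add: \<kappa>_def mat2_def)
    show "\<forall>i<2. \<forall>j<2. cmod ((inv\<^bsub>SL 2\<^esub> \<kappa>) $$ (i, j)) \<le> 1"
      using small unfolding \<kappa>_def inv_mat2[OF k1] by (simp add: mat2_def)
    show "1 \<le> s" by (rule s1)
    have "(cmod e)\<^sup>2 \<le> A\<^sup>2"
      using AD D0 mult_left_mono[of D A A] by (simp add: power2_eq_square)
    then have "cmod e \<le> A" by (rule power2_le_imp_le) (use A1 in simp)
    then show "cmod z \<le> 1" using A1 by (simp add: z_def norm_divide divide_le_eq)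
    have "a * e - cnj c = b * complex_of_real A"
    proof -
      have "a * e - cnj c = a * cnj a * b + cnj c * (a * d - 1)" by (simp add: e_def algebra_simps)
      also have "a * d - 1 = b * c" using det by (simp add: algebra_simps)
      finally show ?thesis by (simp add: Ac algebra_simps)
    qed
    then have 1: "a * z - cnj c / complex_of_real A = b"
      using s0 by (simp add: z_def diff_divide_distrib[symmetric])
    have "c * e + cnj a = d * complex_of_real A"
    proof -
      have "c * e + cnj a = cnj a * (b * c + 1) + c * cnj c * d" by (simp add: e_def algebra_simps)
      also have "b * c + 1 = a * d" using det by (simp add: algebra_simps)
      finally show ?thesis by (simp add: Ac algebra_simps)
    qed
    then have 2: "c * z + cnj a / complex_of_real A = d"
      using s0 by (simp add: z_def add_divide_distrib[symmetric])
    have cancel: "inverse (complex_of_real s) * (complex_of_real s * x) = x" for x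
      using s0 by (simp add: mult.assoc[symmetric])
    show "mat2 a b c d = \<kappa> * (dg (complex_of_real s) * up z)"
      using s0 1 2 by (simp add: cancel \<kappa>_def dg_def up_def mat2_mult divide_inverse mult.assoc sc[symmetric])
  qed
qed

text \<open>A unitary factor on the left changes norms by bounded amounts only, so the bound for
  \<open>dg s * up z\<close> extends to all \<open>g\<close> whose first column is the longer one.
  For the other \<open>g\<close> the Weyl element \<open>q\<close> exchanges the columns up to sign,
  and the uniform bound for the pair translated by \<open>q\<close> applies.\<close>

lemma semistable_of_dominated:
  assumes V: "sl2_rep m \<rho> K P" and W: "sl2_rep k \<sigma> L Q" and irr: "irreducible_rep 2 k \<sigma>"
    and v: "v \<in> carrier_vec m" "v \<noteq> 0\<^sub>v m" and w: "w \<in> carrier_vec k" "w \<noteq> 0\<^sub>v k"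
    and dom: "dominated \<rho> K P m v \<sigma> L Q k w"
  shows "semistable 2 m \<rho> k \<sigma> v w"
proof -
  interpret V: sl2_rep m \<rho> K P by (rule V)
  interpret W: sl2_rep k \<sigma> L Q by (rule W)
  define q where "q = mat2 0 1 (-1) 0"
  have qS: "q \<in> carrier (SL 2)" by (simp add: q_def mat2_in_SL)
  obtain B1 where B1: "0 \<le> B1" "\<And>z s. cmod z \<le> 1 \<Longrightarrow> 1 \<le> s \<Longrightarrow>
    vnorm (\<rho> (dg (complex_of_real s) * up z) *\<^sub>v v) \<le> B1 * vnorm (\<sigma> (dg (complex_of_real s) * up z) *\<^sub>v w)"
    using uniform_bound[OF V W irr v(1) w dom] by blast
  obtain B2 where B2: "0 \<le> B2" "\<And>z s. cmod z \<le> 1 \<Longrightarrow> 1 \<le> s \<Longrightarrow>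
    vnorm (\<rho> (dg (complex_of_real s) * up z) *\<^sub>v (\<rho> q *\<^sub>v v)) \<le>
      B2 * vnorm (\<sigma> (dg (complex_of_real s) * up z) *\<^sub>v (\<sigma> q *\<^sub>v w))"
    using uniform_bound[OF V W irr V.rho_vec[OF qS v(1)] W.rho_vec[OF qS w(1)] W.rho_nonzero[OF qS w]
        dominated_translate[OF V W v(1) w(1) dom qS]] by blast
  obtain C where C: "0 \<le> C" "\<And>g u. g \<in> carrier (SL 2) \<Longrightarrow> (\<forall>i<2. \<forall>j<2. cmod (g $$ (i, j)) \<le> 1) \<Longrightarrow>
    u \<in> carrier_vec m \<Longrightarrow> vnorm (\<rho> g *\<^sub>v u) \<le> C * vnorm u" using V.rho_compact_bound by blast
  obtain C' where C': "0 \<le> C'" "\<And>g u. g \<in> carrier (SL 2) \<Longrightarrow> (\<forall>i<2. \<forall>j<2. cmod (g $$ (i, j)) \<le> 1) \<Longrightarrow>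
    u \<in> carrier_vec k \<Longrightarrow> vnorm (\<sigma> g *\<^sub>v u) \<le> C' * vnorm u" using W.rho_compact_bound by blast
  have step: "vnorm (\<rho> (\<kappa> * b) *\<^sub>v v') \<le> C * B * C' * vnorm (\<sigma> (\<kappa> * b) *\<^sub>v w')"
    if \<kappa>: "\<kappa> \<in> carrier (SL 2)" "\<forall>i<2. \<forall>j<2. cmod (\<kappa> $$ (i, j)) \<le> 1"
        "\<forall>i<2. \<forall>j<2. cmod ((inv\<^bsub>SL 2\<^esub> \<kappa>) $$ (i, j)) \<le> 1"
      and b: "b \<in> carrier (SL 2)" and v': "v' \<in> carrier_vec m" and w': "w' \<in> carrier_vec k"
      and B: "0 \<le> B" "vnorm (\<rho> b *\<^sub>v v') \<le> B * vnorm (\<sigma> b *\<^sub>v w')" for \<kappa> b v' w' B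
  proof -
    have "vnorm (\<rho> (\<kappa> * b) *\<^sub>v v') \<le> C * vnorm (\<rho> b *\<^sub>v v')"
      unfolding V.rho_mult[OF \<kappa>(1) b v'] by (rule C(2)[OF \<kappa>(1,2) V.rho_vec[OF b v']])
    also have "\<dots> \<le> C * (B * vnorm (\<sigma> b *\<^sub>v w'))" using B(2) C(1) by (rule mult_left_mono)
    \<comment> \<open>A lower bound for the action of \<open>\<kappa>\<close> on the target comes
      from an upper bound for its inverse.\<close>
    also have "\<sigma> b *\<^sub>v w' = \<sigma> (inv\<^bsub>SL 2\<^esub> \<kappa>) *\<^sub>v (\<sigma> (\<kappa> * b) *\<^sub>v w')"
      unfolding W.rho_mult[OF \<kappa>(1) b w'] using W.rho_inv[OF \<kappa>(1) W.rho_vec[OF b w']] by simp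
    also have "C * (B * vnorm (\<sigma> (inv\<^bsub>SL 2\<^esub> \<kappa>) *\<^sub>v (\<sigma> (\<kappa> * b) *\<^sub>v w'))) \<le> C * (B * (C' * vnorm (\<sigma> (\<kappa> * b) *\<^sub>v w')))"
      using C(1) B(1) C'(2)[OF inv_SL(1)[OF \<kappa>(1)] \<kappa>(3) W.rho_vec[OF mult_in_SL[OF \<kappa>(1) b] w']]
      by (intro mult_left_mono)
    finally show ?thesis by (simp add: mult.assoc)
  qed
  have "vnorm (\<rho> g *\<^sub>v v) \<le> C * (B1 + B2) * C' * vnorm (\<sigma> g *\<^sub>v w)" if g: "g \<in> carrier (SL 2)" for g
  proof -
    obtain a b c d where abcd: "g = mat2 a b c d" "a * d - b * c = 1" using SL2_cases[OF g] .
    show ?thesis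
    proof (cases "(cmod b)\<^sup>2 + (cmod d)\<^sup>2 \<le> (cmod a)\<^sup>2 + (cmod c)\<^sup>2")
      case True
      obtain \<kappa> s z where \<kappa>: "\<kappa> \<in> carrier (SL 2)" "\<forall>i<2. \<forall>j<2. cmod (\<kappa> $$ (i, j)) \<le> 1"
        "\<forall>i<2. \<forall>j<2. cmod ((inv\<^bsub>SL 2\<^esub> \<kappa>) $$ (i, j)) \<le> 1" and s: "1 \<le> s" and z: "cmod z \<le> 1"
        and eq: "mat2 a b c d = \<kappa> * (dg (complex_of_real s) * up z)"
        using iwasawa_longer_column[OF abcd(2) True] .
      have bS: "dg (complex_of_real s) * up z \<in> carrier (SL 2)" using s by (intro mult_in_SL dg_SL up_SL) auto
      have "vnorm (\<rho> g *\<^sub>v v) \<le> C * B1 * C' * vnorm (\<sigma> g *\<^sub>v w)"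
        unfolding abcd(1) eq by (rule step[OF \<kappa> bS v(1) w(1) B1(1) B1(2)[OF z s]])
      also have "\<dots> \<le> C * (B1 + B2) * C' * vnorm (\<sigma> g *\<^sub>v w)"
        using C(1) C'(1) B1(1) B2(1) by (intro mult_right_mono mult_left_mono vnorm_nonneg) auto
      finally show ?thesis .
    next
      case False
      have det': "b * (- c) - (- a) * d = 1" using abcd(2) by (simp add: algebra_simps)
      have le': "(cmod (- a))\<^sup>2 + (cmod (- c))\<^sup>2 \<le> (cmod b)\<^sup>2 + (cmod d)\<^sup>2" using False by simp
      obtain \<kappa> s z where \<kappa>: "\<kappa> \<in> carrier (SL 2)" "\<forall>i<2. \<forall>j<2. cmod (\<kappa> $$ (i, j)) \<le> 1"
        "\<forall>i<2. \<forall>j<2. cmod ((inv\<^bsub>SL 2\<^esub> \<kappa>) $$ (i, j)) \<le> 1" and s: "1 \<le> s" and z: "cmod z \<le> 1"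
        and eq: "mat2 b (- a) d (- c) = \<kappa> * (dg (complex_of_real s) * up z)"
        using iwasawa_longer_column[OF det' le'] .
      have bS: "dg (complex_of_real s) * up z \<in> carrier (SL 2)" using s by (intro mult_in_SL dg_SL up_SL) auto
      have gS: "\<kappa> * (dg (complex_of_real s) * up z) \<in> carrier (SL 2)" using \<kappa>(1) bS by (rule mult_in_SL)
      have "g = mat2 b (- a) d (- c) * q" by (simp add: abcd(1) q_def mat2_mult)
      then have gq: "g = \<kappa> * (dg (complex_of_real s) * up z) * q" by (simp only: eq)
      have "vnorm (\<rho> g *\<^sub>v v) \<le> C * B2 * C' * vnorm (\<sigma> g *\<^sub>v w)"
        unfolding gq V.rho_mult[OF gS qS v(1)] W.rho_mult[OF gS qS w(1)]
        by (rule step[OF \<kappa> bS V.rho_vec[OF qS v(1)] W.rho_vec[OF qS w(1)] B2(1) B2(2)[OF z s]])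
      also have "\<dots> \<le> C * (B1 + B2) * C' * vnorm (\<sigma> g *\<^sub>v w)"
        using C(1) C'(1) B1(1) B2(1) by (intro mult_right_mono mult_left_mono vnorm_nonneg) auto
      finally show ?thesis .
    qed
  qed
  then show ?thesis
    using V.rho_vec[OF _ v(1)] W.rho_vec[OF _ w(1)] V.rho_nonzero[OF _ v] by (intro semistable_of_bound) auto
qed

text \<open>Natural exponents of the two diagonal entries \<open>t\<close> and \<open>1/t\<close>
  that together represent \<open>t powi l\<close>.\<close>

definition int_exponent :: "int \<Rightarrow> nat \<Rightarrow> nat" where
  "int_exponent l = (\<lambda>i. if i = 0 then nat l else nat (- l))"

context sl2_rep
begin

text \<open>Instance of \<open>weights_eq\<close> whose functionals are the coordinates of
  \<open>P l * \<rho> h\<close>. They are indexed by pairs \<open>(l, i)\<close>, and all those with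
  the same \<open>l\<close> share one character.\<close>

lemma weights_conj_torus_2:
  assumes h: "h \<in> carrier (SL 2)" and u: "u \<in> carrier_vec m"
  defines "g \<equiv> inv\<^bsub>SL 2\<^esub> h"
  shows "weights 2 (conj_torus 2 g) m \<rho> u =
    {monomial_char 2 g (int_exponent l) | l. l \<in> K \<and> P l *\<^sub>v (\<rho> h *\<^sub>v u) \<noteq> 0\<^sub>v m}"
proof -
  have g: "g \<in> carrier (SL 2)" "inv\<^bsub>SL 2\<^esub> g = h"
    using inv_SL(1)[OF h] group.inv_inv[OF group_SL h] by (auto simp: g_def)
  have functional: "(\<Sum>j<m. (P l * \<rho> h) $$ (i, j) * x $ j) = (P l *\<^sub>v (\<rho> h *\<^sub>v x)) $ i"
    if "i < m" "x \<in> carrier_vec m" for l i x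
    using mult_mat_vec_index[OF mult_carrier_mat[OF P_carrier rho_carrier[OF h]] that(2,1)]
      assoc_mult_mat_vec[OF P_carrier rho_carrier[OF h] that(2)] by simp
  have "weights 2 (conj_torus 2 g) m \<rho> u =
    {monomial_char 2 g (int_exponent (fst s)) | s. s \<in> K \<times> {..<m} \<and>
       (\<Sum>j<m. (P (fst s) * \<rho> h) $$ (snd s, j) * u $ j) \<noteq> 0}"
  proof (rule weights_eq[OF u conj_torus_components_exist[OF rep g(1) u]])
    show "monomial_char 2 g (int_exponent (fst s)) \<in> characters 2 (conj_torus 2 g)" for s :: "int \<times> nat"
      by (rule monomial_char_in_characters[OF g(1)])
    show "x = 0\<^sub>v m" if x: "x \<in> carrier_vec m"
      and 0: "\<And>s. s \<in> K \<times> {..<m} \<Longrightarrow> (\<Sum>j<m. (P (fst s) * \<rho> h) $$ (snd s, j) * x $ j) = 0" for x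
    proof -
      have "P l *\<^sub>v (\<rho> h *\<^sub>v x) = 0\<^sub>v m" if "l \<in> K" for l
      proof (rule vec_eq_zeroI[OF P_vec[OF rho_vec[OF h x]]])
        fix i assume "i < m"
        then show "(P l *\<^sub>v (\<rho> h *\<^sub>v x)) $ i = 0"
          using 0[of "(l, i)"] functional[of i x l] that x by simp
      qed
      then have "\<rho> h *\<^sub>v x = 0\<^sub>v m" by (rule P_zero_imp_zero[OF rho_vec[OF h x]])
      then show ?thesis using rho_nonzero[OF h x] by blast
    qed
    fix s x and y :: "complex vec" assume s: "s \<in> K \<times> {..<m}" and x: "x \<in> conj_torus 2 g" and y: "y \<in> carrier_vec m"
    obtain l i where li: "s = (l, i)" "l \<in> K" "i < m" using s by auto
    define t where "t = conj_mat 2 g x $$ (0, 0)"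
    note xD = conj_torusD[OF g(1) x]
    have t0: "t \<noteq> 0" unfolding t_def by (rule conj_torus_diag_nonzero[OF g(1) x]) simp
    have "t * conj_mat 2 g x $$ (1, 1) = 1"
      using conj_torus_det[OF g(1) x] by (simp add: t_def numeral_2_eq_2)
    then have t1: "conj_mat 2 g x $$ (1, 1) = inverse t" by (metis inverse_unique)
    have dgt: "conj_mat 2 g x = dg t"
      unfolding dg_def using xD(3) t1 conj_torus_off_diag[OF g(1) x, of 0 1] conj_torus_off_diag[OF g(1) x, of 1 0]
      by (intro mat2_eqI) (auto simp: t_def)
    have "h * x = conj_mat 2 g x * h"
    proof -
      have "conj_mat 2 g x * h = h * x * (g * h)"
        using xD(2) SL_carrier_mat[OF h] SL_carrier_mat[OF g(1)]
        unfolding conj_mat_def g(2) by (intro assoc_mult_mat) auto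
      then show ?thesis
        using inv_SL(3)[OF h] xD(2) SL_carrier_mat[OF h] by (simp add: g_def)
    qed
    then have "\<rho> h *\<^sub>v (\<rho> x *\<^sub>v y) = \<rho> (dg t) *\<^sub>v (\<rho> h *\<^sub>v y)"
      using rho_mult[OF h xD(1) y] rho_mult[OF dg_SL[OF t0] h y] dgt by simp
    then have "P l *\<^sub>v (\<rho> h *\<^sub>v (\<rho> x *\<^sub>v y)) = (t powi l) \<cdot>\<^sub>v (P l *\<^sub>v (\<rho> h *\<^sub>v y))"
      using P_torus[OF t0 li(2) rho_vec[OF h y]] by simp
    moreover have "monomial_char 2 g (int_exponent l) x = t powi l"
      using x t1 t_def by (simp add: monomial_char_def int_exponent_def numeral_2_eq_2 power_int_def)
    ultimately show "(\<Sum>j<m. (P (fst s) * \<rho> h) $$ (snd s, j) * (\<rho> x *\<^sub>v y) $ j) =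
        monomial_char 2 g (int_exponent (fst s)) x * (\<Sum>j<m. (P (fst s) * \<rho> h) $$ (snd s, j) * y $ j)"
      using functional[OF li(3) rho_vec[OF xD(1) y]] functional[OF li(3) y] li P_carrier[of l] by simp
  qed
  also have "\<dots> = {monomial_char 2 g (int_exponent l) | l. l \<in> K \<and> P l *\<^sub>v (\<rho> h *\<^sub>v u) \<noteq> 0\<^sub>v m}" (is "?A = ?B")
  proof (intro equalityI subsetI)
    fix \<chi> assume "\<chi> \<in> ?A"
    then obtain l i where li: "\<chi> = monomial_char 2 g (int_exponent l)" "l \<in> K" "i < m"
      "(\<Sum>j<m. (P l * \<rho> h) $$ (i, j) * u $ j) \<noteq> 0" by auto
    then have "P l *\<^sub>v (\<rho> h *\<^sub>v u) \<noteq> 0\<^sub>v m" using functional[OF li(3) u, of l] by auto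
    then show "\<chi> \<in> ?B" using li by blast
  next
    fix \<chi> assume "\<chi> \<in> ?B"
    then obtain l where l: "\<chi> = monomial_char 2 g (int_exponent l)" "l \<in> K" "P l *\<^sub>v (\<rho> h *\<^sub>v u) \<noteq> 0\<^sub>v m" by blast
    then obtain i where "i < m" "(P l *\<^sub>v (\<rho> h *\<^sub>v u)) $ i \<noteq> 0"
      using vec_eq_zeroI[OF P_vec[OF rho_vec[OF h u]], of l] by blast
    then show "\<chi> \<in> ?A" using l functional[OF _ u, of i l] by (intro CollectI exI[of _ "(l, i)"]) auto
  qed
  finally show ?thesis .
qed

end

text \<open>Evaluating weights at the coroot turns the inclusion of polytopes into the comparison of integers.\<close>

lemma numerically_semistable_dominated:
  assumes V: "sl2_rep m \<rho> K P" and W: "sl2_rep k \<sigma> L Q"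
    and v: "v \<in> carrier_vec m" and w: "w \<in> carrier_vec k"
    and num: "numerically_semistable 2 m \<rho> k \<sigma> v w"
  shows "dominated \<rho> K P m v \<sigma> L Q k w"
  unfolding dominated_def
proof (intro ballI impI)
  interpret V: sl2_rep m \<rho> K P by (rule V)
  interpret W: sl2_rep k \<sigma> L Q by (rule W)
  fix h b assume h: "h \<in> carrier (SL 2)" and b: "b \<in> K" "P b *\<^sub>v (\<rho> h *\<^sub>v v) \<noteq> 0\<^sub>v m"
  define g where "g = inv\<^bsub>SL 2\<^esub> h"
  have g: "g \<in> carrier (SL 2)" "inv\<^bsub>SL 2\<^esub> g = h"
    using inv_SL(1)[OF h] group.inv_inv[OF group_SL h] by (auto simp: g_def)
  note c = conj_carrier[OF g(1)]
  let ?T = "conj_torus 2 g"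
  \<comment> \<open>The coroot \<open>diag(1, -1)\<close>, moved into the Lie algebra of the
    conjugate torus. The curve \<open>\<gamma>\<close> is the one-parameter subgroup tangent to it,
    and the weight of exponent \<open>l\<close> takes the value \<open>l\<close> on it.\<close>
  define X where "X = g * mat2 1 0 0 (-1) * inv\<^bsub>SL 2\<^esub> g"
  have Xc: "X \<in> carrier_mat 2 2" unfolding X_def
    by (rule mult_carrier_mat[OF mult_carrier_mat[OF c(1) mat2_carrier] c(2)])
  have Xconj: "conj_mat 2 g X = mat2 1 0 0 (-1)"
    using conj_mat_eq_iff[OF g(1) Xc mat2_carrier] by (simp add: X_def)
  define \<gamma> where "\<gamma> s = g * dg (exp (complex_of_real s)) * inv\<^bsub>SL 2\<^esub> g" for s
  have ent: "(g * mat2 p 0 0 q * inv\<^bsub>SL 2\<^esub> g) $$ (i, j) =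
      g $$ (i, 0) * p * (inv\<^bsub>SL 2\<^esub> g) $$ (0, j) + g $$ (i, 1) * q * (inv\<^bsub>SL 2\<^esub> g) $$ (1, j)" if ij: "i < 2" "j < 2" for p q i j
  proof -
    have 1: "(g * mat2 p 0 0 q) $$ (i, l) = g $$ (i, 0) * mat2 p 0 0 q $$ (0, l) + g $$ (i, 1) * mat2 p 0 0 q $$ (1, l)" if "l < 2" for l
      using mult_mat_index[OF c(1) mat2_carrier ij(1) that] by (simp add: numeral_2_eq_2)
    show ?thesis
      using mult_mat_index[OF mult_carrier_mat[OF c(1) mat2_carrier] c(2) ij, of p 0 0 q] 1[of 0] 1[of 1]
      by (simp add: numeral_2_eq_2 del: index_mult_mat)
  qed
  have "tangent_curve 2 ?T X \<gamma>"
    unfolding tangent_curve_def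
  proof (intro conjI allI impI)
    have "dg (exp (complex_of_real 0)) = 1\<^sub>m 2" by (simp add: dg_def one_mat2)
    then show "\<gamma> 0 = 1\<^sub>m 2" using c by (simp add: \<gamma>_def)
    show "\<gamma> s \<in> ?T" for s
    proof (rule conj_torusI[OF g(1)])
      have D: "dg (exp (complex_of_real s)) \<in> carrier (SL 2)" by (rule dg_SL) simp
      show S: "\<gamma> s \<in> carrier (SL 2)" unfolding \<gamma>_def using g(1) D c(5) by (intro mult_in_SL)
      have "conj_mat 2 g (\<gamma> s) = dg (exp (complex_of_real s))"
        using conj_mat_eq_iff[OF g(1) SL_carrier_mat[OF S] SL_carrier_mat[OF D]] by (simp add: \<gamma>_def)
      then show "conj_mat 2 g (\<gamma> s) $$ (i, j) = 0" if "i < 2" "j < 2" "i \<noteq> j" for i j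
        using that by (simp add: dg_def mat2_def)
    qed
    fix i j :: nat assume ij: "i < 2" "j < 2"
    have e: "((\<lambda>s. exp (complex_of_real s)) has_vector_derivative 1) (at 0)"
      "((\<lambda>s. inverse (exp (complex_of_real s))) has_vector_derivative -1) (at 0)"
    proof -
      have "((\<lambda>z. exp z) has_field_derivative 1) (at (complex_of_real 0))"
        "((\<lambda>z. inverse (exp z)) has_field_derivative -1) (at (complex_of_real 0))"
        by (auto intro!: derivative_eq_intros)
      from this[THEN has_vector_derivative_real_field]
      show "((\<lambda>s. exp (complex_of_real s)) has_vector_derivative 1) (at 0)"
        "((\<lambda>s. inverse (exp (complex_of_real s))) has_vector_derivative -1) (at 0)" .
    qed
    have "((\<lambda>s. g $$ (i, 0) * exp (complex_of_real s) * (inv\<^bsub>SL 2\<^esub> g) $$ (0, j) +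
        g $$ (i, 1) * inverse (exp (complex_of_real s)) * (inv\<^bsub>SL 2\<^esub> g) $$ (1, j)) has_vector_derivative
        (g $$ (i, 0) * 1 * (inv\<^bsub>SL 2\<^esub> g) $$ (0, j) + g $$ (i, 1) * (-1) * (inv\<^bsub>SL 2\<^esub> g) $$ (1, j))) (at 0)"
      by (intro has_vector_derivative_add has_vector_derivative_mult_left has_vector_derivative_mult_right e)
    then show "((\<lambda>s. \<gamma> s $$ (i, j)) has_vector_derivative X $$ (i, j)) (at 0)"
      by (simp only: \<gamma>_def X_def dg_def ent[OF ij])
  qed
  then have XL: "X \<in> Lie 2 ?T" using Xc by (auto simp: Lie_def)
  have diff: "differential 2 ?T (monomial_char 2 g (int_exponent l)) X = of_int l" for l
  proof -
    have "complex_of_nat (nat l) - of_nat (nat (- l)) = of_int l" by (cases "0 \<le> l") (simp_all add: of_nat_nat)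
    then show ?thesis
      unfolding differential_monomial_char[OF g(1) XL] Xconj by (simp add: numeral_2_eq_2 int_exponent_def)
  qed
  have wv: "weights 2 ?T m \<rho> v = {monomial_char 2 g (int_exponent l) | l. l \<in> K \<and> P l *\<^sub>v (\<rho> h *\<^sub>v v) \<noteq> 0\<^sub>v m}"
    unfolding g_def by (rule V.weights_conj_torus_2[OF h v])
  have ww: "weights 2 ?T k \<sigma> w = {monomial_char 2 g (int_exponent l) | l. l \<in> L \<and> Q l *\<^sub>v (\<sigma> h *\<^sub>v w) \<noteq> 0\<^sub>v k}"
    unfolding g_def by (rule W.weights_conj_torus_2[OF h w])
  have "weights 2 ?T m \<rho> v \<subseteq> (\<lambda>l. monomial_char 2 g (int_exponent l)) ` K" unfolding wv by blast
  then have "finite (weights 2 ?T m \<rho> v)" using V.finite_K by (blast intro: finite_subset)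
  moreover have "monomial_char 2 g (int_exponent b) \<in> weights 2 ?T m \<rho> v" unfolding wv using b by blast
  ultimately have "weight_point 2 ?T (monomial_char 2 g (int_exponent b)) \<in> weight_polytope 2 ?T m \<rho> v"
    by (rule weight_point_in_polytope)
  then have "weight_point 2 ?T (monomial_char 2 g (int_exponent b)) \<in> weight_polytope 2 ?T k \<sigma> w"
    using num conj_torus_maximal_2[OF g(1)] unfolding numerically_semistable_def by blast
  then obtain a where eq: "weight_point 2 ?T (monomial_char 2 g (int_exponent b)) =
      (\<lambda>X\<in>Lie 2 ?T. \<Sum>\<chi>\<in>weights 2 ?T k \<sigma> w. complex_of_real (a \<chi>) * differential 2 ?T \<chi> X)"
    and a: "\<forall>\<chi>\<in>weights 2 ?T k \<sigma> w. 0 \<le> a \<chi>" "(\<Sum>\<chi>\<in>weights 2 ?T k \<sigma> w. a \<chi>) = (1 :: real)"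
    unfolding weight_polytope_def by blast
  have val: "of_int b = (\<Sum>\<chi>\<in>weights 2 ?T k \<sigma> w. complex_of_real (a \<chi>) * differential 2 ?T \<chi> X)"
    using fun_cong[OF eq, of X] XL by (simp add: weight_point_def diff)
  show "\<exists>l\<in>L. b \<le> l \<and> Q l *\<^sub>v (\<sigma> h *\<^sub>v w) \<noteq> 0\<^sub>v k"
  proof (rule ccontr)
    assume none: "\<not> ?thesis"
    \<comment> \<open>Weights of \<open>w\<close> below \<open>b\<close> are at most
      \<open>b - 1\<close> by integrality, and so is each of their convex combinations; yet the
      polytope of \<open>w\<close> contains a point with value \<open>b\<close>.\<close>
    have le: "Re (complex_of_real (a \<chi>) * differential 2 ?T \<chi> X) \<le> a \<chi> * (real_of_int b - 1)"
      if \<chi>: "\<chi> \<in> weights 2 ?T k \<sigma> w" for \<chi>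
    proof -
      obtain l where l: "\<chi> = monomial_char 2 g (int_exponent l)" "l \<in> L" "Q l *\<^sub>v (\<sigma> h *\<^sub>v w) \<noteq> 0\<^sub>v k"
        using \<chi> unfolding ww by blast
      then have "l < b" using none by force
      then have "real_of_int l \<le> real_of_int b - 1" by linarith
      then show ?thesis unfolding l(1) diff using a(1) \<chi> l(1) by (simp add: mult_left_mono)
    qed
    have "real_of_int b = (\<Sum>\<chi>\<in>weights 2 ?T k \<sigma> w. Re (complex_of_real (a \<chi>) * differential 2 ?T \<chi> X))"
      using arg_cong[OF val, of Re] by (simp only: Re_sum) simp
    also have "\<dots> \<le> (\<Sum>\<chi>\<in>weights 2 ?T k \<sigma> w. a \<chi> * (real_of_int b - 1))" by (rule sum_mono[OF le])
    also have "\<dots> = real_of_int b - 1" using a(2) by (simp add: sum_distrib_right[symmetric])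
    finally show False by simp
  qed
qed

lemma semistable_if_numerically_semistable_SL2:
  assumes "rational_rep 2 m \<rho>" "rational_rep 2 k \<sigma>" "irreducible_rep 2 k \<sigma>"
    "v \<in> carrier_vec m" "v \<noteq> 0\<^sub>v m" "w \<in> carrier_vec k" "w \<noteq> 0\<^sub>v k"
    "numerically_semistable 2 m \<rho> k \<sigma> v w"
  shows "semistable 2 m \<rho> k \<sigma> v w"
proof -
  obtain K P where V: "sl2_rep m \<rho> K P" using sl2_rep_exists[OF assms(1)] by blast
  obtain L Q where W: "sl2_rep k \<sigma> L Q" using sl2_rep_exists[OF assms(2)] by blast
  show ?thesis
    using semistable_of_dominated[OF V W assms(3-7) numerically_semistable_dominated[OF V W assms(4,6,8)]] .
qed

section \<open>Representations given by matrix coefficients\<close>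

lemma rational_repI:
  assumes mult: "\<And>g h i j. g \<in> carrier (SL n) \<Longrightarrow> h \<in> carrier (SL n) \<Longrightarrow> i < m \<Longrightarrow> j < m \<Longrightarrow>
      R (g * h) i j = (\<Sum>k<m. R g i k * R h k j)"
    and one: "\<And>i j. i < m \<Longrightarrow> j < m \<Longrightarrow> R (1\<^sub>m n) i j = (if i = j then 1 else 0)"
    and regular: "\<And>i j. i < m \<Longrightarrow> j < m \<Longrightarrow> regular_on n (carrier (SL n)) (\<lambda>g. R g i j)"
  shows "rational_rep n m (\<lambda>g. mat m m (\<lambda>(i, j). R g i j))"
proof -
  let ?\<rho> = "\<lambda>g. mat m m (\<lambda>(i, j). R g i j)"
  have m: "?\<rho> (g * h) = ?\<rho> g * ?\<rho> h" if "g \<in> carrier (SL n)" "h \<in> carrier (SL n)" for g h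
  proof (rule eq_matI)
    fix i j assume "i < dim_row (?\<rho> g * ?\<rho> h)" "j < dim_col (?\<rho> g * ?\<rho> h)"
    then have ij: "i < m" "j < m" by auto
    have "(?\<rho> g * ?\<rho> h) $$ (i, j) = (\<Sum>k<m. ?\<rho> g $$ (i, k) * ?\<rho> h $$ (k, j))"
      using ij by (intro mult_mat_index) auto
    then show "?\<rho> (g * h) $$ (i, j) = (?\<rho> g * ?\<rho> h) $$ (i, j)" using mult[OF that ij] ij by simp
  qed auto
  have o: "?\<rho> (1\<^sub>m n) = 1\<^sub>m m" by (rule eq_matI) (auto simp: one)
  have "det (?\<rho> g) \<noteq> 0" if g: "g \<in> carrier (SL n)" for g
  proof
    assume "det (?\<rho> g) = 0"
    moreover have "det (?\<rho> g) * det (?\<rho> (inv\<^bsub>SL n\<^esub> g)) = det (?\<rho> (g * inv\<^bsub>SL n\<^esub> g))"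
      unfolding m[OF g inv_SL(1)[OF g]] by (rule det_mult[symmetric, of _ m]) auto
    ultimately show False using inv_SL(2)[OF g] o by simp
  qed
  then have "?\<rho> \<in> hom (SL n) (GL m)" using m by (intro homI) (auto simp: carrier_GL)
  then show ?thesis using regular by (simp add: rational_rep_def)
qed

text \<open>To find the weights for a conjugate of the diagonal torus, one may conjugate the vector instead.\<close>

lemma weights_conj_torus:
  assumes rep: "rational_rep n m \<rho>" and g: "g \<in> carrier (SL n)" and u: "u \<in> carrier_vec m"
    and diag: "\<And>d x s. d \<in> carrier (SL n) \<Longrightarrow> diagonal_mat d \<Longrightarrow> x \<in> carrier_vec m \<Longrightarrow> s \<in> S \<Longrightarrow>
      (\<Sum>j<m. a s j * (\<rho> d *\<^sub>v x) $ j) = (\<Prod>i<n. d $$ (i, i) ^ \<alpha> s i) * (\<Sum>j<m. a s j * x $ j)"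
    and sep: "\<And>x. x \<in> carrier_vec m \<Longrightarrow> (\<And>s. s \<in> S \<Longrightarrow> (\<Sum>j<m. a s j * x $ j) = 0) \<Longrightarrow> x = 0\<^sub>v m"
  shows "weights n (conj_torus n g) m \<rho> u =
    {monomial_char n g (\<alpha> s) | s. s \<in> S \<and> (\<Sum>j<m. a s j * (\<rho> (inv\<^bsub>SL n\<^esub> g) *\<^sub>v u) $ j) \<noteq> 0}"
proof -
  let ?h = "inv\<^bsub>SL n\<^esub> g"
  note h = inv_SL(1)[OF g] and hc = rational_rep_carrier[OF rep inv_SL(1)[OF g]]
  \<comment> \<open>The functional \<open>a s\<close> pulled back along \<open>\<rho> ?h\<close>,
    which carries the action of the conjugate torus to that of the diagonal one.\<close>
  define b where "b s j = (\<Sum>i<m. a s i * \<rho> ?h $$ (i, j))" for s j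
  have b: "(\<Sum>j<m. b s j * x $ j) = (\<Sum>j<m. a s j * (\<rho> ?h *\<^sub>v x) $ j)" if x: "x \<in> carrier_vec m" for s x
  proof -
    have "(\<Sum>j<m. b s j * x $ j) = (\<Sum>j<m. \<Sum>i<m. a s i * (\<rho> ?h $$ (i, j) * x $ j))"
      by (simp add: b_def sum_distrib_right mult.assoc)
    also have "\<dots> = (\<Sum>i<m. a s i * (\<Sum>j<m. \<rho> ?h $$ (i, j) * x $ j))"
      by (subst sum.swap) (simp add: sum_distrib_left)
    finally show ?thesis using mult_mat_vec_index[OF hc x] by simp
  qed
  have "weights n (conj_torus n g) m \<rho> u =
      {monomial_char n g (\<alpha> s) | s. s \<in> S \<and> (\<Sum>j<m. b s j * u $ j) \<noteq> 0}"
  proof (rule weights_eq[OF u conj_torus_components_exist[OF rep g u]])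
    show "monomial_char n g (\<alpha> s) \<in> characters n (conj_torus n g)" for s
      by (rule monomial_char_in_characters[OF g])
    show "x = 0\<^sub>v m" if x: "x \<in> carrier_vec m" and 0: "\<And>s. s \<in> S \<Longrightarrow> (\<Sum>j<m. b s j * x $ j) = 0" for x
    proof -
      have "\<rho> ?h *\<^sub>v x = 0\<^sub>v m"
        using sep[OF mult_mat_vec_carrier[OF hc x]] 0 unfolding b[OF x] by blast
      moreover have "x = \<rho> g *\<^sub>v (\<rho> ?h *\<^sub>v x)"
        using rational_rep_mult_vec[OF rep g h x] inv_SL(2)[OF g] rational_rep_one[OF rep] x by simp
      ultimately show ?thesis using mult_mat_zero_vec[OF rational_rep_carrier[OF rep g]] by simp
    qed
    fix s x and y :: "complex vec" assume s: "s \<in> S" and x: "x \<in> conj_torus n g" and y: "y \<in> carrier_vec m"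
    note xD = conj_torusD[OF g x]
    have D: "conj_mat n g x \<in> carrier (SL n)" by (rule conj_in_SL[OF g xD(1)])
    have "?h * x = conj_mat n g x * ?h"
    proof -
      have "conj_mat n g x * ?h = ?h * x * (g * ?h)"
        using xD(2) SL_carrier_mat[OF h] SL_carrier_mat[OF g]
        unfolding conj_mat_def by (intro assoc_mult_mat) auto
      then show ?thesis using inv_SL(2)[OF g] xD(2) SL_carrier_mat[OF h] by simp
    qed
    then have "\<rho> ?h *\<^sub>v (\<rho> x *\<^sub>v y) = \<rho> (conj_mat n g x) *\<^sub>v (\<rho> ?h *\<^sub>v y)"
      using rational_rep_mult_vec[OF rep h xD(1) y] rational_rep_mult_vec[OF rep D h y] by simp
    then show "(\<Sum>j<m. b s j * (\<rho> x *\<^sub>v y) $ j) = monomial_char n g (\<alpha> s) x * (\<Sum>j<m. b s j * y $ j)"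
      using diag[OF D xD(4) mult_mat_vec_carrier[OF hc y] s] x
        b[OF mult_mat_vec_carrier[OF rational_rep_carrier[OF rep xD(1)] y]] b[OF y]
      by (simp add: monomial_char_def)
  qed
  then show ?thesis unfolding b[OF u] .
qed

section \<open>A reducible target for SL(2)\<close>

text \<open>\<open>sym2 g\<close> is the action of \<open>g\<close> on binary quadratic forms in the basis \<open>x\<^sup>2, x y, y\<^sup>2\<close>, and index \<open>3\<close> of
  \<open>sym2_triv\<close> carries an additional trivial summand. The pair is \<open>(x y, x\<^sup>2 + 1)\<close>.\<close>

definition sym2 :: "complex mat \<Rightarrow> nat \<Rightarrow> nat \<Rightarrow> complex" where
  "sym2 g i j = (let a = g $$ (0, 0); b = g $$ (0, 1); c = g $$ (1, 0); d = g $$ (1, 1) in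
     if i = 0 then (if j = 0 then a\<^sup>2 else if j = 1 then a * b else b\<^sup>2)
     else if i = 1 then (if j = 0 then 2 * a * c else if j = 1 then a * d + b * c else 2 * b * d)
     else (if j = 0 then c\<^sup>2 else if j = 1 then c * d else d\<^sup>2))"

definition sym2_triv :: "complex mat \<Rightarrow> nat \<Rightarrow> nat \<Rightarrow> complex" where
  "sym2_triv g i j = (if i < 3 \<and> j < 3 then sym2 g i j else if i = j then 1 else 0)"

lemma less_3_cases: "i < 3 \<Longrightarrow> i = 0 \<or> i = 1 \<or> i = (2 :: nat)"
  by auto

lemma sum_less_3: "(\<Sum>i<3. f i) = f 0 + f 1 + f (2 :: nat)"
  by (simp add: numeral_3_eq_3 numeral_2_eq_2)

lemma sum_less_4: "(\<Sum>i<4. f i) = (\<Sum>i<3. f i) + f (3 :: nat)"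
  by (simp add: eval_nat_numeral)

lemma sym2_mult:
  assumes "g \<in> carrier (SL 2)" "h \<in> carrier (SL 2)" "i < 3" "j < 3"
  shows "sym2 (g * h) i j = (\<Sum>k<3. sym2 g i k * sym2 h k j)"
proof -
  obtain a b c d where g: "g = mat2 a b c d" using SL2_cases[OF assms(1)] .
  obtain a' b' c' d' where h: "h = mat2 a' b' c' d'" using SL2_cases[OF assms(2)] .
  show ?thesis
    using less_3_cases[OF assms(3)] less_3_cases[OF assms(4)]
    by (elim disjE) (simp_all add: g h mat2_mult sym2_def sum_less_3 power2_eq_square algebra_simps)
qed

lemma sym2_one: "i < 3 \<Longrightarrow> j < 3 \<Longrightarrow> sym2 (1\<^sub>m 2) i j = (if i = j then 1 else 0)"
  by (auto dest!: less_3_cases simp: sym2_def)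

lemma regular_on_add: "regular_on n T f \<Longrightarrow> regular_on n T f' \<Longrightarrow> regular_on n T (\<lambda>g. f g + f' g)"
  using regular_on_sum[of "UNIV :: bool set" n T "\<lambda>b. if b then f else f'"] by (simp add: UNIV_bool add.commute)

lemma sym2_regular: "regular_on 2 T (\<lambda>g. sym2 g i j)"
proof -
  have e: "regular_on 2 T (\<lambda>g. g $$ (p, q))" if "p < 2" "q < 2" for p q
    using that by (rule regular_on_entry)
  show ?thesis
    unfolding sym2_def Let_def
    by (cases "i = 0"; cases "i = 1"; cases "j = 0"; cases "j = 1"; simp)
      (intro regular_on_add regular_on_mult regular_on_power regular_on_const e; simp)+
qed

abbreviation \<open>sym2_rep \<equiv> \<lambda>g. mat 3 3 (\<lambda>(i, j). sym2 g i j)\<close>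
abbreviation \<open>sym2_triv_rep \<equiv> \<lambda>g. mat 4 4 (\<lambda>(i, j). sym2_triv g i j)\<close>

lemma sym2_rational: "rational_rep 2 3 sym2_rep"
  by (rule rational_repI) (use sym2_mult sym2_one sym2_regular in auto)

lemma sym2_triv_rational: "rational_rep 2 4 sym2_triv_rep"
proof (rule rational_repI)
  show "sym2_triv (g * h) i j = (\<Sum>k<4. sym2_triv g i k * sym2_triv h k j)"
    if "g \<in> carrier (SL 2)" "h \<in> carrier (SL 2)" "i < 4" "j < 4" for g h i j
  proof -
    have "i < 3 \<or> i = 3" "j < 3 \<or> j = 3" using that by auto
    then show ?thesis
      using sym2_mult[OF that(1,2), of i j] by (auto simp: sum_less_4 sym2_triv_def)
  qed
  show "regular_on 2 (carrier (SL 2)) (\<lambda>g. sym2_triv g i j)" for i j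
    by (cases "i < 3"; cases "j < 3"; cases "i = j"; simp add: sym2_triv_def sym2_regular regular_on_const)
qed (use sym2_one in \<open>auto simp: sym2_triv_def\<close>)

text \<open>The weights of \<open>x^2\<close>, \<open>x y\<close> and \<open>y^2\<close>. The last
  clause also serves index 3 of \<open>sym2_triv\<close>: the two diagonal entries multiply to 1, so
  the exponent \<open>(1, 1)\<close> is the trivial character, shared by \<open>x y\<close> and the
  trivial summand.\<close>

definition sym2_exponent :: "nat \<Rightarrow> nat \<Rightarrow> nat" where
  "sym2_exponent s = (if s = 0 then (\<lambda>i. if i = 0 then 2 else 0) else if s = 2 then (\<lambda>i. if i = 0 then 0 else 2)
     else (\<lambda>i. 1))"

lemma diagonal_SL2:
  assumes "d \<in> carrier (SL 2)" "diagonal_mat d"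
  obtains p q where "d = mat2 p 0 0 q" "p * q = 1"
proof -
  obtain a b c e where "d = mat2 a b c e" "a * e - b * c = 1" using SL2_cases[OF assms(1)] .
  moreover from this have "b = 0" "c = 0"
    using assms(2) unfolding diagonal_mat_def
    by (metis One_nat_def carrier_matD lessI mat2_carrier mat2_entries(2) numeral_2_eq_2 pos2 zero_neq_one,
        metis One_nat_def carrier_matD lessI mat2_carrier mat2_entries(3) numeral_2_eq_2 pos2 zero_neq_one)
  ultimately show thesis using that by simp
qed

lemma sym2_weights:
  assumes g: "g \<in> carrier (SL 2)" and u: "u \<in> carrier_vec 3"
  shows "weights 2 (conj_torus 2 g) 3 sym2_rep u =
    {monomial_char 2 g (sym2_exponent s) | s. s < 3 \<and> (sym2_rep (inv\<^bsub>SL 2\<^esub> g) *\<^sub>v u) $ s \<noteq> 0}"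
proof -
  have delta: "(\<Sum>j<3. (if j = s then 1 else 0) * x $ j) = x $ s" if "s < 3" for s and x :: "complex vec"
    using that by (simp add: sum.delta if_distrib[of "\<lambda>c. c * _"] cong: if_cong)
  have "weights 2 (conj_torus 2 g) 3 sym2_rep u =
    {monomial_char 2 g (sym2_exponent s) | s. s \<in> {..<3} \<and>
      (\<Sum>j<3. (if j = s then 1 else 0) * (sym2_rep (inv\<^bsub>SL 2\<^esub> g) *\<^sub>v u) $ j) \<noteq> 0}"
  proof (rule weights_conj_torus[OF sym2_rational g u])
    fix d and s :: nat and x :: "complex vec" assume d: "d \<in> carrier (SL 2)" "diagonal_mat d" and x: "x \<in> carrier_vec 3" and s: "s \<in> {..<3}"
    obtain p q where pq: "d = mat2 p 0 0 q" "p * q = 1" using diagonal_SL2[OF d] .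
    have "(sym2_rep d *\<^sub>v x) $ s = (\<Sum>j<3. sym2 d s j * x $ j)"
      using mult_mat_vec_index[of "sym2_rep d" 3 3 x s] x s by simp
    also have "\<dots> = (\<Prod>i<2. d $$ (i, i) ^ sym2_exponent s i) * x $ s"
      using less_3_cases[of s] s pq(2)
      by (auto simp: pq(1) sym2_def sum_less_3 sym2_exponent_def numeral_2_eq_2)
    finally show "(\<Sum>j<3. (if j = s then 1 else 0) * (sym2_rep d *\<^sub>v x) $ j) =
        (\<Prod>i<2. d $$ (i, i) ^ sym2_exponent s i) * (\<Sum>j<3. (if j = s then 1 else 0) * x $ j)"
      using s by (simp only: delta lessThan_iff)
  next
    fix x :: "complex vec" assume "x \<in> carrier_vec 3" "\<And>s. s \<in> {..<3} \<Longrightarrow> (\<Sum>j<3. (if j = s then 1 else 0) * x $ j) = 0"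
    then show "x = 0\<^sub>v 3" using delta by (intro vec_eq_zeroI) auto
  qed
  moreover have "s \<in> {..<3} \<and> (\<Sum>j<3. (if j = s then 1 else 0) * (sym2_rep (inv\<^bsub>SL 2\<^esub> g) *\<^sub>v u) $ j) \<noteq> 0 \<longleftrightarrow>
      s < 3 \<and> (sym2_rep (inv\<^bsub>SL 2\<^esub> g) *\<^sub>v u) $ s \<noteq> 0" for s
    by (cases "s < 3") (simp_all only: delta lessThan_iff simp_thms)
  ultimately show ?thesis by (simp only:)
qed

lemma sym2_triv_weights:
  assumes g: "g \<in> carrier (SL 2)" and u: "u \<in> carrier_vec 4"
  shows "weights 2 (conj_torus 2 g) 4 sym2_triv_rep u =
    {monomial_char 2 g (sym2_exponent s) | s. s < 4 \<and> (sym2_triv_rep (inv\<^bsub>SL 2\<^esub> g) *\<^sub>v u) $ s \<noteq> 0}"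
proof -
  have delta: "(\<Sum>j<4. (if j = s then 1 else 0) * x $ j) = x $ s" if "s < 4" for s and x :: "complex vec"
    using that by (simp add: sum.delta if_distrib[of "\<lambda>c. c * _"] cong: if_cong)
  have "weights 2 (conj_torus 2 g) 4 sym2_triv_rep u =
    {monomial_char 2 g (sym2_exponent s) | s. s \<in> {..<4} \<and>
      (\<Sum>j<4. (if j = s then 1 else 0) * (sym2_triv_rep (inv\<^bsub>SL 2\<^esub> g) *\<^sub>v u) $ j) \<noteq> 0}"
  proof (rule weights_conj_torus[OF sym2_triv_rational g u])
    fix d and s :: nat and x :: "complex vec" assume d: "d \<in> carrier (SL 2)" "diagonal_mat d" and x: "x \<in> carrier_vec 4" and s: "s \<in> {..<4}"
    obtain p q where pq: "d = mat2 p 0 0 q" "p * q = 1" using diagonal_SL2[OF d] .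
    have "(sym2_triv_rep d *\<^sub>v x) $ s = (\<Sum>j<4. sym2_triv d s j * x $ j)"
      using mult_mat_vec_index[of "sym2_triv_rep d" 4 4 x s] x s by simp
    also have "\<dots> = (\<Prod>i<2. d $$ (i, i) ^ sym2_exponent s i) * x $ s"
    proof -
      have "s = 0 \<or> s = 1 \<or> s = 2 \<or> s = 3" using s by auto
      then show ?thesis using pq(2)
        by (auto simp: pq(1) sym2_triv_def sym2_def sum_less_3 sum_less_4 sym2_exponent_def numeral_2_eq_2)
    qed
    finally show "(\<Sum>j<4. (if j = s then 1 else 0) * (sym2_triv_rep d *\<^sub>v x) $ j) =
        (\<Prod>i<2. d $$ (i, i) ^ sym2_exponent s i) * (\<Sum>j<4. (if j = s then 1 else 0) * x $ j)"
      using s by (simp only: delta lessThan_iff)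
  next
    fix x :: "complex vec" assume "x \<in> carrier_vec 4" "\<And>s. s \<in> {..<4} \<Longrightarrow> (\<Sum>j<4. (if j = s then 1 else 0) * x $ j) = 0"
    then show "x = 0\<^sub>v 4" using delta by (intro vec_eq_zeroI) auto
  qed
  moreover have "s \<in> {..<4} \<and> (\<Sum>j<4. (if j = s then 1 else 0) * (sym2_triv_rep (inv\<^bsub>SL 2\<^esub> g) *\<^sub>v u) $ j) \<noteq> 0 \<longleftrightarrow>
      s < 4 \<and> (sym2_triv_rep (inv\<^bsub>SL 2\<^esub> g) *\<^sub>v u) $ s \<noteq> 0" for s
    by (cases "s < 4") (simp_all only: delta lessThan_iff simp_thms)
  ultimately show ?thesis by (simp only:)
qed

text \<open>For \<open>h\<close> with rows \<open>(a, b)\<close> and \<open>(c, d)\<close>, the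
  translate of \<open>v\<close> has the coefficients \<open>a b\<close> and \<open>c d\<close> at
  \<open>x^2\<close> and \<open>y^2\<close>; where these are nonzero, so are the coefficients
  \<open>a^2\<close> and \<open>c^2\<close> of the translate of \<open>w\<close>. Weight 0 always
  occurs in \<open>w\<close> through the trivial summand. But \<open>a b\<close> can be arbitrarily
  large while \<open>a^2\<close>, \<open>a c\<close> and \<open>c^2\<close> stay bounded, and this
  destroys semistability.\<close>

lemma reducible_counterexample:
  defines "v \<equiv> vec 3 (\<lambda>i. if i = 1 then 1 else 0) :: complex vec"
    and "w \<equiv> vec 4 (\<lambda>i. if i = 0 \<or> i = 3 then 1 else 0) :: complex vec"
  shows "\<not> irreducible_rep 2 4 sym2_triv_rep" "numerically_semistable 2 3 sym2_rep 4 sym2_triv_rep v w"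
    "\<not> semistable 2 3 sym2_rep 4 sym2_triv_rep v w"
proof -
  have vc: "v \<in> carrier_vec 3" and wc: "w \<in> carrier_vec 4" by (auto simp: v_def w_def)
  have rv: "(sym2_rep g *\<^sub>v v) $ i = sym2 g i 1" if "i < 3" for g i
    using mult_mat_vec_index[of "sym2_rep g" 3 3 v i] vc that
    by (simp add: v_def sum_less_3)
  have rw: "(sym2_triv_rep g *\<^sub>v w) $ i = sym2_triv g i 0 + sym2_triv g i 3" if "i < 4" for g i
    using mult_mat_vec_index[of "sym2_triv_rep g" 4 4 w i] wc that
    by (simp add: w_def sum_less_3 sum_less_4)
  show "\<not> irreducible_rep 2 4 sym2_triv_rep"
  proof
    assume irr: "irreducible_rep 2 4 sym2_triv_rep"
    \<comment> \<open>The summand of quadratic forms, as the kernel of the trivial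
      coordinate.\<close>
    let ?U = "{u \<in> carrier_vec 4. u $ 3 = (0 :: complex)}"
    have "VectorSpace.subspace class_ring ?U (module_vec TYPE(complex) 4)"
      by (rule subspace_vecI) auto
    moreover have "sym2_triv_rep g *\<^sub>v u \<in> ?U" if "u \<in> ?U" for g u
    proof -
      have "(sym2_triv_rep g *\<^sub>v u) $ 3 = (\<Sum>j<4. sym2_triv g 3 j * u $ j)"
        using mult_mat_vec_index[of "sym2_triv_rep g" 4 4 u 3] that by simp
      also have "\<dots> = 0" using that by (simp add: sym2_triv_def sum_less_3 sum_less_4)
      finally show ?thesis using that by (auto intro!: mult_mat_vec_carrier[of _ 4 4])
    qed
    ultimately have "?U = {0\<^sub>v 4} \<or> ?U = carrier_vec 4" using irr unfolding irreducible_rep_def by blast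
    moreover have "unit_vec 4 0 \<in> ?U" "unit_vec 4 0 \<noteq> (0\<^sub>v 4 :: complex vec)" by auto
    moreover have "unit_vec 4 3 \<notin> ?U" "unit_vec 4 3 \<in> carrier_vec 4" by auto
    ultimately show False by blast
  qed
  show "numerically_semistable 2 3 sym2_rep 4 sym2_triv_rep v w"
    unfolding numerically_semistable_def
  proof (intro allI impI)
    fix T assume "maximal_torus 2 T"
    then obtain g where g: "g \<in> carrier (SL 2)" "T = conj_torus 2 g"
      using maximal_torus_eq_conj_torus[of 2 T] by auto
    let ?h = "inv\<^bsub>SL 2\<^esub> g"
    have fin: "finite {f s | s. s < N \<and> Q s}" for f :: "nat \<Rightarrow> complex mat \<Rightarrow> complex" and N :: nat and Q
      by (rule finite_subset[of _ "f ` {..<N}"]) auto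
    have finv: "finite (weights 2 T 3 sym2_rep v)" and finw: "finite (weights 2 T 4 sym2_triv_rep w)"
      unfolding g(2) sym2_weights[OF g(1) vc] sym2_triv_weights[OF g(1) wc] by (rule fin)+
    have "weights 2 T 3 sym2_rep v \<subseteq> weights 2 T 4 sym2_triv_rep w"
    proof
      fix \<chi> assume "\<chi> \<in> weights 2 T 3 sym2_rep v"
      then obtain s where s: "\<chi> = monomial_char 2 g (sym2_exponent s)" "s < 3" "(sym2_rep ?h *\<^sub>v v) $ s \<noteq> 0"
        unfolding g(2) sym2_weights[OF g(1) vc] by blast
      then have s3: "sym2 ?h s 1 \<noteq> 0" using rv[OF s(2), of ?h] by simp
      define s' where "s' = (if s = 1 then 3 else s)"
      have "s' < 4" "sym2_exponent s' = sym2_exponent s" "sym2_triv ?h s' 0 + sym2_triv ?h s' 3 \<noteq> 0"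
        using less_3_cases[OF s(2)] s3 by (auto simp: s'_def sym2_exponent_def sym2_triv_def sym2_def)
      then show "\<chi> \<in> weights 2 T 4 sym2_triv_rep w"
        unfolding g(2) sym2_triv_weights[OF g(1) wc] using s(1) rw[of s' ?h] by (intro CollectI exI[of _ s']) auto
    qed
    then show "weight_polytope 2 T 3 sym2_rep v \<subseteq> weight_polytope 2 T 4 sym2_triv_rep w"
      using finv finw by (intro weight_polytope_subset weight_point_in_polytope) auto
  qed
  define e where "e l = complex_of_real (inverse (real (Suc l)))" for l
  have e0: "e l \<noteq> 0" for l by (simp add: e_def del: of_nat_Suc)
  have "(\<lambda>l. complex_of_real (inverse (real (Suc l)))) \<longlonglongrightarrow> complex_of_real 0"
    by (rule tendsto_of_real[OF LIMSEQ_inverse_real_of_nat])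
  then have e: "e \<longlonglongrightarrow> 0" unfolding e_def of_real_0 .
  \<comment> \<open>Chosen with \<open>a = e\<close>, \<open>a * b = 1 / e\<close> and
    \<open>c = 0\<close>: scaled by \<open>e\<close>, the translate of \<open>v\<close> tends to
    \<open>x^2\<close> and that of \<open>w\<close> to 0.\<close>
  define G where "G l = mat2 (e l) (inverse (e l) ^ 2) 0 (inverse (e l))" for l
  define y where "y = vec 3 (\<lambda>i. if i = 0 then 1 else 0 :: complex)"
  show "\<not> semistable 2 3 sym2_rep 4 sym2_triv_rep v w"
  proof (rule not_semistable_of_limit[where g = G and c = e and y = y])
    show "G l \<in> carrier (SL 2)" for l using e0[of l] by (simp add: G_def mat2_in_SL)
    show "y \<noteq> 0\<^sub>v 3"
    proof
      assume "y = 0\<^sub>v 3"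
      then have "y $ 0 = 0" by simp
      then show False by (simp add: y_def)
    qed
    fix i :: nat
    show "(\<lambda>l. e l * (sym2_rep (G l) *\<^sub>v v) $ i) \<longlonglongrightarrow> y $ i" if i: "i < 3"
    proof -
      have "e l * (sym2_rep (G l) *\<^sub>v v) $ i = (if i = 0 then 1 else if i = 1 then e l else 0)" for l
        unfolding rv[OF i] using e0[of l] less_3_cases[OF i]
        by (auto simp: sym2_def Let_def G_def power2_eq_square mult.assoc[symmetric])
      then show ?thesis using e i less_3_cases[OF i] by (auto simp: y_def)
    qed
    show "(\<lambda>l. e l * (sym2_triv_rep (G l) *\<^sub>v w) $ i) \<longlonglongrightarrow> 0" if i: "i < 4"
    proof -
      have i': "i = 0 \<or> i = 1 \<or> i = 2 \<or> i = 3" using i by auto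
      have eq: "e l * (sym2_triv_rep (G l) *\<^sub>v w) $ i = (if i = 0 then e l * (e l * e l) else if i = 3 then e l else 0)" for l
        unfolding rw[OF i] using i' by (auto simp: sym2_triv_def sym2_def Let_def G_def power2_eq_square)
      have "(\<lambda>l. e l * (e l * e l)) \<longlonglongrightarrow> 0 * (0 * 0)" by (intro tendsto_mult e)
      then show ?thesis unfolding eq using e by (cases "i = 0"; cases "i = 3"; simp)
    qed
  qed (use e0 wc in \<open>auto simp: y_def intro!: mult_mat_vec_carrier[of _ 3 3] vc\<close>)
qed

section \<open>Bases of function spaces\<close>

text \<open>The coordinate functionals \<open>c j\<close> are combinations of evaluations, so the matrix coefficients of a
  linear action on \<open>U\<close> are combinations of its values.\<close>

definition dual_basis ::
  "'i set \<Rightarrow> ('i \<Rightarrow> complex) set \<Rightarrow> nat \<Rightarrow> (nat \<Rightarrow> 'i \<Rightarrow> complex) \<Rightarrow> (nat \<Rightarrow> 'i \<Rightarrow> complex) \<Rightarrow> bool" where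
  "dual_basis S U m b c \<longleftrightarrow> (\<forall>j<m. b j \<in> U) \<and>
    (\<forall>i<m. \<forall>j<m. (\<Sum>s\<in>S. c i s * b j s) = (if i = j then 1 else 0)) \<and>
    (\<forall>u\<in>U. \<forall>s. u s = (\<Sum>j<m. (\<Sum>s\<in>S. c j s * u s) * b j s))"

lemma dual_basisD:
  assumes "dual_basis S U m b c"
  shows "\<And>j. j < m \<Longrightarrow> b j \<in> U"
    "\<And>i j. i < m \<Longrightarrow> j < m \<Longrightarrow> (\<Sum>s\<in>S. c i s * b j s) = (if i = j then 1 else 0)"
    "\<And>u s. u \<in> U \<Longrightarrow> u s = (\<Sum>j<m. (\<Sum>s\<in>S. c j s * u s) * b j s)"
  using assms unfolding dual_basis_def by blast+

text \<open>Induction on the support. The functions in \<open>U\<close> that vanish at the new point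
  \<open>a\<close> form a subspace \<open>U0\<close> of codimension at most one; if it is proper,
  one further function \<open>u1\<close> with value 1 at \<open>a\<close> completes a basis.\<close>

lemma function_space_basis:
  fixes U :: "('i \<Rightarrow> complex) set"
  assumes "finite S" "\<And>u s. u \<in> U \<Longrightarrow> s \<notin> S \<Longrightarrow> u s = 0" "(\<lambda>s. 0) \<in> U"
    and "\<And>u v. u \<in> U \<Longrightarrow> v \<in> U \<Longrightarrow> (\<lambda>s. u s + v s) \<in> U" "\<And>x u. u \<in> U \<Longrightarrow> (\<lambda>s. x * u s) \<in> U"
  shows "\<exists>m b c. dual_basis S U m b c"
  using assms
proof (induction S arbitrary: U rule: finite_induct)
  case empty
  then show ?case by (intro exI[of _ "0 :: nat"]) (auto simp: dual_basis_def)
next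
  case (insert a S)
  define U0 where "U0 = {u \<in> U. u a = 0}"
  have "\<exists>m b c. dual_basis S U0 m b c"
  proof (rule insert.IH)
    fix u s assume u: "u \<in> U0" and s: "s \<notin> S"
    show "u s = 0"
    proof (cases "s = a")
      case False
      then have "s \<notin> insert a S" using s by simp
      then show ?thesis using insert.prems(1)[of u s] u by (simp add: U0_def)
    qed (use u in \<open>simp add: U0_def\<close>)
  qed (use insert.prems(2,3,4) in \<open>auto simp: U0_def\<close>)
  then obtain m b c where basis: "dual_basis S U0 m b c" by blast
  note b = dual_basisD(1)[OF basis] and dual = dual_basisD(2)[OF basis] and expand = dual_basisD(3)[OF basis]
  show ?case
  proof (cases "U = U0")
    case True
    have e: "(\<Sum>s\<in>insert a S. c j s * u s) = (\<Sum>s\<in>S. c j s * u s)" if "u \<in> U0" for j u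
      using insert.hyps that by (simp add: U0_def)
    show ?thesis
      unfolding True dual_basis_def
    proof (rule exI[of _ m], rule exI[of _ b], rule exI[of _ c], intro conjI allI impI ballI)
      show "(\<Sum>s\<in>insert a S. c i s * b j s) = (if i = j then 1 else 0)" if "i < m" "j < m" for i j
        unfolding e[OF b[OF that(2)]] by (rule dual[OF that])
      show "u s = (\<Sum>j<m. (\<Sum>s\<in>insert a S. c j s * u s) * b j s)" if "u \<in> U0" for u s
        unfolding e[OF that] by (rule expand[OF that])
    qed (rule b)
  next
    case False
    then obtain u0 where u0: "u0 \<in> U" "u0 a \<noteq> 0" by (auto simp: U0_def)
    define u1 where "u1 = (\<lambda>s. inverse (u0 a) * u0 s)"
    have u1: "u1 \<in> U" "u1 a = 1" using insert.prems(4)[OF u0(1)] u0(2) by (auto simp: u1_def)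
    define b' where "b' j = (if j < m then b j else u1)" for j
    \<comment> \<open>For \<open>j < m\<close> these are the coefficients of the old functional
      composed with the projection \<open>red\<close> along \<open>u1\<close>; the last functional
      is evaluation at \<open>a\<close>.\<close>
    define c' where "c' j s = (if j < m then (if s = a then - (\<Sum>t\<in>S. c j t * u1 t) else c j s)
      else (if s = a then 1 else 0))" for j s
    define red where "red u = (\<lambda>s. u s - u a * u1 s)" for u :: "'i \<Rightarrow> complex"
    have red: "red u \<in> U0" if "u \<in> U" for u
      using insert.prems(3)[OF that insert.prems(4)[OF u1(1), of "- u a"]] u1(2)
      by (simp add: U0_def red_def)
    have f1: "(\<Sum>s\<in>insert a S. c' j s * u s) = (\<Sum>s\<in>S. c j s * red u s)" if "j < m" for j u
    proof -
      have "(\<Sum>s\<in>insert a S. c' j s * u s) = - (\<Sum>t\<in>S. c j t * u1 t) * u a + (\<Sum>s\<in>S. c' j s * u s)"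
        using insert.hyps that by (simp add: c'_def)
      also have "(\<Sum>s\<in>S. c' j s * u s) = (\<Sum>s\<in>S. c j s * u s)"
        using insert.hyps that by (intro sum.cong) (auto simp: c'_def)
      finally show ?thesis by (simp add: red_def algebra_simps sum_subtractf sum_distrib_left)
    qed
    have f2: "(\<Sum>s\<in>insert a S. c' m s * u s) = u a" for u
    proof -
      have "(\<Sum>s\<in>S. c' m s * u s) = 0"
        using insert.hyps by (intro sum.neutral) (auto simp: c'_def)
      then show ?thesis using insert.hyps by (simp add: c'_def)
    qed
    have redb: "red (b j) = b j" if "j < m" for j using b[OF that] by (auto simp: red_def U0_def)
    have redu: "red u1 = (\<lambda>s. 0)" by (auto simp: red_def u1(2))
    show ?thesis unfolding dual_basis_def
    proof (rule exI[of _ "Suc m"], rule exI[of _ b'], rule exI[of _ c'], intro conjI allI impI ballI)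
      show "b' j \<in> U" if "j < Suc m" for j using b[of j] u1(1) by (auto simp: b'_def U0_def)
      show "(\<Sum>s\<in>insert a S. c' i s * b' j s) = (if i = j then 1 else 0)" if "i < Suc m" "j < Suc m" for i j
      proof (cases "i < m")
        case True
        then show ?thesis unfolding f1[OF True] using dual[OF True, of j] redb[of j] redu that by (auto simp: b'_def)
      next
        case False
        then have "i = m" using that by simp
        then show ?thesis using b[of j] u1(2) that by (auto simp: f2 b'_def U0_def)
      qed
      show "u s = (\<Sum>j<Suc m. (\<Sum>s\<in>insert a S. c' j s * u s) * b' j s)" if u: "u \<in> U" for u s
      proof -
        have "(\<Sum>j<Suc m. (\<Sum>s\<in>insert a S. c' j s * u s) * b' j s) =
            (\<Sum>j<m. (\<Sum>s\<in>S. c j s * red u s) * b j s) + u a * u1 s"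
          by (simp add: f1 f2 b'_def)
        also have "(\<Sum>j<m. (\<Sum>s\<in>S. c j s * red u s) * b j s) = red u s" by (rule expand[OF red[OF u], symmetric])
        finally show ?thesis by (simp add: red_def)
      qed
    qed
  qed
qed

text \<open>A double annihilator argument: the functional \<open>\<phi>\<close> takes a function to
  the value at \<open>s0\<close> of its difference from its projection to \<open>U\<close>. It
  vanishes on \<open>U\<close>, hence by \<open>dual\<close> on \<open>V\<close>, so every
  \<open>t\<close> in \<open>V\<close> agrees with its projection at each \<open>s0\<close>.\<close>

lemma function_space_duality:
  fixes U V :: "('i \<Rightarrow> complex) set"
  assumes fin: "finite S" and supp: "\<And>u s. u \<in> V \<Longrightarrow> s \<notin> S \<Longrightarrow> u s = 0" and UV: "U \<subseteq> V"
    and U: "(\<lambda>s. 0) \<in> U" "\<And>u v. u \<in> U \<Longrightarrow> v \<in> U \<Longrightarrow> (\<lambda>s. u s + v s) \<in> U" "\<And>x u. u \<in> U \<Longrightarrow> (\<lambda>s. x * u s) \<in> U"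
    and dual: "\<And>\<phi> t. (\<And>u. u \<in> U \<Longrightarrow> (\<Sum>s\<in>S. \<phi> s * u s) = 0) \<Longrightarrow> t \<in> V \<Longrightarrow> (\<Sum>s\<in>S. \<phi> s * t s) = 0"
  shows "V \<subseteq> U"
proof
  fix t assume t: "t \<in> V"
  have "\<exists>m b c. dual_basis S U m b c"
    using fin supp[OF subsetD[OF UV]] U by (rule function_space_basis)
  then obtain m b c where basis: "dual_basis S U m b c" by blast
  note b = dual_basisD(1)[OF basis] and expand = dual_basisD(3)[OF basis]
  have "t s0 = (\<Sum>j<m. (\<Sum>s\<in>S. c j s * t s) * b j s0)" for s0
  proof (cases "s0 \<in> S")
    case True
    define \<phi> where "\<phi> s = (if s = s0 then 1 else 0) - (\<Sum>j<m. c j s * b j s0)" for s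
    have \<phi>: "(\<Sum>s\<in>S. \<phi> s * u s) = u s0 - (\<Sum>j<m. (\<Sum>s\<in>S. c j s * u s) * b j s0)" for u
    proof -
      have "(\<Sum>s\<in>S. \<phi> s * u s) = (\<Sum>s\<in>S. if s = s0 then u s else 0) - (\<Sum>s\<in>S. \<Sum>j<m. c j s * u s * b j s0)"
        unfolding sum_subtractf[symmetric]
      proof (intro sum.cong refl)
        fix s
        have "(\<Sum>j<m. c j s * b j s0) * u s = (\<Sum>j<m. c j s * u s * b j s0)"
          unfolding sum_distrib_right by (intro sum.cong refl) (simp add: ac_simps)
        then show "\<phi> s * u s = (if s = s0 then u s else 0) - (\<Sum>j<m. c j s * u s * b j s0)"
          by (simp add: \<phi>_def left_diff_distrib)
      qed
      also have "(\<Sum>s\<in>S. \<Sum>j<m. c j s * u s * b j s0) = (\<Sum>j<m. (\<Sum>s\<in>S. c j s * u s) * b j s0)"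
        by (subst sum.swap) (simp add: sum_distrib_right)
      finally show ?thesis using True fin by simp
    qed
    have "(\<Sum>s\<in>S. \<phi> s * t s) = 0"
      using t by (rule dual[rotated]) (simp add: \<phi> expand[symmetric])
    then show ?thesis unfolding \<phi> by simp
  next
    case False
    then have "b j s0 = 0" if "j < m" for j using supp UV b[OF that] by blast
    then show ?thesis using supp[OF t False] by simp
  qed
  then have eq: "t = (\<lambda>s0. \<Sum>j<m. (\<Sum>s\<in>S. c j s * t s) * b j s0)" by blast
  have mem: "(\<lambda>s0. \<Sum>j<k. (\<Sum>s\<in>S. c j s * t s) * b j s0) \<in> U" if "k \<le> m" for k
    using that by (induction k) (use U b in auto)
  show "t \<in> U" by (rule back_subst[of "\<lambda>x. x \<in> U", OF mem[OF order_refl] eq[symmetric]])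
qed

section \<open>The tensor action\<close>

text \<open>The entry at \<open>(I, I')\<close> of the \<open>a\<close>-th tensor power of
  \<open>A\<close>.\<close>

definition mono_coeff :: "nat \<Rightarrow> complex mat \<Rightarrow> nat list \<Rightarrow> nat list \<Rightarrow> complex" where
  "mono_coeff a A I I' = (\<Prod>p<a. A $$ (I ! p, I' ! p))"

lemma mono_coeff_0 [simp]: "mono_coeff 0 A I I' = 1"
  by (simp add: mono_coeff_def)

lemma mono_coeff_Cons [simp]: "mono_coeff (Suc a) A (i # I) (j # J) = A $$ (i, j) * mono_coeff a A I J"
  unfolding mono_coeff_def by (subst prod.lessThan_Suc_shift) simp

lemma indices_0 [simp]: "indices 0 = {[]}"
  by (auto simp: indices_def)

lemma Cons_in_indices [simp]: "k # I \<in> indices (Suc a) \<longleftrightarrow> k < 3 \<and> I \<in> indices a"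
  by (auto simp: indices_def)

lemma Cons_notin_indices_0 [simp]: "k # I \<notin> indices 0"
  by simp

lemma indices_Suc: "indices (Suc a) = (\<lambda>(k, I). k # I) ` ({..<3} \<times> indices a)"
proof (intro equalityI subsetI)
  fix I assume "I \<in> indices (Suc a)"
  then show "I \<in> (\<lambda>(k, I). k # I) ` ({..<3} \<times> indices a)" by (cases I) (auto simp: indices_def)
qed auto

lemma finite_indices [simp]: "finite (indices a)"
  by (induction a) (auto simp: indices_Suc)

lemma sum_indices_Suc: "(\<Sum>I\<in>indices (Suc a). f I) = (\<Sum>k<3. \<Sum>I\<in>indices a. f (k # I))"
proof -
  have "(\<Sum>I\<in>indices (Suc a). f I) = (\<Sum>x\<in>{..<3} \<times> indices a. f (fst x # snd x))"
    unfolding indices_Suc by (subst sum.reindex) (auto simp: inj_on_def case_prod_beta)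
  then show ?thesis by (simp add: sum.cartesian_product case_prod_beta)
qed

lemma indices_cases:
  assumes "I \<in> indices (Suc a)"
  obtains k I' where "I = k # I'" "k < 3" "I' \<in> indices a"
  using assms by (auto simp: indices_Suc)

lemma mono_coeff_mult:
  assumes "A \<in> carrier_mat 3 3" "B \<in> carrier_mat 3 3" "I \<in> indices a" "I'' \<in> indices a"
  shows "(\<Sum>I'\<in>indices a. mono_coeff a A I I' * mono_coeff a B I' I'') = mono_coeff a (A * B) I I''"
  using assms(3,4)
proof (induction a arbitrary: I I'')
  case (Suc a)
  obtain i J where I: "I = i # J" "i < 3" "J \<in> indices a" using Suc.prems(1) by (rule indices_cases)
  obtain k K where I'': "I'' = k # K" "k < 3" "K \<in> indices a" using Suc.prems(2) by (rule indices_cases)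
  have "(\<Sum>I'\<in>indices (Suc a). mono_coeff (Suc a) A I I' * mono_coeff (Suc a) B I' I'') =
      (\<Sum>l<3. A $$ (i, l) * B $$ (l, k)) * (\<Sum>L\<in>indices a. mono_coeff a A J L * mono_coeff a B L K)"
    unfolding I(1) I''(1) sum_indices_Suc sum_product by (simp add: algebra_simps)
  also have "(\<Sum>l<3. A $$ (i, l) * B $$ (l, k)) = (A * B) $$ (i, k)"
    by (rule mult_mat_index[symmetric]) (use assms I I'' in auto)
  finally show ?case using Suc.IH[OF I(3) I''(3)] by (simp add: I(1) I''(1) del: index_mult_mat)
qed simp

lemma mono_coeff_one:
  "I \<in> indices a \<Longrightarrow> I' \<in> indices a \<Longrightarrow> mono_coeff a (1\<^sub>m 3) I I' = (if I = I' then 1 else 0)"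
proof (induction a arbitrary: I I')
  case (Suc a)
  obtain i J where I: "I = i # J" "i < 3" "J \<in> indices a" using Suc.prems(1) by (rule indices_cases)
  obtain k K where I': "I' = k # K" "k < 3" "K \<in> indices a" using Suc.prems(2) by (rule indices_cases)
  show ?case using Suc.IH[OF I(3) I'(3)] I I' by simp
qed simp

lemma tensor_action_eq:
  assumes "I \<in> indices a" "J \<in> indices b"
  shows "tensor_action a b g t I J = (\<Sum>I'\<in>indices a. \<Sum>J'\<in>indices b.
    mono_coeff a g I I' * mono_coeff b (inv\<^bsub>SL 3\<^esub> g) J' J * t I' J')"
  using assms by (simp add: tensor_action_def mono_coeff_def)

lemma tensor_action_outside:
  "I \<notin> indices a \<or> J \<notin> indices b \<Longrightarrow> tensor_action a b g t I J = 0"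
  by (auto simp: tensor_action_def)

lemma tensor_action_sum:
  "finite X \<Longrightarrow> tensor_action a b g (\<lambda>I J. \<Sum>x\<in>X. c x * t x I J) I J = (\<Sum>x\<in>X. c x * tensor_action a b g (t x) I J)"
proof (cases "I \<in> indices a \<and> J \<in> indices b")
  case True
  assume X: "finite X"
  have "tensor_action a b g (\<lambda>I J. \<Sum>x\<in>X. c x * t x I J) I J =
      (\<Sum>I'\<in>indices a. \<Sum>J'\<in>indices b. \<Sum>x\<in>X. c x * (mono_coeff a g I I' * mono_coeff b (inv\<^bsub>SL 3\<^esub> g) J' J * t x I' J'))"
    using True by (simp add: tensor_action_eq sum_distrib_left mult.assoc mult.left_commute)
  also have "\<dots> = (\<Sum>I'\<in>indices a. \<Sum>x\<in>X. \<Sum>J'\<in>indices b. c x * (mono_coeff a g I I' * mono_coeff b (inv\<^bsub>SL 3\<^esub> g) J' J * t x I' J'))"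
    by (intro sum.cong refl sum.swap)
  also have "\<dots> = (\<Sum>x\<in>X. \<Sum>I'\<in>indices a. \<Sum>J'\<in>indices b. c x * (mono_coeff a g I I' * mono_coeff b (inv\<^bsub>SL 3\<^esub> g) J' J * t x I' J'))"
    by (rule sum.swap)
  finally show ?thesis using True by (simp add: tensor_action_eq sum_distrib_left)
qed (simp add: tensor_action_outside)

lemma tensor_action_mult:
  assumes g: "g \<in> carrier (SL 3)" and h: "h \<in> carrier (SL 3)"
  shows "tensor_action a b (g * h) t = tensor_action a b g (tensor_action a b h t)"
proof (intro ext)
  fix I J
  let ?g = "inv\<^bsub>SL 3\<^esub> g" and ?h = "inv\<^bsub>SL 3\<^esub> h"
  have inv: "inv\<^bsub>SL 3\<^esub> (g * h) = ?h * ?g" using group.inv_mult_group[OF group_SL g h] by simp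
  show "tensor_action a b (g * h) t I J = tensor_action a b g (tensor_action a b h t) I J"
  proof (cases "I \<in> indices a \<and> J \<in> indices b")
    case True
    have I: "I \<in> indices a" and J: "J \<in> indices b" using True by auto
    have "tensor_action a b g (tensor_action a b h t) I J =
      (\<Sum>I'\<in>indices a. \<Sum>J'\<in>indices b. mono_coeff a g I I' * mono_coeff b ?g J' J *
        (\<Sum>I''\<in>indices a. \<Sum>J''\<in>indices b. mono_coeff a h I' I'' * mono_coeff b ?h J'' J' * t I'' J''))"
      unfolding tensor_action_eq[OF I J] by (intro sum.cong) (auto simp: tensor_action_eq)
    \<comment> \<open>The interchanges that follow bring together the two sums over intermediate
      indices. Each is an entry of a tensor power of a matrix product, the second with the inverses
      in reversed order, as in the inverse of \<open>g * h\<close>.\<close>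
    also have "\<dots> = (\<Sum>I'\<in>indices a. \<Sum>J'\<in>indices b. \<Sum>I''\<in>indices a. \<Sum>J''\<in>indices b.
        (mono_coeff a g I I' * mono_coeff a h I' I'') * (mono_coeff b ?h J'' J' * mono_coeff b ?g J' J) * t I'' J'')"
      by (simp add: sum_distrib_left algebra_simps)
    also have "\<dots> = (\<Sum>I'\<in>indices a. \<Sum>I''\<in>indices a. \<Sum>J'\<in>indices b. \<Sum>J''\<in>indices b.
        (mono_coeff a g I I' * mono_coeff a h I' I'') * (mono_coeff b ?h J'' J' * mono_coeff b ?g J' J) * t I'' J'')"
      by (intro sum.cong refl sum.swap)
    also have "\<dots> = (\<Sum>I''\<in>indices a. \<Sum>I'\<in>indices a. \<Sum>J'\<in>indices b. \<Sum>J''\<in>indices b.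
        (mono_coeff a g I I' * mono_coeff a h I' I'') * (mono_coeff b ?h J'' J' * mono_coeff b ?g J' J) * t I'' J'')"
      by (rule sum.swap)
    also have "\<dots> = (\<Sum>I''\<in>indices a. \<Sum>I'\<in>indices a. \<Sum>J''\<in>indices b. \<Sum>J'\<in>indices b.
        (mono_coeff a g I I' * mono_coeff a h I' I'') * (mono_coeff b ?h J'' J' * mono_coeff b ?g J' J) * t I'' J'')"
      by (intro sum.cong refl sum.swap)
    also have "\<dots> = (\<Sum>I''\<in>indices a. \<Sum>J''\<in>indices b. \<Sum>I'\<in>indices a. \<Sum>J'\<in>indices b.
        (mono_coeff a g I I' * mono_coeff a h I' I'') * (mono_coeff b ?h J'' J' * mono_coeff b ?g J' J) * t I'' J'')"
      by (intro sum.cong refl sum.swap)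
    also have "\<dots> = (\<Sum>I''\<in>indices a. \<Sum>J''\<in>indices b. (\<Sum>I'\<in>indices a. mono_coeff a g I I' * mono_coeff a h I' I'') *
        (\<Sum>J'\<in>indices b. mono_coeff b ?h J'' J' * mono_coeff b ?g J' J) * t I'' J'')"
      by (intro sum.cong refl, subst sum_product) (simp only: sum_distrib_right)
    also have "\<dots> = tensor_action a b (g * h) t I J"
      unfolding tensor_action_eq[OF I J] inv
      using g h inv_SL(1)[OF g] inv_SL(1)[OF h] I J
      by (intro sum.cong) (auto simp: mono_coeff_mult SL_carrier_mat)
    finally show ?thesis by simp
  qed (simp add: tensor_action_outside)
qed

lemma tensor_action_one:
  assumes "\<And>I J. I \<notin> indices a \<or> J \<notin> indices b \<Longrightarrow> t I J = 0"
  shows "tensor_action a b (1\<^sub>m 3) t = t"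
proof (intro ext)
  fix I J
  have inv: "inv\<^bsub>SL 3\<^esub> (1\<^sub>m 3) = 1\<^sub>m 3" using monoid.inv_one[OF group.is_monoid[OF group_SL[of 3]]] by simp
  show "tensor_action a b (1\<^sub>m 3) t I J = t I J"
  proof (cases "I \<in> indices a \<and> J \<in> indices b")
    case True
    have "tensor_action a b (1\<^sub>m 3) t I J =
        (\<Sum>I'\<in>indices a. \<Sum>J'\<in>indices b. (if I' = I then (if J' = J then t I' J' else 0) else 0))"
      using True unfolding inv by (simp only: tensor_action_eq inv) (intro sum.cong, auto simp: mono_coeff_one)
    also have "\<dots> = (\<Sum>I'\<in>indices a. if I' = I then t I' J else 0)"
      using True by (intro sum.cong) (auto simp: sum.delta)
    also have "\<dots> = t I J" using True by (simp add: sum.delta)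
    finally show ?thesis .
  qed (use assms tensor_action_outside in auto)
qed

section \<open>Compatibility of the action with symmetry and contraction\<close>

lemma permute_indices:
  assumes "p permutes {..<a}" "I \<in> indices a"
  shows "permute_list p I \<in> indices a"
  using assms by (auto simp: indices_def)

lemma mono_coeff_permute:
  assumes p: "p permutes {..<a}" and "I \<in> indices a" "I' \<in> indices a"
  shows "mono_coeff a A (permute_list p I) (permute_list p I') = mono_coeff a A I I'"
proof -
  have "length I = a" "length I' = a" using assms(2,3) by (auto simp: indices_def)
  then have "mono_coeff a A (permute_list p I) (permute_list p I') = (\<Prod>q<a. A $$ (I ! p q, I' ! p q))"
    using p unfolding mono_coeff_def by (intro prod.cong) (auto simp: permute_list_nth)
  also have "\<dots> = mono_coeff a A I I'"
    unfolding mono_coeff_def using prod.permute[OF p, of "\<lambda>q. A $$ (I ! q, I' ! q)"] by (simp add: comp_def)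
  finally show ?thesis .
qed

lemma permute_list_bij:
  assumes p: "p permutes {..<a}"
  shows "bij_betw (permute_list p) (indices a) (indices a)"
proof -
  have "inj_on (permute_list p) (indices a)"
  proof (rule inj_onI)
    fix I I' assume I: "I \<in> indices a" "I' \<in> indices a" and eq: "permute_list p I = permute_list p I'"
    have len: "length I = a" "length I' = a" using I by (auto simp: indices_def)
    show "I = I'"
    proof (rule nth_equalityI)
      fix q assume "q < length I"
      then obtain r where r: "r < a" "q = p r" using p len permutes_image[OF p] by (metis imageE lessThan_iff)
      show "I ! q = I' ! q" using arg_cong[OF eq, of "\<lambda>L. L ! r"] r len p by (simp add: permute_list_nth)
    qed (simp add: len)
  qed
  moreover have "permute_list p ` indices a \<subseteq> indices a" using permute_indices[OF p] by blast
  ultimately show ?thesis using finite_indices by (metis bij_betw_def endo_inj_surj)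
qed

text \<open>Permuting both index lists of \<open>mono_coeff\<close> by the same permutation does not
  change it. Reindexing the sums moves the permutation onto \<open>t\<close>, where symmetry absorbs
  it.\<close>

lemma tensor_action_sym:
  assumes t: "t \<in> sym_tensors a b"
  shows "tensor_action a b g t \<in> sym_tensors a b"
  unfolding sym_tensors_def
proof (intro CollectI conjI allI impI)
  show "tensor_action a b g t I J = 0" if "I \<notin> indices a \<or> J \<notin> indices b" for I J
    using that by (rule tensor_action_outside)
  have sym: "t I J = t I' J'" if "mset I = mset I'" "mset J = mset J'" for I I' J J'
    using t that unfolding sym_tensors_def by blast
  fix I I' J J' :: "nat list" assume mI: "mset I = mset I'" and mJ: "mset J = mset J'"
  have len: "length I = length I'" "length J = length J'" "set I = set I'" "set J = set J'"
    using mset_eq_length[OF mI] mset_eq_length[OF mJ] mset_eq_setD[OF mI] mset_eq_setD[OF mJ] by blast+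
  show "tensor_action a b g t I J = tensor_action a b g t I' J'"
  proof (cases "I' \<in> indices a \<and> J' \<in> indices b")
    case True
    then have I': "I' \<in> indices a" "length I' = a" and J': "J' \<in> indices b" "length J' = b" by (auto simp: indices_def)
    obtain p where p: "p permutes {..<a}" "permute_list p I' = I" using mset_eq_permutation[OF mI] I'(2) by auto
    obtain q where q: "q permutes {..<b}" "permute_list q J' = J" using mset_eq_permutation[OF mJ] J'(2) by auto
    have I: "I \<in> indices a" and J: "J \<in> indices b" using True len by (auto simp: indices_def)
    have "tensor_action a b g t I J = (\<Sum>K\<in>indices a. \<Sum>L\<in>indices b.
        mono_coeff a g I (permute_list p K) * mono_coeff b (inv\<^bsub>SL 3\<^esub> g) (permute_list q L) J * t (permute_list p K) (permute_list q L))"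
      unfolding tensor_action_eq[OF I J]
      by (subst sum.reindex_bij_betw[OF permute_list_bij[OF p(1)], symmetric])
         (subst sum.reindex_bij_betw[OF permute_list_bij[OF q(1)], symmetric], rule refl)
    also have "\<dots> = (\<Sum>K\<in>indices a. \<Sum>L\<in>indices b.
        mono_coeff a g I' K * mono_coeff b (inv\<^bsub>SL 3\<^esub> g) L J' * t K L)"
    proof (intro sum.cong refl)
      fix K L assume KL: "K \<in> indices a" "L \<in> indices b"
      have "mset (permute_list p K) = mset K" "mset (permute_list q L) = mset L"
        using KL p(1) q(1) by (auto simp: indices_def)
      then have "t (permute_list p K) (permute_list q L) = t K L" by (rule sym)
      then show "mono_coeff a g I (permute_list p K) * mono_coeff b (inv\<^bsub>SL 3\<^esub> g) (permute_list q L) J * t (permute_list p K) (permute_list q L) =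
          mono_coeff a g I' K * mono_coeff b (inv\<^bsub>SL 3\<^esub> g) L J' * t K L"
        using mono_coeff_permute[OF p(1) I'(1) KL(1), of g] mono_coeff_permute[OF q(1) KL(2) J'(1), of "inv\<^bsub>SL 3\<^esub> g"]
        by (simp add: p(2) q(2))
    qed
    finally show ?thesis unfolding tensor_action_eq[OF I'(1) J'(1)] .
  next
    case False
    then have "I \<notin> indices a \<or> J \<notin> indices b" using len by (auto simp: indices_def)
    then show ?thesis using False tensor_action_outside by metis
  qed
qed

text \<open>Summing over the contracted index multiplies the inverse of \<open>g\<close> by
  \<open>g\<close>. The resulting Kronecker delta leaves a contraction of \<open>t\<close>, which is
  zero.\<close>

lemma tensor_action_contraction:
  assumes g: "g \<in> carrier (SL 3)" and t: "t \<in> Gamma a b"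
  shows "contraction (tensor_action a b g t) = (\<lambda>I J. 0)"
proof (intro ext)
  fix I J
  show "contraction (tensor_action a b g t) I J = 0"
  proof (cases "\<exists>a' b'. a = Suc a' \<and> b = Suc b' \<and> I \<in> indices a' \<and> J \<in> indices b'")
    case True
    then obtain a' b' where ab: "a = Suc a'" "b = Suc b'" and I: "I \<in> indices a'" and J: "J \<in> indices b'" by blast
    let ?g = "inv\<^bsub>SL 3\<^esub> g"
    have tr: "(\<Sum>k<3. t (k # I') (k # J')) = 0" for I' J'
    proof -
      have "contraction t I' J' = 0" using t by (simp add: Gamma_def)
      then show ?thesis by (simp add: contraction_def)
    qed
    have gg: "(\<Sum>k<3. ?g $$ (j, k) * g $$ (k, i)) = (if j = i then 1 else 0)" if "i < 3" "j < 3" for i j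
      using mult_mat_index[of ?g 3 3 g 3 j i] inv_SL[OF g] g that by (simp add: SL_carrier_mat del: index_mult_mat)
    have "contraction (tensor_action a b g t) I J =
      (\<Sum>k<3. \<Sum>i<3. \<Sum>I'\<in>indices a'. \<Sum>j<3. \<Sum>J'\<in>indices b'.
        (?g $$ (j, k) * g $$ (k, i)) * (mono_coeff a' g I I' * mono_coeff b' ?g J' J * t (i # I') (j # J')))"
      unfolding contraction_def ab
      by (intro sum.cong refl, subst tensor_action_eq) (use I J in \<open>auto simp: sum_indices_Suc algebra_simps intro!: sum.cong\<close>)
    also have "\<dots> = (\<Sum>i<3. \<Sum>k<3. \<Sum>I'\<in>indices a'. \<Sum>j<3. \<Sum>J'\<in>indices b'.
        (?g $$ (j, k) * g $$ (k, i)) * (mono_coeff a' g I I' * mono_coeff b' ?g J' J * t (i # I') (j # J')))"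
      by (rule sum.swap)
    also have "\<dots> = (\<Sum>i<3. \<Sum>I'\<in>indices a'. \<Sum>k<3. \<Sum>j<3. \<Sum>J'\<in>indices b'.
        (?g $$ (j, k) * g $$ (k, i)) * (mono_coeff a' g I I' * mono_coeff b' ?g J' J * t (i # I') (j # J')))"
      by (intro sum.cong refl sum.swap)
    also have "\<dots> = (\<Sum>i<3. \<Sum>I'\<in>indices a'. \<Sum>j<3. \<Sum>k<3. \<Sum>J'\<in>indices b'.
        (?g $$ (j, k) * g $$ (k, i)) * (mono_coeff a' g I I' * mono_coeff b' ?g J' J * t (i # I') (j # J')))"
      by (intro sum.cong refl sum.swap)
    also have "\<dots> = (\<Sum>i<3. \<Sum>I'\<in>indices a'. \<Sum>j<3. (\<Sum>k<3. ?g $$ (j, k) * g $$ (k, i)) *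
        (\<Sum>J'\<in>indices b'. mono_coeff a' g I I' * mono_coeff b' ?g J' J * t (i # I') (j # J')))"
      by (simp only: sum_product)
    also have "\<dots> = (\<Sum>i<3. \<Sum>I'\<in>indices a'. \<Sum>j<3. if j = i then
        (\<Sum>J'\<in>indices b'. mono_coeff a' g I I' * mono_coeff b' ?g J' J * t (i # I') (j # J')) else 0)"
      by (intro sum.cong) (auto simp: gg)
    also have "\<dots> = (\<Sum>i<3. \<Sum>I'\<in>indices a'. \<Sum>J'\<in>indices b'. mono_coeff a' g I I' * mono_coeff b' ?g J' J * t (i # I') (i # J'))"
      by (intro sum.cong) (auto simp: sum.delta)
    also have "\<dots> = (\<Sum>I'\<in>indices a'. \<Sum>i<3. \<Sum>J'\<in>indices b'. mono_coeff a' g I I' * mono_coeff b' ?g J' J * t (i # I') (i # J'))"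
      by (rule sum.swap)
    also have "\<dots> = (\<Sum>I'\<in>indices a'. \<Sum>J'\<in>indices b'. \<Sum>i<3. mono_coeff a' g I I' * mono_coeff b' ?g J' J * t (i # I') (i # J'))"
      by (intro sum.cong refl sum.swap)
    also have "\<dots> = 0" by (simp add: sum_distrib_left[symmetric] tr)
    finally show ?thesis .
  next
    \<comment> \<open>For all other index lists, and whenever \<open>a\<close> or \<open>b\<close>
      is 0, the entries lie outside the index sets and vanish.\<close>
    case False
    then have "k # I \<notin> indices a \<or> k # J \<notin> indices b" for k
      by (cases a; cases b) auto
    then show ?thesis by (simp add: contraction_def tensor_action_outside)
  qed
qed

lemma tensor_action_Gamma:
  "g \<in> carrier (SL 3) \<Longrightarrow> t \<in> Gamma a b \<Longrightarrow> tensor_action a b g t \<in> Gamma a b"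
  using tensor_action_sym tensor_action_contraction by (auto simp: Gamma_def)

lemma Gamma_outside: "t \<in> Gamma a b \<Longrightarrow> I \<notin> indices a \<or> J \<notin> indices b \<Longrightarrow> t I J = 0"
  unfolding Gamma_def sym_tensors_def by blast

lemma Gamma_iff:
  "t \<in> Gamma a b \<longleftrightarrow> (\<forall>I J. I \<notin> indices a \<or> J \<notin> indices b \<longrightarrow> t I J = 0) \<and>
     (\<forall>I I' J J'. mset I = mset I' \<longrightarrow> mset J = mset J' \<longrightarrow> t I J = t I' J') \<and>
     (\<forall>I J. (\<Sum>k<3. t (k # I) (k # J)) = 0)"
  by (simp add: Gamma_def sym_tensors_def contraction_def fun_eq_iff)

lemma Gamma_sym: "t \<in> Gamma a b \<Longrightarrow> mset I = mset I' \<Longrightarrow> mset J = mset J' \<Longrightarrow> t I J = t I' J'"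
  unfolding Gamma_iff by blast

lemma Gamma_trace: "t \<in> Gamma a b \<Longrightarrow> (\<Sum>k<3. t (k # I) (k # J)) = 0"
  unfolding Gamma_iff by blast

lemma Gamma_zero: "(\<lambda>I J. 0) \<in> Gamma a b"
  unfolding Gamma_iff by simp

lemma Gamma_add:
  assumes t: "t \<in> Gamma a b" and t': "t' \<in> Gamma a b"
  shows "(\<lambda>I J. t I J + t' I J) \<in> Gamma a b"
  unfolding Gamma_iff
proof (intro conjI allI impI)
  show "t I J + t' I J = t I' J' + t' I' J'" if "mset I = mset I'" "mset J = mset J'" for I I' J J'
    using Gamma_sym[OF t that] Gamma_sym[OF t' that] by simp
qed (simp_all add: Gamma_outside[OF t] Gamma_outside[OF t'] sum.distrib Gamma_trace[OF t] Gamma_trace[OF t'])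

lemma Gamma_scale:
  assumes t: "t \<in> Gamma a b"
  shows "(\<lambda>I J. x * t I J) \<in> Gamma a b"
  unfolding Gamma_iff
proof (intro conjI allI impI)
  show "x * t I J = x * t I' J'" if "mset I = mset I'" "mset J = mset J'" for I I' J J'
    using Gamma_sym[OF t that] by simp
qed (simp_all add: Gamma_outside[OF t] sum_distrib_left[symmetric] Gamma_trace[OF t])

section \<open>The representations Gamma\<close>

definition combine :: "(nat \<Rightarrow> nat list \<Rightarrow> nat list \<Rightarrow> complex) \<Rightarrow> complex vec \<Rightarrow> nat list \<Rightarrow> nat list \<Rightarrow> complex" where
  "combine B x = (\<lambda>I J. \<Sum>j<dim_vec x. x $ j * B j I J)"

text \<open>\<open>B\<close> is a basis of \<open>\<Gamma>\<^sub>a\<^sub>,\<^sub>b\<close> with coordinate functionals \<open>c\<close>, and \<open>\<rho>\<close> is the action in this basis.\<close>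

definition Gamma_model ::
  "nat \<Rightarrow> nat \<Rightarrow> nat \<Rightarrow> (complex mat \<Rightarrow> complex mat) \<Rightarrow> (nat \<Rightarrow> nat list \<Rightarrow> nat list \<Rightarrow> complex) \<Rightarrow>
   (nat \<Rightarrow> nat list \<Rightarrow> nat list \<Rightarrow> complex) \<Rightarrow> bool" where
  "Gamma_model a b m \<rho> B c \<longleftrightarrow> rational_rep 3 m \<rho> \<and>
     bij_betw (combine B) (carrier_vec m) (Gamma a b) \<and>
     (\<forall>g\<in>carrier (SL 3). \<forall>x\<in>carrier_vec m. combine B (\<rho> g *\<^sub>v x) = tensor_action a b g (combine B x)) \<and>
     (\<forall>x\<in>carrier_vec m. \<forall>i<m. x $ i = (\<Sum>I\<in>indices a. \<Sum>J\<in>indices b. c i I J * combine B x I J))"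

lemma regular_on_tensor_action:
  "regular_on 3 (carrier (SL 3)) (\<lambda>g. tensor_action a b g t I J)"
proof (cases "I \<in> indices a \<and> J \<in> indices b")
  case True
  have r: "regular_on 3 (carrier (SL 3)) (\<lambda>g. \<Sum>I'\<in>indices a. \<Sum>J'\<in>indices b.
      mono_coeff a g I I' * mono_coeff b (inv\<^bsub>SL 3\<^esub> g) J' J * t I' J')"
    unfolding mono_coeff_def
  proof (intro regular_on_sum regular_on_mult regular_on_prod regular_on_const finite_indices finite_lessThan)
    fix I' J' p assume *: "I' \<in> indices a" "J' \<in> indices b" "p \<in> {..<a}"
    then have "I ! p < 3" "I' ! p < 3" using True by (auto simp: indices_def subset_iff)
    then show "regular_on 3 (carrier (SL 3)) (\<lambda>g. g $$ (I ! p, I' ! p))" by (rule regular_on_entry)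
  next
    fix I' J' q assume *: "I' \<in> indices a" "J' \<in> indices b" "q \<in> {..<b}"
    then have "J ! q < 3" "J' ! q < 3" using True by (auto simp: indices_def subset_iff)
    then show "regular_on 3 (carrier (SL 3)) (\<lambda>g. (inv\<^bsub>SL 3\<^esub> g) $$ (J' ! q, J ! q))"
      by (intro regular_on_inv_entry)
  qed
  show ?thesis by (rule regular_on_cong[OF r]) (use True in \<open>simp add: tensor_action_eq\<close>)
next
  case False
  show ?thesis by (rule regular_on_cong[OF regular_on_const[of 3 _ 0]]) (use False in \<open>auto simp: tensor_action_outside\<close>)
qed

text \<open>The dimension is left abstract: a basis and its coordinate functionals come from
  \<open>function_space_basis\<close>, applied to tensors read as functions of the pair
  \<open>(I, J)\<close>. The entries of \<open>\<rho> g\<close> are fixed combinations of values of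
  \<open>tensor_action\<close>, hence regular.\<close>

lemma Gamma_model_exists: "\<exists>m \<rho> B c. Gamma_model a b m \<rho> B c"
proof -
  let ?S = "indices a \<times> indices b"
  define U where "U = {u. (\<lambda>I J. u (I, J)) \<in> Gamma a b}"
  have "\<exists>m b0 c0. dual_basis ?S U m b0 c0"
  proof (rule function_space_basis)
    show "u s = 0" if "u \<in> U" "s \<notin> ?S" for u s
    proof -
      obtain I J where s: "s = (I, J)" by fastforce
      have "I \<notin> indices a \<or> J \<notin> indices b" using that(2) s by simp
      then show ?thesis using Gamma_outside[of "\<lambda>I J. u (I, J)" a b I J] that(1) s by (simp add: U_def)
    qed
  qed (auto simp: U_def Gamma_zero intro: Gamma_add Gamma_scale)
  then obtain m b0 c0 where basis: "dual_basis ?S U m b0 c0" by blast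
  define B where "B j I J = b0 j (I, J)" for j I J
  define c where "c j I J = c0 j (I, J)" for j I J
  define f where "f j t = (\<Sum>I\<in>indices a. \<Sum>J\<in>indices b. c j I J * t I J)" for j and t :: "nat list \<Rightarrow> nat list \<Rightarrow> complex"
  have fS: "(\<Sum>s\<in>?S. c0 j s * u s) = f j (\<lambda>I J. u (I, J))" for j u
    by (simp add: f_def c_def sum.cartesian_product case_prod_beta)
  have B: "B j \<in> Gamma a b" if "j < m" for j
    using dual_basisD(1)[OF basis that] by (simp add: U_def B_def[abs_def])
  have dual: "f i (B j) = (if i = j then 1 else 0)" if "i < m" "j < m" for i j
    using dual_basisD(2)[OF basis that] unfolding fS by (simp add: B_def[abs_def])
  have expand: "t I J = (\<Sum>j<m. f j t * B j I J)" if "t \<in> Gamma a b" for t I J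
    using dual_basisD(3)[OF basis, of "\<lambda>(I, J). t I J" "(I, J)"] that unfolding fS by (simp add: U_def B_def)
  have f_sum: "f i (\<lambda>I J. \<Sum>x\<in>X. y x * t x I J) = (\<Sum>x\<in>X. y x * f i (t x))" if "finite X" for i X y t
  proof -
    have "f i (\<lambda>I J. \<Sum>x\<in>X. y x * t x I J) = (\<Sum>I\<in>indices a. \<Sum>x\<in>X. \<Sum>J\<in>indices b. y x * (c i I J * t x I J))"
      unfolding f_def by (intro sum.cong refl, subst sum.swap) (simp add: sum_distrib_left mult.left_commute)
    also have "\<dots> = (\<Sum>x\<in>X. \<Sum>I\<in>indices a. \<Sum>J\<in>indices b. y x * (c i I J * t x I J))" by (rule sum.swap)
    finally show ?thesis by (simp add: f_def sum_distrib_left)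
  qed
  define R where "R g i j = f i (tensor_action a b g (B j))" for g i j
  define \<rho> where "\<rho> = (\<lambda>g. mat m m (\<lambda>(i, j). R g i j))"
  have actB: "tensor_action a b g (B j) = (\<lambda>I J. \<Sum>k<m. R g k j * B k I J)" if "g \<in> carrier (SL 3)" "j < m" for g j
    using expand[OF tensor_action_Gamma[OF that(1) B[OF that(2)]]] by (auto simp: R_def)
  have rep: "rational_rep 3 m \<rho>"
    unfolding \<rho>_def
  proof (rule rational_repI)
    fix g h i j assume g: "g \<in> carrier (SL 3)" and h: "h \<in> carrier (SL 3)" and ij: "i < m" "j < m"
    have "tensor_action a b (g * h) (B j) = (\<lambda>I J. \<Sum>k<m. R h k j * tensor_action a b g (B k) I J)"
      unfolding tensor_action_mult[OF g h] actB[OF h ij(2)] by (intro ext tensor_action_sum) simp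
    then show "R (g * h) i j = (\<Sum>k<m. R g i k * R h k j)"
      unfolding R_def[of "g * h"] by (simp only: f_sum[OF finite_lessThan]) (simp add: R_def mult.commute)
  next
    show "R (1\<^sub>m 3) i j = (if i = j then 1 else 0)" if "i < m" "j < m" for i j
      unfolding R_def using tensor_action_one[of a b "B j"] Gamma_outside[OF B[OF that(2)]] dual[OF that] by simp
    show "regular_on 3 (carrier (SL 3)) (\<lambda>g. R g i j)" for i j
      unfolding R_def f_def by (intro regular_on_sum regular_on_mult regular_on_const regular_on_tensor_action) auto
  qed
  have comb: "combine B x = (\<lambda>I J. \<Sum>j<m. x $ j * B j I J)" if "x \<in> carrier_vec m" for x
    using that by (simp add: combine_def)
  have combG: "combine B x \<in> Gamma a b" if x: "x \<in> carrier_vec m" for x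
  proof -
    have "(\<lambda>I J. \<Sum>j<k. x $ j * B j I J) \<in> Gamma a b" if "k \<le> m" for k
      using that
    proof (induction k)
      case 0
      then show ?case using Gamma_zero by simp
    next
      case (Suc k)
      then show ?case using Gamma_add[OF Suc.IH Gamma_scale[OF B[of k], of "x $ k"]] by simp
    qed
    then show ?thesis unfolding comb[OF x] by blast
  qed
  have coord: "f i (combine B x) = x $ i" if x: "x \<in> carrier_vec m" and i: "i < m" for x i
  proof -
    have "f i (combine B x) = (\<Sum>j<m. x $ j * f i (B j))" unfolding comb[OF x] by (rule f_sum) simp
    also have "\<dots> = (\<Sum>j<m. if i = j then x $ j else 0)" using i by (intro sum.cong) (auto simp: dual)
    finally show ?thesis using i by simp
  qed
  have bij: "bij_betw (combine B) (carrier_vec m) (Gamma a b)"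
  proof (rule bij_betw_byWitness[where f' = "\<lambda>t. vec m (\<lambda>j. f j t)"])
    show "\<forall>x\<in>carrier_vec m. vec m (\<lambda>j. f j (combine B x)) = x"
      using coord by (auto intro!: eq_vecI)
    show "\<forall>t\<in>Gamma a b. combine B (vec m (\<lambda>j. f j t)) = t"
      using expand by (auto simp: combine_def)
  qed (use combG in auto)
  have "combine B (\<rho> g *\<^sub>v x) = tensor_action a b g (combine B x)" if g: "g \<in> carrier (SL 3)" and x: "x \<in> carrier_vec m" for g x
  proof -
    have rx: "\<rho> g *\<^sub>v x \<in> carrier_vec m" using x mult_mat_vec_carrier[of "\<rho> g" m m x] by (simp add: \<rho>_def)
    have rxi: "(\<rho> g *\<^sub>v x) $ i = (\<Sum>j<m. R g i j * x $ j)" if "i < m" for i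
      using mult_mat_vec_index[of "\<rho> g" m m x i] x that by (simp add: \<rho>_def)
    have "tensor_action a b g (combine B x) = (\<lambda>I J. \<Sum>j<m. x $ j * tensor_action a b g (B j) I J)"
      unfolding comb[OF x] by (intro ext tensor_action_sum) simp
    also have "\<dots> = (\<lambda>I J. \<Sum>j<m. \<Sum>k<m. R g k j * x $ j * B k I J)"
      by (intro ext sum.cong) (auto simp: actB[OF g] sum_distrib_left algebra_simps)
    also have "\<dots> = (\<lambda>I J. \<Sum>k<m. \<Sum>j<m. R g k j * x $ j * B k I J)"
      by (intro ext sum.swap)
    also have "\<dots> = combine B (\<rho> g *\<^sub>v x)"
      unfolding comb[OF rx] by (intro ext sum.cong) (auto simp: rxi sum_distrib_right simp del: index_mult_mat_vec)
    finally show ?thesis by simp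
  qed
  then have "Gamma_model a b m \<rho> B c"
    unfolding Gamma_model_def using rep bij coord by (auto simp: f_def)
  then show ?thesis by blast
qed

context
  fixes a b m \<rho> B c
  assumes model: "Gamma_model a b m \<rho> B c"
begin

lemma model_rep: "rational_rep 3 m \<rho>"
  and model_bij: "bij_betw (combine B) (carrier_vec m) (Gamma a b)"
  and model_action: "g \<in> carrier (SL 3) \<Longrightarrow> x \<in> carrier_vec m \<Longrightarrow> combine B (\<rho> g *\<^sub>v x) = tensor_action a b g (combine B x)"
  and model_coord: "x \<in> carrier_vec m \<Longrightarrow> i < m \<Longrightarrow> x $ i = (\<Sum>I\<in>indices a. \<Sum>J\<in>indices b. c i I J * combine B x I J)"
  using model unfolding Gamma_model_def by blast+

lemma combine_add: "x \<in> carrier_vec m \<Longrightarrow> y \<in> carrier_vec m \<Longrightarrow> combine B (x + y) = (\<lambda>I J. combine B x I J + combine B y I J)"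
  unfolding combine_def by (auto simp: distrib_right sum.distrib)

lemma combine_scale: "x \<in> carrier_vec m \<Longrightarrow> combine B (d \<cdot>\<^sub>v x) = (\<lambda>I J. d * combine B x I J)"
  unfolding combine_def by (auto simp: sum_distrib_left mult.assoc)

lemma combine_zero: "combine B (0\<^sub>v m) = (\<lambda>I J. 0)"
  by (simp add: combine_def)

lemma model_isomorphic: "isomorphic_to_Gamma m \<rho> a b"
  unfolding isomorphic_to_Gamma_def
  by (rule exI[of _ "combine B"]) (use model_bij combine_add combine_scale model_action in auto)

lemma model_Gamma: "x \<in> carrier_vec m \<Longrightarrow> combine B x \<in> Gamma a b"
  using bij_betwE[OF model_bij] by blast

lemma model_eq: "x \<in> carrier_vec m \<Longrightarrow> y \<in> carrier_vec m \<Longrightarrow> combine B x = combine B y \<Longrightarrow> x = y"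
  using bij_betw_imp_inj_on[OF model_bij] by (auto dest: inj_onD)

lemma model_preimage:
  assumes "t \<in> Gamma a b"
  obtains x where "x \<in> carrier_vec m" "combine B x = t"
proof -
  have "t \<in> combine B ` carrier_vec m" using assms bij_betw_imp_surj_on[OF model_bij] by simp
  then show thesis using that by auto
qed

end

section \<open>Invariant subspaces of tensors\<close>

definition invariant_space :: "nat \<Rightarrow> nat \<Rightarrow> (nat list \<Rightarrow> nat list \<Rightarrow> complex) set \<Rightarrow> bool" where
  "invariant_space a b U \<longleftrightarrow> U \<subseteq> Gamma a b \<and> (\<lambda>I J. 0) \<in> U \<and>
     (\<forall>t\<in>U. \<forall>t'\<in>U. (\<lambda>I J. t I J + t' I J) \<in> U) \<and> (\<forall>x. \<forall>t\<in>U. (\<lambda>I J. x * t I J) \<in> U) \<and>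
     (\<forall>g\<in>carrier (SL 3). \<forall>t\<in>U. tensor_action a b g t \<in> U)"

lemma invariant_spaceD:
  assumes "invariant_space a b U"
  shows "U \<subseteq> Gamma a b" "(\<lambda>I J. 0) \<in> U" "\<And>t t'. t \<in> U \<Longrightarrow> t' \<in> U \<Longrightarrow> (\<lambda>I J. t I J + t' I J) \<in> U"
    "\<And>x t. t \<in> U \<Longrightarrow> (\<lambda>I J. x * t I J) \<in> U" "\<And>g t. g \<in> carrier (SL 3) \<Longrightarrow> t \<in> U \<Longrightarrow> tensor_action a b g t \<in> U"
  using assms unfolding invariant_space_def by blast+

text \<open>Invariant subspaces are transported along the isomorphism \<open>combine B\<close>. The
  tensor \<open>t0\<close> guarantees positive dimension, which is part of irreducibility.\<close>

lemma model_irreducible: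
  assumes model: "Gamma_model a b m \<rho> B c" and nz: "t0 \<in> Gamma a b" "t0 \<noteq> (\<lambda>I J. 0)"
    and irr: "\<And>U t. invariant_space a b U \<Longrightarrow> t \<in> U \<Longrightarrow> t \<noteq> (\<lambda>I J. 0) \<Longrightarrow> Gamma a b \<subseteq> U"
  shows "irreducible_rep 3 m \<rho>"
  unfolding irreducible_rep_def
proof (intro conjI allI impI)
  show "0 < m"
  proof (rule ccontr)
    assume "\<not> 0 < m"
    then have m: "m = 0" by simp
    obtain x where "x \<in> carrier_vec m" "combine B x = t0" using model_preimage[OF model nz(1)] .
    then show False using nz(2) m by (auto simp: combine_def)
  qed
  fix W assume W: "VectorSpace.subspace class_ring W (module_vec TYPE(complex) m)"
    and inv: "\<forall>g\<in>carrier (SL 3). \<forall>u\<in>W. \<rho> g *\<^sub>v u \<in> W"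
  note WD = subspace_vecD[OF W]
  show "W = {0\<^sub>v m} \<or> W = carrier_vec m"
  proof (cases "W = {0\<^sub>v m}")
    case False
    then obtain x where x: "x \<in> W" "x \<noteq> 0\<^sub>v m" using WD(2) by blast
    let ?U = "combine B ` W"
    have "invariant_space a b ?U"
      unfolding invariant_space_def
    proof (intro conjI ballI allI)
      show "?U \<subseteq> Gamma a b" using model_Gamma[OF model] WD(1) by blast
      show "(\<lambda>I J. 0) \<in> ?U" using imageI[OF WD(2), of "combine B"] unfolding combine_zero[OF model] .
      fix t assume "t \<in> ?U"
      then obtain y where y: "t = combine B y" "y \<in> W" by blast
      have yc: "y \<in> carrier_vec m" using y WD(1) by blast
      show "(\<lambda>I J. d * t I J) \<in> ?U" for d
        using WD(4)[OF y(2), of d] unfolding y(1) combine_scale[OF model yc, symmetric] by blast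
      show "tensor_action a b g t \<in> ?U" if g: "g \<in> carrier (SL 3)" for g
        using inv g y(2) unfolding y(1) model_action[OF model g yc, symmetric] by blast
      fix t' assume "t' \<in> ?U"
      then obtain z where z: "t' = combine B z" "z \<in> W" by blast
      have zc: "z \<in> carrier_vec m" using z WD(1) by blast
      show "(\<lambda>I J. t I J + t' I J) \<in> ?U"
        using WD(3)[OF y(2) z(2)] unfolding y(1) z(1) combine_add[OF model yc zc, symmetric] by blast
    qed
    moreover have "combine B x \<noteq> (\<lambda>I J. 0)"
    proof
      assume "combine B x = (\<lambda>I J. 0)"
      then have "x = 0\<^sub>v m"
        using model_eq[OF model, of x "0\<^sub>v m"] x(1) WD(1) combine_zero[OF model] by auto
      then show False using x(2) by simp
    qed
    ultimately have sub: "Gamma a b \<subseteq> ?U" using irr x(1) by blast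
    have "carrier_vec m \<subseteq> W"
    proof
      fix y :: "complex vec" assume y: "y \<in> carrier_vec m"
      then have "combine B y \<in> ?U" using sub model_Gamma[OF model y] by blast
      then obtain z where "z \<in> W" "combine B y = combine B z" by blast
      then show "y \<in> W" using model_eq[OF model y, of z] WD(1) by auto
    qed
    then show ?thesis using WD(1) by blast
  qed simp
qed

lemma tensor_action_diagonal:
  assumes d: "d \<in> carrier (SL 3)" "diagonal_mat d" and I: "I \<in> indices a" "J \<in> indices b"
  shows "tensor_action a b d t I J =
    (\<Prod>p<a. d $$ (I ! p, I ! p)) * (\<Prod>q<b. inverse (d $$ (J ! q, J ! q))) * t I J"
proof -
  let ?e = "inv\<^bsub>SL 3\<^esub> d"
  have dc: "d \<in> carrier_mat 3 3" and ec: "?e \<in> carrier_mat 3 3" using d inv_SL(1)[OF d(1)] by (auto simp: SL_carrier_mat)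
  have de: "d $$ (i, i) * ?e $$ (i, j) = (if i = j then 1 else 0)" if "i < 3" "j < 3" for i j
    using diagonal_mult_left[OF dc ec d(2) that] inv_SL(2)[OF d(1)] that by simp
  have ei: "?e $$ (i, i) = inverse (d $$ (i, i))" if "i < 3" for i
    using de[OF that that] by (metis inverse_unique)
  have e0: "?e $$ (i, j) = 0" if "i < 3" "j < 3" "i \<noteq> j" for i j
    using de[OF that(1) that(2)] de[OF that(1) that(1)] that(3) by auto
  have off: "mono_coeff n A K K' = 0"
    if "K \<in> indices n" "K' \<in> indices n" "K \<noteq> K'"
      and A0: "\<And>i j. i < 3 \<Longrightarrow> j < 3 \<Longrightarrow> i \<noteq> j \<Longrightarrow> A $$ (i, j) = 0" for n A K K'
  proof -
    have len: "length K = n" "length K' = n" using that by (auto simp: indices_def)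
    have "\<exists>p<n. K ! p \<noteq> K' ! p"
    proof (rule ccontr)
      assume "\<not> ?thesis"
      then have "K = K'" using len by (intro nth_equalityI) auto
      then show False using that(3) by simp
    qed
    then obtain p where p: "p < n" "K ! p \<noteq> K' ! p" by blast
    then have "K ! p < 3" "K' ! p < 3" using that(1,2) by (auto simp: indices_def subset_iff)
    then have "A $$ (K ! p, K' ! p) = 0" using A0 p by blast
    then show ?thesis unfolding mono_coeff_def using p by (intro prod_zero) auto
  qed
  have d0: "d $$ (i, j) = 0" if "i < 3" "j < 3" "i \<noteq> j" for i j
    using d(2) dc that by (auto simp: diagonal_mat_def)
  have "tensor_action a b d t I J = (\<Sum>I'\<in>indices a. if I' = I then
      (\<Sum>J'\<in>indices b. if J' = J then mono_coeff a d I I' * mono_coeff b ?e J' J * t I' J' else 0) else 0)"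
    unfolding tensor_action_eq[OF I]
  proof (intro sum.cong refl)
    fix I' assume I': "I' \<in> indices a"
    show "(\<Sum>J'\<in>indices b. mono_coeff a d I I' * mono_coeff b ?e J' J * t I' J') = (if I' = I then
      (\<Sum>J'\<in>indices b. if J' = J then mono_coeff a d I I' * mono_coeff b ?e J' J * t I' J' else 0) else 0)"
    proof (cases "I' = I")
      case True
      have "mono_coeff b ?e J' J = 0" if "J' \<in> indices b" "J' \<noteq> J" for J'
        using that(1) I(2) that(2) e0 by (rule off)
      then have "(\<Sum>J'\<in>indices b. mono_coeff a d I I' * mono_coeff b ?e J' J * t I' J') =
          (\<Sum>J'\<in>indices b. if J' = J then mono_coeff a d I I' * mono_coeff b ?e J' J * t I' J' else 0)"
        by (intro sum.cong) auto
      then show ?thesis by (simp only: True if_True simp_thms)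
    next
      case False
      have "mono_coeff a d I I' = 0" using I(1) I' False[symmetric] d0 by (rule off)
      then show ?thesis using False by simp
    qed
  qed
  also have "\<dots> = mono_coeff a d I I * mono_coeff b ?e J J * t I J" using I by (simp add: sum.delta)
  also have "mono_coeff b ?e J J = (\<Prod>q<b. inverse (d $$ (J ! q, J ! q)))"
    unfolding mono_coeff_def using I(2) by (intro prod.cong refl ei) (auto simp: indices_def subset_iff)
  finally show ?thesis by (simp add: mono_coeff_def)
qed

text \<open>Applying \<open>\<Prod>e. (d - e)\<close>, over the eigenvalues \<open>e\<close> of a diagonal \<open>d\<close> other than that at \<open>(I0, J0)\<close>, isolates
  the coordinate \<open>(I0, J0)\<close>.\<close>

lemma invariant_space_coordinate:
  assumes U: "invariant_space a b U" and t: "t \<in> U" "t I0 J0 \<noteq> 0"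
    and IJ0: "I0 \<in> indices a" "J0 \<in> indices b"
    and d: "d \<in> carrier (SL 3)" "diagonal_mat d"
    and ev: "\<And>I J. ev I J = (\<Prod>p<a. d $$ (I ! p, I ! p)) * (\<Prod>q<b. inverse (d $$ (J ! q, J ! q)))"
    and iso: "\<And>I J. I \<in> indices a \<Longrightarrow> J \<in> indices b \<Longrightarrow> (I, J) \<noteq> (I0, J0) \<Longrightarrow> ev I J \<noteq> ev I0 J0"
  shows "(\<lambda>I J. if I = I0 \<and> J = J0 then 1 else 0) \<in> U"
proof -
  note UD = invariant_spaceD[OF U]
  have step: "(\<lambda>I J. (\<Prod>e\<in>E. ev I J - e) * t I J) \<in> U" if "finite E" for E
    using that
  proof (induction E rule: finite_induct)
    case empty
    then show ?case using t(1) by simp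
  next
    case (insert e E)
    let ?u = "\<lambda>I J. (\<Prod>e\<in>E. ev I J - e) * t I J"
    have "(\<lambda>I J. tensor_action a b d ?u I J + - e * ?u I J) \<in> U"
      by (intro UD(3) UD(4) UD(5) insert.IH d)
    moreover have "(\<lambda>I J. tensor_action a b d ?u I J + - e * ?u I J) = (\<lambda>I J. (\<Prod>e\<in>insert e E. ev I J - e) * t I J)"
    proof (intro ext)
      fix I J
      show "tensor_action a b d ?u I J + - e * ?u I J = (\<Prod>e\<in>insert e E. ev I J - e) * t I J"
      proof (cases "I \<in> indices a \<and> J \<in> indices b")
        case True
        then have "tensor_action a b d ?u I J = ev I J * ?u I J"
          unfolding ev using tensor_action_diagonal[OF d, of I a J b] by blast
        then show ?thesis using insert.hyps by (simp add: algebra_simps)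
      next
        case False
        then show ?thesis using Gamma_outside[of t a b I J] t(1) UD(1) by (auto simp: tensor_action_outside)
      qed
    qed
    ultimately show ?case by simp
  qed
  define E where "E = (\<lambda>(I, J). ev I J) ` (indices a \<times> indices b) - {ev I0 J0}"
  have finE: "finite E" by (simp add: E_def)
  let ?P = "\<Prod>e\<in>E. ev I0 J0 - e"
  have P: "?P \<noteq> 0" using finE by (auto simp: E_def prod_zero_iff)
  have "(\<lambda>I J. inverse (?P * t I0 J0) * ((\<Prod>e\<in>E. ev I J - e) * t I J)) \<in> U"
    by (intro UD(4) step finE)
  moreover have "(\<lambda>I J. inverse (?P * t I0 J0) * ((\<Prod>e\<in>E. ev I J - e) * t I J)) = (\<lambda>I J. if I = I0 \<and> J = J0 then 1 else 0)"
  proof (intro ext)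
    fix I J
    show "inverse (?P * t I0 J0) * ((\<Prod>e\<in>E. ev I J - e) * t I J) = (if I = I0 \<and> J = J0 then 1 else 0)"
    proof (cases "I = I0 \<and> J = J0")
      case True
      then show ?thesis using P t(2) by (simp add: field_simps)
    next
      case False
      show ?thesis
      proof (cases "I \<in> indices a \<and> J \<in> indices b")
        case True
        then have "ev I J \<in> E" using iso[of I J] False by (force simp: E_def)
        then have "(\<Prod>e\<in>E. ev I J - e) = 0" using finE by (intro prod_zero) auto
        then show ?thesis using False by simp
      next
        case out: False
        then have "t I J = 0" using Gamma_outside[of t a b I J] t(1) UD(1) by blast
        then show ?thesis using False by simp
      qed
    qed
  qed
  ultimately show ?thesis by simp
qed

lemma invariant_space_duality:
  assumes U: "invariant_space a b U"
    and dual: "\<And>\<phi> t. (\<And>u. u \<in> U \<Longrightarrow> (\<Sum>I\<in>indices a. \<Sum>J\<in>indices b. \<phi> I J * u I J) = 0) \<Longrightarrow> t \<in> Gamma a b \<Longrightarrow>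
      (\<Sum>I\<in>indices a. \<Sum>J\<in>indices b. \<phi> I J * t I J) = (0 :: complex)"
  shows "Gamma a b \<subseteq> U"
proof
  note UD = invariant_spaceD[OF U]
  let ?S = "indices a \<times> indices b"
  let ?U = "{u. (\<lambda>I J. u (I, J)) \<in> U}" and ?V = "{u. (\<lambda>I J. u (I, J)) \<in> Gamma a b}"
  have S: "(\<Sum>s\<in>?S. \<phi> s * u s) = (\<Sum>I\<in>indices a. \<Sum>J\<in>indices b. \<phi> (I, J) * u (I, J))" for \<phi> u :: "nat list \<times> nat list \<Rightarrow> complex"
    by (simp add: sum.cartesian_product case_prod_beta)
  have "?V \<subseteq> ?U"
  proof (rule function_space_duality[of ?S])
    show "u s = 0" if "u \<in> ?V" "s \<notin> ?S" for u s
    proof -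
      obtain I J where s: "s = (I, J)" by fastforce
      have "I \<notin> indices a \<or> J \<notin> indices b" using that(2) s by simp
      then show ?thesis using Gamma_outside[of "\<lambda>I J. u (I, J)" a b I J] that(1) s by simp
    qed
    fix \<phi> t assume *: "\<And>u. u \<in> ?U \<Longrightarrow> (\<Sum>s\<in>?S. \<phi> s * u s) = 0" and t: "t \<in> ?V"
    have "(\<Sum>I\<in>indices a. \<Sum>J\<in>indices b. \<phi> (I, J) * u I J) = 0" if "u \<in> U" for u
      using *[of "\<lambda>(I, J). u I J"] that unfolding S by simp
    then show "(\<Sum>s\<in>?S. \<phi> s * t s) = 0"
      unfolding S using dual[of "\<lambda>I J. \<phi> (I, J)" "\<lambda>I J. t (I, J)"] t by simp
  qed (use UD in auto)
  moreover fix t assume "t \<in> Gamma a b"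
  then have "(\<lambda>(I, J). t I J) \<in> ?V" by simp
  ultimately have "(\<lambda>(I, J). t I J) \<in> ?U" by (rule subsetD)
  then show "t \<in> U" by simp
qed

section \<open>Flags: a vector together with a covector that vanishes on it\<close>

definition cross :: "(nat \<Rightarrow> complex) \<Rightarrow> (nat \<Rightarrow> complex) \<Rightarrow> nat \<Rightarrow> complex" where
  "cross p q k = (if k = 0 then p 1 * q 2 - p 2 * q 1 else if k = 1 then p 2 * q 0 - p 0 * q 2 else p 0 * q 1 - p 1 * q 0)"

lemma det_3x3:
  assumes A: "A \<in> carrier_mat 3 3"
  shows "det A = A $$ (0, 0) * (A $$ (1, 1) * A $$ (2, 2) - A $$ (1, 2) * A $$ (2, 1))
    - A $$ (0, 1) * (A $$ (1, 0) * A $$ (2, 2) - A $$ (1, 2) * A $$ (2, 0))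
    + A $$ (0, 2) * (A $$ (1, 0) * A $$ (2, 1) - A $$ (1, 1) * A $$ (2, 0))"
proof -
  have "mat_delete A 0 j \<in> carrier_mat 2 2" for j using A by (auto simp: mat_delete_def)
  then have "det (mat_delete A 0 j) = mat_delete A 0 j $$ (0, 0) * mat_delete A 0 j $$ (1, 1)
      - mat_delete A 0 j $$ (0, 1) * mat_delete A 0 j $$ (1, 0)" for j by (rule det_2x2)
  then show ?thesis
    using A laplace_expansion_row[OF A, of 0]
    by (simp add: sum_less_3 cofactor_def mat_delete_def numeral_2_eq_2 right_diff_distrib)
qed

text \<open>With \<open>r \<bullet> (p \<times> q) = 1\<close>, the matrix with rows \<open>p, q, r\<close> has the inverse with columns
  \<open>q \<times> r, r \<times> p, p \<times> q\<close>.\<close>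

lemma flag_matrix:
  assumes i: "i < 3" "cross p q i \<noteq> 0"
  obtains G H where "G \<in> carrier (SL 3)" "H \<in> carrier (SL 3)" "G * H = 1\<^sub>m 3" "H * G = 1\<^sub>m 3"
    "\<And>j. j < 3 \<Longrightarrow> G $$ (0, j) = p j" "\<And>k. k < 3 \<Longrightarrow> H $$ (k, 2) = cross p q k"
proof -
  define r where "r k = (if k = i then inverse (cross p q i) else 0)" for k
  have r: "r 0 * cross p q 0 + r 1 * cross p q 1 + r 2 * cross p q 2 = 1"
    using less_3_cases[OF i(1)] i(2) by (auto simp: r_def)
  define G where "G = mat 3 3 (\<lambda>(i, j). if i = 0 then p j else if i = 1 then q j else r j)"
  define H where "H = mat 3 3 (\<lambda>(i, j). if j = 0 then cross q r i else if j = 1 then cross r p i else cross p q i)"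
  have c: "G \<in> carrier_mat 3 3" "H \<in> carrier_mat 3 3" by (simp_all add: G_def H_def)
  have "det G = 1" unfolding det_3x3[OF c(1)] r[symmetric] by (simp add: G_def cross_def algebra_simps)
  then have GS: "G \<in> carrier (SL 3)" using c by (simp add: carrier_SL)
  have GH: "G * H = 1\<^sub>m 3"
  proof (rule eq_matI)
    fix k l assume "k < dim_row (1\<^sub>m 3 :: complex mat)" "l < dim_col (1\<^sub>m 3 :: complex mat)"
    then have kl: "k < 3" "l < 3" by auto
    have "(G * H) $$ (k, l) = (\<Sum>j<3. G $$ (k, j) * H $$ (j, l))" by (rule mult_mat_index[OF c kl])
    also have "\<dots> = (if k = l then r 0 * cross p q 0 + r 1 * cross p q 1 + r 2 * cross p q 2 else 0)"
      using less_3_cases[OF kl(1)] less_3_cases[OF kl(2)]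
      by (elim disjE) (simp_all add: sum_less_3 G_def H_def cross_def algebra_simps)
    finally show "(G * H) $$ (k, l) = 1\<^sub>m 3 $$ (k, l)" using r kl by simp
  qed (use c in auto)
  have inv: "inv\<^bsub>SL 3\<^esub> G = H"
  proof -
    note I = inv_SL[OF GS]
    have Ic: "inv\<^bsub>SL 3\<^esub> G \<in> carrier_mat 3 3" using I(1) by (rule SL_carrier_mat)
    have "inv\<^bsub>SL 3\<^esub> G = inv\<^bsub>SL 3\<^esub> G * (G * H)" using GH Ic by simp
    also have "\<dots> = (inv\<^bsub>SL 3\<^esub> G * G) * H" using Ic c by (rule assoc_mult_mat[symmetric])
    finally show ?thesis using I(3) c by simp
  qed
  show thesis
  proof (rule that[OF GS _ GH])
    show "H \<in> carrier (SL 3)" "H * G = 1\<^sub>m 3" using inv_SL[OF GS] inv by auto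
  qed (auto simp: G_def H_def)
qed

text \<open>Places a flag where \<open>tensor_action\<close> reads it off in the coordinate with
  upper indices 0 and lower indices 2 of a translate. \<open>flag_column\<close> places it where the
  translates of the unit tensor at that coordinate display it.\<close>

lemma flag_row:
  assumes "i < 3" "cross p q i \<noteq> 0"
  obtains g where "g \<in> carrier (SL 3)" "\<And>j. j < 3 \<Longrightarrow> g $$ (0, j) = p j"
    "\<And>k. k < 3 \<Longrightarrow> (inv\<^bsub>SL 3\<^esub> g) $$ (k, 2) = cross p q k"
proof -
  obtain G H where *: "G \<in> carrier (SL 3)" "H \<in> carrier (SL 3)" "G * H = 1\<^sub>m 3" "H * G = 1\<^sub>m 3"
    "\<And>j. j < 3 \<Longrightarrow> G $$ (0, j) = p j" "\<And>k. k < 3 \<Longrightarrow> H $$ (k, 2) = cross p q k" using flag_matrix[OF assms] by blast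
  have "inv\<^bsub>SL 3\<^esub> G = H" by (rule group.inv_equality[OF group_SL]) (use * in auto)
  then show thesis using that[of G] * by simp
qed

lemma flag_column:
  assumes "i < 3" "cross p q i \<noteq> 0"
  obtains g where "g \<in> carrier (SL 3)" "\<And>j. j < 3 \<Longrightarrow> g $$ (j, 0) = p j"
    "\<And>k. k < 3 \<Longrightarrow> (inv\<^bsub>SL 3\<^esub> g) $$ (2, k) = cross p q k"
proof -
  obtain G H where *: "G \<in> carrier (SL 3)" "H \<in> carrier (SL 3)" "G * H = 1\<^sub>m 3" "H * G = 1\<^sub>m 3"
    "\<And>j. j < 3 \<Longrightarrow> G $$ (0, j) = p j" "\<And>k. k < 3 \<Longrightarrow> H $$ (k, 2) = cross p q k" using flag_matrix[OF assms] by blast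
  have c: "G \<in> carrier_mat 3 3" "H \<in> carrier_mat 3 3" using * by (auto simp: SL_carrier_mat)
  have S: "transpose_mat G \<in> carrier (SL 3)" "transpose_mat H \<in> carrier (SL 3)"
    using *(1,2) c by (auto simp: carrier_SL det_transpose)
  have "transpose_mat H * transpose_mat G = 1\<^sub>m 3" using transpose_mult[OF c] *(3) by simp
  then have "inv\<^bsub>SL 3\<^esub> (transpose_mat G) = transpose_mat H"
    by (intro group.inv_equality[OF group_SL]) (use S in auto)
  then show thesis using that[OF S(1)] * c by simp
qed

lemma sum_indices_1: "(\<Sum>I\<in>indices 1. f I) = (\<Sum>i<3. f [i])"
  using sum_indices_Suc[of f 0] by simp

lemma sum_indices_2: "(\<Sum>I\<in>indices 2. f I) = (\<Sum>i<3. \<Sum>j<3. f [i, j])"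
  using sum_indices_Suc[of f 1] unfolding One_nat_def[symmetric] sum_indices_1 by (simp add: numeral_2_eq_2)

lemma indices_1_iff: "J \<in> indices (Suc 0) \<longleftrightarrow> (\<exists>k<3. J = [k])"
  unfolding indices_Suc by auto

lemma indices_2_iff: "I \<in> indices 2 \<longleftrightarrow> (\<exists>i<3. \<exists>j<3. I = [i, j])"
  unfolding numeral_2_eq_2 indices_Suc by auto

lemma tensor_action_2_1:
  assumes "i < 3" "j < 3" "k < 3"
  shows "tensor_action 2 1 g t [i, j] [k] =
    (\<Sum>i'<3. \<Sum>j'<3. \<Sum>k'<3. g $$ (i, i') * g $$ (j, j') * (inv\<^bsub>SL 3\<^esub> g) $$ (k', k) * t [i', j'] [k'])"
proof -
  have I: "[i, j] \<in> indices 2" "[k] \<in> indices 1" using assms by (auto simp: indices_1_iff indices_2_iff)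
  show ?thesis
    unfolding tensor_action_eq[OF I] sum_indices_1 sum_indices_2
    by (simp add: numeral_2_eq_2)
qed

lemma tensor_action_0_2:
  assumes "j < 3" "k < 3"
  shows "tensor_action 0 2 g t [] [j, k] =
    (\<Sum>j'<3. \<Sum>k'<3. (inv\<^bsub>SL 3\<^esub> g) $$ (j', j) * (inv\<^bsub>SL 3\<^esub> g) $$ (k', k) * t [] [j', k'])"
proof -
  have I: "[] \<in> indices 0" "[j, k] \<in> indices 2" using assms by (auto simp: indices_2_iff)
  show ?thesis
    unfolding tensor_action_eq[OF I] sum_indices_2 by (simp add: numeral_2_eq_2)
qed

section \<open>Irreducibility\<close>

text \<open>A function vanishing on all \<open>p \<otimes> p \<otimes> l\<close> with \<open>l p = 0\<close> comes from the contraction.\<close>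

lemma flag_vanishing:
  fixes c :: "nat \<Rightarrow> nat \<Rightarrow> nat \<Rightarrow> complex"
  assumes sym: "\<And>i j k. c i j k = c j i k"
    and van: "\<And>p q. (\<Sum>i<3. \<Sum>j<3. \<Sum>k<3. c i j k * (p i * p j * cross p q k)) = 0"
    and ijk: "i < 3" "j < 3" "k < 3"
  shows "c i j k = (if i = j then if k = i then c i i i else 0
    else if k = j then c i i i / 2 else if k = i then c j j j / 2 else 0)"
proof -
  define \<tau> where "\<tau> p k = (\<Sum>i<3. \<Sum>j<3. c i j k * (p i * p j))" for p k
  have v: "\<tau> p 0 * cross p q 0 + \<tau> p 1 * cross p q 1 + \<tau> p 2 * cross p q 2 = 0" for p q
    using van[of p q] by (simp add: \<tau>_def sum_less_3 algebra_simps)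
  \<comment> \<open>By the triple product, \<open>v\<close> says that the cross product of
    \<open>\<tau> p\<close> and \<open>p\<close> is orthogonal to every \<open>q\<close>, so
    \<open>\<tau> p\<close> is proportional to \<open>p\<close>; the three unit vectors give its
    coordinates.\<close>
  have T: "\<tau> p k * p l = \<tau> p l * p k" if "k < 3" "l < 3" for p k l
    using v[of p "\<lambda>n. if n = 0 then 1 else 0"] v[of p "\<lambda>n. if n = 1 then 1 else 0"] v[of p "\<lambda>n. if n = 2 then 1 else 0"]
      less_3_cases[OF that(1)] less_3_cases[OF that(2)]
    by (elim disjE) (simp_all add: cross_def algebra_simps)
  \<comment> \<open>Test vectors \<open>e_i + x e_k\<close>. Taking \<open>x = 0\<close> kills
    \<open>c i i k\<close>, taking \<open>x = 1\<close> kills the coefficients with three distinct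
    indices, and comparing \<open>x = 1\<close> with \<open>x = -1\<close> isolates the part odd in
    \<open>x\<close>, which relates \<open>c i k k\<close> to \<open>c i i i\<close>.\<close>
  define P where "P i x k = (\<lambda>l. if l = i then 1 else if l = k then x else 0)" for i k :: nat and x :: complex
  have \<tau>P: "\<tau> (P i x k) m = c i i m + 2 * x * c i k m + x\<^sup>2 * c k k m" if "i < 3" "k < 3" "i \<noteq> k" for i k m x
    using less_3_cases[OF that(1)] less_3_cases[OF that(2)] that(3) sym[of 1 0 m] sym[of 2 0 m] sym[of 2 1 m]
    by (elim disjE) (simp_all add: \<tau>_def P_def sum_less_3 power2_eq_square algebra_simps)
  have z1: "c i i k = 0" if "i < 3" "k < 3" "i \<noteq> k" for i k
    using T[OF that(2,1), of "P i 0 k"] \<tau>P[OF that, of 0] that by (simp add: P_def)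
  have z2: "c i j k = 0" if "i < 3" "j < 3" "k < 3" "i \<noteq> j" "i \<noteq> k" "j \<noteq> k" for i j k
    using T[OF that(3,1), of "P i 1 j"] \<tau>P[OF that(1,2,4), of 1 k] that z1[OF that(1,3,5)] z1[OF that(2,3,6)]
    by (simp add: P_def)
  have z3: "c i k k = c i i i / 2" if "i < 3" "k < 3" "i \<noteq> k" for i k
  proof -
    have "2 * x * c i k k + x\<^sup>2 * c k k k = x * c i i i + 2 * x\<^sup>2 * c i k i" for x
      using T[OF that(2,1), of "P i x k"] \<tau>P[OF that, of x] that z1[OF that] z1[OF that(2,1) that(3)[symmetric]]
      by (simp add: P_def power2_eq_square algebra_simps)
    from this[of 1] this[of "-1"]
    have 1: "2 * c i k k + c k k k = c i i i + 2 * c i k i" and 2: "- (2 * c i k k) + c k k k = - c i i i + 2 * c i k i"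
      by simp_all
    have 4: "4 * c i k k = 2 * c i i i" using arg_cong2[OF 1 2, of "(-)"] by (simp add: algebra_simps)
    have "c i k k = 4 * c i k k / 4" by simp
    then show ?thesis unfolding 4 by simp
  qed
  show ?thesis
    using z1[OF ijk(1,3)] z2[OF ijk] z3[OF ijk(1,2)] z3[OF ijk(2,1)] sym[of i j k] by auto
qed

text \<open>Every vector is a cross product, so the quadratic form of \<open>c\<close> is
  identically zero. The chosen \<open>p\<close> and \<open>q\<close> evaluate it at
  \<open>(1, x, 0)\<close>, \<open>(1, 0, x)\<close> and \<open>(0, 1, x)\<close>, which determines
  all coefficients.\<close>

lemma quadratic_vanishing:
  fixes c :: "nat \<Rightarrow> nat \<Rightarrow> complex"
  assumes sym: "\<And>j k. c j k = c k j"
    and van: "\<And>p q. (\<Sum>j<3. \<Sum>k<3. c j k * (cross p q j * cross p q k)) = 0"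
    and jk: "j < 3" "k < 3"
  shows "c j k = 0"
proof -
  have a: "c 0 0 + 2 * x * c 0 1 + x\<^sup>2 * c 1 1 = 0" for x
    using van[of "\<lambda>n. if n = 2 then 1 else 0" "\<lambda>n. if n = 0 then x else if n = 1 then -1 else 0"] sym[of 1 0]
    by (simp add: cross_def sum_less_3 power2_eq_square algebra_simps)
  have b: "c 0 0 + 2 * x * c 0 2 + x\<^sup>2 * c 2 2 = 0" for x
    using van[of "\<lambda>n. if n = 1 then 1 else 0" "\<lambda>n. if n = 0 then -x else if n = 2 then 1 else 0"] sym[of 2 0]
    by (simp add: cross_def sum_less_3 power2_eq_square algebra_simps)
  have d: "c 1 1 + 2 * x * c 1 2 + x\<^sup>2 * c 2 2 = 0" for x
    using van[of "\<lambda>n. if n = 0 then 1 else 0" "\<lambda>n. if n = 1 then x else if n = 2 then -1 else 0"] sym[of 2 1]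
    by (simp add: cross_def sum_less_3 power2_eq_square algebra_simps)
  have 0: "c 0 0 = 0" "c 1 1 = 0" using a[of 0] d[of 0] by auto
  have 1: "c 0 1 = 0" using a[of 1] 0 by simp
  have 2: "c 2 2 = 0" using b[of 1] b[of "-1"] 0 by (simp add: algebra_simps)
  have 3: "c 0 2 = 0" "c 1 2 = 0" using b[of 1] d[of 1] 0 2 by auto
  show ?thesis
    using less_3_cases[OF jk(1)] less_3_cases[OF jk(2)] 0 1 2 3 sym[of 1 0] sym[of 2 0] sym[of 2 1] by auto
qed

text \<open>Among tensors with two upper indices and one lower index the largest eigenvalue of this
  matrix is 8, attained only at \<open>([0, 0], [2])\<close>; with two lower indices it is 4,
  attained only at \<open>([], [2, 2])\<close>. These are the coordinates of highest weight, so they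
  can be isolated.\<close>

definition dominant_diag :: "complex mat" where
  "dominant_diag = mat 3 3 (\<lambda>(i, j). if i = j then if i = 0 then 2 else if i = 1 then 1 else 1 / 2 else 0)"

lemma dominant_diag: "dominant_diag \<in> carrier (SL 3)" "diagonal_mat dominant_diag"
  by (auto simp: dominant_diag_def carrier_SL det_3x3 diagonal_mat_def)

lemma dominant_diag_entries [simp]:
  "dominant_diag $$ (0, 0) = 2" "dominant_diag $$ (Suc 0, Suc 0) = 1" "dominant_diag $$ (2, 2) = 1 / 2"
  by (simp_all add: dominant_diag_def)

text \<open>A tensor that vanishes on all flags is of trace type by \<open>flag_vanishing\<close>,
  and a trace-free one is then zero. So some translate of \<open>t\<close> has a nonzero highest
  weight coordinate, and the highest weight tensor \<open>hw\<close> lies in \<open>U\<close>.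
  Dually, a functional that kills all translates of \<open>hw\<close> vanishes on flags, is of trace
  type, and therefore kills every trace-free tensor.\<close>

lemma Gamma_2_1_irreducible_space:
  assumes U: "invariant_space 2 1 U" and t: "t \<in> U" "t \<noteq> (\<lambda>I J. 0)"
  shows "Gamma 2 1 \<subseteq> U"
proof -
  note UD = invariant_spaceD[OF U]
  have tG: "t \<in> Gamma 2 1" using UD(1) t(1) by blast
  have symG: "s [i, j] J = s [j, i] J" if "s \<in> Gamma 2 1" for s i j J
    by (rule Gamma_sym[OF that]) auto
  have "\<exists>g\<in>carrier (SL 3). tensor_action 2 1 g t [0, 0] [2] \<noteq> 0"
  proof (rule ccontr)
    assume none: "\<not> ?thesis"
    let ?c = "\<lambda>i j k. t [i, j] [k]"
    have van: "(\<Sum>i<3. \<Sum>j<3. \<Sum>k<3. ?c i j k * (p i * p j * cross p q k)) = 0" for p q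
    proof (cases "\<exists>i<3. cross p q i \<noteq> 0")
      case True
      then obtain i where i: "i < 3" "cross p q i \<noteq> 0" by blast
      obtain g where g: "g \<in> carrier (SL 3)" "\<And>j. j < 3 \<Longrightarrow> g $$ (0, j) = p j"
        "\<And>k. k < 3 \<Longrightarrow> (inv\<^bsub>SL 3\<^esub> g) $$ (k, 2) = cross p q k" using flag_row[OF i] by blast
      have l: "(0 :: nat) < 3" "(2 :: nat) < 3" by auto
      have "(\<Sum>i<3. \<Sum>j<3. \<Sum>k<3. ?c i j k * (p i * p j * cross p q k)) = tensor_action 2 1 g t [0, 0] [2]"
        unfolding tensor_action_2_1[OF l(1) l(1) l(2), of g t] using g(2,3) by (simp add: sum_less_3 algebra_simps)
      then show ?thesis using none g(1) by simp
    qed (simp add: sum_less_3)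
    have c: "?c i j k = (if i = j then if k = i then ?c i i i else 0
      else if k = j then ?c i i i / 2 else if k = i then ?c j j j / 2 else 0)" if "i < 3" "j < 3" "k < 3" for i j k
      by (rule flag_vanishing[of ?c, OF symG[OF tG] van that])
    \<comment> \<open>On a tensor of trace type the contraction adds \<open>?c i i i\<close> and two
      halves of it, so it equals \<open>2 * ?c i i i\<close>.\<close>
    have ci: "?c i i i = 0" if "i < 3" for i
    proof -
      have "(\<Sum>k<3. ?c k i k) = 0" using Gamma_trace[OF tG, of "[i]" "[]"] by simp
      moreover have "(\<Sum>k<3. ?c k i k) = (\<Sum>k<3. if k = i then ?c i i i else ?c i i i / 2)"
        by (intro sum.cong refl, subst c) (use that in auto)
      moreover have "\<dots> = 2 * ?c i i i" using less_3_cases[OF that] by (elim disjE) (simp_all add: sum_less_3)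
      ultimately show ?thesis by simp
    qed
    have "t I J = 0" for I J
    proof (cases "I \<in> indices 2 \<and> J \<in> indices 1")
      case True
      then obtain i j k where "i < 3" "j < 3" "k < 3" "I = [i, j]" "J = [k]" by (auto simp: indices_1_iff indices_2_iff)
      then show ?thesis using c[of i j k] ci by auto
    next
      case False
      then show ?thesis using Gamma_outside[OF tG] by blast
    qed
    then show False using t(2) by blast
  qed
  then obtain g where g: "g \<in> carrier (SL 3)" "tensor_action 2 1 g t [0, 0] [2] \<noteq> 0" by blast
  define hw where "hw = (\<lambda>(I :: nat list) (J :: nat list). if I = [0, 0] \<and> J = [2] then 1 else 0 :: complex)"
  have hw: "hw \<in> U"
    unfolding hw_def
  proof (rule invariant_space_coordinate[OF U UD(5)[OF g(1) t(1)] g(2) _ _ dominant_diag refl])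
    show "[0, 0] \<in> indices 2" "[2] \<in> indices 1" by (auto simp: indices_1_iff indices_2_iff)
    fix I J assume "I \<in> indices 2" "J \<in> indices 1" and ne: "(I, J) \<noteq> ([0, 0], [2])"
    then obtain i j k where ijk: "i < 3" "j < 3" "k < 3" "I = [i, j]" "J = [k]" by (auto simp: indices_1_iff indices_2_iff)
    show "(\<Prod>p<2. dominant_diag $$ (I ! p, I ! p)) * (\<Prod>q<1. inverse (dominant_diag $$ (J ! q, J ! q))) \<noteq>
      (\<Prod>p<2. dominant_diag $$ ([0, 0] ! p, [0, 0] ! p)) * (\<Prod>q<1. inverse (dominant_diag $$ ([2] ! q, [2] ! q)))"
      using less_3_cases[OF ijk(1)] less_3_cases[OF ijk(2)] less_3_cases[OF ijk(3)] ne
      unfolding ijk(4,5) by (elim disjE) (simp_all add: numeral_2_eq_2 dominant_diag_def del: dominant_diag_entries)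
  qed
  show ?thesis
  proof (rule invariant_space_duality[OF U])
    fix \<phi> :: "nat list \<Rightarrow> nat list \<Rightarrow> complex" and s
    assume kill: "\<And>u. u \<in> U \<Longrightarrow> (\<Sum>I\<in>indices 2. \<Sum>J\<in>indices 1. \<phi> I J * u I J) = 0" and s: "s \<in> Gamma 2 1"
    \<comment> \<open>Only the part of \<open>\<phi>\<close> that is symmetric in the upper indices
      acts on symmetric tensors; symmetrising without division causes the factors 2 below.\<close>
    let ?c = "\<lambda>i j k. \<phi> [i, j] [k] + \<phi> [j, i] [k]"
    have van: "(\<Sum>i<3. \<Sum>j<3. \<Sum>k<3. ?c i j k * (p i * p j * cross p q k)) = 0" for p q
    proof (cases "\<exists>i<3. cross p q i \<noteq> 0")
      case True
      then obtain i where i: "i < 3" "cross p q i \<noteq> 0" by blast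
      obtain g where g: "g \<in> carrier (SL 3)" "\<And>j. j < 3 \<Longrightarrow> g $$ (j, 0) = p j"
        "\<And>k. k < 3 \<Longrightarrow> (inv\<^bsub>SL 3\<^esub> g) $$ (2, k) = cross p q k" using flag_column[OF i] by blast
      have "tensor_action 2 1 g hw [i, j] [k] = p i * p j * cross p q k" if "i < 3" "j < 3" "k < 3" for i j k
        unfolding tensor_action_2_1[OF that] using g(2)[OF that(1)] g(2)[OF that(2)] g(3)[OF that(3)]
        by (simp add: sum_less_3 hw_def)
      then have "(\<Sum>i<3. \<Sum>j<3. \<Sum>k<3. \<phi> [i, j] [k] * (p i * p j * cross p q k)) = 0"
        using kill[OF UD(5)[OF g(1) hw]] unfolding sum_indices_1 sum_indices_2 by simp
      moreover have "(\<Sum>i<3. \<Sum>j<3. \<Sum>k<3. ?c i j k * (p i * p j * cross p q k)) =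
          2 * (\<Sum>i<3. \<Sum>j<3. \<Sum>k<3. \<phi> [i, j] [k] * (p i * p j * cross p q k))"
        by (simp add: sum_less_3 algebra_simps)
      ultimately show ?thesis by simp
    qed (simp add: sum_less_3)
    have c: "?c i j k = (if i = j then if k = i then ?c i i i else 0
      else if k = j then ?c i i i / 2 else if k = i then ?c j j j / 2 else 0)" if "i < 3" "j < 3" "k < 3" for i j k
      by (rule flag_vanishing[of ?c, OF add.commute van that])
    have tr: "s [i, 0] [0] + s [i, 1] [1] + s [i, 2] [2] = 0" for i
      using Gamma_trace[OF s, of "[i]" "[]"] symG[OF s, of _ i] by (simp add: sum_less_3)
    have "2 * (\<Sum>i<3. \<Sum>j<3. \<Sum>k<3. \<phi> [i, j] [k] * s [i, j] [k]) = (\<Sum>i<3. \<Sum>j<3. \<Sum>k<3. ?c i j k * s [i, j] [k])"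
      using symG[OF s, of 1 0] symG[OF s, of 2 0] symG[OF s, of 2 1] by (simp add: sum_less_3 algebra_simps)
    also have "\<dots> = (\<Sum>i<3. \<Sum>j<3. \<Sum>k<3. (if i = j then if k = i then ?c i i i else 0
      else if k = j then ?c i i i / 2 else if k = i then ?c j j j / 2 else 0) * s [i, j] [k])"
      by (intro sum.cong refl) (subst c, auto)
    also have "\<dots> = (\<Sum>i<3. ?c i i i * (s [i, 0] [0] + s [i, 1] [1] + s [i, 2] [2]))"
      using symG[OF s, of 1 0] symG[OF s, of 2 0] symG[OF s, of 2 1] by (simp add: sum_less_3 algebra_simps)
    also have "\<dots> = 0" by (simp only: tr) simp
    finally show "(\<Sum>I\<in>indices 2. \<Sum>J\<in>indices 1. \<phi> I J * s I J) = 0" unfolding sum_indices_1 sum_indices_2 by simp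
  qed
qed

text \<open>The same two-sided argument with \<open>quadratic_vanishing\<close> in place of
  \<open>flag_vanishing\<close>: a symmetric tensor in two covectors is a quadratic form, and the
  vectors \<open>cross p q\<close> fill the whole space.\<close>

lemma Gamma_0_2_irreducible_space:
  assumes U: "invariant_space 0 2 U" and t: "t \<in> U" "t \<noteq> (\<lambda>I J. 0)"
  shows "Gamma 0 2 \<subseteq> U"
proof -
  note UD = invariant_spaceD[OF U]
  have tG: "t \<in> Gamma 0 2" using UD(1) t(1) by blast
  have symG: "s I [i, j] = s I [j, i]" if "s \<in> Gamma 0 2" for s i j I
    by (rule Gamma_sym[OF that]) auto
  have "\<exists>g\<in>carrier (SL 3). tensor_action 0 2 g t [] [2, 2] \<noteq> 0"
  proof (rule ccontr)
    assume none: "\<not> ?thesis"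
    let ?c = "\<lambda>j k. t [] [j, k]"
    have van: "(\<Sum>j<3. \<Sum>k<3. ?c j k * (cross p q j * cross p q k)) = 0" for p q
    proof (cases "\<exists>i<3. cross p q i \<noteq> 0")
      case True
      then obtain i where i: "i < 3" "cross p q i \<noteq> 0" by blast
      obtain g where g: "g \<in> carrier (SL 3)" "\<And>j. j < 3 \<Longrightarrow> g $$ (0, j) = p j"
        "\<And>k. k < 3 \<Longrightarrow> (inv\<^bsub>SL 3\<^esub> g) $$ (k, 2) = cross p q k" using flag_row[OF i] by blast
      have "tensor_action 0 2 g t [] [2, 2] = 0" using none g(1) by blast
      then show ?thesis using tensor_action_0_2[of 2 2 g t] g(3) by (simp add: sum_less_3 algebra_simps)
    qed (simp add: sum_less_3)
    have "?c j k = 0" if "j < 3" "k < 3" for j k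
      by (rule quadratic_vanishing[of ?c, OF symG[OF tG] van that])
    then have "t I J = 0" for I J
      using Gamma_outside[OF tG, of I J] by (cases "I \<in> indices 0 \<and> J \<in> indices 2") (auto simp: indices_2_iff)
    then show False using t(2) by blast
  qed
  then obtain g where g: "g \<in> carrier (SL 3)" "tensor_action 0 2 g t [] [2, 2] \<noteq> 0" by blast
  define hw where "hw = (\<lambda>(I :: nat list) (J :: nat list). if I = [] \<and> J = [2, 2] then 1 else 0 :: complex)"
  have hw: "hw \<in> U"
    unfolding hw_def
  proof (rule invariant_space_coordinate[OF U UD(5)[OF g(1) t(1)] g(2) _ _ dominant_diag refl])
    show "[] \<in> indices 0" "[2, 2] \<in> indices 2" by (auto simp: indices_2_iff)
    fix I J assume "I \<in> indices 0" "J \<in> indices 2" and ne: "(I, J) \<noteq> ([], [2, 2])"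
    then obtain j k where jk: "j < 3" "k < 3" "I = []" "J = [j, k]" by (auto simp: indices_2_iff)
    show "(\<Prod>p<0. dominant_diag $$ (I ! p, I ! p)) * (\<Prod>q<2. inverse (dominant_diag $$ (J ! q, J ! q))) \<noteq>
      (\<Prod>p<0. dominant_diag $$ ([] ! p, [] ! p)) * (\<Prod>q<2. inverse (dominant_diag $$ ([2, 2] ! q, [2, 2] ! q)))"
      using less_3_cases[OF jk(1)] less_3_cases[OF jk(2)] ne
      unfolding jk(3,4) by (elim disjE) (simp_all add: numeral_2_eq_2 dominant_diag_def del: dominant_diag_entries)
  qed
  show ?thesis
  proof (rule invariant_space_duality[OF U])
    fix \<phi> :: "nat list \<Rightarrow> nat list \<Rightarrow> complex" and s
    assume kill: "\<And>u. u \<in> U \<Longrightarrow> (\<Sum>I\<in>indices 0. \<Sum>J\<in>indices 2. \<phi> I J * u I J) = 0" and s: "s \<in> Gamma 0 2"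
    let ?c = "\<lambda>j k. \<phi> [] [j, k] + \<phi> [] [k, j]"
    have van: "(\<Sum>j<3. \<Sum>k<3. ?c j k * (cross p q j * cross p q k)) = 0" for p q
    proof (cases "\<exists>i<3. cross p q i \<noteq> 0")
      case True
      then obtain i where i: "i < 3" "cross p q i \<noteq> 0" by blast
      obtain g where g: "g \<in> carrier (SL 3)" "\<And>j. j < 3 \<Longrightarrow> g $$ (j, 0) = p j"
        "\<And>k. k < 3 \<Longrightarrow> (inv\<^bsub>SL 3\<^esub> g) $$ (2, k) = cross p q k" using flag_column[OF i] by blast
      have "tensor_action 0 2 g hw [] [j, k] = cross p q j * cross p q k" if "j < 3" "k < 3" for j k
        unfolding tensor_action_0_2[OF that] using g(3)[OF that(1)] g(3)[OF that(2)]
        by (simp add: sum_less_3 hw_def)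
      then have "(\<Sum>j<3. \<Sum>k<3. \<phi> [] [j, k] * (cross p q j * cross p q k)) = 0"
        using kill[OF UD(5)[OF g(1) hw]] unfolding sum_indices_2 by simp
      moreover have "(\<Sum>j<3. \<Sum>k<3. ?c j k * (cross p q j * cross p q k)) =
          2 * (\<Sum>j<3. \<Sum>k<3. \<phi> [] [j, k] * (cross p q j * cross p q k))"
        by (simp add: sum_less_3 algebra_simps)
      ultimately show ?thesis by simp
    qed (simp add: sum_less_3)
    have c: "?c j k = 0" if "j < 3" "k < 3" for j k
      by (rule quadratic_vanishing[of ?c, OF add.commute van that])
    have "2 * (\<Sum>j<3. \<Sum>k<3. \<phi> [] [j, k] * s [] [j, k]) = (\<Sum>j<3. \<Sum>k<3. ?c j k * s [] [j, k])"
      using symG[OF s, of "[]" 1 0] symG[OF s, of "[]" 2 0] symG[OF s, of "[]" 2 1] by (simp add: sum_less_3 algebra_simps)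
    also have "\<dots> = 0" by (intro sum.neutral ballI) (use c in auto)
    finally show "(\<Sum>I\<in>indices 0. \<Sum>J\<in>indices 2. \<phi> I J * s I J) = 0" unfolding sum_indices_2 by simp
  qed
qed

section \<open>Weights of the representations Gamma\<close>

definition tensor_exponent :: "nat \<Rightarrow> nat \<Rightarrow> nat list \<Rightarrow> nat list \<Rightarrow> nat \<Rightarrow> nat" where
  "tensor_exponent a b I J l = (\<Sum>p<a. if I ! p = l then 1 else 0) + (\<Sum>q<b. if J ! q = l then 0 else 1)"

text \<open>Since \<open>det d = 1\<close>, the inverse of a diagonal entry is the product of the other two.\<close>

lemma diagonal_SL3_monomial:
  assumes d: "d \<in> carrier (SL 3)" "diagonal_mat d" and I: "I \<in> indices a" "J \<in> indices b"
  shows "(\<Prod>p<a. d $$ (I ! p, I ! p)) * (\<Prod>q<b. inverse (d $$ (J ! q, J ! q))) =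
    (\<Prod>l<3. d $$ (l, l) ^ tensor_exponent a b I J l)"
proof -
  have prod3: "(\<Prod>l<3. f l) = f 0 * f 1 * f 2" for f :: "nat \<Rightarrow> complex"
    by (simp add: numeral_3_eq_3 numeral_2_eq_2)
  have dc: "d \<in> carrier_mat 3 3" and det: "det d = 1" using d(1) by (auto simp: carrier_SL)
  have off: "d $$ (i, j) = 0" if "i < 3" "j < 3" "i \<noteq> j" for i j
    using d(2) dc that by (auto simp: diagonal_mat_def)
  have det: "d $$ (0, 0) * d $$ (1, 1) * d $$ (2, 2) = 1"
    using det unfolding det_3x3[OF dc] by (simp add: off mult.assoc)
  have 1: "d $$ (k, k) = (\<Prod>l<3. d $$ (l, l) ^ (if k = l then 1 else 0))" if "k < 3" for k
    using less_3_cases[OF that] by (elim disjE) (simp_all add: prod3)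
  have 2: "inverse (d $$ (k, k)) = (\<Prod>l<3. d $$ (l, l) ^ (if k = l then 0 else 1))" if "k < 3" for k
  proof -
    have "d $$ (k, k) * (\<Prod>l<3. d $$ (l, l) ^ (if k = l then 0 else 1)) = 1"
      using less_3_cases[OF that] det by (elim disjE) (simp_all add: prod3 mult_ac)
    then show ?thesis by (rule inverse_unique)
  qed
  have Ip: "I ! p < 3" if "p < a" for p using I(1) that by (auto simp: indices_def subset_iff)
  have Jq: "J ! q < 3" if "q < b" for q using I(2) that by (auto simp: indices_def subset_iff)
  have "(\<Prod>p<a. d $$ (I ! p, I ! p)) = (\<Prod>p<a. \<Prod>l<3. d $$ (l, l) ^ (if I ! p = l then 1 else 0))"
    by (intro prod.cong refl 1 Ip) simp
  moreover have "\<dots> = (\<Prod>l<3. d $$ (l, l) ^ (\<Sum>p<a. if I ! p = l then 1 else 0))"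
    unfolding power_sum by (rule prod.swap)
  moreover have "(\<Prod>q<b. inverse (d $$ (J ! q, J ! q))) = (\<Prod>q<b. \<Prod>l<3. d $$ (l, l) ^ (if J ! q = l then 0 else 1))"
    by (intro prod.cong refl 2 Jq) simp
  moreover have "\<dots> = (\<Prod>l<3. d $$ (l, l) ^ (\<Sum>q<b. if J ! q = l then 0 else 1))"
    unfolding power_sum by (rule prod.swap)
  ultimately show ?thesis unfolding tensor_exponent_def power_add prod.distrib by simp
qed

text \<open>Instance of \<open>weights_conj_torus\<close>: the entries of a tensor are weight
  functionals of the diagonal torus, and they separate vectors because \<open>combine B\<close> is
  injective.\<close>

lemma model_weights:
  assumes model: "Gamma_model a b m \<rho> B c" and g: "g \<in> carrier (SL 3)" and u: "u \<in> carrier_vec m"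
  shows "weights 3 (conj_torus 3 g) m \<rho> u =
    (\<lambda>(I, J). monomial_char 3 g (tensor_exponent a b I J)) `
      {(I, J). I \<in> indices a \<and> J \<in> indices b \<and> tensor_action a b (inv\<^bsub>SL 3\<^esub> g) (combine B u) I J \<noteq> 0}"
proof -
  let ?h = "inv\<^bsub>SL 3\<^esub> g"
  note rep = model_rep[OF model] and h = inv_SL(1)[OF g]
  have comb: "(\<Sum>j<m. B j (fst s) (snd s) * x $ j) = combine B x (fst s) (snd s)" if "x \<in> carrier_vec m" for s x
    using that by (simp add: combine_def mult.commute)
  have rc: "\<rho> x *\<^sub>v y \<in> carrier_vec m" if "x \<in> carrier (SL 3)" "y \<in> carrier_vec m" for x y
    using mult_mat_vec_carrier[OF rational_rep_carrier[OF rep that(1)] that(2)] .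
  have "weights 3 (conj_torus 3 g) m \<rho> u = {monomial_char 3 g (tensor_exponent a b (fst s) (snd s)) | s.
      s \<in> indices a \<times> indices b \<and> (\<Sum>j<m. B j (fst s) (snd s) * (\<rho> ?h *\<^sub>v u) $ j) \<noteq> 0}"
  proof (rule weights_conj_torus[OF rep g u])
    fix d and x :: "complex vec" and s :: "nat list \<times> nat list"
    assume d: "d \<in> carrier (SL 3)" "diagonal_mat d" and x: "x \<in> carrier_vec m" and s: "s \<in> indices a \<times> indices b"
    have I: "fst s \<in> indices a" "snd s \<in> indices b" using s by auto
    show "(\<Sum>j<m. B j (fst s) (snd s) * (\<rho> d *\<^sub>v x) $ j) =
        (\<Prod>i<3. d $$ (i, i) ^ tensor_exponent a b (fst s) (snd s) i) * (\<Sum>j<m. B j (fst s) (snd s) * x $ j)"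
      unfolding comb[OF x] comb[OF rc[OF d(1) x]] model_action[OF model d(1) x] tensor_action_diagonal[OF d I]
        diagonal_SL3_monomial[OF d I] ..
  next
    fix x :: "complex vec"
    assume x: "x \<in> carrier_vec m" and 0: "\<And>s. s \<in> indices a \<times> indices b \<Longrightarrow> (\<Sum>j<m. B j (fst s) (snd s) * x $ j) = 0"
    have "combine B x I J = 0" for I J
    proof (cases "I \<in> indices a \<and> J \<in> indices b")
      case True
      then show ?thesis using 0[of "(I, J)"] comb[OF x, of "(I, J)"] by simp
    next
      case False
      then show ?thesis using Gamma_outside[OF model_Gamma[OF model x]] by blast
    qed
    then have "combine B x = combine B (0\<^sub>v m)" unfolding combine_zero[OF model] by blast
    then show "x = 0\<^sub>v m" by (rule model_eq[OF model x zero_carrier_vec])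
  qed
  then show ?thesis unfolding comb[OF rc[OF h u]] model_action[OF model h u] by (auto simp: image_iff)
qed

lemma finite_model_weights:
  assumes "Gamma_model a b m \<rho> B c" "g \<in> carrier (SL 3)" "u \<in> carrier_vec m"
  shows "finite (weights 3 (conj_torus 3 g) m \<rho> u)"
  unfolding model_weights[OF assms]
  by (rule finite_imageI, rule finite_subset[of _ "indices a \<times> indices b"]) auto

text \<open>Coordinates in the basis \<open>B\<close> are finite linear combinations of tensor
  entries, so limits may be taken entry by entry.\<close>

lemma model_tendsto:
  assumes model: "Gamma_model a b m \<rho> B c" and x: "\<And>l. x l \<in> carrier_vec m" and y: "y \<in> carrier_vec m"
    and lim: "\<And>I J. I \<in> indices a \<Longrightarrow> J \<in> indices b \<Longrightarrow> (\<lambda>l. e l * combine B (x l) I J) \<longlonglongrightarrow> combine B y I J"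
    and i: "i < m"
  shows "(\<lambda>l :: nat. e l * x l $ i) \<longlonglongrightarrow> y $ i"
proof -
  have "(\<lambda>l. \<Sum>I\<in>indices a. \<Sum>J\<in>indices b. c i I J * (e l * combine B (x l) I J)) \<longlonglongrightarrow>
      (\<Sum>I\<in>indices a. \<Sum>J\<in>indices b. c i I J * combine B y I J)"
    by (intro tendsto_sum tendsto_mult tendsto_const lim)
  moreover have "e l * x l $ i = (\<Sum>I\<in>indices a. \<Sum>J\<in>indices b. c i I J * (e l * combine B (x l) I J))" for l
    unfolding model_coord[OF model x i] sum_distrib_left by (intro sum.cong refl) (simp add: mult.left_commute)
  ultimately show ?thesis unfolding model_coord[OF model y i] by simp
qed

section \<open>A pair in Gamma(0,2) and Gamma(2,1)\<close>

lemma mset_eq_pair: "mset I = {#i, j#} \<longleftrightarrow> I = [i, j] \<or> I = [j, i]"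
proof
  assume m: "mset I = {#i, j#}"
  have "length I = 2" using arg_cong[OF m, of size] by simp
  then obtain k l where I: "I = [k, l]" by (auto simp: numeral_2_eq_2 length_Suc_conv)
  have "{#k, l#} = {#i, j#}" using m I by simp
  then show "I = [i, j] \<or> I = [j, i]" unfolding I by (auto simp: add_eq_conv_ex)
next
  assume "I = [i, j] \<or> I = [j, i]"
  then show "mset I = {#i, j#}" by (elim disjE) (simp_all only: mset.simps add_mset_commute)
qed

text \<open>As polynomials, with \<open>X, Y, Z\<close> dual to \<open>x, y, z\<close>: \<open>v_tensor\<close> is \<open>2 X Y\<close>, \<open>w_tensor\<close> is
  \<open>2 z (z Z - x X - y Y + y X)\<close>, and \<open>square_tensor\<close>, the limit of rescaled translates of \<open>v_tensor\<close>, is \<open>2 X\<^sup>2\<close>.\<close>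

definition v_tensor :: "nat list \<Rightarrow> nat list \<Rightarrow> complex" where
  "v_tensor I J = (if mset I = {#} \<and> mset J = {#0, 1#} then 1 else 0)"

definition w_tensor :: "nat list \<Rightarrow> nat list \<Rightarrow> complex" where
  "w_tensor I J =
     (if mset I = {#2, 2#} \<and> mset J = {#2#} then 2
      else if mset I = {#0, 2#} \<and> mset J = {#0#} \<or> mset I = {#1, 2#} \<and> mset J = {#1#} then -1
      else if mset I = {#1, 2#} \<and> mset J = {#0#} then 1 else 0)"

definition square_tensor :: "nat list \<Rightarrow> nat list \<Rightarrow> complex" where
  "square_tensor I J = (if mset I = {#} \<and> mset J = {#0, 0#} then 2 else 0)"

lemma v_tensor_pair: "v_tensor [] [j, k] = (if j = 0 \<and> k = 1 \<or> j = 1 \<and> k = 0 then 1 else 0)"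
  unfolding v_tensor_def mset_eq_pair by simp

lemma square_tensor_pair: "square_tensor [] [j, k] = (if j = 0 \<and> k = 0 then 2 else 0)"
  unfolding square_tensor_def mset_eq_pair by simp

lemma w_tensor_triple:
  "w_tensor [i, j] [k] =
    (if i = 2 \<and> j = 2 \<and> k = 2 then 2
     else if (i = 0 \<and> j = 2 \<or> i = 2 \<and> j = 0) \<and> k = 0 \<or> (i = 1 \<and> j = 2 \<or> i = 2 \<and> j = 1) \<and> k = 1 then -1
     else if (i = 1 \<and> j = 2 \<or> i = 2 \<and> j = 1) \<and> k = 0 then 1 else 0)"
  unfolding w_tensor_def mset_eq_pair mset_single_iff by (simp only: list.inject simp_thms conj_assoc)

lemma in_indices:
  "i < 3 \<Longrightarrow> [i] \<in> indices 1" "i < 3 \<Longrightarrow> j < 3 \<Longrightarrow> [i, j] \<in> indices 2"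
  by (auto simp: numeral_2_eq_2)

lemma v_tensor_Gamma: "v_tensor \<in> Gamma 0 2"
  unfolding Gamma_iff
proof (intro conjI allI impI)
  show "v_tensor I J = 0" if "I \<notin> indices 0 \<or> J \<notin> indices 2" for I J
    using that in_indices(2)[of 0 1] in_indices(2)[of 1 0] unfolding v_tensor_def mset_eq_pair by (auto split: if_splits)
  show "v_tensor I J = v_tensor I' J'" if "mset I = mset I'" "mset J = mset J'" for I I' J J'
    using that by (simp add: v_tensor_def)
  have "v_tensor (k # I) J = 0" for k I J unfolding v_tensor_def mset.simps(2) by (simp only: add_mset_not_empty simp_thms if_False)
  then show "(\<Sum>k<3. v_tensor (k # I) (k # J)) = 0" for I J by (simp only: sum.neutral_const)
qed

lemma square_tensor_Gamma: "square_tensor \<in> Gamma 0 2"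
  unfolding Gamma_iff
proof (intro conjI allI impI)
  show "square_tensor I J = 0" if "I \<notin> indices 0 \<or> J \<notin> indices 2" for I J
    using that in_indices(2)[of 0 0] unfolding square_tensor_def mset_eq_pair by (auto split: if_splits)
  show "square_tensor I J = square_tensor I' J'" if "mset I = mset I'" "mset J = mset J'" for I I' J J'
    using that by (simp add: square_tensor_def)
  have "square_tensor (k # I) J = 0" for k I J unfolding square_tensor_def mset.simps(2) by (simp only: add_mset_not_empty simp_thms if_False)
  then show "(\<Sum>k<3. square_tensor (k # I) (k # J)) = 0" for I J by (simp only: sum.neutral_const)
qed

lemma w_tensor_outside:
  assumes "size (mset I) \<noteq> 2 \<or> size (mset J) \<noteq> 1"
  shows "w_tensor I J = 0"
proof (rule ccontr)
  assume "w_tensor I J \<noteq> 0"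
  then have "mset I \<in> {{#2, 2#}, {#0, 2#}, {#1, 2#}}" "mset J \<in> {{#0#}, {#1#}, {#2#}}"
    unfolding w_tensor_def by (auto simp del: mset_single_iff split: if_splits)
  then have "size (mset I) = 2" "size (mset J) = 1" by (auto simp del: size_mset)
  then show False using assms by blast
qed

lemma w_tensor_Gamma: "w_tensor \<in> Gamma 2 1"
  unfolding Gamma_iff
proof (intro conjI allI impI)
  show "w_tensor I J = w_tensor I' J'" if "mset I = mset I'" "mset J = mset J'" for I I' J J'
    using that unfolding w_tensor_def by simp
  show "w_tensor I J = 0" if "I \<notin> indices 2 \<or> J \<notin> indices 1" for I J
  proof (rule ccontr)
    assume nz: "w_tensor I J \<noteq> 0"
    have "I \<in> {[2, 2], [0, 2], [2, 0], [1, 2], [2, 1]}" "J \<in> {[0], [1], [2]}"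
      using nz unfolding w_tensor_def mset_eq_pair mset_single_iff by (auto split: if_splits)
    then show False using that in_indices(1)[of 0] in_indices(1)[of 1] in_indices(1)[of 2] in_indices(2)[of 2 2]
      in_indices(2)[of 0 2] in_indices(2)[of 2 0] in_indices(2)[of 1 2] in_indices(2)[of 2 1] by auto
  qed
  show "(\<Sum>k<3. w_tensor (k # I) (k # J)) = 0" for I J
  proof (cases "length I = 1 \<and> length J = 0")
    case True
    then obtain i where I: "I = [i]" "J = []" by (auto simp: length_Suc_conv)
    have "(\<Sum>k<3. w_tensor [k, i] [k]) = 0"
      by (cases "i = 0"; cases "i = 1"; cases "i = 2") (simp_all add: sum_less_3 w_tensor_triple)
    then show ?thesis unfolding I .
  next
    case False
    then have "w_tensor (k # I) (k # J) = 0" for k by (intro w_tensor_outside) auto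
    then show ?thesis by simp
  qed
qed

section \<open>Translates of the two tensors\<close>

lemma tensor_action_v_tensor:
  assumes "j < 3" "k < 3"
  shows "tensor_action 0 2 g v_tensor [] [j, k] =
    (inv\<^bsub>SL 3\<^esub> g) $$ (0, j) * (inv\<^bsub>SL 3\<^esub> g) $$ (1, k) + (inv\<^bsub>SL 3\<^esub> g) $$ (1, j) * (inv\<^bsub>SL 3\<^esub> g) $$ (0, k)"
proof -
  have "(\<Sum>j<3. \<Sum>k<3. f j * h k * v_tensor [] [j, k]) = f 0 * h 1 + f 1 * h 0" for f h :: "nat \<Rightarrow> complex"
    unfolding sum_less_3 v_tensor_pair by simp
  then show ?thesis unfolding tensor_action_0_2[OF assms] .
qed

lemma inv_SL3_row:
  assumes g: "g \<in> carrier (SL 3)" and ik: "i < 3" "k < 3"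
  shows "g $$ (i, 0) * (inv\<^bsub>SL 3\<^esub> g) $$ (0, k) + g $$ (i, 1) * (inv\<^bsub>SL 3\<^esub> g) $$ (1, k)
    + g $$ (i, 2) * (inv\<^bsub>SL 3\<^esub> g) $$ (2, k) = (if i = k then 1 else 0)"
proof -
  have "(g * inv\<^bsub>SL 3\<^esub> g) $$ (i, k) = (\<Sum>l<3. g $$ (i, l) * (inv\<^bsub>SL 3\<^esub> g) $$ (l, k))"
    by (rule mult_mat_index[OF SL_carrier_mat[OF g] SL_carrier_mat[OF inv_SL(1)[OF g]] ik])
  moreover have "(g * inv\<^bsub>SL 3\<^esub> g) $$ (i, k) = (if i = k then 1 else 0)" unfolding inv_SL(2)[OF g] using ik by simp
  ultimately show ?thesis unfolding sum_less_3 by simp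
qed

text \<open>The rows of \<open>g * inv g = 1\<close> eliminate \<open>x X + y Y\<close> and turn
  \<open>w_tensor\<close> into \<open>2 z (2 z Z - 1 + y X)\<close>, with 1 for the identity tensor.
  The first column of \<open>g\<close> no longer occurs; the boundedness in
  \<open>pair_not_semistable\<close> rests on this.\<close>

lemma tensor_action_w_tensor:
  assumes g: "g \<in> carrier (SL 3)" and ijk: "i < 3" "j < 3" "k < 3"
  shows "tensor_action 2 1 g w_tensor [i, j] [k] =
    4 * g $$ (i, 2) * g $$ (j, 2) * (inv\<^bsub>SL 3\<^esub> g) $$ (2, k)
    - (if i = k then g $$ (j, 2) else 0) - (if j = k then g $$ (i, 2) else 0)
    + (g $$ (i, 1) * g $$ (j, 2) + g $$ (i, 2) * g $$ (j, 1)) * (inv\<^bsub>SL 3\<^esub> g) $$ (0, k)"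
proof -
  let ?h = "inv\<^bsub>SL 3\<^esub> g"
  have "tensor_action 2 1 g w_tensor [i, j] [k] = 2 * g $$ (i, 2) * g $$ (j, 2) * ?h $$ (2, k)
      - (g $$ (i, 0) * g $$ (j, 2) + g $$ (i, 2) * g $$ (j, 0)) * ?h $$ (0, k)
      - (g $$ (i, 1) * g $$ (j, 2) + g $$ (i, 2) * g $$ (j, 1)) * ?h $$ (1, k)
      + (g $$ (i, 1) * g $$ (j, 2) + g $$ (i, 2) * g $$ (j, 1)) * ?h $$ (0, k)"
    unfolding tensor_action_2_1[OF ijk] by (simp add: sum_less_3 w_tensor_triple algebra_simps)
  also have "\<dots> = 4 * g $$ (i, 2) * g $$ (j, 2) * ?h $$ (2, k)
      - g $$ (j, 2) * (g $$ (i, 0) * ?h $$ (0, k) + g $$ (i, 1) * ?h $$ (1, k) + g $$ (i, 2) * ?h $$ (2, k))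
      - g $$ (i, 2) * (g $$ (j, 0) * ?h $$ (0, k) + g $$ (j, 1) * ?h $$ (1, k) + g $$ (j, 2) * ?h $$ (2, k))
      + (g $$ (i, 1) * g $$ (j, 2) + g $$ (i, 2) * g $$ (j, 1)) * ?h $$ (0, k)"
    by (simp add: algebra_simps)
  finally show ?thesis unfolding inv_SL3_row[OF g ijk(1,3)] inv_SL3_row[OF g ijk(2,3)] by simp
qed

text \<open>In the next two lemmas \<open>x, y, z\<close> are the columns of a matrix and \<open>X, Y, Z\<close> the rows of its inverse.\<close>

lemma diagonal_weight_aux:
  fixes x y z X Y Z :: "nat \<Rightarrow> complex"
  assumes col: "x k * X k + y k * Y k + z k * Z k = 1" "x k * X i + y k * Y i + z k * Z i = 0"
    and row: "X i * z i + X j * z j + X k * z k = 0" "Z i * z i + Z j * z j + Z k * z k = 1"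
      "X i * y i + X j * y j + X k * y k = 0" "Y i * z i + Y j * z j + Y k * z k = 0"
      "Y i * y i + Y j * y j + Y k * y k = 1"
    and X: "X i \<noteq> 0"
    and 1: "4 * z k * z j * Z i + (y k * z j + z k * y j) * X i = 0"
    and 2: "4 * z k * z k * Z i + (y k * z k + z k * y k) * X i = 0"
  shows False
proof -
  \<comment> \<open>In terms of \<open>m\<close>, assumptions 1 and 2 read
    \<open>z k * m j + z j * m k = 0\<close> and \<open>z k * m k = 0\<close>, while
    \<open>X\<close> pairs with \<open>m\<close> to 0 and \<open>Y\<close> pairs with it to
    \<open>X i\<close>. If \<open>z k\<close> is nonzero, then \<open>m j = m k = 0\<close>; the
    first pairing gives \<open>m i = 0\<close>, and the second a contradiction.\<close>
  define m where "m l = 2 * Z i * z l + X i * y l" for l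
  have m1: "z k * m j + z j * m k = 0" using 1 by (simp add: m_def algebra_simps)
  have "2 * (z k * m k) = 0" using 2 by (simp add: m_def algebra_simps)
  then have m2: "z k * m k = 0" by simp
  show False
  proof (cases "z k = 0")
    case zk: True
    show False
    proof (cases "z j = 0")
      case True
      then have "z i = 0" using row(1) zk X by simp
      then show False using row(2) zk True by simp
    next
      case False
      then have "y k = 0" using m1 zk X by (simp add: m_def)
      then show False using col zk X by simp
    qed
  next
    case False
    then have mk: "m k = 0" and mj: "m j = 0" using m1 m2 by auto
    have "X i * m i + X j * m j + X k * m k =
        2 * Z i * (X i * z i + X j * z j + X k * z k) + X i * (X i * y i + X j * y j + X k * y k)"
      by (simp add: m_def algebra_simps)
    then have mi: "m i = 0" using mk mj X unfolding row by simp
    have "Y i * m i + Y j * m j + Y k * m k =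
        2 * Z i * (Y i * z i + Y j * z j + Y k * z k) + X i * (Y i * y i + Y j * y j + Y k * y k)"
      by (simp add: m_def algebra_simps)
    then show False using mi mk mj X unfolding row by simp
  qed
qed

lemma mixed_weight_aux:
  fixes x y z X Y Z :: "nat \<Rightarrow> complex"
  assumes col: "x k * X k + y k * Y k + z k * Z k = 1" "x k * X i + y k * Y i + z k * Z i = 0"
      "x k * X j + y k * Y j + z k * Z j = 0" "x i * X j + y i * Y j + z i * Z j = 0"
    and XY: "X i \<noteq> 0" "Y j \<noteq> 0" "X j = 0"
    and 1: "4 * z k * z i * Z i - z k + (y k * z i + z k * y i) * X i = 0"
    and 2: "4 * z k * z i * Z j = 0"
    and 3: "4 * z k * z j * Z j - z k = 0"
  shows False
proof -
  \<comment> \<open>Since \<open>X j = 0\<close> and \<open>Y j\<close> is nonzero, the column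
    relations against \<open>j\<close> make \<open>y\<close> vanish at \<open>k\<close> or
    \<open>i\<close> whenever \<open>z\<close> does. This excludes \<open>z k = 0\<close> here and
    \<open>z i = 0\<close> below.\<close>
  have zk: "z k \<noteq> 0"
  proof
    assume "z k = 0"
    moreover from this have "y k = 0" using col(3) XY by simp
    ultimately show False using col(1,2) XY by simp
  qed
  show False
  proof (cases "z i = 0")
    case True
    then have "y i = 0" using col(4) XY by simp
    then show False using 1 zk True by simp
  next
    case False
    then have "Z j = 0" using 2 zk by simp
    then show False using 3 zk by simp
  qed
qed

text \<open>Let \<open>\<epsilon>_l\<close> be the differential of the \<open>l\<close>-th diagonal
  entry; these sum to 0. The weights of \<open>v\<close> are
  \<open>-\<epsilon>_i - \<epsilon>_j\<close> with \<open>X_i Y_j\<close> or \<open>X_j Y_i\<close>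
  nonzero. With three distinct indices, \<open>-2 \<epsilon>_i\<close> equals
  \<open>\<epsilon>_n + \<epsilon>_j - \<epsilon>_i\<close>, and it is the midpoint of
  \<open>2 \<epsilon>_n - \<epsilon>_i\<close> and \<open>2 \<epsilon>_j - \<epsilon>_i\<close>.
  Likewise \<open>-\<epsilon>_i - \<epsilon>_j = \<epsilon>_n\<close> is itself a possible weight of
  \<open>w\<close>, and the midpoint of \<open>-2 \<epsilon>_i\<close> and
  \<open>-2 \<epsilon>_j\<close>. The two auxiliary lemmas show that the relevant components of
  \<open>w\<close> cannot vanish together.\<close>

lemma pair_numerically_semistable:
  assumes V: "Gamma_model 0 2 m \<rho> B c" and W: "Gamma_model 2 1 k \<sigma> B' c'"
    and v: "v \<in> carrier_vec m" "combine B v = v_tensor" and w: "w \<in> carrier_vec k" "combine B' w = w_tensor"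
  shows "numerically_semistable 3 m \<rho> k \<sigma> v w"
  unfolding numerically_semistable_def
proof (intro allI impI)
  fix T assume "maximal_torus 3 T"
  then obtain g where g: "g \<in> carrier (SL 3)" and T: "T = conj_torus 3 g"
    using maximal_torus_eq_conj_torus[of 3 T] by auto
  define h where "h = inv\<^bsub>SL 3\<^esub> g"
  have h: "h \<in> carrier (SL 3)" using inv_SL(1)[OF g] by (simp add: h_def)
  have hg: "inv\<^bsub>SL 3\<^esub> h = g" unfolding h_def by (rule group.inv_inv[OF group_SL g])
  define P where "P \<alpha> \<longleftrightarrow> weight_point 3 T (monomial_char 3 g \<alpha>) \<in> weight_polytope 3 T k \<sigma> w" for \<alpha>
  have mid: "P \<alpha>" if "P \<beta>" "P \<gamma>" "\<And>l. l < 3 \<Longrightarrow> 2 * \<alpha> l = \<beta> l + \<gamma> l" for \<alpha> \<beta> \<gamma>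
    unfolding P_def by (rule weight_polytope_midpoint[OF g T that[unfolded P_def]])
  \<comment> \<open>Only the values of an exponent below 3 matter; the midpoint rule with equal ends
    expresses this.\<close>
  have eq: "P \<alpha>" if "P \<beta>" "\<And>l. l < 3 \<Longrightarrow> \<alpha> l = \<beta> l" for \<alpha> \<beta>
    by (rule mid[OF that(1) that(1)]) (simp add: that(2))
  define x where "x i = h $$ (i, 0)" for i
  define y where "y i = h $$ (i, 1)" for i
  define z where "z i = h $$ (i, 2)" for i
  define X where "X i = g $$ (0, i)" for i
  define Y where "Y i = g $$ (1, i)" for i
  define Z where "Z i = g $$ (2, i)" for i
  have col: "x i * X k + y i * Y k + z i * Z k = (if i = k then 1 else 0)" if "i < 3" "k < 3" for i k
    using inv_SL3_row[OF h that] unfolding hg x_def y_def z_def X_def Y_def Z_def .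
  have row: "(\<Sum>l<3. g $$ (p, l) * h $$ (l, q)) = (if p = q then 1 else 0)" if "p < 3" "q < 3" for p q
  proof -
    have "(g * h) $$ (p, q) = (\<Sum>l<3. g $$ (p, l) * h $$ (l, q))"
      by (rule mult_mat_index[OF SL_carrier_mat[OF g] SL_carrier_mat[OF h] that])
    moreover have "(g * h) $$ (p, q) = (if p = q then 1 else 0)" using inv_SL(2)[OF g] that by (simp add: h_def)
    ultimately show ?thesis by simp
  qed
  have three: "(\<Sum>l<3. f l) = f i + f j + f k" if "{i, j, k} = {0, 1, 2}" "i \<noteq> j" "i \<noteq> k" "j \<noteq> k"
    for f :: "nat \<Rightarrow> complex" and i j k :: nat
  proof -
    have "{..<3} = {i, j, k}" unfolding that(1) by auto
    then show ?thesis using that(2-4) by simp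
  qed
  \<comment> \<open>\<open>F i j k\<close> is the entry at \<open>([i, j], [k])\<close> of the
    translate of \<open>w\<close>. The exponents \<open>e\<close> and \<open>f\<close> below belong
    to entries with two upper and one lower index, and with two lower indices; each lower index
    counts as the product of the two other diagonal entries.\<close>
  define F where "F i j k = 4 * z i * z j * Z k - (if i = k then z j else 0) - (if j = k then z i else 0)
      + (y i * z j + z i * y j) * X k" for i j k
  define e :: "nat \<Rightarrow> nat \<Rightarrow> nat \<Rightarrow> nat \<Rightarrow> nat" where
    "e i j k l = (if i = l then 1 else 0) + (if j = l then 1 else 0) + (if k = l then 0 else 1)" for i j k l
  define f :: "nat \<Rightarrow> nat \<Rightarrow> nat \<Rightarrow> nat" where
    "f i j l = (if i = l then 0 else 1) + (if j = l then 0 else 1)" for i j l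
  have PF: "P (e i j n)" if "i < 3" "j < 3" "n < 3" "F i j n \<noteq> 0" for i j n
  proof -
    have "tensor_action 2 1 h (combine B' w) [i, j] [n] = F i j n"
      unfolding w(2) tensor_action_w_tensor[OF h that(1-3)] hg F_def y_def z_def X_def Z_def ..
    then have "([i, j], [n]) \<in> {(I, J). I \<in> indices 2 \<and> J \<in> indices 1 \<and> tensor_action 2 1 h (combine B' w) I J \<noteq> 0}"
      using that in_indices(1)[of n] in_indices(2)[of i j] by simp
    then have "monomial_char 3 g (tensor_exponent 2 1 [i, j] [n]) \<in> weights 3 T k \<sigma> w"
      unfolding T model_weights[OF W g w(1)] h_def[symmetric] by (rule rev_image_eqI) simp
    moreover have "tensor_exponent 2 1 [i, j] [n] = e i j n"
      by (intro ext) (simp add: tensor_exponent_def e_def numeral_2_eq_2)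
    ultimately show ?thesis
      unfolding P_def using weight_point_in_polytope finite_model_weights[OF W g w(1)] T by metis
  qed
  have third: "\<exists>n<3. i \<noteq> n \<and> j \<noteq> n \<and> {i, j, n} = {0, 1, 2}" if "i < 3" "j < 3" "i \<noteq> j" for i j :: nat
    using less_3_cases[OF that(1)] less_3_cases[OF that(2)] that(3)
    by (intro exI[of _ "3 - i - j"]) (elim disjE; auto)
  have lt: "l = i \<or> l = j \<or> l = n" if "{i, j, n} = {0, 1, 2}" "l < 3" for i j n l :: nat
    using that less_3_cases[of l] by blast
  have diag: "P (f i i)" if i: "i < 3" and Xi: "X i \<noteq> 0" for i
  proof -
    have "\<exists>j<3. i \<noteq> j" by (rule exI[of _ "if i = 0 then 1 else 0"]) auto
    then obtain j where j: "j < 3" "i \<noteq> j" by blast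
    obtain n where n: "n < 3" "i \<noteq> n" "j \<noteq> n" "{i, j, n} = {0, 1, 2}" using third[OF i j] by blast
    have n': "{i, n, j} = {0, 1, 2}" unfolding n(4)[symmetric] by auto
    note r = row[unfolded three[OF n(4) j(2) n(2,3)]] and r' = row[unfolded three[OF n' n(2) j(2) n(3)[symmetric]]]
    \<comment> \<open>Either the component whose weight is \<open>f i i\<close> itself occurs, or
      both components whose weights have \<open>f i i\<close> as midpoint. If one of the latter two
      is missing together with the first, \<open>diagonal_weight_aux\<close> applies, with
      \<open>j\<close> and \<open>n\<close> in the matching roles.\<close>
    have dich: "F n j i \<noteq> 0 \<or> F n n i \<noteq> 0 \<and> F j j i \<noteq> 0"
    proof (rule ccontr)
      assume "\<not> ?thesis"
      then have F0: "F n j i = 0" and FF: "F n n i = 0 \<or> F j j i = 0" by auto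
      show False using FF
      proof
        assume F1: "F n n i = 0"
        show False
          using col[of n n] col[of n i] r[of 0 2] r[of 2 2] r[of 0 1] r[of 1 2] r[of 1 1] i j n F0 F1
          by (intro diagonal_weight_aux[of x n X y Y z Z i j] Xi)
            (simp_all add: F_def x_def y_def z_def X_def Y_def Z_def)
      next
        assume F1: "F j j i = 0"
        show False
          using col[of j j] col[of j i] r'[of 0 2] r'[of 2 2] r'[of 0 1] r'[of 1 2] r'[of 1 1] i j n F0 F1
          by (intro diagonal_weight_aux[of x j X y Y z Z i n] Xi)
            (simp_all add: F_def x_def y_def z_def X_def Y_def Z_def algebra_simps)
      qed
    qed
    then show ?thesis
    proof
      assume "F n j i \<noteq> 0"
      then have "P (e n j i)" using PF i j n by blast
      then show ?thesis
      proof (rule eq)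
        fix l :: nat assume "l < 3"
        then have "l = i \<or> l = j \<or> l = n" by (rule lt[OF n(4)])
        then show "f i i l = e n j i l" using j n(2,3) by (elim disjE) (simp_all add: f_def e_def)
      qed
    next
      assume "F n n i \<noteq> 0 \<and> F j j i \<noteq> 0"
      then have "P (e n n i)" "P (e j j i)" using PF i j n by blast+
      then show ?thesis
      proof (rule mid)
        fix l :: nat assume "l < 3"
        then have "l = i \<or> l = j \<or> l = n" by (rule lt[OF n(4)])
        then show "2 * f i i l = e n n i l + e j j i l" using j n(2,3) by (elim disjE) (simp_all add: f_def e_def)
      qed
    qed
  qed
  have offdiag: "P (f i j)" if ij: "i < 3" "j < 3" "i \<noteq> j" and XY: "X i \<noteq> 0" "Y j \<noteq> 0" for i j
  proof -
    obtain n where n: "n < 3" "i \<noteq> n" "j \<noteq> n" "{i, j, n} = {0, 1, 2}" using third[OF ij] by blast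
    have diag_mid: "P (f i j)" if "P (f j j)"
      by (rule mid[OF diag[OF ij(1) XY(1)] that]) (simp add: f_def)
    \<comment> \<open>\<open>F n i i\<close> and \<open>F n j j\<close> belong to the weight
      \<open>f i j\<close> itself. \<open>X j\<close> and \<open>F n i j\<close> each provide
      \<open>f j j\<close>, whose midpoint with \<open>f i i\<close> is
      \<open>f i j\<close>.\<close>
    have "X j \<noteq> 0 \<or> F n i i \<noteq> 0 \<or> F n i j \<noteq> 0 \<or> F n j j \<noteq> 0"
    proof (rule ccontr)
      assume *: "\<not> ?thesis"
      show False
        using col[of n n] col[of n i] col[of n j] col[of i j] ij n *
        by (intro mixed_weight_aux[of x n X y Y z Z i j] XY) (auto simp: F_def)
    qed
    then consider "X j \<noteq> 0" | "F n i i \<noteq> 0" | "F n i j \<noteq> 0" | "F n j j \<noteq> 0" by blast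
    then show ?thesis
    proof cases
      case 1
      then show ?thesis using diag_mid diag ij(2) by blast
    next
      case 2
      then have "P (e n i i)" using PF ij n by blast
      then show ?thesis
      proof (rule eq)
        fix l :: nat assume "l < 3"
        then have "l = i \<or> l = j \<or> l = n" by (rule lt[OF n(4)])
        then show "f i j l = e n i i l" using ij(3) n(2,3) by (elim disjE) (simp_all add: f_def e_def)
      qed
    next
      case 3
      then have "P (e n i j)" using PF ij n by blast
      then have "P (f j j)"
      proof (rule eq)
        fix l :: nat assume "l < 3"
        then have "l = i \<or> l = j \<or> l = n" by (rule lt[OF n(4)])
        then show "f j j l = e n i j l" using ij(3) n(2,3) by (elim disjE) (simp_all add: f_def e_def)
      qed
      then show ?thesis by (rule diag_mid)
    next
      case 4
      then have "P (e n j j)" using PF ij n by blast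
      then show ?thesis
      proof (rule eq)
        fix l :: nat assume "l < 3"
        then have "l = i \<or> l = j \<or> l = n" by (rule lt[OF n(4)])
        then show "f i j l = e n j j l" using ij(3) n(2,3) by (elim disjE) (simp_all add: f_def e_def)
      qed
    qed
  qed
  have Pf: "P (f i j)" if "i < 3" "j < 3" "X i \<noteq> 0" "Y j \<noteq> 0" for i j
    using diag offdiag that by (cases "i = j") auto
  have "weight_point 3 T \<chi> \<in> weight_polytope 3 T k \<sigma> w" if \<chi>w: "\<chi> \<in> weights 3 T m \<rho> v" for \<chi>
  proof -
    obtain s where s: "s \<in> {(I, J). I \<in> indices 0 \<and> J \<in> indices 2 \<and> tensor_action 0 2 h (combine B v) I J \<noteq> 0}"
      "\<chi> = (\<lambda>(I, J). monomial_char 3 g (tensor_exponent 0 2 I J)) s"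
      using \<chi>w unfolding T model_weights[OF V g v(1)] h_def[symmetric] by blast
    obtain I J where s': "s = (I, J)" by (cases s)
    have I: "I \<in> indices 0" "J \<in> indices 2" "tensor_action 0 2 h (combine B v) I J \<noteq> 0"
      and \<chi>: "\<chi> = monomial_char 3 g (tensor_exponent 0 2 I J)"
      using s unfolding s' by auto
    obtain i j where J: "J = [i, j]" and ij: "i < 3" "j < 3" using I(2) unfolding indices_2_iff by blast
    have I0: "I = []" using I(1) by simp
    have "X i * Y j + Y i * X j \<noteq> 0"
      using I(3) unfolding I0 J v(2) tensor_action_v_tensor[OF ij] hg X_def Y_def by simp
    then have "X i \<noteq> 0 \<and> Y j \<noteq> 0 \<or> X j \<noteq> 0 \<and> Y i \<noteq> 0" by auto
    then have "P (f i j) \<or> P (f j i)" using Pf ij by blast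
    moreover have "f j i = f i j" by (intro ext) (simp add: f_def)
    moreover have "tensor_exponent 0 2 I J = f i j"
      unfolding I0 J by (intro ext) (simp add: tensor_exponent_def f_def numeral_2_eq_2)
    ultimately show ?thesis unfolding \<chi> P_def by simp
  qed
  then show "weight_polytope 3 T m \<rho> v \<subseteq> weight_polytope 3 T k \<sigma> w"
    using finite_model_weights[OF V g v(1)] unfolding T by (intro weight_polytope_subset) auto
qed

text \<open>Along the curve \<open>G\<close> below, \<open>v\<close> grows like \<open>1 / e\<close> while \<open>w\<close> stays bounded.\<close>

lemma pair_not_semistable:
  assumes V: "Gamma_model 0 2 m \<rho> B c" and W: "Gamma_model 2 1 k \<sigma> B' c'"
    and v: "v \<in> carrier_vec m" "combine B v = v_tensor" and w: "w \<in> carrier_vec k" "combine B' w = w_tensor"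
  shows "\<not> semistable 3 m \<rho> k \<sigma> v w"
proof -
  define e where "e l = complex_of_real (inverse (real (Suc l)))" for l
  have e0: "e l \<noteq> 0" for l by (simp add: e_def del: of_nat_Suc)
  have "(\<lambda>l. complex_of_real (inverse (real (Suc l)))) \<longlonglongrightarrow> complex_of_real 0"
    by (rule tendsto_of_real[OF LIMSEQ_inverse_real_of_nat])
  then have e: "e \<longlonglongrightarrow> 0" unfolding e_def of_real_0 .
  \<comment> \<open>\<open>G\<close> fixes \<open>z\<close> and \<open>Z\<close>, sends
    \<open>y\<close> to \<open>e y\<close>, \<open>X\<close> to \<open>e X\<close>, and
    \<open>Y\<close> to \<open>e^-1 Y + e^-2 X\<close>. So \<open>2 X Y\<close> becomes
    \<open>2 e^-1 X^2 + 2 X Y\<close>, whereas in \<open>2 z (2 z Z - 1 + y X)\<close> only the last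
    term changes, by the factor \<open>e^2\<close>.\<close>
  define G where "G l = mat 3 3 (\<lambda>(i, j). if i = 0 \<and> j = 0 then inverse (e l) else if i = 1 \<and> j = 0 then - (inverse (e l))\<^sup>2
    else if i = 1 \<and> j = 1 then e l else if i = 2 \<and> j = 2 then 1 else 0)" for l
  define H where "H l = mat 3 3 (\<lambda>(i, j). if i = 0 \<and> j = 0 then e l else if i = 1 \<and> j = 0 then (inverse (e l))\<^sup>2
    else if i = 1 \<and> j = 1 then inverse (e l) else if i = 2 \<and> j = 2 then 1 else 0)" for l
  have c: "G l \<in> carrier_mat 3 3" "H l \<in> carrier_mat 3 3" for l by (simp_all add: G_def H_def)
  have G: "G l \<in> carrier (SL 3)" for l
    unfolding carrier_SL using c e0[of l] by (simp add: det_3x3[OF c(1)]) (simp add: G_def)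
  have H: "H l \<in> carrier (SL 3)" for l
    unfolding carrier_SL using c e0[of l] by (simp add: det_3x3[OF c(2)]) (simp add: H_def)
  have HG: "H l * G l = 1\<^sub>m 3" for l
  proof (rule eq_matI)
    fix p q assume "p < dim_row (1\<^sub>m 3 :: complex mat)" "q < dim_col (1\<^sub>m 3 :: complex mat)"
    then have pq: "p < 3" "q < 3" by auto
    have "(H l * G l) $$ (p, q) = (\<Sum>j<3. H l $$ (p, j) * G l $$ (j, q))" by (rule mult_mat_index[OF c(2) c(1) pq])
    also have "\<dots> = (if p = q then 1 else 0)"
      using less_3_cases[OF pq(1)] less_3_cases[OF pq(2)] e0[of l]
      by (elim disjE) (simp_all add: sum_less_3 G_def H_def power2_eq_square)
    finally show "(H l * G l) $$ (p, q) = 1\<^sub>m 3 $$ (p, q)" using pq by simp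
  qed (use c in auto)
  have inv: "inv\<^bsub>SL 3\<^esub> (G l) = H l" for l
    by (rule group.inv_equality[OF group_SL]) (use G H HG in auto)
  obtain y where y: "y \<in> carrier_vec m" "combine B y = square_tensor"
    using model_preimage[OF V square_tensor_Gamma] .
  have rc: "\<rho> g *\<^sub>v v \<in> carrier_vec m" if "g \<in> carrier (SL 3)" for g
    using mult_mat_vec_carrier[OF rational_rep_carrier[OF model_rep[OF V] that] v(1)] .
  have sc: "\<sigma> g *\<^sub>v w \<in> carrier_vec k" if "g \<in> carrier (SL 3)" for g
    using mult_mat_vec_carrier[OF rational_rep_carrier[OF model_rep[OF W] that] w(1)] .
  show ?thesis
  proof (rule not_semistable_of_limit[where g = G and c = e and y = y])
    show "y \<noteq> 0\<^sub>v m"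
    proof
      assume "y = 0\<^sub>v m"
      then have "square_tensor [] [0, 0] = 0" using combine_zero[OF V] y(2) by metis
      then show False by (simp add: square_tensor_pair)
    qed
    fix i :: nat
    show "(\<lambda>l. e l * (\<rho> (G l) *\<^sub>v v) $ i) \<longlonglongrightarrow> y $ i" if i: "i < m"
    proof (rule model_tendsto[OF V rc[OF G] y(1) _ i])
      fix I J assume IJ: "I \<in> indices 0" "J \<in> indices 2"
      obtain p q where J: "J = [p, q]" and pq: "p < 3" "q < 3" using IJ(2) unfolding indices_2_iff by blast
      have I: "I = []" using IJ(1) by simp
      have "e l * combine B (\<rho> (G l) *\<^sub>v v) I J =
          (if p = 0 \<and> q = 0 then 2 else if p = 0 \<and> q = 1 \<or> p = 1 \<and> q = 0 then e l else 0)" for l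
        unfolding model_action[OF V G v(1)] v(2) I J tensor_action_v_tensor[OF pq] inv
      proof -
        have H: "H l $$ (0, 0) = e l" "H l $$ (1, 0) = (inverse (e l))\<^sup>2" "H l $$ (1, 1) = inverse (e l)"
          "H l $$ (0, 1) = 0" "H l $$ (0, 2) = 0" "H l $$ (1, 2) = 0" by (simp_all add: H_def)
        have "e l * (e l * (inverse (e l))\<^sup>2 + (inverse (e l))\<^sup>2 * e l) = 2"
          using e0[of l] by (simp add: power2_eq_square field_simps)
        then show "e l * (H l $$ (0, p) * H l $$ (1, q) + H l $$ (1, p) * H l $$ (0, q)) =
            (if p = 0 \<and> q = 0 then 2 else if p = 0 \<and> q = 1 \<or> p = 1 \<and> q = 0 then e l else 0)"
          using less_3_cases[OF pq(1)] less_3_cases[OF pq(2)] e0[of l] H[unfolded One_nat_def]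
          by (elim disjE) simp_all
      qed
      moreover have "(\<lambda>l. if p = 0 \<and> q = 0 then 2 else if p = 0 \<and> q = 1 \<or> p = 1 \<and> q = 0 then e l else 0)
          \<longlonglongrightarrow> (if p = 0 \<and> q = 0 then 2 else 0)"
        using e less_3_cases[OF pq(1)] less_3_cases[OF pq(2)] by (elim disjE) simp_all
      ultimately show "(\<lambda>l. e l * combine B (\<rho> (G l) *\<^sub>v v) I J) \<longlonglongrightarrow> combine B y I J"
        unfolding y(2) I J square_tensor_pair by (simp only:)
    qed
    show "(\<lambda>l. e l * (\<sigma> (G l) *\<^sub>v w) $ i) \<longlonglongrightarrow> 0" if i: "i < k"
    proof -
      have "(\<lambda>l. e l * (\<sigma> (G l) *\<^sub>v w) $ i) \<longlonglongrightarrow> 0\<^sub>v k $ i"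
      proof (rule model_tendsto[OF W sc[OF G] zero_carrier_vec _ i])
        fix I J assume IJ: "I \<in> indices 2" "J \<in> indices 1"
        obtain p q where I: "I = [p, q]" and pq: "p < 3" "q < 3" using IJ(1) unfolding indices_2_iff by blast
        obtain n where J: "J = [n]" and n: "n < 3" using IJ(2) unfolding One_nat_def indices_1_iff by blast
        \<comment> \<open>Kronecker deltas write the entries uniformly in their indices, so that one
          limit covers all cases.\<close>
        define \<delta> where "\<delta> a b = (if a = b then 1 else 0 :: complex)" for a b :: nat
        have ent: "G l $$ (p, 2) = \<delta> p 2" "G l $$ (p, 1) = e l * \<delta> p 1" "H l $$ (2, p) = \<delta> p 2"
          "H l $$ (0, p) = e l * \<delta> p 0" if "p < 3" for l p
          using less_3_cases[OF that] by (auto simp: G_def H_def \<delta>_def)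
        have "combine B' (\<sigma> (G l) *\<^sub>v w) I J = 4 * \<delta> p 2 * \<delta> q 2 * \<delta> n 2
            - (if p = n then \<delta> q 2 else 0) - (if q = n then \<delta> p 2 else 0)
            + (e l * \<delta> p 1 * \<delta> q 2 + \<delta> p 2 * (e l * \<delta> q 1)) * (e l * \<delta> n 0)" for l
          unfolding model_action[OF W G w(1)] w(2) I J tensor_action_w_tensor[OF G pq n] inv
            ent[OF pq(1)] ent[OF pq(2)] ent[OF n] ..
        moreover have "(\<lambda>l. e l * (4 * \<delta> p 2 * \<delta> q 2 * \<delta> n 2
            - (if p = n then \<delta> q 2 else 0) - (if q = n then \<delta> p 2 else 0)
            + (e l * \<delta> p 1 * \<delta> q 2 + \<delta> p 2 * (e l * \<delta> q 1)) * (e l * \<delta> n 0))) \<longlonglongrightarrow>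
            0 * (4 * \<delta> p 2 * \<delta> q 2 * \<delta> n 2
            - (if p = n then \<delta> q 2 else 0) - (if q = n then \<delta> p 2 else 0)
            + (0 * \<delta> p 1 * \<delta> q 2 + \<delta> p 2 * (0 * \<delta> q 1)) * (0 * \<delta> n 0))"
          by (intro tendsto_mult tendsto_add tendsto_diff tendsto_const e)
        ultimately show "(\<lambda>l. e l * combine B' (\<sigma> (G l) *\<^sub>v w) I J) \<longlonglongrightarrow> combine B' (0\<^sub>v k) I J"
          unfolding combine_zero[OF W] mult_zero_left by (simp only:)
      qed
      then show ?thesis using i by simp
    qed
  qed (use G e0 rc rational_rep_carrier[OF model_rep[OF W]] w y in auto)
qed

lemma Gamma_counterexample:
  "\<exists>m k \<rho> \<sigma> v w. rational_rep 3 m \<rho> \<and> rational_rep 3 k \<sigma> \<and>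
     irreducible_rep 3 m \<rho> \<and> irreducible_rep 3 k \<sigma> \<and> homogeneous m \<rho> k \<sigma> \<and>
     v \<in> carrier_vec m \<and> v \<noteq> 0\<^sub>v m \<and> w \<in> carrier_vec k \<and> w \<noteq> 0\<^sub>v k \<and>
     numerically_semistable 3 m \<rho> k \<sigma> v w \<and> \<not> semistable 3 m \<rho> k \<sigma> v w"
proof -
  obtain m \<rho> B c where V: "Gamma_model 0 2 m \<rho> B c" using Gamma_model_exists[of 0 2] by blast
  obtain k \<sigma> B' c' where W: "Gamma_model 2 1 k \<sigma> B' c'" using Gamma_model_exists[of 2 1] by blast
  have v0: "v_tensor \<noteq> (\<lambda>I J. 0)"
  proof
    assume *: "v_tensor = (\<lambda>I J. 0)"
    have "v_tensor [] [0, 1] = 0" by (simp only: *)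
    then show False unfolding v_tensor_pair by simp
  qed
  have w0: "w_tensor \<noteq> (\<lambda>I J. 0)"
  proof
    assume *: "w_tensor = (\<lambda>I J. 0)"
    have "w_tensor [2, 2] [2] = 0" by (simp only: *)
    then show False unfolding w_tensor_triple by simp
  qed
  obtain v where v: "v \<in> carrier_vec m" "combine B v = v_tensor" using model_preimage[OF V v_tensor_Gamma] .
  obtain w where w: "w \<in> carrier_vec k" "combine B' w = w_tensor" using model_preimage[OF W w_tensor_Gamma] .
  \<comment> \<open>For \<open>Gamma 0 2\<close> and \<open>Gamma 2 1\<close> the invariant
    \<open>a + 2 * b\<close> is 4.\<close>
  have "homogeneous m \<rho> k \<sigma>"
    unfolding homogeneous_def
    by (rule exI[of _ 0], rule exI[of _ 2], rule exI[of _ 2], rule exI[of _ 1])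
      (use model_isomorphic[OF V] model_isomorphic[OF W] in simp)
  moreover have "irreducible_rep 3 m \<rho>"
    by (rule model_irreducible[OF V v_tensor_Gamma v0 Gamma_0_2_irreducible_space])
  moreover have "irreducible_rep 3 k \<sigma>"
    by (rule model_irreducible[OF W w_tensor_Gamma w0 Gamma_2_1_irreducible_space])
  moreover have "v \<noteq> 0\<^sub>v m" "w \<noteq> 0\<^sub>v k" using v(2) w(2) v0 w0 combine_zero[OF V] combine_zero[OF W] by auto
  ultimately show ?thesis
    using model_rep[OF V] model_rep[OF W] v(1) w(1) pair_numerically_semistable[OF V W v w] pair_not_semistable[OF V W v w]
    by blast
qed

theorem theorem1p3:
  shows
   "(\<forall>m k \<rho> \<sigma> v w.
       rational_rep 2 m \<rho> \<longrightarrow> rational_rep 2 k \<sigma> \<longrightarrow> irreducible_rep 2 k \<sigma> \<longrightarrow>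
       v \<in> carrier_vec m \<longrightarrow> v \<noteq> 0\<^sub>v m \<longrightarrow> w \<in> carrier_vec k \<longrightarrow> w \<noteq> 0\<^sub>v k \<longrightarrow>
       numerically_semistable 2 m \<rho> k \<sigma> v w \<longrightarrow> semistable 2 m \<rho> k \<sigma> v w) \<and>
    (\<exists>m k \<rho> \<sigma> v w.
       rational_rep 2 m \<rho> \<and> rational_rep 2 k \<sigma> \<and> \<not> irreducible_rep 2 k \<sigma> \<and>
       v \<in> carrier_vec m \<and> v \<noteq> 0\<^sub>v m \<and> w \<in> carrier_vec k \<and> w \<noteq> 0\<^sub>v k \<and>
       numerically_semistable 2 m \<rho> k \<sigma> v w \<and> \<not> semistable 2 m \<rho> k \<sigma> v w) \<and>
    (\<exists>m k \<rho> \<sigma> v w.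
       rational_rep 3 m \<rho> \<and> rational_rep 3 k \<sigma> \<and>
       irreducible_rep 3 m \<rho> \<and> irreducible_rep 3 k \<sigma> \<and> homogeneous m \<rho> k \<sigma> \<and>
       v \<in> carrier_vec m \<and> v \<noteq> 0\<^sub>v m \<and> w \<in> carrier_vec k \<and> w \<noteq> 0\<^sub>v k \<and>
       numerically_semistable 3 m \<rho> k \<sigma> v w \<and> \<not> semistable 3 m \<rho> k \<sigma> v w)"
proof (intro conjI)
  show "\<forall>m k \<rho> \<sigma> v w.
       rational_rep 2 m \<rho> \<longrightarrow> rational_rep 2 k \<sigma> \<longrightarrow> irreducible_rep 2 k \<sigma> \<longrightarrow>
       v \<in> carrier_vec m \<longrightarrow> v \<noteq> 0\<^sub>v m \<longrightarrow> w \<in> carrier_vec k \<longrightarrow> w \<noteq> 0\<^sub>v k \<longrightarrow>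
       numerically_semistable 2 m \<rho> k \<sigma> v w \<longrightarrow> semistable 2 m \<rho> k \<sigma> v w"
    using semistable_if_numerically_semistable_SL2 by blast
  define v where "v = vec 3 (\<lambda>i. if i = 1 then 1 else 0 :: complex)"
  define w where "w = vec 4 (\<lambda>i. if i = 0 \<or> i = 3 then 1 else 0 :: complex)"
  have "v $ 1 = 1" "w $ 0 = 1" by (simp_all add: v_def w_def)
  then have "v \<noteq> 0\<^sub>v 3" "w \<noteq> 0\<^sub>v 4" by auto
  moreover have "v \<in> carrier_vec 3" "w \<in> carrier_vec 4" by (simp_all add: v_def w_def)
  ultimately show "\<exists>m k \<rho> \<sigma> v w.
       rational_rep 2 m \<rho> \<and> rational_rep 2 k \<sigma> \<and> \<not> irreducible_rep 2 k \<sigma> \<and>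
       v \<in> carrier_vec m \<and> v \<noteq> 0\<^sub>v m \<and> w \<in> carrier_vec k \<and> w \<noteq> 0\<^sub>v k \<and>
       numerically_semistable 2 m \<rho> k \<sigma> v w \<and> \<not> semistable 2 m \<rho> k \<sigma> v w"
    using sym2_rational sym2_triv_rational reducible_counterexample unfolding v_def w_def by blast
qed (rule Gamma_counterexample)

end
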